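(* Let $T$ be any maximal torus of $H$, with split rank $r$. Fix compact sets $C_G\subset G$ and $C_H\subset H$, and let $L$ be a lattice in $M_n(F)$. Then there are positive constants $c_L,c_1,c_2,c_3$, depending only on $C_G$, $C_H$ and $L$, such that for all $g\in G$, $h\in H$, $\gamma\in T_r$ with $gS(\gamma)^{-1}g^{\vdash}\in C_G$ and $h^{-1}\gamma h\in C_H$, and all $k\in\mathbb Z$, the following two statements hold. (1) If $2k+c_1+c_2\phi(\gamma)+c_3\phi^S(\gamma)<0$, then $w_k(g,h)=0$. (2) If $2k+c_1+c_2\phi(\gamma)+c_3\phi^S(\gamma)\ge 0$, then $$w_k(g,h)\le c_L\,\bigl(2k+c_1+c_2\phi(\gamma)+c_3\phi^S(\gamma)\bigr)^r .$$
   Context: $F$ is a $p$-adic field of characteristic zero, $\mathcal O$ its ring of integers, $\varpi$ a uniformizer, $q$ the order of the residue field, $|\cdot|$ the absolute value with $|\varpi|=q^{-1}$. Let $m\ge 1$, $n=2m$, $G=GL_n(F)$. There are two cases. (Orthogonal) Let $\Lambda$ be an invertible symmetric $2\times2$ matrix over $F$, $w$ the $n\times n$ permutation matrix with $1$'s on the antidiagonal, and $J=\begin{pmatrix} & & w_{m-1}\\ &\Lambda& \\ w_{m-1}& & \end{pmatrix}$ of size $n$. Put $H^+=\{h\in G: hJ\,{}^th=J\}$, $H=SO(J)$, $g^{\vdash}=w\,{}^tg\,w^{-1}$, $S(\gamma)=wJ^{-1}(\gamma-I)$. (Symplectic) Let $u$ be the $n\times n$ antidiagonal matrix with $u_{i,n+1-i}=(-1)^{i+1}$.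 Put $H^+=H=\{h\in G: hu\,{}^th=u\}$, $g^{\vdash}=u\,{}^tg\,u^{-1}$, $S(\gamma)=\gamma-I$. In both cases $\varepsilon(g)=(g^{-1})^{\vdash}$. Tori are over $F$ and identified with their $F$-points. $T_r$ is the set of regular elements of $T$: those whose centralizer in $H^+$ (as algebraic group) is $T$; then $S(\gamma)$ is invertible. $D(\gamma)=\det(\mathrm{Ad}(\gamma)-1;\mathrm{Lie}(H)/\mathrm{Lie}(T))$. For $\delta\in G$, $G_{\varepsilon,\delta}=\{g\in G: g\delta g^{\vdash}=\delta\}$ and $D_\varepsilon(\delta)=\det(\mathrm{Ad}(\delta)\circ\varepsilon-1;\mathrm{Lie}(G)/\mathrm{Lie}(G_{\varepsilon,\delta}))$ for $\varepsilon$-regular $\varepsilon$-semisimple $\delta$. Put $\phi(\gamma)=\log_q\max\{1,|D(\gamma)|^{-1}\}$ and $\phi^S(\gamma)=\log_q\max\{1,|D_\varepsilon(S(\gamma))|^{-1}\}$. A lattice in $M_n(F)$ is an open compact subset; the lattice $L$ here is assumed to contain $0$ and to be stable under multiplication by $GL_n(\mathcal O)$. Fix a Haar measure on $T$ giving its maximal compact subgroup finite volume. For $g\in G$, $h\in H^+$, $k\in\mathbb Z$, $w_k(g,h)=\mathrm{vol}_T(T\cap\varpi^{-k}g^{-1}Lh^{-1})$. *)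

theory Defs
  imports
    "HOL-Analysis.Analysis"
    "HOL-Algebra.Algebraic_Closure_Type"
    "Jordan_Normal_Form.Determinant"
begin

hide_const (open) Finite_Cartesian_Product.mat Determinants.det

definition ring_of_integers :: "('a::field \<Rightarrow> real) \<Rightarrow> 'a set" where
  "ring_of_integers absv = {x. absv x \<le> 1}"

definition residue_field :: "('a::field \<Rightarrow> real) \<Rightarrow> 'a set set" where
  "residue_field absv = ring_of_integers absv //
     {(x, y). x \<in> ring_of_integers absv \<and> y \<in> ring_of_integers absv \<and> absv (x - y) < 1}"

definition residue_order :: "('a::field \<Rightarrow> real) \<Rightarrow> nat" where
  "residue_order absv = card (residue_field absv)"

definition uniformizer :: "('a::field \<Rightarrow> real) \<Rightarrow> 'a \<Rightarrow> bool" where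
  "uniformizer absv \<pi> \<longleftrightarrow> \<pi> \<noteq> 0 \<and> {x. absv x < 1} = {\<pi> * y | y. y \<in> ring_of_integers absv}"

text \<open>
  A field of characteristic zero which is complete for a discrete valuation with finite residue
  field, that is, a finite extension of some field of p-adic numbers. The absolute value is the
  normalized one.
\<close>

locale padic_field =
  fixes absv :: "'a::field_char_0 \<Rightarrow> real"
  assumes absv_nonneg: "absv x \<ge> 0"
    and absv_eq_0_iff: "absv x = 0 \<longleftrightarrow> x = 0"
    and absv_mult: "absv (x * y) = absv x * absv y"
    and absv_ultrametric: "absv (x + y) \<le> max (absv x) (absv y)"
    and complete: "Metric_space.mcomplete UNIV (\<lambda>x y. absv (x - y))"
    and finite_residue_field: "finite (residue_field absv)"
    and uniformizer_exists: "\<exists>\<pi>. uniformizer absv \<pi>"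
    and absv_uniformizer: "uniformizer absv \<pi> \<Longrightarrow> absv \<pi> = 1 / real (residue_order absv)"

definition GL :: "nat \<Rightarrow> 'a::field mat monoid" where
  "GL n = units_of (ring_mat TYPE('a) n ())"

definition GL_integers :: "('a::field \<Rightarrow> real) \<Rightarrow> nat \<Rightarrow> 'a mat set" where
  "GL_integers absv n = {A \<in> carrier (GL n).
     \<forall>B \<in> {A, inv\<^bsub>GL n\<^esub> A}. \<forall>i<n. \<forall>j<n. B $$ (i, j) \<in> ring_of_integers absv}"

definition mat_dist :: "('a::field \<Rightarrow> real) \<Rightarrow> nat \<Rightarrow> 'a mat \<Rightarrow> 'a mat \<Rightarrow> real" where
  "mat_dist absv n A B = Max {absv (A $$ (i, j) - B $$ (i, j)) | i j. i < n \<and> j < n}"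

definition mat_topology :: "('a::field \<Rightarrow> real) \<Rightarrow> nat \<Rightarrow> 'a mat topology" where
  "mat_topology absv n = Metric_space.mtopology (carrier_mat n n) (mat_dist absv n)"

definition invariant_lattice :: "('a::field \<Rightarrow> real) \<Rightarrow> nat \<Rightarrow> 'a mat set \<Rightarrow> bool" where
  "invariant_lattice absv n L \<longleftrightarrow>
     openin (mat_topology absv n) L \<and> compactin (mat_topology absv n) L \<and> 0\<^sub>m n n \<in> L \<and>
     (\<forall>k \<in> GL_integers absv n. \<forall>M \<in> L. k * M \<in> L \<and> M * k \<in> L)"

text \<open>
  An algebraic group is a Zariski closed subgroup of a general linear group over the algebraic
  closure. Below, \<open>K\<close> is a subfield of the algebraic closure of \<open>F\<close>, either all of it or
  \<open>ground_field\<close>, the image of \<open>F\<close>. As \<open>F\<close> is perfect, a closed set is defined over \<open>F\<close> as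
  soon as it is cut out by polynomials with coefficients in \<open>F\<close>.
\<close>

definition ground_field :: "'a::field alg_closure set" where
  "ground_field = range to_ac"

inductive_set poly_funs :: "nat \<Rightarrow> 'b::field set \<Rightarrow> ('b mat \<Rightarrow> 'b) set"
  for n :: nat and K :: "'b set" where
  const: "c \<in> K \<Longrightarrow> (\<lambda>_. c) \<in> poly_funs n K"
| entry: "i < n \<Longrightarrow> j < n \<Longrightarrow> (\<lambda>A. A $$ (i, j)) \<in> poly_funs n K"
| add: "f \<in> poly_funs n K \<Longrightarrow> g \<in> poly_funs n K \<Longrightarrow> (\<lambda>A. f A + g A) \<in> poly_funs n K"
| mult: "f \<in> poly_funs n K \<Longrightarrow> g \<in> poly_funs n K \<Longrightarrow> (\<lambda>A. f A * g A) \<in> poly_funs n K"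

definition algebraic_group_over :: "'b::field set \<Rightarrow> nat \<Rightarrow> 'b mat set \<Rightarrow> bool" where
  "algebraic_group_over K n M \<longleftrightarrow>
     subgroup M (GL n) \<and>
     (\<exists>P \<subseteq> poly_funs n K. M = {g \<in> carrier (GL n). \<forall>f \<in> P. f g = 0})"

definition regular_function_on ::
    "'b::field set \<Rightarrow> nat \<Rightarrow> 'b mat set \<Rightarrow> ('b mat \<Rightarrow> 'b) \<Rightarrow> bool" where
  "regular_function_on K n M f \<longleftrightarrow>
     (\<exists>p \<in> poly_funs n K. \<exists>e. \<forall>g \<in> M. f g = p g / det g ^ e)"

definition regular_map_on ::
    "'b::field set \<Rightarrow> nat \<Rightarrow> 'b mat set \<Rightarrow> nat \<Rightarrow> ('b mat \<Rightarrow> 'b mat) \<Rightarrow> bool" where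
  "regular_map_on K n M d f \<longleftrightarrow>
     (\<forall>i<d. \<forall>j<d. regular_function_on K n M (\<lambda>g. f g $$ (i, j)))"

definition algebraic_group_iso ::
    "'b::field set \<Rightarrow> nat \<Rightarrow> 'b mat set \<Rightarrow> nat \<Rightarrow> 'b mat set \<Rightarrow> ('b mat \<Rightarrow> 'b mat) \<Rightarrow> bool" where
  "algebraic_group_iso K n M d Y f \<longleftrightarrow>
     f \<in> iso (GL n \<lparr>carrier := M\<rparr>) (GL d \<lparr>carrier := Y\<rparr>) \<and>
     regular_map_on K n M d f \<and> regular_map_on K d Y n (inv_into M f)"

definition diagonal_torus :: "nat \<Rightarrow> 'b::field mat set" where
  "diagonal_torus d = {A \<in> carrier (GL d). diagonal_mat A}"

definition torus :: "nat \<Rightarrow> 'a::field alg_closure mat set \<Rightarrow> bool" where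
  "torus n T \<longleftrightarrow> algebraic_group_over ground_field n T \<and>
     (\<exists>d f. algebraic_group_iso UNIV n T d (diagonal_torus d) f)"

definition split_torus :: "nat \<Rightarrow> nat \<Rightarrow> 'a::field alg_closure mat set \<Rightarrow> bool" where
  "split_torus n d T \<longleftrightarrow> algebraic_group_over ground_field n T \<and>
     (\<exists>f. algebraic_group_iso ground_field n T d (diagonal_torus d) f)"

definition has_split_rank :: "nat \<Rightarrow> 'a::field alg_closure mat set \<Rightarrow> nat \<Rightarrow> bool" where
  "has_split_rank n T r \<longleftrightarrow>
     (\<exists>S \<subseteq> T. split_torus n r S) \<and> (\<forall>d. \<forall>S \<subseteq> T. split_torus n d S \<longrightarrow> d \<le> r)"

definition maximal_torus ::
    "nat \<Rightarrow> 'a::field alg_closure mat set \<Rightarrow> 'a alg_closure mat set \<Rightarrow> bool" where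
  "maximal_torus n H T \<longleftrightarrow>
     torus n T \<and> T \<subseteq> H \<and> (\<forall>T'. torus n T' \<and> T \<subseteq> T' \<and> T' \<subseteq> H \<longrightarrow> T' = T)"

definition F_points :: "nat \<Rightarrow> 'a::field alg_closure mat set \<Rightarrow> 'a mat set" where
  "F_points n M = {A \<in> carrier_mat n n. map_mat to_ac A \<in> M}"

text \<open>
  The \<open>F\<close>-points of the Lie algebra: matrices at which the differential at the identity of every
  polynomial vanishing on the group vanishes, the differential being the linear coefficient of
  the polynomial restricted to the line through the identity.
\<close>

definition Lie :: "nat \<Rightarrow> 'a::field alg_closure mat set \<Rightarrow> 'a mat set" where
  "Lie n M = {A \<in> carrier_mat n n.
     \<forall>f \<in> poly_funs n UNIV. (\<forall>g \<in> M. f g = 0) \<longrightarrow>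
       (\<exists>p. (\<forall>t. poly p t = f (1\<^sub>m n + t \<cdot>\<^sub>m map_mat to_ac A)) \<and> poly.coeff p 1 = 0)}"

definition mat_lincomb :: "nat \<Rightarrow> 'a::field mat list \<Rightarrow> 'a vec \<Rightarrow> 'a mat" where
  "mat_lincomb n bs c = mat n n (\<lambda>(i, j). \<Sum>k<length bs. c $ k * (bs ! k) $$ (i, j))"

definition quotient_basis :: "nat \<Rightarrow> 'a::field mat set \<Rightarrow> 'a mat set \<Rightarrow> 'a mat list \<Rightarrow> bool" where
  "quotient_basis n V W bs \<longleftrightarrow> set bs \<subseteq> V \<and>
     (\<forall>M \<in> V. \<exists>!c. c \<in> carrier_vec (length bs) \<and> M - mat_lincomb n bs c \<in> W)"

text \<open>
  The determinant of the endomorphism of \<open>V/W\<close> induced by \<open>f\<close>, computed in any basis;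
  \<open>f\<close> must be linear and preserve the subspaces \<open>W \<subseteq> V\<close> of the space of matrices.
\<close>

definition quotient_det ::
    "nat \<Rightarrow> ('a::field mat \<Rightarrow> 'a mat) \<Rightarrow> 'a mat set \<Rightarrow> 'a mat set \<Rightarrow> 'a" where
  "quotient_det n f V W = (THE D. \<exists>bs A. quotient_basis n V W bs \<and>
     A \<in> carrier_mat (length bs) (length bs) \<and>
     (\<forall>j<length bs. f (bs ! j) - mat_lincomb n bs (col A j) \<in> W) \<and> D = det A)"

datatype 'a form_case = Orthogonal "'a mat" | Symplectic

fun valid_case :: "'a::field form_case \<Rightarrow> bool" where
  "valid_case (Orthogonal \<Lambda>) \<longleftrightarrow> \<Lambda> \<in> carrier (GL 2) \<and> transpose_mat \<Lambda> = \<Lambda>"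
| "valid_case Symplectic \<longleftrightarrow> True"

text \<open>Matrix indices start at zero, hence \<open>i + j + 1 = n\<close> on the antidiagonal and the sign
  \<open>(-1) ^ i\<close> in \<open>u_mat\<close>.\<close>

definition w_mat :: "nat \<Rightarrow> 'a::field mat" where
  "w_mat n = mat n n (\<lambda>(i, j). if i + j + 1 = n then 1 else 0)"

definition u_mat :: "nat \<Rightarrow> 'a::field mat" where
  "u_mat n = mat n n (\<lambda>(i, j). if i + j + 1 = n then (-1) ^ i else 0)"

text \<open>The central \<open>2 \<times> 2\<close> block of \<open>J_mat\<close> has row and column indices \<open>m - 1\<close> and \<open>m\<close>.\<close>

definition J_mat :: "nat \<Rightarrow> 'a::field mat \<Rightarrow> 'a mat" where
  "J_mat m \<Lambda> = mat (2 * m) (2 * m) (\<lambda>(i, j).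
     if i \<in> {m - 1, m} \<and> j \<in> {m - 1, m} then \<Lambda> $$ (i - (m - 1), j - (m - 1))
     else if i + j + 1 = 2 * m then 1 else 0)"

fun form_mat :: "nat \<Rightarrow> 'a::field form_case \<Rightarrow> 'a mat" where
  "form_mat m (Orthogonal \<Lambda>) = J_mat m \<Lambda>"
| "form_mat m Symplectic = u_mat (2 * m)"

definition H_plus :: "nat \<Rightarrow> 'a::field form_case \<Rightarrow> 'a alg_closure mat set" where
  "H_plus m C = {h \<in> carrier (GL (2 * m)).
     h * map_mat to_ac (form_mat m C) * transpose_mat h = map_mat to_ac (form_mat m C)}"

fun H_group :: "nat \<Rightarrow> 'a::field form_case \<Rightarrow> 'a alg_closure mat set" where
  "H_group m (Orthogonal \<Lambda>) = {h \<in> H_plus m (Orthogonal \<Lambda>). det h = 1}"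
| "H_group m Symplectic = H_plus m Symplectic"

text \<open>The anti-involution written as a superscript turnstile is \<open>dagger P\<close>, with \<open>P\<close> equal to
  \<open>dagger_mat m C\<close>.\<close>

fun dagger_mat :: "nat \<Rightarrow> 'a::field form_case \<Rightarrow> 'a mat" where
  "dagger_mat m (Orthogonal \<Lambda>) = w_mat (2 * m)"
| "dagger_mat m Symplectic = u_mat (2 * m)"

definition dagger :: "'b::field mat \<Rightarrow> 'b mat \<Rightarrow> 'b mat" where
  "dagger P g = P * transpose_mat g * inv\<^bsub>GL (dim_row P)\<^esub> P"

fun S_map :: "nat \<Rightarrow> 'a::field form_case \<Rightarrow> 'a mat \<Rightarrow> 'a mat" where
  "S_map m (Orthogonal \<Lambda>) \<gamma> =
     w_mat (2 * m) * inv\<^bsub>GL (2 * m)\<^esub> (J_mat m \<Lambda>) * (\<gamma> - 1\<^sub>m (2 * m))"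
| "S_map m Symplectic \<gamma> = \<gamma> - 1\<^sub>m (2 * m)"

definition regular_elements ::
    "nat \<Rightarrow> 'a::field form_case \<Rightarrow> 'a alg_closure mat set \<Rightarrow> 'a mat set" where
  "regular_elements m C T = {\<gamma> \<in> F_points (2 * m) T.
     {h \<in> H_plus m C. h * map_mat to_ac \<gamma> = map_mat to_ac \<gamma> * h} = T}"

definition Ad :: "nat \<Rightarrow> 'a::field mat \<Rightarrow> 'a mat \<Rightarrow> 'a mat" where
  "Ad n g M = g * M * inv\<^bsub>GL n\<^esub> g"

definition D_disc ::
    "nat \<Rightarrow> 'a::field form_case \<Rightarrow> 'a alg_closure mat set \<Rightarrow> 'a mat \<Rightarrow> 'a" where
  "D_disc m C T \<gamma> =
     quotient_det (2 * m) (\<lambda>M. Ad (2 * m) \<gamma> M - M) (Lie (2 * m) (H_group m C)) (Lie (2 * m) T)"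

definition twisted_centralizer ::
    "nat \<Rightarrow> 'a::field form_case \<Rightarrow> 'a mat \<Rightarrow> 'a alg_closure mat set" where
  "twisted_centralizer m C \<delta> = {g \<in> carrier (GL (2 * m)).
     g * map_mat to_ac \<delta> * dagger (map_mat to_ac (dagger_mat m C)) g = map_mat to_ac \<delta>}"

text \<open>On the Lie algebra the involution sending \<open>g\<close> to the dagger of its inverse acts through its
  differential, minus the dagger.\<close>

definition D_eps :: "nat \<Rightarrow> 'a::field form_case \<Rightarrow> 'a mat \<Rightarrow> 'a" where
  "D_eps m C \<delta> =
     quotient_det (2 * m) (\<lambda>M. Ad (2 * m) \<delta> (- dagger (dagger_mat m C) M) - M)
       (Lie (2 * m) (carrier (GL (2 * m)))) (Lie (2 * m) (twisted_centralizer m C \<delta>))"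

definition phi_H :: "('a::field \<Rightarrow> real) \<Rightarrow> nat \<Rightarrow> 'a form_case \<Rightarrow>
    'a alg_closure mat set \<Rightarrow> 'a mat \<Rightarrow> real" where
  "phi_H absv m C T \<gamma> =
     log (real (residue_order absv)) (max 1 (inverse (absv (D_disc m C T \<gamma>))))"

definition phi_S :: "('a::field \<Rightarrow> real) \<Rightarrow> nat \<Rightarrow> 'a form_case \<Rightarrow> 'a mat \<Rightarrow> real" where
  "phi_S absv m C \<gamma> =
     log (real (residue_order absv)) (max 1 (inverse (absv (D_eps m C (S_map m C \<gamma>)))))"

text \<open>For closed subgroups, where the topology is second countable and locally compact, so that
  regularity is automatic.\<close>

definition haar_measure_on ::
    "('a::field \<Rightarrow> real) \<Rightarrow> nat \<Rightarrow> 'a mat set \<Rightarrow> 'a mat measure \<Rightarrow> bool" where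
  "haar_measure_on absv n M \<mu> \<longleftrightarrow>
     space \<mu> = M \<and>
     sets \<mu> = sigma_sets M {U. openin (subtopology (mat_topology absv n) M) U} \<and>
     (\<forall>t \<in> M. \<forall>A \<in> sets \<mu>. emeasure \<mu> ((\<lambda>x. t * x) ` A) = emeasure \<mu> A) \<and>
     (\<forall>A. compactin (subtopology (mat_topology absv n) M) A \<longrightarrow> emeasure \<mu> A < \<infinity>) \<and>
     (\<forall>U. openin (subtopology (mat_topology absv n) M) U \<and> U \<noteq> {} \<longrightarrow> emeasure \<mu> U > 0)"

definition compact_subgroup ::
    "('a::field \<Rightarrow> real) \<Rightarrow> nat \<Rightarrow> 'a mat set \<Rightarrow> 'a mat set \<Rightarrow> bool" where
  "compact_subgroup absv n M K \<longleftrightarrow>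
     subgroup K (GL n) \<and> compactin (subtopology (mat_topology absv n) M) K"

definition maximal_compact_subgroup ::
    "('a::field \<Rightarrow> real) \<Rightarrow> nat \<Rightarrow> 'a mat set \<Rightarrow> 'a mat set \<Rightarrow> bool" where
  "maximal_compact_subgroup absv n M K \<longleftrightarrow> compact_subgroup absv n M K \<and>
     (\<forall>K'. compact_subgroup absv n M K' \<and> K \<subseteq> K' \<longrightarrow> K' = K)"

definition weight :: "nat \<Rightarrow> 'a::field \<Rightarrow> 'a mat set \<Rightarrow> 'a mat set \<Rightarrow> 'a mat measure \<Rightarrow>
    int \<Rightarrow> 'a mat \<Rightarrow> 'a mat \<Rightarrow> real" where
  "weight n \<pi> L M \<mu> k g h = measure \<mu>
     (M \<inter> (\<lambda>A. (\<pi> powi (- k)) \<cdot>\<^sub>m (inv\<^bsub>GL n\<^esub> g * A * inv\<^bsub>GL n\<^esub> h)) ` L)"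

end

(*
The centralizer of a regular element gamma contains no unipotent element and, in the orthogonal
case, no reflection. Hence gamma has n distinct eigenvalues l_i, none of them 1 or -1. The
eigenvalues of Ad(gamma) - 1 on Lie(H) include l_i^2 - 1 in the symplectic case; those of the
twisted adjoint action of S(gamma) include l_i - 1 in the orthogonal case. All the other ones are
integral up to a constant depending on C_H, so that |det(gamma - 1)|^(-1) is at most a constant
times a power of max(1, |D|^(-1)) or of max(1, |D_eps|^(-1)).

Let Y = g (gamma - 1)^(-1) J g^T, which lies in a fixed compact set, and let x = g t h with t in T,
gamma' = h^(-1) gamma h. Then x (gamma' - 1)^(-1) J x^T = Y, so a bound on the entries of x bounds
x^(-1). If t and t' both contribute to the weight, h^(-1) t^(-1) t' h is therefore bounded by
N = C q^(2k) / |det(gamma - 1)|, and 1 <= N.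

The commutant of gamma is a product of fields. The norms to F of the components of t, one for each
pair of components exchanged by the adjoint involution of J, have valuations that determine t modulo
the maximal compact subgroup, and there are at most r such pairs since each one gives a split torus
of rank one. These valuations are bounded by n log_q N, so the number of cosets is O((1 + log_q N)^r).
*)
theory Submission
  imports Defs "Jordan_Normal_Form.Char_Poly"
begin

text \<open>The absolute value is never extended to the algebraic closure: \<open>abd c x\<close>
  says that \<open>x / c\<close> is integral over the ring of integers, and only elements of
  \<open>F\<close> are finally compared by \<open>absv\<close>. Galois theory is avoided in the same
  spirit. The field factors of the commutant appear as minimal sets of eigenvalue indices whose
  projector has entries in \<open>F\<close>, and a linear functional from the closure to
  \<open>F\<close> brings solutions of linear systems down to \<open>F\<close>. The spectrum of
  \<open>\<gamma>\<close> is simple because an invariant nilpotent element of the Lie algebra would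
  give a polynomial one-parameter group inside a torus. The discriminant \<open>D\<close> is
  compared with \<open>det (\<gamma> - 1)\<close> through its \<open>n\<close>-th power: each of
  \<open>n\<close> eigenvalues divides \<open>D\<close> with integral quotient up to a constant, and
  their product is \<open>det (\<gamma> - 1)\<close> times an integral factor. Hence both
  coefficients of the two functions \<phi> are \<open>n\<close>. If the weight is not zero, the
  identity is among the quotients, so \<open>1 \<le> N\<close>. With one more unit in the additive
  constant this gives \<open>x \<ge> 1\<close>, which proves the vanishing for \<open>x < 0\<close>
  and allows raising the exponent from the number of pairs to \<open>r\<close>.\<close>

abbreviation acm :: "'a::field mat => 'a alg_closure mat" where
 "acm \<equiv> map_mat to_ac"

abbreviation Mat :: "nat => 'b mat set" where
 "Mat n \<equiv> carrier_mat n n"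

abbreviation Vec :: "nat => 'b vec set" where
 "Vec n \<equiv> carrier_vec n"

abbreviation Id :: "nat => 'b::{zero,one} mat" where
 "Id n \<equiv> 1\<^sub>m n"

notation smult_mat (infixl \<open>\<cdot>\<close> 70)

interpretation to_ac: field_hom "to_ac :: 'a::field => 'a alg_closure" by unfold_locales auto

interpretation to_ac: inj_comm_ring_hom "to_ac :: 'a::field => 'a alg_closure" by unfold_locales auto

section \<open>Invertible matrices and extension of scalars to the algebraic closure\<close>

lemma carrier_GL: "carrier (GL n) = {A \<in> Mat n. det A \<noteq> (0 :: 'a::field)}"
proof -
 have "A \<in> Units (ring_mat TYPE('a) n ()) ==> A \<in> Mat n" for A by (auto simp: Units_def ring_mat_def)
 thus ?thesis using unit_imp_det_non_zero[where 'a='a and b="()" and n=n]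
   det_non_zero_imp_unit[where 'a='a and b="()" and n=n] by (auto simp: GL_def units_of_def)
qed

lemma mult_GL [simp]: "A \<otimes>\<^bsub>GL n\<^esub> B = A * B" by (simp add: GL_def units_of_def ring_mat_simps)

lemma one_GL [simp]: "\<one>\<^bsub>GL n\<^esub> = Id n" by (simp add: GL_def units_of_def ring_mat_simps)

lemma group_GL: "group (GL n :: 'a::field mat monoid)"
proof -
 interpret ring "ring_mat TYPE('a) n ()" by (rule ring_mat)
 show ?thesis unfolding GL_def by (rule units_group)
qed

lemma GL_inv:
 fixes A :: "'a::field mat"
 assumes "A \<in> Mat n" "det A \<noteq> 0"
 shows "inv\<^bsub>GL n\<^esub> A \<in> Mat n" "A * inv\<^bsub>GL n\<^esub> A = Id n" "inv\<^bsub>GL n\<^esub> A * A = Id n"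
  "det (inv\<^bsub>GL n\<^esub> A) = inverse (det A)"
proof -
 interpret group "GL n :: 'a mat monoid" by (rule group_GL)
 have A: "A \<in> carrier (GL n)" using assms by (simp add: carrier_GL)
 show 1: "inv\<^bsub>GL n\<^esub> A \<in> Mat n" using inv_closed[OF A] by (simp add: carrier_GL)
 show "A * inv\<^bsub>GL n\<^esub> A = Id n" using r_inv[OF A] by simp
 show 2: "inv\<^bsub>GL n\<^esub> A * A = Id n" using l_inv[OF A] by simp
 have "det (inv\<^bsub>GL n\<^esub> A) * det A = 1" using arg_cong[OF 2, of det] 1 assms by (simp add: det_mult)
 thus "det (inv\<^bsub>GL n\<^esub> A) = inverse (det A)" using assms by (simp add: field_simps)
qed

text \<open>For square matrices a one-sided inverse suffices. The determinant clauses are the usual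
  way of reading off invertibility from an explicit inverse in what follows.\<close>

lemma GL_inv_eqI:
 fixes A :: "'a::field mat"
 assumes "A \<in> Mat n" "B \<in> Mat n" "A * B = Id n"
 shows "inv\<^bsub>GL n\<^esub> A = B" "det A \<noteq> 0" "det B \<noteq> 0"
proof -
 interpret group "GL n :: 'a mat monoid" by (rule group_GL)
 have "det A * det B = 1" using assms by (metis det_mult det_one)
 thus d: "det A \<noteq> 0" "det B \<noteq> 0" by auto
 have AB: "A \<in> carrier (GL n)" "B \<in> carrier (GL n)" using d assms by (auto simp: carrier_GL)
 show "inv\<^bsub>GL n\<^esub> A = B" using inv_equality[of B A] AB mat_mult_left_right_inverse[OF assms] by simp
qed

lemma mat_cancel_right:
 fixes A :: "'a::field mat"
 assumes "A \<in> Mat n" "B \<in> Mat n" "Z \<in> Mat n" "det Z \<noteq> 0"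
  "A * Z = B * Z"
 shows "A = B"
proof -
 let ?Y = "inv\<^bsub>GL n\<^esub> Z"
 have "A * (Z * ?Y) = A * Z * ?Y" "B * (Z * ?Y) = B * Z * ?Y"
  by (rule assoc_mult_mat[symmetric]; use assms GL_inv(1)[of Z n] in auto)+
 hence "A * (Z * ?Y) = B * (Z * ?Y)" unfolding assms(5) by (rule trans[OF _ sym])
 thus ?thesis using assms GL_inv(2,3)[of Z n] by simp
qed

lemma mat_cancel_left:
 fixes A :: "'a::field mat"
 assumes "A \<in> Mat n" "B \<in> Mat n" "Z \<in> Mat n" "det Z \<noteq> 0"
  "Z * A = Z * B"
 shows "A = B"
proof -
 let ?Y = "inv\<^bsub>GL n\<^esub> Z"
 have "?Y * Z * A = ?Y * (Z * A)" "?Y * Z * B = ?Y * (Z * B)"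
  by (rule assoc_mult_mat; use assms GL_inv(1)[of Z n] in auto)+
 hence "?Y * Z * A = ?Y * Z * B" unfolding assms(5) by (rule trans[OF _ sym])
 thus ?thesis using assms GL_inv(2,3)[of Z n] by simp
qed

lemma map_mat_inj: "acm A = acm B \<longleftrightarrow> A = B" using to_ac.mat_hom_inj by auto

lemma det_map_ac [simp]: "det (acm A) = to_ac (det A)" by (rule to_ac.hom_det)

lemma map_ac_mult:
 "A \<in> Mat n ==> B \<in> Mat n ==>
  acm (A * B) = acm A * acm B" by (rule to_ac.mat_hom_mult)

lemma map_ac_one [simp]: "acm (Id n) = Id n" by (rule to_ac.mat_hom_one)

lemma map_ac_transpose [simp]: "acm A\<^sup>T = (acm A)\<^sup>T" by (auto intro: eq_matI)

subsection \<open>Polynomial functions\<close>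

lemma poly_funs_sum:
 "(\<And>i. i \<in> I ==> f i \<in> poly_funs n K) ==> 0 \<in> K ==> (\<lambda>A. \<Sum>i\<in>I. f i A) \<in> poly_funs n K"
 by (induction I rule: infinite_finite_induct) (auto intro: poly_funs.intros)

lemma poly_funs_prod:
 "(\<And>i. i \<in> I ==> f i \<in> poly_funs n K) ==> 1 \<in> K ==> (\<lambda>A. \<Prod>i\<in>I. f i A) \<in> poly_funs n K"
 by (induction I rule: infinite_finite_induct) (auto intro: poly_funs.intros)

text \<open>Agreement with polynomial functions is demanded on \<open>Mat n\<close> only: the
  members of \<open>poly_funs\<close> are functions on matrices of all sizes, and nothing is known
  about entries outside the declared dimensions.\<close>

definition poly_mat :: "nat => 'b::field set => ('b mat => 'b mat) => bool" where
 "poly_mat n K F \<longleftrightarrow> (\<forall>A \<in> Mat n. F A \<in> Mat n) \<and>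
   (\<forall>i<n. \<forall>j<n. \<exists>f \<in> poly_funs n K. \<forall>A \<in> Mat n. F A $$ (i, j) = f A)"

lemma poly_matD:
 assumes "poly_mat n K F"
 shows "A \<in> Mat n ==> F A \<in> Mat n"
  "i < n ==> j < n ==> \<exists>f \<in> poly_funs n K. \<forall>A \<in> Mat n. F A $$ (i, j) = f A" using assms by (auto simp: poly_mat_def)

lemma poly_mat_id: "poly_mat n K (\<lambda>A. A)" by (auto simp: poly_mat_def intro!: bexI[OF _ poly_funs.entry])

lemma poly_mat_const:
 "M \<in> Mat n ==> (\<And>i j. i < n ==> j < n ==> M $$ (i, j) \<in> K) ==> poly_mat n K (\<lambda>_. M)"
 by (auto simp: poly_mat_def intro!: bexI[OF _ poly_funs.const])

lemma poly_mat_add: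
 assumes "poly_mat n K F" "poly_mat n K G"
 shows "poly_mat n K (\<lambda>A. F A + G A)"
proof -
 have "\<exists>f \<in> poly_funs n K. \<forall>A \<in> Mat n. (F A + G A) $$ (i, j) = f A"
  if ij: "i < n" "j < n" for i j
 proof -
  from poly_matD(2)[OF assms(1) ij] poly_matD(2)[OF assms(2) ij]
  obtain f g where fg: "f \<in> poly_funs n K" "g \<in> poly_funs n K"
   "\<And>A. A \<in> Mat n ==> F A $$ (i, j) = f A"
   "\<And>A. A \<in> Mat n ==> G A $$ (i, j) = g A" by blast
  show ?thesis
  proof (intro bexI[of _ "\<lambda>A. f A + g A"] poly_funs.add ballI)
   fix A :: "'a mat" assume A: "A \<in> Mat n"
   show "(F A + G A) $$ (i, j) = f A + g A"
    using poly_matD(1)[OF assms(1) A] poly_matD(1)[OF assms(2) A] ij fg(3,4)[OF A] by auto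
  qed (use fg in auto)
 qed
 thus ?thesis using poly_matD(1)[OF assms(1)] poly_matD(1)[OF assms(2)] unfolding poly_mat_def by auto
qed

lemma poly_mat_mult:
 assumes "poly_mat n K F" "poly_mat n K G" "0 \<in> K"
 shows "poly_mat n K (\<lambda>A. F A * G A)"
proof -
 have "\<exists>f \<in> poly_funs n K. \<forall>A \<in> Mat n. (F A * G A) $$ (i, j) = f A"
  if ij: "i < n" "j < n" for i j
 proof -
  have "\<forall>k<n. \<exists>f. f \<in> poly_funs n K \<and> (\<forall>A \<in> Mat n. F A $$ (i, k) = f A)"
   using poly_matD(2)[OF assms(1) ij(1)] by blast
  then obtain f where f: "\<And>k. k < n ==> f k \<in> poly_funs n K"
   "\<And>k A. k < n ==> A \<in> Mat n ==> F A $$ (i, k) = f k A" by metis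
  have "\<forall>k<n. \<exists>f. f \<in> poly_funs n K \<and> (\<forall>A \<in> Mat n. G A $$ (k, j) = f A)"
   using poly_matD(2)[OF assms(2) _ ij(2)] by blast
  then obtain g where g: "\<And>k. k < n ==> g k \<in> poly_funs n K"
   "\<And>k A. k < n ==> A \<in> Mat n ==> G A $$ (k, j) = g k A" by metis
  have "(F A * G A) $$ (i, j) = (\<Sum>k<n. f k A * g k A)" if A: "A \<in> Mat n" for A
  proof -
   have "F A \<in> Mat n" "G A \<in> Mat n" using poly_matD(1)[OF assms(1) A] poly_matD(1)[OF assms(2) A] .
   thus ?thesis using ij f(2)[OF _ A] g(2)[OF _ A]
    by (auto simp: scalar_prod_def lessThan_atLeast0 intro!: sum.cong)
  qed
  thus ?thesis using f g \<open>0 \<in> K\<close> by (intro bexI[of _ "\<lambda>A. \<Sum>k<n. f k A * g k A"] poly_funs_sum poly_funs.mult) auto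
 qed
 thus ?thesis using poly_matD(1)[OF assms(1)] poly_matD(1)[OF assms(2)]
  unfolding poly_mat_def by (auto intro: mult_carrier_mat[of _ n n _ n])
qed

lemma poly_mat_transpose:
 assumes "poly_mat n K F"
 shows "poly_mat n K (\<lambda>A. (F A)\<^sup>T)"
proof -
 have "\<exists>f \<in> poly_funs n K. \<forall>A \<in> Mat n. (F A)\<^sup>T $$ (i, j) = f A"
  if ij: "i < n" "j < n" for i j
 proof -
  from poly_matD(2)[OF assms ij(2,1)] obtain f where f: "f \<in> poly_funs n K"
   "\<And>A. A \<in> Mat n ==> F A $$ (j, i) = f A" by blast
  have "(F A)\<^sup>T $$ (i, j) = f A" if "A \<in> Mat n" for A using poly_matD(1)[OF assms that] ij f(2)[OF that] by auto
  thus ?thesis by (intro bexI[OF _ f(1)] ballI)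
 qed
 thus ?thesis using poly_matD(1)[OF assms(1)] unfolding poly_mat_def by auto
qed

text \<open>The Leibniz expansion is polynomial in the entries; its signs are the reason for
  \<open>- 1 \<in> K\<close>.\<close>

lemma poly_funs_det:
 assumes "poly_mat n K F" "0 \<in> K" "1 \<in> K" "- 1 \<in> K"
 shows "\<exists>f \<in> poly_funs n K. \<forall>A \<in> Mat n. det (F A) = f A"
proof -
 have "\<forall>i j. \<exists>f. i < n \<and> j < n --> f \<in> poly_funs n K \<and> (\<forall>A \<in> Mat n. F A $$ (i, j) = f A)"
  using poly_matD(2)[OF assms(1)] by blast
 then obtain f where f: "\<And>i j. i < n ==> j < n ==> f i j \<in> poly_funs n K"
  "\<And>i j A. i < n ==> j < n ==> A \<in> Mat n ==> F A $$ (i, j) = f i j A" by metis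
 have p: "p i < n" if "p permutes {0..<n}" "i < n" for p i using that permutes_in_image[of p "{0..<n}" i] by auto
 show ?thesis
 proof (intro bexI[of _ "\<lambda>A. \<Sum>p\<in>{p. p permutes {0..<n}}. signof p * (\<Prod>i\<in>{0..<n}. f i (p i) A)"] ballI)
  fix A :: "'a mat" assume A: "A \<in> Mat n"
  have "F A \<in> Mat n" using poly_matD(1)[OF assms(1) A] .
  thus "det (F A) = (\<Sum>p\<in>{p. p permutes {0..<n}}. signof p * (\<Prod>i\<in>{0..<n}. f i (p i) A))"
   using f(2)[OF _ _ A] p by (auto simp: det_def' intro!: sum.cong prod.cong)
 next
  show "(\<lambda>A. \<Sum>p\<in>{p. p permutes {0..<n}}. signof p * (\<Prod>i\<in>{0..<n}. f i (p i) A)) \<in> poly_funs n K"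
  proof (intro poly_funs_sum poly_funs.mult poly_funs_prod poly_funs.const)
   show "signof p \<in> K" for p :: "nat => nat" using assms by (auto simp: sign_def)
  qed (use assms f p in auto)
 qed
qed

lemma ground_field_closed [simp]: "to_ac x \<in> ground_field" "0 \<in> ground_field" "1 \<in> ground_field" "- 1 \<in> ground_field"
 unfolding ground_field_def by (auto intro: range_eqI[of _ _ 0] range_eqI[of _ _ 1] range_eqI[of _ _ "-1"])

subsection \<open>Rank one matrices\<close>

definition outer :: "'a::field vec => 'a vec => 'a mat" where
 "outer v w = mat (dim_vec v) (dim_vec w) (\<lambda>(i, j). v $ i * w $ j)"

lemma outer_carrier [simp]: "v \<in> Vec n ==> w \<in> carrier_vec k ==> outer v w \<in> carrier_mat n k"
 by (auto simp: outer_def)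

lemma outer_index [simp]: "i < dim_vec v ==> j < dim_vec w ==> outer v w $$ (i, j) = v $ i * w $ j"
 "dim_row (outer v w) = dim_vec v" "dim_col (outer v w) = dim_vec w" by (auto simp: outer_def)

lemma transpose_outer: "(outer v w)\<^sup>T = outer w v" by (auto intro!: eq_matI)

lemma mult_outer:
 "A \<in> Mat n ==> v \<in> Vec n ==> w \<in> Vec n ==> A * outer v w = outer (A *\<^sub>v v) w"
 by (intro eq_matI) (auto simp: scalar_prod_def sum_distrib_right mult.assoc)

lemma outer_mult:
 "A \<in> Mat n ==> v \<in> Vec n ==> w \<in> Vec n ==>
  outer v w * A = outer v (A\<^sup>T *\<^sub>v w)"
 by (intro eq_matI) (auto simp: scalar_prod_def sum_distrib_left mult_ac intro!: sum.cong)

lemma outer_mult_vec: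
 "v \<in> Vec n ==> w \<in> Vec n ==> x \<in> Vec n ==> outer v w *\<^sub>v x = (w \<bullet> x) \<cdot>\<^sub>v v"
 by (intro eq_vecI) (auto simp: scalar_prod_def sum_distrib_left sum_distrib_right mult_ac intro!: sum.cong)

lemma outer_smult_left: "outer (c \<cdot>\<^sub>v v) w = c \<cdot> outer v w" by (intro eq_matI) auto

lemma outer_smult_right: "outer v (c \<cdot>\<^sub>v w) = c \<cdot> outer v w" by (intro eq_matI) auto

lemma outer_zero_iff:
 assumes "v \<in> Vec n" "w \<in> carrier_vec k"
 shows "outer v w = 0\<^sub>m n k \<longleftrightarrow> v = 0\<^sub>v n \<or> w = 0\<^sub>v k"
proof
 assume *: "outer v w = 0\<^sub>m n k"
 show "v = 0\<^sub>v n \<or> w = 0\<^sub>v k"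
 proof (rule ccontr)
  assume "\<not> ?thesis"
  then obtain i j where "i < n" "j < k" "v $ i \<noteq> 0" "w $ j \<noteq> 0"
   using assms by (metis carrier_vecD eq_vecI index_zero_vec)
  moreover have "outer v w $$ (i, j) = 0" using * calculation by simp
  ultimately show False using assms by auto
 qed
qed (use assms in "auto intro!: eq_matI simp: outer_def")

lemma mat_eq_via_vec:
 fixes A :: "'a::field mat"
 assumes "A \<in> Mat n" "B \<in> Mat n"
  "\<And>x. x \<in> Vec n ==> A *\<^sub>v x = B *\<^sub>v x"
 shows "A = B"
proof (rule eq_matI)
 fix i j assume "i < dim_row B" "j < dim_col B"
 hence ij: "i < n" "j < n" using assms by auto
 have "(A *\<^sub>v unit_vec n j) $ i = (B *\<^sub>v unit_vec n j) $ i" by (simp add: assms)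
 thus "A $$ (i, j) = B $$ (i, j)" using assms(1,2) ij by simp
qed (use assms in auto)

section \<open>Absolute values, bounded and compact sets of matrices\<close>

context padic_field
begin

lemma absv_0 [simp]: "absv 0 = 0" by (simp add: absv_eq_0_iff)

lemma absv_1 [simp]: "absv 1 = 1" using absv_mult[of 1 1] absv_eq_0_iff[of 1] by simp

lemma absv_minus_1: "absv (- 1) = 1"
proof -
 have "absv (- 1) * absv (- 1) = 1" using absv_mult[of "-1" "-1"] by simp
 thus ?thesis using absv_nonneg[of "-1"] by (metis abs_of_nonneg real_sqrt_abs2 real_sqrt_one)
qed

lemma absv_minus [simp]: "absv (- x) = absv x" using absv_mult[of "-1" x] absv_minus_1 by simp

lemma absv_pos: "x \<noteq> 0 ==> absv x > 0" using absv_nonneg[of x] absv_eq_0_iff[of x] by linarith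

lemma absv_inverse: "absv (inverse x) = inverse (absv x)"
proof (cases "x = 0")
 case False
 hence "absv x * absv (inverse x) = 1" using absv_mult[of x "inverse x"] by simp
 thus ?thesis using absv_pos[OF False] by (simp add: field_simps)
qed simp

lemma absv_divide: "absv (x / y) = absv x / absv y" by (simp add: divide_inverse absv_mult absv_inverse)

lemma absv_power: "absv (x ^ k) = absv x ^ k" by (induction k) (auto simp: absv_mult)

lemma absv_powi: "absv (x powi k) = absv x powi k" by (simp add: power_int_def absv_power absv_inverse)

lemma absv_prod: "absv (prod f S) = (\<Prod>x\<in>S. absv (f x))"
 by (induction S rule: infinite_finite_induct) (auto simp: absv_mult)

lemma absv_diff: "absv (x - y) \<le> max (absv x) (absv y)" using absv_ultrametric[of x "- y"] by simp

lemma absv_sum_le: "(\<And>x. x \<in> S ==> absv (f x) \<le> R) ==> 0 \<le> R ==> absv (sum f S) \<le> R"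
proof (induction S rule: infinite_finite_induct)
 case (insert x S)
 have "absv (f x + sum f S) \<le> max (absv (f x)) (absv (sum f S))" by (rule absv_ultrametric)
 also have "\<dots> \<le> R" using insert by auto
 finally show ?case using insert by simp
qed auto

lemma absv_dist_triangle: "absv (x - z) \<le> max (absv (x - y)) (absv (y - z))"
 using absv_ultrametric[of "x - y" "y - z"] by simp

lemma absv_commute: "absv (x - y) = absv (y - x)" using absv_minus[of "x - y"] by simp

lemma abs_absv_diff: "\<bar>absv x - absv y\<bar> \<le> absv (x - y)"
proof -
 have "absv x \<le> max (absv (x - y)) (absv y)" using absv_ultrametric[of "x - y" y] by simp
 moreover have "absv y \<le> max (absv (x - y)) (absv x)"
  using absv_ultrametric[of "y - x" x] by (simp add: absv_commute)
 ultimately show ?thesis using absv_nonneg[of x] absv_nonneg[of y] absv_nonneg[of "x-y"] by linarith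
qed

abbreviation "q \<equiv> real (residue_order absv)"

text \<open>The classes of \<open>0\<close> and \<open>1\<close> are two different elements of the
  finite residue field.\<close>

lemma q_gt_1: "q > 1"
proof -
 let ?r = "{(x, y). x \<in> ring_of_integers absv \<and> y \<in> ring_of_integers absv \<and> absv (x - y) < 1}"
 have in0: "?r `` {0} \<in> residue_field absv" "?r `` {1} \<in> residue_field absv"
  unfolding residue_field_def by (rule quotientI, simp add: ring_of_integers_def)+
 have "0 \<in> ?r `` {0}" "0 \<notin> ?r `` {1}" by (auto simp: ring_of_integers_def)
 hence "?r `` {0} \<noteq> ?r `` {1}" by blast
 hence "card {?r `` {0}, ?r `` {1}} = 2" by simp
 hence "residue_order absv \<ge> 2" using in0 card_mono[OF finite_residue_field, of "{?r `` {0}, ?r `` {1}}"]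
  by (simp add: residue_order_def)
 thus ?thesis by simp
qed

lemma uniformizer_absv: "uniformizer absv \<pi> ==> absv \<pi> = inverse q"
 by (simp add: absv_uniformizer inverse_eq_divide)

lemma uniformizer_lt_1: "uniformizer absv \<pi> ==> absv x < 1 ==> absv x \<le> inverse q"
proof -
 assume u: "uniformizer absv \<pi>" and "absv x < 1"
 then obtain y where "x = \<pi> * y" "absv y \<le> 1" unfolding uniformizer_def ring_of_integers_def by blast
 thus ?thesis using mult_left_mono[of "absv y" 1 "absv \<pi>"] uniformizer_absv[OF u] absv_nonneg[of \<pi>]
  by (simp add: absv_mult)
qed

text \<open>With \<open>k\<close> the logarithm of \<open>absv x\<close> rounded up,
  \<open>x * \<pi> powi k\<close> has absolute value in the half-open interval from
  \<open>inverse q\<close> (excluded) to \<open>1\<close>, and \<open>uniformizer_lt_1\<close>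
  leaves only \<open>1\<close> there.\<close>

lemma absv_discrete:
 assumes "x \<noteq> 0"
 obtains k :: int where "absv x = q powi k"
proof -
 obtain \<pi> where u: "uniformizer absv \<pi>" using uniformizer_exists by blast
 define k where "k = \<lfloor>log q (absv x)\<rfloor>"
 have x: "absv x > 0" using absv_pos[OF assms] .
 define j where "j = - log q (absv x)"
 define k where "k = \<lceil>log q (absv x)\<rceil>"
 have "log q (absv x) \<le> k" "log q (absv x) > k - 1" unfolding k_def by linarith+
 hence "absv x \<le> q powr k" "absv x > q powr (k - 1)" using q_gt_1 x by (simp_all add: log_le_iff less_log_iff)
 hence *: "absv x \<le> q powi k" "absv x > q powi (k - 1)"
  using q_gt_1 powr_real_of_int'[of q k] powr_real_of_int'[of q "k - 1"] by auto
 define y where "y = x * \<pi> powi k"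
 have y: "absv y = absv x / q powi k"
  by (simp add: y_def absv_mult absv_powi uniformizer_absv[OF u] power_int_inverse divide_inverse)
 have qp: "q powi k > 0" using q_gt_1 by (simp add: zero_less_power_int)
 have "absv y \<le> 1" using * qp by (simp add: y)
 moreover have "absv y > inverse q"
 proof -
  have "q powi (k - 1) = q powi k / q" using q_gt_1 by (simp add: power_int_diff)
  hence "q powi k / q < absv x" using * by simp
  hence "q powi k / q / q powi k < absv x / q powi k" using qp by (rule divide_strict_right_mono)
  moreover have "q powi k / q / q powi k = 1 / q" using qp by (simp add: field_simps)
  ultimately show ?thesis by (simp only: y inverse_eq_divide)
 qed
 ultimately have "absv y = 1" using uniformizer_lt_1[OF u, of y] by linarith
 hence "absv x = q powi k" using y qp by (simp add: field_simps)
 thus ?thesis by (rule that)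
qed

subsection \<open>Bounded matrices\<close>

text \<open>The bound in the maximum norm. By the ultrametric inequality bounds of factors multiply
  without any factor \<open>n\<close>, and sums keep the bound, so that all later constants are
  plain products.\<close>

definition mbd :: "nat => real => 'a mat => bool" where
 "mbd n R A \<longleftrightarrow> A \<in> Mat n \<and> (\<forall>i<n. \<forall>j<n. absv (A $$ (i, j)) \<le> R)"

lemma mbd_carrier: "mbd n R A ==> A \<in> Mat n" by (simp add: mbd_def)

lemma mbd_index: "mbd n R A ==> i < n ==> j < n ==> absv (A $$ (i, j)) \<le> R" by (simp add: mbd_def)

lemma mbd_mono: "mbd n R A ==> R \<le> R' ==> mbd n R' A" by (force simp: mbd_def)

lemma mbd_exists: "A \<in> Mat n ==> \<exists>R\<ge>1. mbd n R A"
proof -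
 assume A: "A \<in> Mat n"
 let ?S = "insert 1 ((\<lambda>(i, j). absv (A $$ (i, j))) ` ({..<n} \<times> {..<n}))"
 have "mbd n (Max ?S) A" using A by (auto simp: mbd_def intro!: Max_ge)
 moreover have "Max ?S \<ge> 1" by (rule Max_ge) auto
 ultimately show ?thesis by blast
qed

lemma mbd_mult: "mbd n R A ==> mbd n R' B ==> 0 \<le> R ==> 0 \<le> R' ==> mbd n (R * R') (A * B)" unfolding mbd_def
 by (auto simp: scalar_prod_def absv_mult absv_nonneg intro!: absv_sum_le mult_mono)

lemma mbd_add: "mbd n R A ==> mbd n R B ==> mbd n R (A + B)"
 unfolding mbd_def by (auto intro!: order_trans[OF absv_ultrametric])

lemma mbd_minus: "mbd n R A ==> mbd n R B ==> mbd n R (A - B)"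
 unfolding mbd_def by (auto intro!: order_trans[OF absv_diff])

lemma mbd_smult: "mbd n R A ==> 0 \<le> R ==> mbd n (absv c * R) (c \<cdot> A)"
 unfolding mbd_def by (auto simp: absv_mult absv_nonneg intro!: mult_mono)

lemma mbd_transpose: "mbd n R A ==> mbd n R A\<^sup>T" unfolding mbd_def by auto

lemma mbd_one: "1 \<le> R ==> mbd n R (Id n)" unfolding mbd_def by auto

lemma mbd_det:
 assumes "mbd n R A" "0 \<le> R"
 shows "absv (det A) \<le> R ^ n"
proof -
 have "absv (signof p * (\<Prod>i = 0..<n. A $$ (i, p i))) \<le> R ^ n" if "p permutes {0..<n}" for p
 proof -
  have p: "p i < n" if "i < n" for i using that permutes_in_image[OF \<open>p permutes _\<close>, of i] by auto
  have "(\<Prod>i = 0..<n. absv (A $$ (i, p i))) \<le> (\<Prod>i = 0..<n. R)"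
   using assms p by (intro prod_mono) (auto simp: mbd_def absv_nonneg)
  thus ?thesis by (auto simp: absv_mult absv_prod sign_def)
 qed
 moreover have "det A = (\<Sum>p \<in> {p. p permutes {0..<n}}. signof p * (\<Prod>i = 0..<n. A $$ (i, p i)))"
  using assms by (simp add: det_def' mbd_def)
 ultimately show ?thesis using assms by (auto intro!: absv_sum_le)
qed

text \<open>The adjugate formula: cofactors are determinants of size \<open>n - 1\<close>, and
  \<open>1 \<le> R\<close> allows the uniform bound \<open>R ^ n\<close>. The determinant of
  \<open>\<gamma> - 1\<close> enters the final estimate through this denominator.\<close>

lemma mbd_inverse:
 assumes "mbd n R A" "1 \<le> R" "det A \<noteq> 0"
 shows "mbd n (R ^ n / absv (det A)) (inv\<^bsub>GL n\<^esub> A)"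
proof -
 have A: "A \<in> Mat n" using assms mbd_carrier by blast
 let ?B = "inverse (det A) \<cdot> adj_mat A"
 have c: "?B \<in> Mat n" using adj_mat(1)[OF A] by simp
 have "A * ?B = inverse (det A) \<cdot> (A * adj_mat A)" by (rule mult_smult_distrib[OF A adj_mat(1)[OF A]])
 also have "\<dots> = Id n" unfolding adj_mat(2)[OF A] using assms(3) by (intro eq_matI) auto
 finally have inv: "inv\<^bsub>GL n\<^esub> A = ?B" using GL_inv_eqI[OF A c] by simp
 have "absv (cofactor A j i) \<le> R ^ n" if "i < n" "j < n" for i j
 proof -
  have *: "mbd (n - 1) R (mat_delete A j i)" using assms(1) A that by (auto simp: mbd_def mat_delete_def)
  have "absv (cofactor A j i) = absv (det (mat_delete A j i))"
   by (simp add: cofactor_def absv_mult absv_power absv_minus_1)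
  also have "\<dots> \<le> R ^ (n - 1)" using mbd_det[OF *] assms(2) by simp
  also have "\<dots> \<le> R ^ n" using assms(2) by (intro power_increasing) auto
  finally show ?thesis .
 qed
 thus ?thesis unfolding inv using A c
  by (auto simp: mbd_def absv_mult absv_inverse adj_mat_def divide_inverse absv_nonneg
    mult.commute[of "R ^ n"] intro!: mult_left_mono)
qed

subsection \<open>Convergence\<close>

text \<open>Entrywise convergence; for \<open>n > 0\<close> it is convergence in
  \<open>mat_topology\<close>. Positivity of \<open>n\<close> recurs because \<open>mat_dist\<close>
  is a maximum over the entries, an empty set for \<open>n = 0\<close>.\<close>

definition mconv :: "nat => (nat => 'a mat) => 'a mat => bool" where
 "mconv n \<sigma> l \<longleftrightarrow> l \<in> Mat n \<and> (\<forall>k. \<sigma> k \<in> Mat n) \<and>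
   (\<forall>i<n. \<forall>j<n. (\<lambda>k. absv (\<sigma> k $$ (i, j) - l $$ (i, j))) \<longlonglongrightarrow> 0)"

lemma tendsto_absv_bounded:
 assumes "(\<lambda>k. absv (f k - a)) \<longlonglongrightarrow> 0"
 shows "(\<lambda>k. absv (f k)) \<longlonglongrightarrow> absv a" unfolding tendsto_iff
proof (intro allI impI)
 fix e :: real assume "e > 0"
 hence "\<forall>\<^sub>F k in sequentially. absv (f k - a) < e" using assms absv_nonneg unfolding tendsto_iff by simp
 thus "\<forall>\<^sub>F k in sequentially. dist (absv (f k)) (absv a) < e"
  by eventually_elim (use abs_absv_diff in "auto simp: dist_real_def intro: le_less_trans")
qed

lemma poly_funs_mconv:
 assumes "p \<in> poly_funs n UNIV" "mconv n \<sigma> l"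
 shows "(\<lambda>k. absv (p (\<sigma> k) - p l)) \<longlonglongrightarrow> 0" using assms(1)
proof (induction rule: poly_funs.induct)
 case (entry i j)
 thus ?case using assms(2) by (auto simp: mconv_def)
next
 case (add f g)
 let ?b = "\<lambda>k. absv (f (\<sigma> k) - f l) + absv (g (\<sigma> k) - g l)"
 have "?b \<longlonglongrightarrow> 0 + 0" by (intro tendsto_add add.IH)
 hence lim: "?b \<longlonglongrightarrow> 0" by simp
 have le: "absv (f (\<sigma> k) + g (\<sigma> k) - (f l + g l)) \<le> ?b k" for k
  using absv_ultrametric[of "f (\<sigma> k) - f l" "g (\<sigma> k) - g l"]
   absv_nonneg[of "f (\<sigma> k) - f l"] absv_nonneg[of "g (\<sigma> k) - g l"] by (simp add: algebra_simps)
 show ?case by (rule Lim_null_comparison[OF always_eventually lim]) (use le absv_nonneg in simp)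
next
 case (mult f g)
 let ?b = "\<lambda>k. absv (f (\<sigma> k)) * absv (g (\<sigma> k) - g l) + absv (f (\<sigma> k) - f l) * absv (g l)"
 have "?b \<longlonglongrightarrow> absv (f l) * 0 + 0 * absv (g l)" by (intro tendsto_intros mult.IH tendsto_absv_bounded)
 hence lim: "?b \<longlonglongrightarrow> 0" by simp
 have le: "absv (f (\<sigma> k) * g (\<sigma> k) - f l * g l) \<le> ?b k" for k
 proof -
  have "f (\<sigma> k) * g (\<sigma> k) - f l * g l = f (\<sigma> k) * (g (\<sigma> k) - g l) + (f (\<sigma> k) - f l) * g l"
   by (simp add: algebra_simps)
  hence "absv (f (\<sigma> k) * g (\<sigma> k) - f l * g l) \<le>
    max (absv (f (\<sigma> k)) * absv (g (\<sigma> k) - g l)) (absv (f (\<sigma> k) - f l) * absv (g l))"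
   using absv_ultrametric[of "f (\<sigma> k) * (g (\<sigma> k) - g l)" "(f (\<sigma> k) - f l) * g l"] by (simp only: absv_mult)
  also have "\<dots> \<le> ?b k" using mult_nonneg_nonneg[OF absv_nonneg absv_nonneg, of "f (\<sigma> k)" "g (\<sigma> k) - g l"]
    mult_nonneg_nonneg[OF absv_nonneg absv_nonneg, of "f (\<sigma> k) - f l" "g l"] by linarith
  finally show ?thesis .
 qed
 show ?case by (rule Lim_null_comparison[OF always_eventually lim]) (use le absv_nonneg in simp)
qed simp

lemma poly_mat_mconv:
 assumes "poly_mat n UNIV F" "mconv n \<sigma> l"
 shows "mconv n (\<lambda>k. F (\<sigma> k)) (F l)" unfolding mconv_def
proof (intro conjI allI impI)
 have c: "\<And>k. \<sigma> k \<in> Mat n" "l \<in> Mat n" using assms by (auto simp: mconv_def)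
 show "F l \<in> Mat n" "\<And>k. F (\<sigma> k) \<in> Mat n" by (intro poly_matD(1)[OF assms(1)] c)+
 fix i j assume "i < n" "j < n"
 from poly_matD(2)[OF assms(1) this] obtain f where f: "f \<in> poly_funs n UNIV"
  "\<And>A. A \<in> Mat n ==> F A $$ (i, j) = f A" by blast
 show "(\<lambda>k. absv (F (\<sigma> k) $$ (i, j) - F l $$ (i, j))) \<longlonglongrightarrow> 0"
  using poly_funs_mconv[OF f(1) assms(2)] by (simp add: f(2)[OF c(1)] f(2)[OF c(2)])
qed

lemma mat_dist_less_iff:
 assumes "n > 0"
 shows "mat_dist absv n A B < e \<longleftrightarrow> (\<forall>i<n. \<forall>j<n. absv (A $$ (i, j) - B $$ (i, j)) < e)"
proof -
 have *: "{absv (A $$ (i, j) - B $$ (i, j)) | i j. i < n \<and> j < n} =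
   (\<lambda>(i, j). absv (A $$ (i, j) - B $$ (i, j))) ` ({..<n} \<times> {..<n})" by auto
 show ?thesis unfolding mat_dist_def * using assms by (subst Max_less_iff) auto
qed

lemma mat_dist_ge: "i < n ==> j < n ==> absv (A $$ (i, j) - B $$ (i, j)) \<le> mat_dist absv n A B"
proof -
 assume ij: "i < n" "j < n"
 hence "n > 0" by simp
 from mat_dist_less_iff[OF this, of A B "absv (A $$ (i, j) - B $$ (i, j))"] ij show ?thesis by force
qed

lemma mat_dist_attained:
 assumes "n > 0"
 obtains i j where "i < n" "j < n" "mat_dist absv n A B = absv (A $$ (i, j) - B $$ (i, j))"
proof -
 have *: "{absv (A $$ (i, j) - B $$ (i, j)) | i j. i < n \<and> j < n} =
   (\<lambda>(i, j). absv (A $$ (i, j) - B $$ (i, j))) ` ({..<n} \<times> {..<n})" by auto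
 have "mat_dist absv n A B \<in> {absv (A $$ (i, j) - B $$ (i, j)) | i j. i < n \<and> j < n}"
  unfolding mat_dist_def * using assms by (intro Max_in) auto
 thus ?thesis using that by auto
qed

lemma Metric_space_mat:
 assumes "n > 0"
 shows "Metric_space (Mat n) (mat_dist absv n)"
proof
 fix A B C :: "'a mat"
 from mat_dist_attained[OF assms] obtain i j where 1: "i < n" "j < n"
  "mat_dist absv n A B = absv (A $$ (i, j) - B $$ (i, j))" by metis
 show "0 \<le> mat_dist absv n A B" using 1 absv_nonneg by simp
 show "mat_dist absv n A B = mat_dist absv n B A" unfolding mat_dist_def by (subst absv_commute) (rule refl)
 {
  assume "A \<in> Mat n" "B \<in> Mat n"
  thus "mat_dist absv n A B = 0 \<longleftrightarrow> A = B"
  proof (safe intro!: eq_matI)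
   fix i j assume "i < dim_row B" "j < dim_col B" "B \<in> Mat n" "mat_dist absv n A B = 0"
   hence "absv (A $$ (i, j) - B $$ (i, j)) \<le> 0" using mat_dist_ge[of i n j A B] by auto
   thus "A $$ (i, j) = B $$ (i, j)" using absv_nonneg[of "A $$ (i, j) - B $$ (i, j)"]
    absv_eq_0_iff[of "A $$ (i, j) - B $$ (i, j)"] by auto
  next
   show "mat_dist absv n B B = 0" using mat_dist_attained[OF assms, of B B] by auto
  qed auto
 }
 from mat_dist_attained[OF assms] obtain i j where 2: "i < n" "j < n"
  "mat_dist absv n A C = absv (A $$ (i, j) - C $$ (i, j))" by metis
 have "\<dots> \<le> max (absv (A $$ (i, j) - B $$ (i, j))) (absv (B $$ (i, j) - C $$ (i, j)))" by (rule absv_dist_triangle)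
 also have "\<dots> \<le> mat_dist absv n A B + mat_dist absv n B C"
  using mat_dist_ge[OF 2(1,2), of A B] mat_dist_ge[OF 2(1,2), of B C]
   absv_nonneg[of "A $$ (i, j) - B $$ (i, j)"] absv_nonneg[of "B $$ (i, j) - C $$ (i, j)"] by linarith
 finally show "mat_dist absv n A C \<le> mat_dist absv n A B + mat_dist absv n B C" using 2 by simp
qed

lemma limitin_mat_iff:
 assumes "n > 0" "\<And>k. \<sigma> k \<in> Mat n"
 shows "limitin (mat_topology absv n) \<sigma> l sequentially \<longleftrightarrow> mconv n \<sigma> l"
proof -
 interpret Metric_space "Mat n" "mat_dist absv n" by (rule Metric_space_mat[OF assms(1)])
 have "limitin (mat_topology absv n) \<sigma> l sequentially \<longleftrightarrow>
   l \<in> Mat n \<and> (\<forall>e>0. \<forall>\<^sub>F k in sequentially. mat_dist absv n (\<sigma> k) l < e)"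
  using assms by (simp add: mat_topology_def limitin_metric)
 also have "\<dots> \<longleftrightarrow> mconv n \<sigma> l"
 proof -
  have "(\<forall>\<^sub>F k in sequentially. mat_dist absv n (\<sigma> k) l < e) \<longleftrightarrow>
   (\<forall>i\<in>{..<n}. \<forall>j\<in>{..<n}. \<forall>\<^sub>F k in sequentially. absv (\<sigma> k $$ (i, j) - l $$ (i, j)) < e)" for e
   unfolding mat_dist_less_iff[OF assms(1)]
   by (subst eventually_ball_finite_distrib[symmetric], simp)+ (simp add: Ball_def)
  thus ?thesis using assms absv_nonneg by (auto simp: mconv_def tendsto_iff)
 qed
 finally show ?thesis .
qed

lemma compactin_subseq:
 fixes \<sigma> :: "nat => 'a mat"
 assumes "n > 0" "compactin (mat_topology absv n) S" "\<And>k. \<sigma> k \<in> S"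
 obtains l r where "l \<in> S" "strict_mono r" "mconv n (\<lambda>k. \<sigma> (r k)) l"
proof -
 interpret Metric_space "Mat n" "mat_dist absv n" by (rule Metric_space_mat[OF assms(1)])
 have S: "S \<subseteq> Mat n" and ex: "\<forall>\<sigma>::nat=>'a mat. range \<sigma> \<subseteq> S
     --> (\<exists>l r. l \<in> S \<and> strict_mono r \<and> limitin (mat_topology absv n) (\<sigma> \<circ> r) l sequentially)"
  using assms(2) unfolding mat_topology_def compactin_sequentially by auto
 have "range \<sigma> \<subseteq> S" using assms(3) by auto
 from ex[rule_format, OF this] obtain l r where lr: "l \<in> S" "strict_mono r"
   "limitin (mat_topology absv n) (\<sigma> \<circ> r) l sequentially" by (elim exE conjE)
 have "(\<sigma> \<circ> r) k \<in> Mat n" for k using assms(3)[of "r k"] S by auto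
 from limitin_mat_iff[OF assms(1) this] lr(3) have "mconv n (\<lambda>k. \<sigma> (r k)) l" by (simp add: o_def)
 thus ?thesis by (rule that[OF lr(1,2)])
qed

lemma compactin_bounded:
 assumes "n > 0" "compactin (mat_topology absv n) S"
 obtains R where "R \<ge> 1" "\<And>A. A \<in> S ==> mbd n R A"
proof -
 interpret Metric_space "Mat n" "mat_dist absv n" by (rule Metric_space_mat[OF assms(1)])
 have S: "S \<subseteq> Mat n" using assms(2) compactin_subset_topspace by (force simp: mat_topology_def)
 have "mbounded S" using assms(2) compactin_imp_mbounded by (simp add: mat_topology_def)
 then obtain B r where B: "S \<subseteq> mcball B r" unfolding mbounded_def by blast
 show ?thesis
 proof (cases "S = {}")
  case False
  hence "B \<in> Mat n" using B by (auto simp: mcball_def)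
  from mbd_exists[OF this] obtain R where R: "R \<ge> 1" "mbd n R B" by blast
  have "mbd n (max R r) A" if "A \<in> S" for A unfolding mbd_def
  proof (intro conjI allI impI)
   show "A \<in> Mat n" using that S by blast
   fix i j assume ij: "i < n" "j < n"
   have "absv (B $$ (i, j) - A $$ (i, j)) \<le> r" using that B mat_dist_ge[OF ij, of B A] by (auto simp: mcball_def)
   moreover have "absv (B $$ (i, j)) \<le> R" using R ij by (simp add: mbd_def)
   ultimately show "absv (A $$ (i, j)) \<le> max R r"
    using absv_diff[of "B $$ (i, j)" "B $$ (i, j) - A $$ (i, j)"] by auto
  qed
  thus ?thesis using that[of "max R r"] R by auto
 qed (use that[of 1] in auto)
qed

text \<open>On a compact set of invertible matrices the determinant stays away from zero, since
  otherwise a subsequence would converge to a singular member of the set. The adjugate bound then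
  controls the inverses.\<close>

lemma compactin_GL_bounded:
 assumes "n > 0" "compactin (mat_topology absv n) S" "S \<subseteq> carrier (GL n)"
 obtains R where "R \<ge> 1" "\<And>A. A \<in> S ==> mbd n R A" "\<And>A. A \<in> S ==> mbd n R (inv\<^bsub>GL n\<^esub> A)"
proof -
 from compactin_bounded[OF assms(1,2)] obtain R where R: "R \<ge> 1" "\<And>A. A \<in> S ==> mbd n R A" by blast
 have "\<exists>c>0. \<forall>A\<in>S. absv (det A) \<ge> c"
 proof (rule ccontr)
  assume "\<not> ?thesis"
  hence "\<forall>k::nat. \<exists>A\<in>S. absv (det A) < inverse (real (Suc k))"
   by (metis inverse_positive_iff_positive not_le of_nat_0_less_iff zero_less_Suc)
  then obtain \<sigma> where \<sigma>: "\<And>k. \<sigma> k \<in> S" "\<And>k. absv (det (\<sigma> k)) < inverse (real (Suc k))" by metis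
  from compactin_subseq[OF assms(1,2), of \<sigma>] \<sigma>(1) obtain l r where lr: "l \<in> S" "strict_mono r"
   "mconv n (\<lambda>k. \<sigma> (r k)) l" by blast
  have c: "\<sigma> k \<in> Mat n" "l \<in> Mat n" for k using \<sigma>(1) lr assms(3) by (auto simp: carrier_GL)
  have "\<exists>f \<in> poly_funs n (UNIV :: 'a set). \<forall>A\<in>Mat n. det A = f A" by (rule poly_funs_det[OF poly_mat_id]) auto
  then obtain f where f: "f \<in> poly_funs n (UNIV :: 'a set)" "\<forall>A\<in>Mat n. det A = f A" by (rule bexE)
  have "(\<lambda>k. absv (det (\<sigma> (r k)))) \<longlonglongrightarrow> absv (det l)"
   using tendsto_absv_bounded[OF poly_funs_mconv[OF f(1) lr(3)]] bspec[OF f(2) c(1)] bspec[OF f(2) c(2)] by simp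
  moreover have "(\<lambda>k. absv (det (\<sigma> (r k)))) \<longlonglongrightarrow> 0"
  proof (rule Lim_null_comparison)
   show "(\<lambda>k. inverse (real (Suc (r k)))) \<longlonglongrightarrow> 0"
    using LIMSEQ_subseq_LIMSEQ[OF LIMSEQ_inverse_real_of_nat lr(2)] by (simp add: o_def)
   show "\<forall>\<^sub>F k in sequentially. norm (absv (det (\<sigma> (r k)))) \<le> inverse (real (Suc (r k)))"
    using \<sigma>(2) absv_nonneg by (auto intro!: always_eventually less_imp_le simp del: of_nat_Suc)
  qed
  ultimately have "absv (det l) = 0" by (metis LIMSEQ_unique)
  thus False using lr(1) assms(3) by (auto simp: absv_eq_0_iff carrier_GL)
 qed
 then obtain c where c: "c > 0" "\<And>A. A \<in> S ==> absv (det A) \<ge> c" by blast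
 have "mbd n (max R (R ^ n / c)) (inv\<^bsub>GL n\<^esub> A)" if "A \<in> S" for A
 proof -
  have d: "det A \<noteq> 0" using that assms(3) by (auto simp: carrier_GL)
  have "R ^ n / absv (det A) \<le> R ^ n / c" using c(1) c(2)[OF that] R by (intro divide_left_mono) auto
  thus ?thesis using mbd_mono[OF mbd_inverse[OF R(2)[OF that] R(1) d]] by auto
 qed
 moreover have "mbd n (max R (R ^ n / c)) A" if "A \<in> S" for A using mbd_mono[OF R(2)[OF that]] by simp
 moreover have "1 \<le> max R (R ^ n / c)" using R(1) by simp
 ultimately show ?thesis using that[of "max R (R ^ n / c)"] by blast
qed

text \<open>Each induction step adds one digit of the expansion in powers of \<pi>: an old
  representative plus \<open>\<pi> ^ k\<close> times an integral representative of a residue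
  class.\<close>

lemma finite_reps:
 assumes u: "uniformizer absv \<pi>"
 shows "\<exists>S. finite S \<and> S \<subseteq> ring_of_integers absv \<and>
  (\<forall>x. absv x \<le> 1 --> (\<exists>s\<in>S. absv (x - s) \<le> inverse q ^ k))"
proof (induction k)
 case 0
 show ?case using absv_eq_0_iff by (intro exI[of _ "{0}"]) (auto simp: ring_of_integers_def)
next
 case (Suc k)
 let ?r = "{(x, y). x \<in> ring_of_integers absv \<and> y \<in> ring_of_integers absv \<and> absv (x - y) < 1}"
 define rep where "rep c = (SOME x. x \<in> c \<and> x \<in> ring_of_integers absv)" for c
 let ?S1 = "rep ` residue_field absv"
 have S1: "\<exists>s\<in>?S1. absv s \<le> 1 \<and> absv (x - s) < 1" if "absv x \<le> 1" for x
 proof -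
  have "?r `` {x} \<in> residue_field absv"
   unfolding residue_field_def by (rule quotientI) (use that in "simp add: ring_of_integers_def")
  moreover have "rep (?r `` {x}) \<in> ?r `` {x} \<and> rep (?r `` {x}) \<in> ring_of_integers absv"
   unfolding rep_def by (rule someI[of _ x]) (use that in "auto simp: ring_of_integers_def")
  ultimately show ?thesis by (intro bexI[of _ "rep (?r `` {x})"]) (auto simp: ring_of_integers_def)
 qed
 from Suc obtain S where S: "finite S" "S \<subseteq> ring_of_integers absv"
  "\<And>x. absv x \<le> 1 ==> \<exists>s\<in>S. absv (x - s) \<le> inverse q ^ k" by blast
 let ?T = "(\<lambda>(s, t). s + \<pi> ^ k * t) ` (S \<times> {t \<in> ?S1. absv t \<le> 1})"
 have piq: "absv (\<pi> ^ k) = inverse q ^ k" by (simp add: absv_power uniformizer_absv[OF u])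
 have iq: "inverse q \<le> 1" "inverse q > 0" using q_gt_1 by (auto simp: inverse_le_1_iff)
 have q1: "inverse q ^ k \<le> 1" "inverse q ^ k > 0"
  by (rule power_le_one[OF less_imp_le[OF iq(2)] iq(1)], rule zero_less_power[OF iq(2)])
 have pi0: "\<pi> ^ k \<noteq> 0" using u by (simp add: uniformizer_def)
 show ?case
 proof (intro exI[of _ ?T] conjI allI impI)
  show "finite ?T" using S finite_residue_field by simp
  show "?T \<subseteq> ring_of_integers absv"
  proof
   fix y assume "y \<in> ?T"
   then obtain s t where st: "y = s + \<pi> ^ k * t" "absv s \<le> 1" "absv t \<le> 1"
    using S(2) by (auto simp: ring_of_integers_def)
   have "absv (\<pi> ^ k * t) \<le> 1"
    using mult_mono[of "absv (\<pi> ^ k)" 1 "absv t" 1] st q1 piq by (simp add: absv_mult absv_nonneg)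
   thus "y \<in> ring_of_integers absv"
    using absv_ultrametric[of s "\<pi> ^ k * t"] st by (auto simp: ring_of_integers_def)
  qed
  fix x assume x: "absv x \<le> 1"
  from S(3)[OF x] obtain s where s: "s \<in> S" "absv (x - s) \<le> inverse q ^ k" by blast
  let ?y = "(x - s) / \<pi> ^ k"
  have "absv ?y \<le> 1" using s q1 by (simp add: absv_divide piq field_simps)
  from S1[OF this] obtain t where t: "t \<in> ?S1" "absv t \<le> 1" "absv (?y - t) < 1" by blast
  have "absv (?y - t) \<le> inverse q" using uniformizer_lt_1[OF u t(3)] .
  moreover have "x - (s + \<pi> ^ k * t) = \<pi> ^ k * (?y - t)" using pi0 by (simp add: field_simps)
  ultimately have "absv (x - (s + \<pi> ^ k * t)) \<le> inverse q ^ Suc k" using q1 by (simp add: absv_mult piq)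
  moreover have "s + \<pi> ^ k * t \<in> ?T" using s(1) t(1,2) by (intro image_eqI[of _ _ "(s, t)"]) auto
  ultimately show "\<exists>s\<in>?T. absv (x - s) \<le> inverse q ^ Suc k" by (intro bexI)
 qed
qed

text \<open>Multiplication by \<open>\<pi> ^ k\<close> makes all entries integral. Choosing for each
  entry a representative modulo a high power of \<pi> and dividing back gives a finite net.\<close>

lemma mtotally_bounded_mbd:
 assumes "n > 0"
 shows "Metric_space.mtotally_bounded (Mat n) (mat_dist absv n) {A. mbd n R A}"
proof -
 interpret Metric_space "Mat n" "mat_dist absv n" by (rule Metric_space_mat[OF assms(1)])
 obtain \<pi> where u: "uniformizer absv \<pi>" using uniformizer_exists by blast
 obtain k where k: "q ^ k > R" using real_arch_pow[OF q_gt_1] by blast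
 have pik: "absv (\<pi> ^ k) = inverse (q ^ k)" by (simp add: absv_power uniformizer_absv[OF u] power_inverse)
 have qk: "q ^ k > 0" using q_gt_1 by simp
 have pi0: "\<pi> ^ k \<noteq> 0" using u by (simp add: uniformizer_def)
 have "mtotally_bounded {A. mbd n (q ^ k) A}" unfolding mtotally_bounded_def
 proof (intro allI impI)
  fix e :: real assume e: "e > 0"
  obtain l where l: "inverse q ^ l < e / q ^ k"
   using real_arch_pow_inv[of "e / q ^ k" "inverse q"] e qk q_gt_1 by (auto simp: field_simps)
  from finite_reps[OF u, of l] obtain S where S: "finite S" "S \<subseteq> ring_of_integers absv"
   "\<And>x. absv x \<le> 1 ==> \<exists>s\<in>S. absv (x - s) \<le> inverse q ^ l" by blast
  let ?K = "(\<lambda>f. mat n n (\<lambda>ij. f ij / \<pi> ^ k)) ` (({..<n} \<times> {..<n}) \<rightarrow>\<^sub>E S)"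
  show "\<exists>K. finite K \<and> K \<subseteq> {A. mbd n (q ^ k) A} \<and> {A. mbd n (q ^ k) A} \<subseteq> (\<Union>x\<in>K. mball x e)"
  proof (intro exI[of _ ?K] conjI subsetI)
   show "finite ?K" using S(1) by (intro finite_imageI finite_PiE) auto
  next
   fix A assume "A \<in> ?K"
   then obtain f where f: "f \<in> ({..<n} \<times> {..<n}) \<rightarrow>\<^sub>E S" "A = mat n n (\<lambda>ij. f ij / \<pi> ^ k)" by blast
   have "absv (f ij / \<pi> ^ k) \<le> q ^ k" if "ij \<in> {..<n} \<times> {..<n}" for ij
   proof -
    have "absv (f ij) \<le> 1" using f(1) S(2) that by (auto simp: ring_of_integers_def PiE_iff)
    moreover have "absv (f ij / \<pi> ^ k) = absv (f ij) * q ^ k"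
     by (simp only: absv_divide pik) (simp add: divide_inverse)
    ultimately show ?thesis using mult_right_mono[of "absv (f ij)" 1 "q ^ k"] qk by simp
   qed
   thus "A \<in> {A. mbd n (q ^ k) A}" by (auto simp: mbd_def f(2))
  next
   fix A assume "A \<in> {A. mbd n (q ^ k) A}"
   hence A: "mbd n (q ^ k) A" by simp
   have "\<exists>s. s \<in> S \<and> absv (A $$ ij * \<pi> ^ k - s) \<le> inverse q ^ l" if "ij \<in> {..<n} \<times> {..<n}" for ij
   proof -
    have "absv (A $$ ij) \<le> q ^ k" using A that by (auto simp: mbd_def)
    hence "absv (A $$ ij * \<pi> ^ k) \<le> 1" using qk by (simp add: absv_mult pik field_simps)
    from S(3)[OF this] show ?thesis by blast
   qed
   then obtain f where f: "\<And>ij. ij \<in> {..<n} \<times> {..<n} ==> f ij \<in> S \<and> absv (A $$ ij * \<pi> ^ k - f ij) \<le> inverse q ^ l"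
    by metis
   let ?f = "restrict f ({..<n} \<times> {..<n})"
   let ?B = "mat n n (\<lambda>ij. ?f ij / \<pi> ^ k)"
   have "?f \<in> ({..<n} \<times> {..<n}) \<rightarrow>\<^sub>E S" using f by auto
   hence B: "?B \<in> ?K" by blast
   have "mat_dist absv n ?B A < e" unfolding mat_dist_less_iff[OF assms]
   proof (intro allI impI)
    fix i j assume ij: "i < n" "j < n"
    have "?B $$ (i, j) - A $$ (i, j) = - ((A $$ (i, j) * \<pi> ^ k - f (i, j)) / \<pi> ^ k)"
     using ij pi0 by (simp add: field_simps)
    hence "absv (?B $$ (i, j) - A $$ (i, j)) = absv (A $$ (i, j) * \<pi> ^ k - f (i, j)) * q ^ k"
     by (simp only: absv_minus absv_divide pik) (simp add: divide_inverse)
    also have "\<dots> \<le> inverse q ^ l * q ^ k" using f[of "(i, j)"] ij qk by (intro mult_right_mono) auto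
    also have "\<dots> < e" using l qk by (simp add: field_simps)
    finally show "absv (?B $$ (i, j) - A $$ (i, j)) < e" .
   qed
   hence "A \<in> mball ?B e" using A by (simp add: mbd_def)
   thus "A \<in> (\<Union>x\<in>?K. mball x e)" using B by blast
  qed
 qed
 moreover have "{A. mbd n R A} \<subseteq> {A. mbd n (q ^ k) A}" using mbd_mono k by force
 ultimately show ?thesis by (rule mtotally_bounded_subset)
qed

lemma mcomplete_mat:
 assumes "n > 0"
 shows "Metric_space.mcomplete (Mat n) (mat_dist absv n)"
proof -
 interpret Metric_space "Mat n" "mat_dist absv n" by (rule Metric_space_mat[OF assms(1)])
 interpret F: Metric_space UNIV "\<lambda>x y. absv (x - y)"
 proof
  fix x y z
  show "absv (x - z) \<le> absv (x - y) + absv (y - z)"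
   using absv_dist_triangle[of x z y] absv_nonneg[of "x - y"] absv_nonneg[of "y - z"] by linarith
 qed (auto simp: absv_nonneg absv_eq_0_iff absv_commute)
 show ?thesis unfolding mcomplete_def
 proof (intro allI impI)
  fix \<sigma> :: "nat => 'a mat" assume \<sigma>: "MCauchy \<sigma>"
  hence c: "\<And>k. \<sigma> k \<in> Mat n" by (auto simp: MCauchy_def)
  have "\<exists>x. (\<lambda>k. absv (\<sigma> k $$ (i, j) - x)) \<longlonglongrightarrow> 0" if ij: "i < n" "j < n" for i j
  proof -
   have "F.MCauchy (\<lambda>k. \<sigma> k $$ (i, j))" unfolding F.MCauchy_def
   proof (intro conjI allI impI)
    fix e :: real assume "e > 0"
    with \<sigma> obtain N where N: "\<And>k l. N \<le> k ==> N \<le> l ==> mat_dist absv n (\<sigma> k) (\<sigma> l) < e"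
     unfolding MCauchy_def by blast
    show "\<exists>N. \<forall>k l. N \<le> k --> N \<le> l --> absv (\<sigma> k $$ (i, j) - \<sigma> l $$ (i, j)) < e"
     using N mat_dist_ge[OF ij] le_less_trans by (intro exI[of _ N] allI impI) blast
   qed auto
   with complete obtain x where "limitin F.mtopology (\<lambda>k. \<sigma> k $$ (i, j)) x sequentially"
    unfolding F.mcomplete_def by blast
   hence "(\<lambda>k. absv (\<sigma> k $$ (i, j) - x)) \<longlonglongrightarrow> 0" by (auto simp: F.limitin_metric tendsto_iff absv_nonneg)
   thus ?thesis by blast
  qed
  then obtain l where l: "\<And>i j. i < n ==> j < n ==> (\<lambda>k. absv (\<sigma> k $$ (i, j) - l i j)) \<longlonglongrightarrow> 0" by metis
  have "mconv n \<sigma> (mat n n (\<lambda>(i, j). l i j))" using c l by (simp add: mconv_def)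
  hence "limitin mtopology \<sigma> (mat n n (\<lambda>(i, j). l i j)) sequentially"
   using limitin_mat_iff[OF assms c] by (simp add: mat_topology_def)
  thus "\<exists>x. limitin mtopology \<sigma> x sequentially" by blast
 qed
qed

text \<open>Heine-Borel, from total boundedness and completeness. Closedness is stated by sequences
  because all sets in question are cut out by conditions that pass to entrywise limits.\<close>

lemma compactin_closed_bounded:
 assumes "n > 0" "\<And>A. A \<in> S ==> mbd n R A"
  and closed: "\<And>\<sigma> l. (\<And>k::nat. \<sigma> k \<in> S) ==> mconv n \<sigma> l ==> l \<in> S"
 shows "compactin (mat_topology absv n) S"
proof -
 interpret Metric_space "Mat n" "mat_dist absv n" by (rule Metric_space_mat[OF assms(1)])
 have S: "S \<subseteq> {A. mbd n R A}" using assms(2) by blast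
 have SM: "S \<subseteq> Mat n" using assms(2) mbd_carrier by blast
 have tb: "mtotally_bounded S" using mtotally_bounded_mbd[OF assms(1)] S by (rule mtotally_bounded_subset)
 show ?thesis unfolding mat_topology_def compactin_sequentially
 proof (intro conjI allI impI SM)
  fix \<sigma> :: "nat => 'a mat" assume \<sigma>: "range \<sigma> \<subseteq> S"
  with tb obtain r where r: "strict_mono r" "MCauchy (\<sigma> \<circ> r)" unfolding mtotally_bounded_sequentially by meson
  with mcomplete_mat[OF assms(1)] obtain l where l: "limitin mtopology (\<sigma> \<circ> r) l sequentially"
   unfolding mcomplete_def by meson
  have c: "(\<sigma> \<circ> r) k \<in> Mat n" for k using \<sigma> SM by auto
  have "mconv n (\<sigma> \<circ> r) l"
   using l limitin_mat_iff[where \<sigma> = "\<sigma> \<circ> r", OF assms(1) c, of l] by (simp add: mat_topology_def)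
  moreover have "(\<sigma> \<circ> r) k \<in> S" for k using \<sigma> by auto
  ultimately have "l \<in> S" using closed[of "\<sigma> \<circ> r" l] by blast
  thus "\<exists>l r. l \<in> S \<and> strict_mono r \<and> limitin mtopology (\<sigma> \<circ> r) l sequentially" using r l by blast
 qed
qed

end

section \<open>Integral elements of the algebraic closure\<close>

context padic_field
begin

definition ospan :: "'a alg_closure set => 'a alg_closure set" where
 "ospan S = {\<Sum>s\<in>S. to_ac (c s) * s | c. \<forall>s\<in>S. absv (c s) \<le> 1}"

text \<open>The module criterion for integrality: multiplication by \<open>x\<close> preserves a
  finitely generated module over the ring of integers that contains \<open>1\<close>. In this form
  sums, products and square roots need no manipulation of monic polynomials.\<close>

definition integral_elt :: "'a alg_closure => bool" where
 "integral_elt x \<longleftrightarrow> (\<exists>S. finite S \<and> 1 \<in> S \<and> (\<forall>s\<in>S. x * s \<in> ospan S))"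

lemma ospanI: "(\<And>s. s \<in> S ==> absv (c s) \<le> 1) ==> (\<Sum>s\<in>S. to_ac (c s) * s) \<in> ospan S" unfolding ospan_def by blast

lemma ospanE:
 assumes "x \<in> ospan S"
 obtains c where "\<forall>s\<in>S. absv (c s) \<le> 1" "x = (\<Sum>s\<in>S. to_ac (c s) * s)" using assms unfolding ospan_def by blast

lemma ospan_zero: "0 \<in> ospan S" using ospanI[of S "\<lambda>_. 0"] by simp

lemma ospan_add: "x \<in> ospan S ==> y \<in> ospan S ==> x + y \<in> ospan S"
proof -
 assume x: "x \<in> ospan S" and y: "y \<in> ospan S"
 from x obtain c where c0: "\<forall>s\<in>S. absv (c s) \<le> 1" "x = (\<Sum>s\<in>S. to_ac (c s) * s)" by (rule ospanE)
  note c = c0(1)[rule_format] c0(2)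
 from y obtain d where d0: "\<forall>s\<in>S. absv (d s) \<le> 1" "y = (\<Sum>s\<in>S. to_ac (d s) * s)" by (rule ospanE)
  note d = d0(1)[rule_format] d0(2)
 have "absv (c s + d s) \<le> 1" if "s \<in> S" for s
  using absv_ultrametric[of "c s" "d s"] c(1)[OF that] d(1)[OF that] by linarith
 from ospanI[of S "\<lambda>s. c s + d s", OF this] show ?thesis by (simp add: c(2) d(2) distrib_right sum.distrib)
qed

lemma ospan_smult: "x \<in> ospan S ==> absv a \<le> 1 ==> to_ac a * x \<in> ospan S"
proof -
 assume x: "x \<in> ospan S" and a: "absv a \<le> 1"
 from x obtain c where c0: "\<forall>s\<in>S. absv (c s) \<le> 1" "x = (\<Sum>s\<in>S. to_ac (c s) * s)" by (rule ospanE)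
  note c = c0(1)[rule_format] c0(2)
 have "absv (a * c s) \<le> 1" if "s \<in> S" for s
  using mult_mono[of "absv a" 1 "absv (c s)" 1] a c(1)[OF that] by (simp add: absv_mult absv_nonneg)
 from ospanI[of S "\<lambda>s. a * c s", OF this] show ?thesis by (simp add: c(2) sum_distrib_left mult.assoc)
qed

lemma ospan_sum: "(\<And>i. i \<in> I ==> f i \<in> ospan S) ==> sum f I \<in> ospan S"
 by (induction I rule: infinite_finite_induct) (auto intro: ospan_zero ospan_add)

lemma ospan_base: "finite S ==> s \<in> S ==> s \<in> ospan S"
proof -
 assume S: "finite S" "s \<in> S"
 have "(\<Sum>t\<in>S. to_ac (if t = s then 1 else 0) * t) = (\<Sum>t\<in>S. if t = s then t else 0)" by (intro sum.cong) auto
 also have "\<dots> = s" using S by simp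
 finally show ?thesis using ospanI[of S "\<lambda>t. if t = s then 1 else 0"] by simp
qed

text \<open>Stability of a span under multiplication needs to be checked on generators only.\<close>

lemma ospan_mono_mult:
 assumes "x \<in> ospan S" "\<And>s. s \<in> S ==> y * s \<in> ospan T"
 shows "y * x \<in> ospan T"
proof -
 from assms(1) obtain c where c0: "\<forall>s\<in>S. absv (c s) \<le> 1" "x = (\<Sum>s\<in>S. to_ac (c s) * s)" by (rule ospanE)
  note c = c0(1)[rule_format] c0(2)
 have "y * x = (\<Sum>s\<in>S. to_ac (c s) * (y * s))" by (simp add: c(2) sum_distrib_left mult_ac)
 also have "\<dots> \<in> ospan T" by (intro ospan_sum ospan_smult assms(2) c(1))
 finally show ?thesis .
qed

text \<open>The products of the two generating sets span a module that is stable under both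
  elements.\<close>

lemma integral_elt_common:
 assumes "integral_elt x" "integral_elt y"
 obtains S where "finite S" "1 \<in> S" "\<forall>s\<in>S. x * s \<in> ospan S" "\<forall>s\<in>S. y * s \<in> ospan S"
proof -
 from assms obtain S T where S: "finite S" "1 \<in> S" "\<forall>s\<in>S. x * s \<in> ospan S"
  and T: "finite T" "1 \<in> T" "\<forall>s\<in>T. y * s \<in> ospan T" unfolding integral_elt_def by blast
 let ?U = "(\<lambda>(s, t). s * t) ` (S \<times> T)"
 have U: "finite ?U" using S T by simp
 have base: "s * t \<in> ospan ?U" if "s \<in> S" "t \<in> T" for s t by (rule ospan_base[OF U]) (use that in auto)
 show ?thesis
 proof (rule that[of ?U])
  show "1 \<in> ?U" using S T by (intro image_eqI[of _ _ "(1, 1)"]) auto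
  have "x * u \<in> ospan ?U \<and> y * u \<in> ospan ?U" if "u \<in> ?U" for u
  proof -
  from that obtain s t where st: "s \<in> S" "t \<in> T" "u = s * t" by auto
  have "t * (x * s) \<in> ospan ?U" by (rule ospan_mono_mult[of _ S]) (use S st base in "auto simp: mult.commute")
  moreover have "s * (y * t) \<in> ospan ?U" by (rule ospan_mono_mult[of _ T]) (use T st base in auto)
  ultimately show ?thesis by (simp add: st mult_ac)
  qed
  thus "\<forall>s\<in>?U. x * s \<in> ospan ?U" "\<forall>s\<in>?U. y * s \<in> ospan ?U" by blast+
 qed (rule U)
qed

lemma integral_elt_add: "integral_elt x ==> integral_elt y ==> integral_elt (x + y)"
proof -
 assume "integral_elt x" "integral_elt y"
 then obtain S where S: "finite S" "1 \<in> S"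
  "\<forall>s\<in>S. x * s \<in> ospan S" "\<forall>s\<in>S. y * s \<in> ospan S" by (rule integral_elt_common)
 thus ?thesis unfolding integral_elt_def by (intro exI[of _ S]) (simp add: distrib_right ospan_add)
qed

lemma integral_elt_mult: "integral_elt x ==> integral_elt y ==> integral_elt (x * y)"
proof -
 assume "integral_elt x" "integral_elt y"
 then obtain S where S: "finite S" "1 \<in> S"
  "\<forall>s\<in>S. x * s \<in> ospan S" "\<forall>s\<in>S. y * s \<in> ospan S" by (rule integral_elt_common)
 have "x * y * s \<in> ospan S" if "s \<in> S" for s
  using ospan_mono_mult[OF S(4)[rule_format, OF that] S(3)[rule_format]] by (simp add: mult.assoc)
 thus ?thesis unfolding integral_elt_def using S by blast
qed

lemma integral_elt_to_ac: "absv a \<le> 1 ==> integral_elt (to_ac a)" unfolding integral_elt_def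
 by (intro exI[of _ "{1}"]) (use ospan_smult[OF ospan_base, of "{1}" 1 a] in auto)

lemma integral_elt_1: "integral_elt 1" using integral_elt_to_ac[of 1] by simp

text \<open>If \<open>S\<close> generates a module stable under \<open>y ^ 2\<close>, then
  \<open>S\<close> together with \<open>y S\<close> generates one stable under
  \<open>y\<close>.\<close>

lemma integral_elt_sqrt:
 assumes "integral_elt (y ^ 2)"
 shows "integral_elt y"
proof -
 from assms obtain S where S: "finite S" "1 \<in> S" "\<forall>s\<in>S. y ^ 2 * s \<in> ospan S" unfolding integral_elt_def by blast
 let ?T = "S \<union> (*) y ` S"
 have T: "finite ?T" using S by simp
 have "y * t \<in> ospan ?T" if t: "t \<in> ?T" for t
 proof (cases "t \<in> S")
  case True
  thus ?thesis by (intro ospan_base T) auto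
 next
  case False
  with t obtain s where s: "s \<in> S" "t = y * s" by auto
  have "1 * (y ^ 2 * s) \<in> ospan ?T" by (rule ospan_mono_mult[of _ S]) (use S s T in "auto intro: ospan_base")
  thus ?thesis by (simp add: s power2_eq_square mult.assoc)
 qed
 thus ?thesis unfolding integral_elt_def using T S(2) by (intro exI[of _ ?T]) auto
qed

text \<open>The coordinates of an eigenvector span a module stable under the eigenvalue. Dividing by
  a nonzero coordinate puts \<open>1\<close> among them.\<close>

lemma integral_elt_eigenvalue:
 assumes B: "mbd n 1 B" and v: "v \<in> Vec n" "v \<noteq> 0\<^sub>v n" "acm B *\<^sub>v v = x \<cdot>\<^sub>v v"
 shows "integral_elt x"
proof -
 have Bc: "B \<in> Mat n" using B by (rule mbd_carrier)
 obtain i0 where i0: "i0 < n" "v $ i0 \<noteq> 0" using v by (metis carrier_vecD eq_vecI index_zero_vec)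
 define w where "w i = v $ i / v $ i0" for i
 let ?S = "w ` {..<n}"
 have S: "finite ?S" by simp
 have eq: "x * w i = (\<Sum>j<n. to_ac (B $$ (i, j)) * w j)" if i: "i < n" for i
 proof -
  have "(acm B *\<^sub>v v) $ i = (\<Sum>j<n. to_ac (B $$ (i, j)) * v $ j)"
   using Bc v(1) i by (auto simp: scalar_prod_def lessThan_atLeast0 intro!: sum.cong)
  hence "x * v $ i = (\<Sum>j<n. to_ac (B $$ (i, j)) * v $ j)" using v i by simp
  thus ?thesis by (simp add: w_def sum_divide_distrib)
 qed
 have "x * w i \<in> ospan ?S" if "i < n" for i
  unfolding eq[OF that] by (intro ospan_sum ospan_smult ospan_base) (use B that in "auto simp: mbd_def")
 moreover have "1 \<in> ?S" using i0 by (intro image_eqI[of _ _ i0]) (auto simp: w_def)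
 ultimately show ?thesis unfolding integral_elt_def using S by (intro exI[of _ ?S]) auto
qed

text \<open>A linear functional fixing the ground field turns membership of all powers in a finitely
 generated lattice into a bound on the absolute values of the powers.\<close>

lemma absv_le_1_of_integral:
 assumes "integral_elt (to_ac a)"
 shows "absv a \<le> 1"
proof -
 from assms obtain S where S: "finite S" "1 \<in> S" "\<And>s. s \<in> S ==> to_ac a * s \<in> ospan S"
  unfolding integral_elt_def by blast
 interpret V: vector_space_pair "\<lambda>(c::'a) x. to_ac c * x" "(*) :: 'a => 'a => 'a"
  by unfold_locales (auto simp: algebra_simps)
 have "V.vs1.independent {1}" by (simp add: V.vs1.dependent_single)
 from V.linear_independent_extend[OF this, of "\<lambda>_. 1"] obtain \<phi> where
  lin: "Vector_Spaces.linear (\<lambda>(c::'a) x. to_ac c * x) (*) \<phi>" and \<phi>1: "\<phi> 1 = 1" by auto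
 interpret \<phi>: Vector_Spaces.linear "\<lambda>(c::'a) x. to_ac c * x" "(*) :: 'a => 'a => 'a" \<phi> by (rule lin)
 define R where "R = (\<Sum>s\<in>S. absv (\<phi> s))"
 have "absv (\<phi> y) \<le> R" if y: "y \<in> ospan S" for y
 proof -
  from y obtain c where c0: "\<forall>s\<in>S. absv (c s) \<le> 1" "y = (\<Sum>s\<in>S. to_ac (c s) * s)" by (rule ospanE)
   note c = c0(1)[rule_format] c0(2)
  have "\<phi> y = (\<Sum>s\<in>S. c s * \<phi> s)" by (simp add: c(2) \<phi>.sum \<phi>.scale)
  also have "absv \<dots> \<le> R"
  proof (rule absv_sum_le)
   fix s assume s: "s \<in> S"
   have "absv (c s * \<phi> s) \<le> absv (\<phi> s)"
    using mult_right_mono[OF c(1)[OF s] absv_nonneg[of "\<phi> s"]] by (simp add: absv_mult)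
   also have "\<dots> \<le> R" unfolding R_def by (rule member_le_sum) (use S s absv_nonneg in auto)
   finally show "absv (c s * \<phi> s) \<le> R" .
  qed (simp add: R_def sum_nonneg absv_nonneg)
  finally show ?thesis .
 qed
 moreover have "to_ac (a ^ k) \<in> ospan S" for k
 proof (induction k)
  case (Suc k)
  show ?case using ospan_mono_mult[OF Suc S(3)] by simp
 qed (simp add: ospan_base S)
 moreover have "\<phi> (to_ac (a ^ k)) = a ^ k" for k using \<phi>.scale[of "a ^ k" 1] \<phi>1 by simp
 ultimately have bound: "absv a ^ k \<le> R" for k by (metis absv_power)
 show ?thesis
 proof (rule ccontr)
  assume "\<not> ?thesis"
  then obtain k where "R < absv a ^ k" using real_arch_pow[of "absv a" R] by auto
  thus False using bound[of k] by simp
 qed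
qed

text \<open>Elements whose quotient by \<open>c\<close> is integral play the role of the elements of absolute value
 at most \<open>absv c\<close>.\<close>

definition abd :: "'a => 'a alg_closure => bool" where
 "abd c x \<longleftrightarrow> integral_elt (x / to_ac c)"

lemma abd_mult: "abd c x ==> abd d y ==> abd (c * d) (x * y)" unfolding abd_def using integral_elt_mult by fastforce

lemma abd_add: "abd c x ==> abd c y ==> abd c (x + y)"
 unfolding abd_def using integral_elt_add by (fastforce simp: add_divide_distrib)

lemma abd_mono: "abd c x ==> absv c \<le> absv d ==> c \<noteq> 0 ==> d \<noteq> 0 ==> abd d x"
proof -
 assume a: "abd c x" "absv c \<le> absv d" "c \<noteq> 0" "d \<noteq> 0"
 have "absv (c / d) \<le> 1" using a absv_pos[of d] by (simp add: absv_divide)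
 from integral_elt_mult[OF integral_elt_to_ac[OF this], of "x / to_ac c"] a show ?thesis by (simp add: abd_def)
qed

lemma abd_to_ac: "absv a \<le> absv c ==> c \<noteq> 0 ==> abd c (to_ac a)"
 using integral_elt_to_ac[of "a / c"] absv_pos[of c] by (simp add: abd_def absv_divide)

lemma abd_to_acD: "abd c (to_ac a) ==> c \<noteq> 0 ==> absv a \<le> absv c"
 using absv_le_1_of_integral[of "a / c"] absv_pos[of c] by (simp add: abd_def absv_divide)

lemma abd_minus: "abd c x ==> abd c (- x)"
 using integral_elt_mult[OF integral_elt_to_ac[of "-1"], of "x / to_ac c"] absv_minus_1 by (simp add: abd_def)

lemma abd_prod:
 assumes "\<And>i. i \<in> I ==> abd c (f i)"
 shows "abd (c ^ card I) (prod f I)" using assms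
proof (induction I rule: infinite_finite_induct)
 case (insert i I)
 thus ?case using abd_mult[of c "f i" "c ^ card I" "prod f I"] by auto
qed (auto simp: abd_def integral_elt_1)

lemma abd_eigenvalue:
 assumes B: "mbd n (absv c) B" "c \<noteq> 0"
  and v: "v \<in> Vec n" "v \<noteq> 0\<^sub>v n" "acm B *\<^sub>v v = x \<cdot>\<^sub>v v"
 shows "abd c x" unfolding abd_def
proof (rule integral_elt_eigenvalue[OF _ v(1,2)])
 have Bc: "B \<in> Mat n" using B(1) by (rule mbd_carrier)
 show "mbd n 1 (inverse c \<cdot> B)"
  using mbd_smult[OF B(1) absv_nonneg, of "inverse c"] absv_pos[OF B(2)] by (simp add: absv_inverse)
 have "acm (inverse c \<cdot> B) = inverse (to_ac c) \<cdot> acm B" by (auto intro!: eq_matI)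
 also have "\<dots> *\<^sub>v v = inverse (to_ac c) \<cdot>\<^sub>v (acm B *\<^sub>v v)"
  using Bc v(1) by (intro eq_vecI) (auto simp: scalar_prod_def sum_distrib_left mult.assoc)
 also have "\<dots> = (x / to_ac c) \<cdot>\<^sub>v v" unfolding v(3) using v(1) by (intro eq_vecI) (auto simp: field_simps)
 finally show "acm (inverse c \<cdot> B) *\<^sub>v v = (x / to_ac c) \<cdot>\<^sub>v v" .
qed

end

section \<open>Square matrices\<close>

text \<open>The laws of matrix algebra are restated for a single size. Once \<open>n\<close> is
  instantiated, the simplifier can discharge the dimension conditions without guessing intermediate
  sizes.\<close>

lemma sq_closed:
 "A \<in> Mat n ==> B \<in> Mat n ==> A + B \<in> Mat n"
 "A \<in> Mat n ==> B \<in> Mat n ==> A - B \<in> Mat n"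
 "A \<in> Mat n ==> B \<in> Mat n ==> A * B \<in> Mat n"
 "A \<in> Mat n ==> - A \<in> Mat n"
 "A \<in> Mat n ==> c \<cdot> A \<in> Mat n"
 "A \<in> Mat n ==> A\<^sup>T \<in> Mat n"
 "Id n \<in> Mat n" "0\<^sub>m n n \<in> Mat n"
 for A B :: "'b::field mat" by auto

lemma sq_assoc:
 "A \<in> Mat n ==> B \<in> Mat n ==> D \<in> Mat n ==> A * B * D = A * (B * D)"
 for A B D :: "'b::field mat" by (rule assoc_mult_mat)

lemma sq_distrib:
 "A \<in> Mat n ==> B \<in> Mat n ==> D \<in> Mat n ==> (A + B) * D = A * D + B * D"
 "A \<in> Mat n ==> B \<in> Mat n ==> D \<in> Mat n ==> (A - B) * D = A * D - B * D"
 "A \<in> Mat n ==> B \<in> Mat n ==> D \<in> Mat n ==> D * (A + B) = D * A + D * B"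
 "A \<in> Mat n ==> B \<in> Mat n ==> D \<in> Mat n ==> D * (A - B) = D * A - D * B"
 "A \<in> Mat n ==> B \<in> Mat n ==> (c \<cdot> A) * B = c \<cdot> (A * B)"
 "A \<in> Mat n ==> B \<in> Mat n ==> A * (c \<cdot> B) = c \<cdot> (A * B)"
 "A \<in> Mat n ==> B \<in> Mat n ==> (- A) * B = - (A * B)"
 "A \<in> Mat n ==> B \<in> Mat n ==> A * (- B) = - (A * B)"
 "A \<in> Mat n ==> Id n * A = A" "A \<in> Mat n ==> A * Id n = A"
 for A B D :: "'b::field mat"
 by (simp_all add: add_mult_distrib_mat[of _ n n _ _ n] minus_mult_distrib_mat[of _ n n _ _ n]
  mult_add_distrib_mat[of _ n n _ n] mult_minus_distrib_mat[of _ n n _ n]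
  mult_smult_assoc_mat[of _ n n _ n] mult_smult_distrib[of _ n n _ n])

lemma sq_transpose:
 "A \<in> Mat n ==> B \<in> Mat n ==> (A + B)\<^sup>T = A\<^sup>T + B\<^sup>T"
 "A \<in> Mat n ==> B \<in> Mat n ==> (A - B)\<^sup>T = A\<^sup>T - B\<^sup>T"
 "A \<in> Mat n ==> B \<in> Mat n ==> (A * B)\<^sup>T = B\<^sup>T * A\<^sup>T"
 "A \<in> Mat n ==> (c \<cdot> A)\<^sup>T = c \<cdot> A\<^sup>T"
 "A \<in> Mat n ==> (- A)\<^sup>T = - A\<^sup>T"
 for A B :: "'b::field mat" by (auto intro!: eq_matI simp: transpose_mult[of _ n n _ n])

lemma sq_eqI:
 "A \<in> Mat n ==> B \<in> Mat n ==>
  (\<And>i j. i < n ==> j < n ==> A $$ (i, j) = B $$ (i, j)) ==> A = B"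
 for A B :: "'b::field mat" by (intro eq_matI) auto

lemma sq_index:
 "A \<in> Mat n ==> B \<in> Mat n ==> i < n ==> j < n ==> (A + B) $$ (i, j) = A $$ (i, j) + B $$ (i, j)"
 "A \<in> Mat n ==> B \<in> Mat n ==> i < n ==> j < n ==> (A - B) $$ (i, j) = A $$ (i, j) - B $$ (i, j)"
 "A \<in> Mat n ==> i < n ==> j < n ==> (- A) $$ (i, j) = - A $$ (i, j)"
 "A \<in> Mat n ==> i < n ==> j < n ==> (c \<cdot> A) $$ (i, j) = c * A $$ (i, j)"
 "i < n ==> j < n ==> (0\<^sub>m n n :: 'b mat) $$ (i, j) = 0"
 for A B :: "'b::field mat" by auto

lemma sq_mult_index:
 "A \<in> Mat n ==> B \<in> Mat n ==> i < n ==> j < n ==>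
  (A * B) $$ (i, j) = (\<Sum>k<n. A $$ (i, k) * B $$ (k, j))"
 for A B :: "'b::field mat" by (auto simp: scalar_prod_def lessThan_atLeast0)

text \<open>Cancellation of mutually inverse neighbours inside the right-nested products that
  \<open>sq_assoc\<close> produces.\<close>

lemma sq_inv_cancel:
 fixes A B D :: "'b::field mat"
 assumes "A \<in> Mat n" "B \<in> Mat n" "A * B = Id n" "D \<in> Mat n"
 shows "A * (B * D) = D" "B * (A * D) = D" "B * A = Id n"
proof -
 show BA: "B * A = Id n" by (rule mat_mult_left_right_inverse[OF assms(1-3)])
 show "A * (B * D) = D" using assms by (simp flip: assoc_mult_mat[of _ n n _ n _ n])
 show "B * (A * D) = D" using assms BA by (simp flip: assoc_mult_mat[of _ n n _ n _ n])
qed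

lemma sq_vec:
 "A \<in> Mat n ==> B \<in> Mat n ==> v \<in> Vec n ==> (A * B) *\<^sub>v v = A *\<^sub>v (B *\<^sub>v v)"
 "A \<in> Mat n ==> v \<in> Vec n ==> A *\<^sub>v (c \<cdot>\<^sub>v v) = c \<cdot>\<^sub>v (A *\<^sub>v v)"
 "A \<in> Mat n ==> v \<in> Vec n ==> (c \<cdot> A) *\<^sub>v v = c \<cdot>\<^sub>v (A *\<^sub>v v)"
 "A \<in> Mat n ==> B \<in> Mat n ==> v \<in> Vec n ==> (A + B) *\<^sub>v v = A *\<^sub>v v + B *\<^sub>v v"
 "A \<in> Mat n ==> B \<in> Mat n ==> v \<in> Vec n ==> (A - B) *\<^sub>v v = A *\<^sub>v v - B *\<^sub>v v"
 "A \<in> Mat n ==> v \<in> Vec n ==> w \<in> Vec n ==> A *\<^sub>v (v + w) = A *\<^sub>v v + A *\<^sub>v w"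
 "A \<in> Mat n ==> v \<in> Vec n ==> A *\<^sub>v v \<in> Vec n"
 "v \<in> Vec n ==> Id n *\<^sub>v v = v"
 for A B :: "'b::field mat" by (auto simp: mult_add_distrib_mat_vec[of _ n n] add_mult_distrib_mat_vec[of _ n n]
   minus_mult_distrib_mat_vec[of _ n n] mult_mat_vec[of _ n n]
   intro!: eq_vecI simp: scalar_prod_def sum_distrib_left mult_ac)

section \<open>Lie algebras of isometry groups\<close>

text \<open>\<open>jet u a b\<close>: off the zeros of its denominator \<open>u\<close> agrees with a rational function that is
 regular at the origin with Taylor expansion \<open>a + b t + \<dots>\<close>.\<close>

definition jet :: "('b::field => 'b) => 'b => 'b => bool" where
 "jet u a b \<longleftrightarrow> (\<exists>p d. poly.coeff d 0 \<noteq> 0 \<and> (\<forall>t. poly d t \<noteq> 0 --> u t = poly p t / poly d t) \<and>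
   poly.coeff p 0 = a * poly.coeff d 0 \<and> poly.coeff p 1 = a * poly.coeff d 1 + b * poly.coeff d 0)"

lemma coeff_mult_01:
 "poly.coeff (p * r) 0 = poly.coeff p 0 * poly.coeff r (0::nat)"
 "poly.coeff (p * r) 1 = poly.coeff p 0 * poly.coeff r 1 + poly.coeff p 1 * poly.coeff r (0::nat)"
 by (simp_all add: coeff_mult)

lemma jet_poly: "(\<And>t. u t = poly p t) ==> jet u (poly.coeff p 0) (poly.coeff p 1)"
 unfolding jet_def by (intro exI[of _ p] exI[of _ 1]) auto

lemma jet_ratio: "poly.coeff d 0 \<noteq> 0 ==> (\<And>t. poly d t \<noteq> 0 ==> u t = poly p t / poly d t) ==> \<exists>a b. jet u a b"
proof -
 assume d: "poly.coeff d 0 \<noteq> 0" "\<And>t. poly d t \<noteq> 0 ==> u t = poly p t / poly d t"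
 let ?a = "poly.coeff p 0 / poly.coeff d 0"
 let ?b = "(poly.coeff p 1 - ?a * poly.coeff d 1) / poly.coeff d 0"
 have "jet u ?a ?b" unfolding jet_def by (rule exI[of _ p], rule exI[of _ d]) (use d in auto)
 thus ?thesis by blast
qed

lemma jet_const: "jet (\<lambda>_. c) c 0" using jet_poly[of "\<lambda>_. c" "[:c:]"] by simp

lemma jet_ident: "jet (\<lambda>t. t) 0 1" using jet_poly[of "\<lambda>t. t" "[:0, 1:]"] by simp

lemma jet_add: "jet u a b ==> jet v c d ==> jet (\<lambda>t. u t + v t) (a + c) (b + d)"
proof -
 assume "jet u a b" "jet v c d"
 then obtain p e q f where
  p: "poly.coeff e 0 \<noteq> 0" "\<And>t. poly e t \<noteq> 0 ==> u t = poly p t / poly e t"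
   "poly.coeff p 0 = a * poly.coeff e 0" "poly.coeff p 1 = a * poly.coeff e 1 + b * poly.coeff e 0" and
  q: "poly.coeff f 0 \<noteq> 0" "\<And>t. poly f t \<noteq> 0 ==> v t = poly q t / poly f t"
   "poly.coeff q 0 = c * poly.coeff f 0" "poly.coeff q 1 = c * poly.coeff f 1 + d * poly.coeff f 0"
  unfolding jet_def by blast
 show ?thesis unfolding jet_def
 proof (rule exI[of _ "p * f + q * e"], rule exI[of _ "e * f"], intro conjI allI impI)
  fix t assume "poly (e * f) t \<noteq> 0"
  hence "poly e t \<noteq> 0" "poly f t \<noteq> 0" by auto
  thus "u t + v t = poly (p * f + q * e) t / poly (e * f) t" by (simp add: p(2) q(2) field_simps)
 qed (simp_all add: coeff_mult_01[unfolded One_nat_def] p(1,3) p(4)[unfolded One_nat_def] q(1,3) q(4)[unfolded One_nat_def] algebra_simps)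
qed

lemma jet_mult: "jet u a b ==> jet v c d ==> jet (\<lambda>t. u t * v t) (a * c) (a * d + b * c)"
proof -
 assume "jet u a b" "jet v c d"
 then obtain p e q f where
  p: "poly.coeff e 0 \<noteq> 0" "\<And>t. poly e t \<noteq> 0 ==> u t = poly p t / poly e t"
   "poly.coeff p 0 = a * poly.coeff e 0" "poly.coeff p 1 = a * poly.coeff e 1 + b * poly.coeff e 0" and
  q: "poly.coeff f 0 \<noteq> 0" "\<And>t. poly f t \<noteq> 0 ==> v t = poly q t / poly f t"
   "poly.coeff q 0 = c * poly.coeff f 0" "poly.coeff q 1 = c * poly.coeff f 1 + d * poly.coeff f 0"
  unfolding jet_def by blast
 show ?thesis unfolding jet_def
 proof (rule exI[of _ "p * q"], rule exI[of _ "e * f"], intro conjI allI impI)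
  fix t assume "poly (e * f) t \<noteq> 0"
  hence "poly e t \<noteq> 0" "poly f t \<noteq> 0" by auto
  thus "u t * v t = poly (p * q) t / poly (e * f) t" by (simp add: p(2) q(2))
 qed (simp_all add: coeff_mult_01[unfolded One_nat_def] p(1,3) p(4)[unfolded One_nat_def] q(1,3) q(4)[unfolded One_nat_def] algebra_simps)
qed

lemma jet_sum: "(\<And>i. i \<in> I ==> jet (u i) (a i) (b i)) ==> jet (\<lambda>t. \<Sum>i\<in>I. u i t) (sum a I) (sum b I)"
 by (induction I rule: infinite_finite_induct) (auto intro: jet_const jet_add)

text \<open>A rational function that vanishes off the zeros of a nonzero polynomial has zero
  numerator, because the field is infinite.\<close>

lemma jet_eq_0:
 fixes u :: "'b::field_char_0 => 'b"
 assumes "jet u a b" "e \<noteq> 0" "\<And>t. poly e t \<noteq> 0 ==> u t = 0"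
 shows "a = 0" "b = 0"
proof -
 from assms(1) obtain p d where
  p: "poly.coeff d 0 \<noteq> 0" "\<And>t. poly d t \<noteq> 0 ==> u t = poly p t / poly d t"
   "poly.coeff p 0 = a * poly.coeff d 0" "poly.coeff p 1 = a * poly.coeff d 1 + b * poly.coeff d 0"
  unfolding jet_def by blast
 have d: "d \<noteq> 0" using p(1) by auto
 have "poly (p * (e * d)) t = 0" for t
  using p(2)[of t] assms(3)[of t] by (cases "poly e t = 0"; cases "poly d t = 0") auto
 hence "p * (e * d) = 0" using poly_all_0_iff_0 by blast
 hence "p = 0" using d assms(2) by simp
 thus "a = 0" "b = 0" using p by auto
qed

lemma jet_unique:
 fixes u :: "'b::field_char_0 => 'b"
 assumes "jet u a b" "jet v c d" "e \<noteq> 0" "\<And>t. poly e t \<noteq> 0 ==> u t = v t"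
 shows "a = c" "b = d"
proof -
 have "jet (\<lambda>t. u t + (-1) * v t) (a + (-1) * c) (b + ((-1) * d + 0 * c))"
  by (intro jet_add assms jet_mult jet_const)
 from jet_eq_0[OF this assms(3)] assms(4) show "a = c" "b = d" by auto
qed

text \<open>The chain rule to first order: the straight line through the identity and any curve with
  the same tangent give the same constant and linear coefficients under a polynomial
  function.\<close>

lemma poly_funs_line_jet:
 fixes A :: "'b::field_char_0 mat"
 assumes "f \<in> poly_funs n UNIV" "A \<in> Mat n"
  and c: "\<And>i j. i < n ==> j < n ==> jet (\<lambda>t. c t $$ (i, j)) (if i = j then 1 else 0) (A $$ (i, j))"
 shows "\<exists>p. (\<forall>t. poly p t = f (Id n + t \<cdot> A)) \<and> jet (\<lambda>t. f (c t)) (poly.coeff p 0) (poly.coeff p 1)"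
 using assms(1)
proof (induction rule: poly_funs.induct)
 case (const k)
 show ?case by (rule exI[of _ "[:k:]"]) (simp add: jet_const)
next
 case (entry i j)
 show ?case by (rule exI[of _ "[:if i = j then 1 else 0, A $$ (i, j):]"]) (use entry c[of i j] assms(2) in simp)
next
 case (add f g)
 then obtain p r where "\<forall>t. poly p t = f (Id n + t \<cdot> A)" "jet (\<lambda>t. f (c t)) (poly.coeff p 0) (poly.coeff p 1)"
  "\<forall>t. poly r t = g (Id n + t \<cdot> A)" "jet (\<lambda>t. g (c t)) (poly.coeff r 0) (poly.coeff r 1)" by blast
 thus ?case by (intro exI[of _ "p + r"]) (auto intro: jet_add)
next
 case (mult f g)
 then obtain p r where pr: "\<forall>t. poly p t = f (Id n + t \<cdot> A)" "jet (\<lambda>t. f (c t)) (poly.coeff p 0) (poly.coeff p 1)"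
  "\<forall>t. poly r t = g (Id n + t \<cdot> A)" "jet (\<lambda>t. g (c t)) (poly.coeff r 0) (poly.coeff r 1)" by blast
 show ?case
 proof (rule exI[of _ "p * r"], intro conjI)
  show "\<forall>t. poly (p * r) t = f (Id n + t \<cdot> A) * g (Id n + t \<cdot> A)" using pr by simp
  show "jet (\<lambda>t. f (c t) * g (c t)) (poly.coeff (p * r) 0) (poly.coeff (p * r) 1)"
   unfolding coeff_mult_01 by (rule jet_mult[OF pr(2,4)])
 qed
qed

text \<open>The definition of \<open>Lie\<close> uses the straight line \<open>Id n + t A\<close>,
  which rarely lies in the group. It may be replaced by any rational curve in the group with tangent
  \<open>A\<close> at the identity, even one that is undefined or leaves the group at the zeros of
  \<open>e\<close>.\<close>

lemma LieI:
 fixes A :: "'a::field_char_0 mat"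
 assumes "A \<in> Mat n"
  and "\<And>i j. i < n ==> j < n ==> jet (\<lambda>t. c t $$ (i, j)) (if i = j then 1 else 0) (to_ac (A $$ (i, j)))"
  and "e \<noteq> 0" "\<And>t. poly e t \<noteq> 0 ==> c t \<in> G"
 shows "A \<in> Lie n G" unfolding Lie_def
proof (intro CollectI conjI ballI impI)
 fix f :: "'a alg_closure mat => 'a alg_closure"
 assume f: "f \<in> poly_funs n UNIV" "\<forall>g\<in>G. f g = 0"
 have A: "acm A \<in> Mat n" using assms(1) by simp
 have "jet (\<lambda>t. c t $$ (i, j)) (if i = j then 1 else 0) (acm A $$ (i, j))" if "i < n" "j < n" for i j
  using assms(1,2) that by simp
 from poly_funs_line_jet[OF f(1) A this] obtain p where
  p: "\<forall>t. poly p t = f (Id n + t \<cdot> acm A)" "jet (\<lambda>t. f (c t)) (poly.coeff p 0) (poly.coeff p 1)" by blast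
 have "poly.coeff p 1 = 0" by (rule jet_eq_0(2)[OF p(2) assms(3)]) (use assms(4) f(2) in auto)
 thus "\<exists>p. (\<forall>t. poly p t = f (Id n + t \<cdot> acm A)) \<and> poly.coeff p 1 = 0" using p(1) by blast
qed (fact assms(1))

lemma LieD:
 fixes A :: "'a::field_char_0 mat"
 assumes "A \<in> Lie n G" "f \<in> poly_funs n UNIV" "\<And>g. g \<in> G ==> f g = 0"
  "\<And>t. poly p t = f (Id n + t \<cdot> acm A)"
 shows "poly.coeff p 1 = 0"
proof -
 from assms(1-3) obtain r where r: "\<forall>t. poly r t = f (Id n + t \<cdot> acm A)" "poly.coeff r 1 = 0"
  unfolding Lie_def by blast
 have "poly p = poly r" using assms(4) r(1) by auto
 hence "p = r" by (simp add: poly_eq_poly_eq_iff)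
 thus ?thesis using r by simp
qed

lemma poly_eval_hom: "comm_ring_hom (\<lambda>p. poly p t)" for t :: "'b::comm_ring_1" by unfold_locales auto

lemma poly_eval_semiring_hom: "semiring_hom (\<lambda>p. poly p t)" for t :: "'b::comm_ring_1" by unfold_locales auto

lemma Lie_GL: "Lie n (carrier (GL n)) = (Mat n :: 'a::field_char_0 mat set)"
proof
 show "Lie n (carrier (GL n)) \<subseteq> (Mat n :: 'a mat set)" by (auto simp: Lie_def)
 show "(Mat n :: 'a mat set) \<subseteq> Lie n (carrier (GL n))"
 proof
  fix A :: "'a mat" assume A: "A \<in> Mat n"
  let ?A = "acm A"
  let ?N = "mat n n (\<lambda>(i, j). [:if i = j then 1 else 0, to_ac (A $$ (i, j)):])"
  have N: "map_mat (\<lambda>p. poly p t) ?N = Id n + t \<cdot> ?A" for t using A by (auto intro!: eq_matI)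
  have det: "poly (det ?N) t = det (Id n + t \<cdot> ?A)" for t
   using comm_ring_hom.hom_det[OF poly_eval_hom, of t ?N] by (simp add: N)
  have "Id n + 0 \<cdot> ?A = Id n" using A by (auto intro!: eq_matI)
  hence "poly (det ?N) 0 = 1" unfolding det by simp
  hence "det ?N \<noteq> 0" by auto
  show "A \<in> Lie n (carrier (GL n))"
  proof (rule LieI[OF A, of "\<lambda>t. Id n + t \<cdot> ?A" "det ?N"])
   fix i j assume "i < n" "j < n"
   thus "jet (\<lambda>t. (Id n + t \<cdot> ?A) $$ (i, j)) (if i = j then 1 else 0) (to_ac (A $$ (i, j)))"
    using jet_poly[of "\<lambda>t. (Id n + t \<cdot> ?A) $$ (i, j)" "[:if i = j then 1 else 0, to_ac (A $$ (i, j)):]"] A by simp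
  qed (use \<open>det ?N \<noteq> 0\<close> A in "auto simp: carrier_GL det")
 qed
qed

text \<open>\<open>Y t\<close> is the inverse of \<open>1 - t M\<close>, written as adjugate over
  determinant so that its entries are rational in \<open>t\<close> and regular at
  \<open>0\<close>.\<close>

lemma resolvent:
 fixes M :: "'b::field_char_0 mat"
 assumes M: "M \<in> Mat n"
 obtains Y D where "D \<noteq> 0" "\<forall>t. Y t \<in> Mat n"
  "\<forall>t. poly D t \<noteq> 0 --> (Id n - t \<cdot> M) * Y t = Id n"
  "\<forall>i j. i < n --> j < n --> jet (\<lambda>t. Y t $$ (i, j)) (if i = j then 1 else 0) (M $$ (i, j))"
proof -
 let ?N = "mat n n (\<lambda>(i, j). [:if i = j then 1 else 0, - M $$ (i, j):])"
 have Nc: "?N \<in> Mat n" by simp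
 have N: "map_mat (\<lambda>p. poly p t) ?N = Id n - t \<cdot> M" for t using M by (auto intro!: eq_matI)
 let ?D = "det ?N"
 have det: "poly ?D t = det (Id n - t \<cdot> M)" for t
  using comm_ring_hom.hom_det[OF poly_eval_hom, of t ?N] by (simp add: N)
 have "Id n - 0 \<cdot> M = Id n" using M by (auto intro!: eq_matI)
 hence D0: "poly ?D 0 = 1" unfolding det by simp
 hence D: "?D \<noteq> 0" by auto
 define Y where "Y t = inverse (poly ?D t) \<cdot> map_mat (\<lambda>p. poly p t) (adj_mat ?N)" for t
 have aN: "adj_mat ?N \<in> Mat n" by (rule adj_mat(1)[OF Nc])
 have Yc: "Y t \<in> Mat n" for t using aN by (simp add: Y_def)
 have inv: "(Id n - t \<cdot> M) * Y t = Id n" if "poly ?D t \<noteq> 0" for t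
 proof -
  have "map_mat (\<lambda>p. poly p t) ?N * map_mat (\<lambda>p. poly p t) (adj_mat ?N) = map_mat (\<lambda>p. poly p t) (?D \<cdot> Id n)"
   using semiring_hom.mat_hom_mult[OF poly_eval_semiring_hom Nc aN, of t] adj_mat(2)[OF Nc] by simp
  also have "\<dots> = poly ?D t \<cdot> Id n" by (auto intro!: eq_matI)
  finally have "(Id n - t \<cdot> M) * map_mat (\<lambda>p. poly p t) (adj_mat ?N) = poly ?D t \<cdot> Id n" unfolding N .
  moreover have "(Id n - t \<cdot> M) * Y t = inverse (poly ?D t) \<cdot> ((Id n - t \<cdot> M) * map_mat (\<lambda>p. poly p t) (adj_mat ?N))"
   unfolding Y_def by (rule mult_smult_distrib[of _ n n _ n]) (use M aN in auto)
  ultimately show ?thesis using that by (auto intro!: eq_matI)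
 qed
 have "\<exists>a b. jet (\<lambda>t. Y t $$ (i, j)) a b" if "i < n" "j < n" for i j
  by (rule jet_ratio[of ?D _ "adj_mat ?N $$ (i, j)"])
   (use D0 that aN in "auto simp: Y_def poly_0_coeff_0 divide_inverse mult.commute")
 then obtain a b where ab: "\<And>i j. i < n ==> j < n ==> jet (\<lambda>t. Y t $$ (i, j)) (a i j) (b i j)" by metis
 \<comment> \<open>The equation \<open>Y = 1 + t M Y\<close> determines the constant coefficients of
   the expansion of \<open>Y\<close>, and through them the linear ones.\<close>
 have eq: "Y t $$ (i, j) = (if i = j then 1 else 0) + t * (\<Sum>k<n. M $$ (i, k) * Y t $$ (k, j))"
  if "poly ?D t \<noteq> 0" "i < n" "j < n" for t i j
 proof -
  have "((Id n - t \<cdot> M) * Y t) $$ (i, j) = (\<Sum>k<n. ((if i = k then 1 else 0) - t * M $$ (i, k)) * Y t $$ (k, j))"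
   using Yc[of t] M that by (auto simp: scalar_prod_def lessThan_atLeast0 intro!: sum.cong)
  also have "\<dots> = (\<Sum>k<n. (if i = k then Y t $$ (k, j) else 0) - t * (M $$ (i, k) * Y t $$ (k, j)))"
   by (intro sum.cong) (auto simp: algebra_simps)
  also have "\<dots> = Y t $$ (i, j) - t * (\<Sum>k<n. M $$ (i, k) * Y t $$ (k, j))"
   using that by (simp add: sum_subtractf sum_distrib_left)
  finally show ?thesis using inv[OF that(1)] that by simp
 qed
 have jets: "jet (\<lambda>t. (if i = j then 1 else 0) + t * (\<Sum>k<n. M $$ (i, k) * Y t $$ (k, j)))
   ((if i = j then 1 else 0) + 0 * (\<Sum>k<n. M $$ (i, k) * a k j))
   (0 + (0 * (\<Sum>k<n. M $$ (i, k) * b k j + 0 * a k j) + 1 * (\<Sum>k<n. M $$ (i, k) * a k j)))"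
  if "i < n" "j < n" for i j by (intro jet_add jet_mult jet_sum jet_const jet_ident ab) (use that in auto)
 have a: "a i j = (if i = j then 1 else 0)" and b: "b i j = (\<Sum>k<n. M $$ (i, k) * a k j)"
  if "i < n" "j < n" for i j using jet_unique[OF ab[OF that] jets[OF that] D eq[OF _ that]] by auto
 have "b i j = M $$ (i, j)" if "i < n" "j < n" for i j
 proof -
  have "b i j = (\<Sum>k<n. if k = j then M $$ (i, k) else 0)"
   unfolding b[OF that] using a that by (intro sum.cong) auto
  thus ?thesis using that by simp
 qed
 hence jY: "jet (\<lambda>t. Y t $$ (i, j)) (if i = j then 1 else 0) (M $$ (i, j))" if "i < n" "j < n" for i j
  using ab[OF that] a that by simp
 show ?thesis
 proof (rule that[of ?D Y])
  show "\<forall>t. Y t \<in> Mat n" using Yc by blast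
  show "\<forall>t. poly ?D t \<noteq> 0 --> (Id n - t \<cdot> M) * Y t = Id n" by (intro allI impI inv)
  show "\<forall>i j. i < n --> j < n --> jet (\<lambda>t. Y t $$ (i, j)) (if i = j then 1 else 0) (M $$ (i, j))"
   by (intro allI impI jY)
 qed (rule D)
qed

lemma commute_inverse:
 fixes K Y Z :: "'b::field mat"
 assumes c: "Z \<in> Mat n" "K \<in> Mat n" "Y \<in> Mat n"
  and "Z * K = K * Z" "Z * Y = Id n"
 shows "Y * K = K * Y"
proof -
 note assoc = assoc_mult_mat[of _ n n _ n _ n]
 have Y': "Y * Z = Id n" by (rule mat_mult_left_right_inverse[OF c(1,3) assms(5)])
 have "Y * K = Y * K * (Z * Y)" using c by (simp add: assms(5))
 also have "\<dots> = Y * (K * Z) * Y" using c by (simp add: assoc)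
 also have "\<dots> = Y * (Z * K) * Y" by (simp only: assms(4))
 also have "\<dots> = Y * Z * (K * Y)" using c by (simp add: assoc)
 finally show ?thesis using c by (simp add: Y')
qed

text \<open>The Cayley transform of a skew element. Skewness exchanges the factors
  \<open>1 + M\<close> and \<open>1 - M\<close> with the transposes of each other when they move
  past \<open>B\<close>, and the two factors commute.\<close>

lemma cayley_isometry:
 fixes M B Y :: "'b::field mat"
 assumes c: "M \<in> Mat n" "B \<in> Mat n" "Y \<in> Mat n"
  and MB: "M * B = - (B * M\<^sup>T)" and Y: "(Id n - M) * Y = Id n"
 shows "((Id n + M) * Y) * B * ((Id n + M) * Y)\<^sup>T = B"
proof -
 let ?p = "Id n + M" and ?m = "Id n - M" and ?pt = "Id n + M\<^sup>T" and ?mt = "Id n - M\<^sup>T"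
 have cc: "?p \<in> Mat n" "?m \<in> Mat n" "?pt \<in> Mat n" "?mt \<in> Mat n"
  "Y\<^sup>T \<in> Mat n" "M\<^sup>T \<in> Mat n" using c by auto
 note assoc = assoc_mult_mat[of _ n n _ n _ n]
 have Y': "Y * ?m = Id n" by (rule mat_mult_left_right_inverse[OF cc(2) c(3) Y])
 have 1: "?p * B = B * ?mt" "?m * B = B * ?pt"
  using c MB by (simp_all add: sq_distrib[where n=n] sq_closed[where n=n])
   (auto intro!: sq_eqI[where n=n] sq_closed[where n=n] simp: sq_closed[where n=n] sq_index[where n=n])
 have tm: "?m\<^sup>T = ?mt" "?p\<^sup>T = ?pt" using c by (auto intro!: eq_matI)
 have 2: "?mt * Y\<^sup>T = Id n"
  using arg_cong[OF Y', of transpose_mat] c cc by (simp add: transpose_mult[of _ n n _ n] tm)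
 have pm: "?p * ?m = ?m * ?p" using c by (simp add: sq_distrib[where n=n] sq_closed[where n=n])
   (auto intro!: sq_eqI[where n=n] sq_closed[where n=n] simp: sq_closed[where n=n] sq_index[where n=n])
 have comm: "?p * Y = Y * ?p" by (rule commute_inverse[OF cc(2,1) c(3) pm[symmetric] Y, symmetric])
 have 3: "Y * (B * ?pt) = B" unfolding 1(2)[symmetric] by (rule sq_inv_cancel[OF cc(2) c(3) Y c(2)])
 have 4: "?p * (B * Y\<^sup>T) = B"
 proof -
  have "?p * (B * Y\<^sup>T) = ?p * B * Y\<^sup>T" by (rule sq_assoc[OF cc(1) c(2) cc(5), symmetric])
  also have "\<dots> = B * (?mt * Y\<^sup>T)" unfolding 1 by (rule sq_assoc[OF c(2) cc(4,5)])
  finally show ?thesis using c by (simp add: 2)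
 qed
 have "(?p * Y)\<^sup>T = Y\<^sup>T * ?pt" using transpose_mult[OF cc(1) c(3)] by (simp only: tm)
 hence "?p * Y * B * (?p * Y)\<^sup>T = Y * ?p * B * (Y\<^sup>T * ?pt)" by (simp only: comm)
 also have "\<dots> = Y * (?p * (B * Y\<^sup>T) * ?pt)" using c cc by (simp only: sq_assoc[where n=n] sq_closed[where n=n])
 also have "\<dots> = B" by (simp only: 4 3)
 finally show ?thesis .
qed

text \<open>One inclusion reads off the linear coefficients of the defining equations along the
  line. The other one needs actual curves in the group; the Cayley transform supplies rational ones,
  and it also commutes with \<open>K\<close>. The case \<open>K = Id n\<close> gives the isometry
  group itself.\<close>

lemma Lie_isometry_centralizer:
 fixes B K :: "'a::field_char_0 alg_closure mat"
 assumes B: "B \<in> Mat n" "det B \<noteq> 0" and K: "K \<in> Mat n"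
 defines "G \<equiv> {g \<in> carrier (GL n). g * B * g\<^sup>T = B \<and> g * K = K * g}"
 shows "Lie n G = {A \<in> Mat n. acm A * B = - (B * (acm A)\<^sup>T) \<and>
  acm A * K = K * acm A}" (is "_ = ?R")
proof
 show "Lie n G \<subseteq> ?R"
 proof
  fix A assume A: "A \<in> Lie n G"
  hence Ac: "A \<in> Mat n" by (simp add: Lie_def)
  let ?A = "acm A"
  have c: "?A \<in> Mat n" "Id n + t \<cdot> ?A \<in> Mat n" for t using Ac by auto
  have "(?A * B + B * ?A\<^sup>T) $$ (i, j) = 0" if ij: "i < n" "j < n" for i j
  proof -
   have "poly_mat n UNIV (\<lambda>g. g * B * g\<^sup>T + (- B))"
    by (intro poly_mat_add poly_mat_mult poly_mat_id poly_mat_transpose poly_mat_const) (use B in auto)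
   from poly_matD(2)[OF this ij] obtain f where f: "f \<in> poly_funs n UNIV"
    "\<forall>g\<in>Mat n. (g * B * g\<^sup>T + (- B)) $$ (i, j) = f g" by (rule bexE)
   have "poly.coeff [:0, (?A * B + B * ?A\<^sup>T) $$ (i, j), (?A * B * ?A\<^sup>T) $$ (i, j):] 1 = 0"
   proof (rule LieD[OF A f(1)])
    fix g assume "g \<in> G"
    hence "g \<in> Mat n" "g * B * g\<^sup>T = B" by (auto simp: G_def carrier_GL)
    thus "f g = 0" using f(2)[rule_format, of g] B ij by simp
   next
    fix t
    have "(Id n + t \<cdot> ?A) * B * (Id n + t \<cdot> ?A)\<^sup>T + (- B) =
      t \<cdot> (?A * B + B * ?A\<^sup>T) + (t * t) \<cdot> (?A * B * ?A\<^sup>T)"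
    proof -
     have "?A \<in> Mat n" using Ac by simp
     thus ?thesis using B
      by (simp add: sq_transpose[where n=n] sq_distrib[where n=n] sq_closed[where n=n] sq_assoc[where n=n])
       (auto intro!: sq_eqI[where n=n] sq_closed[where n=n]
        simp: sq_closed[where n=n] sq_index[where n=n] algebra_simps simp del: index_mult_mat)
    qed
    hence "f (Id n + t \<cdot> ?A) = (t \<cdot> (?A * B + B * ?A\<^sup>T) + (t * t) \<cdot> (?A * B * ?A\<^sup>T)) $$ (i, j)"
     using f(2)[rule_format, OF c(2)[of t]] by simp
    thus "poly [:0, (?A * B + B * ?A\<^sup>T) $$ (i, j), (?A * B * ?A\<^sup>T) $$ (i, j):] t = f (Id n + t \<cdot> ?A)"
     using ij Ac B by (auto simp: algebra_simps)
   qed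
   thus ?thesis by simp
  qed
  hence "?A * B + B * ?A\<^sup>T = 0\<^sub>m n n" using Ac B by (intro eq_matI) auto
  hence 1: "?A * B = - (B * ?A\<^sup>T)"
  proof -
   assume *: "?A * B + B * ?A\<^sup>T = 0\<^sub>m n n"
   have "(?A * B) $$ (i, j) + (B * ?A\<^sup>T) $$ (i, j) = 0" if "i < n" "j < n" for i j
    using arg_cong[OF *, of "\<lambda>M. M $$ (i, j)"] that Ac B by simp
   thus ?thesis using Ac B
   by (intro sq_eqI[where n=n]) (auto simp: add_eq_0_iff2 sq_index[where n=n] sq_closed[where n=n] simp del: index_mult_mat)
  qed
  have "(?A * K - K * ?A) $$ (i, j) = 0" if ij: "i < n" "j < n" for i j
  proof -
   have "poly_mat n UNIV (\<lambda>g. g * K + (- K) * g)"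
    by (intro poly_mat_add poly_mat_mult poly_mat_id poly_mat_const) (use K in auto)
   from poly_matD(2)[OF this ij] obtain f where f: "f \<in> poly_funs n UNIV"
    "\<forall>g\<in>Mat n. (g * K + (- K) * g) $$ (i, j) = f g" by (rule bexE)
   have "poly.coeff [:0, (?A * K - K * ?A) $$ (i, j):] 1 = 0"
   proof (rule LieD[OF A f(1)])
    fix g assume "g \<in> G"
    hence g: "g \<in> Mat n" "g * K = K * g" by (auto simp: G_def carrier_GL)
    have "(- K) * g = - (K * g)" using K g by (simp add: uminus_mult_left_mat)
    thus "f g = 0" using f(2)[rule_format, of g] g K ij by simp
   next
    fix t
    have "(Id n + t \<cdot> ?A) * K + (- K) * (Id n + t \<cdot> ?A) = t \<cdot> (?A * K - K * ?A)"
    proof -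
     have "?A \<in> Mat n" using Ac by simp
     thus ?thesis using K by (simp add: sq_distrib[where n=n] sq_closed[where n=n])
       (auto intro!: sq_eqI[where n=n] sq_closed[where n=n]
        simp: sq_closed[where n=n] sq_index[where n=n] algebra_simps simp del: index_mult_mat)
    qed
    hence "f (Id n + t \<cdot> ?A) = (t \<cdot> (?A * K - K * ?A)) $$ (i, j)" using f(2)[rule_format, OF c(2)[of t]] by simp
    thus "poly [:0, (?A * K - K * ?A) $$ (i, j):] t = f (Id n + t \<cdot> ?A)" using ij Ac K by auto
   qed
   thus ?thesis by simp
  qed
  hence "(?A * K) $$ (i, j) = (K * ?A) $$ (i, j)" if "i < n" "j < n" for i j
   using that Ac K by (auto simp del: index_mult_mat(1))
  hence 2: "?A * K = K * ?A" using Ac K by (intro eq_matI) (auto simp del: index_mult_mat(1))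
  show "A \<in> ?R" using Ac 1 2 by simp
 qed
 show "?R \<subseteq> Lie n G"
 proof
  fix A assume "A \<in> ?R"
  hence Ac: "A \<in> Mat n" and AB: "acm A * B = - (B * (acm A)\<^sup>T)"
   and AK: "acm A * K = K * acm A" by auto
  \<comment> \<open>The curve \<open>(1 + t M) (1 - t M)^(-1)\<close> has tangent
    \<open>2 M\<close>, hence the factor one half.\<close>
  define M where "M = inverse 2 \<cdot> acm A"
  have M: "M \<in> Mat n" using Ac by (simp add: M_def)
  obtain Y D where Y0: "D \<noteq> 0" "\<forall>t. Y t \<in> Mat n"
   "\<forall>t. poly D t \<noteq> 0 --> (Id n - t \<cdot> M) * Y t = Id n"
   "\<forall>i j. i < n --> j < n --> jet (\<lambda>t. Y t $$ (i, j)) (if i = j then 1 else 0) (M $$ (i, j))"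
   by (rule resolvent[OF M])
  note Y = Y0(1) Y0(2,3,4)[rule_format]
  let ?c = "\<lambda>t. (Id n + t \<cdot> M) * Y t"
  show "A \<in> Lie n G"
  proof (rule LieI[OF Ac, of ?c D])
   fix i j assume ij: "i < n" "j < n"
   have eq: "?c t $$ (i, j) = Y t $$ (i, j) + t * (\<Sum>k<n. M $$ (i, k) * Y t $$ (k, j))" for t
   proof -
    have "?c t $$ (i, j) = (\<Sum>k<n. ((if i = k then 1 else 0) + t * M $$ (i, k)) * Y t $$ (k, j))"
     using Y(2)[of t] M ij by (auto simp: scalar_prod_def lessThan_atLeast0 intro!: sum.cong)
    also have "\<dots> = (\<Sum>k<n. (if i = k then Y t $$ (k, j) else 0) + t * (M $$ (i, k) * Y t $$ (k, j)))"
     by (intro sum.cong) (auto simp: algebra_simps)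
    also have "\<dots> = Y t $$ (i, j) + t * (\<Sum>k<n. M $$ (i, k) * Y t $$ (k, j))"
     using ij by (simp add: sum.distrib sum_distrib_left)
    finally show ?thesis .
   qed
   have "jet (\<lambda>t. Y t $$ (i, j) + t * (\<Sum>k<n. M $$ (i, k) * Y t $$ (k, j)))
    ((if i = j then 1 else 0) + 0 * (\<Sum>k<n. M $$ (i, k) * (if k = j then 1 else 0)))
    (M $$ (i, j) + (0 * (\<Sum>k<n. M $$ (i, k) * M $$ (k, j) + 0 * (if k = j then 1 else 0)) +
      1 * (\<Sum>k<n. M $$ (i, k) * (if k = j then 1 else 0))))"
    by (intro jet_add jet_mult jet_sum jet_const jet_ident Y(4)) (use ij in auto)
   moreover have "(\<Sum>k<n. M $$ (i, k) * (if k = j then 1 else 0)) = M $$ (i, j)"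
    using ij by (simp add: if_distrib cong: if_cong)
   moreover have "M $$ (i, j) + M $$ (i, j) = to_ac (A $$ (i, j))" using ij Ac by (simp add: M_def)
   ultimately show "jet (\<lambda>t. ?c t $$ (i, j)) (if i = j then 1 else 0) (to_ac (A $$ (i, j)))"
    by (simp only: eq) simp
  next
   fix t assume t: "poly D t \<noteq> 0"
   have tM: "t \<cdot> M \<in> Mat n" using M by simp
   have "(t \<cdot> M) * B = - (B * (t \<cdot> M)\<^sup>T)"
   proof -
    have "(t \<cdot> M) * B = (t * inverse 2) \<cdot> (acm A * B)"
     unfolding M_def using Ac B by (auto simp: mult_smult_assoc_mat[of _ n n _ n] intro!: eq_matI)
    also have "\<dots> = - ((t * inverse 2) \<cdot> (B * (acm A)\<^sup>T))" unfolding AB using Ac B by (auto intro!: eq_matI)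
    also have "(t * inverse 2) \<cdot> (B * (acm A)\<^sup>T) = B * (t \<cdot> M)\<^sup>T" unfolding M_def using Ac B
     by (subst mult_smult_distrib[symmetric, of _ n n _ n]) (auto intro!: arg_cong[of _ _ "(*) B"] eq_matI)
    finally show ?thesis .
   qed
   from cayley_isometry[OF tM B(1) Y(2) this Y(3)[OF t]]
   have iso: "?c t * B * (?c t)\<^sup>T = B" .
   have ct: "?c t \<in> Mat n" using M Y(2)[of t] by (intro mult_carrier_mat[of _ n n]) auto
   have "det (?c t) * det B * det (?c t) = det B" using arg_cong[OF iso, of det] ct B
    by (simp add: det_mult[of _ n] det_transpose)
   hence "det (?c t) \<noteq> 0" using B(2) by auto
   moreover have "?c t * K = K * ?c t"
   proof -
    note assoc = assoc_mult_mat[of _ n n _ n _ n]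
    have tMK: "t \<cdot> M * K = K * (t \<cdot> M)"
    proof -
     have "t \<cdot> M * K = (t * inverse 2) \<cdot> (acm A * K)"
      unfolding M_def using Ac K by (auto simp: mult_smult_assoc_mat[of _ n n _ n] intro!: eq_matI)
     also have "\<dots> = K * ((t * inverse 2) \<cdot> acm A)"
      unfolding AK using Ac K by (simp add: mult_smult_distrib[of _ n n _ n])
     also have "(t * inverse 2) \<cdot> acm A = t \<cdot> M" unfolding M_def using Ac by (auto intro!: eq_matI)
     finally show ?thesis .
    qed
    have 1: "(Id n - t \<cdot> M) * K = K * (Id n - t \<cdot> M)" "(Id n + t \<cdot> M) * K = K * (Id n + t \<cdot> M)"
     using tM K tMK by (simp_all add: minus_mult_distrib_mat[of _ n n _ _ n] mult_minus_distrib_mat[of _ n n _ n]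
      add_mult_distrib_mat[of _ n n _ _ n] mult_add_distrib_mat[of _ n n _ n])
    have YK: "Y t * K = K * Y t"
     by (rule commute_inverse[OF sq_closed(2)[OF sq_closed(7) tM] K Y(2) 1(1) Y(3)[OF t]])
    have cM: "Id n + t \<cdot> M \<in> Mat n" using tM by simp
    have "?c t * K = (Id n + t \<cdot> M) * (Y t * K)" by (rule assoc_mult_mat[OF cM Y(2) K])
    also have "\<dots> = (Id n + t \<cdot> M) * K * Y t" unfolding YK by (rule assoc_mult_mat[OF cM K Y(2), symmetric])
    also have "\<dots> = K * ?c t" unfolding 1(2) by (rule assoc_mult_mat[OF K cM Y(2)])
    finally show ?thesis .
   qed
   ultimately show "?c t \<in> G" using iso ct by (simp add: G_def carrier_GL)
  qed (fact Y(1))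
 qed
qed

section \<open>Determinants on quotients of spaces of matrices\<close>

text \<open>The identity of the line \<open>F\<close> is extended linearly to the closure, regarded
  as a vector space over \<open>F\<close>. Applied entrywise, the functional turns linear relations
  over the closure into relations over \<open>F\<close> without destroying a coefficient normalized
  to \<open>1\<close>.\<close>

lemma to_ac_functional:
 obtains \<phi> :: "'a::field alg_closure => 'a" where
  "\<forall>x y. \<phi> (x + y) = \<phi> x + \<phi> y" "\<forall>a x. \<phi> (to_ac a * x) = a * \<phi> x" "\<phi> 1 = 1"
proof -
 interpret V: vector_space_pair "\<lambda>(c::'a) x. to_ac c * x" "(*) :: 'a => 'a => 'a"
  by unfold_locales (auto simp: algebra_simps)
 have "V.vs1.independent {1}" by (simp add: V.vs1.dependent_single)
 from V.linear_independent_extend[OF this, of "\<lambda>_. 1"] obtain \<phi> where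
  lin: "Vector_Spaces.linear (\<lambda>(c::'a) x. to_ac c * x) (*) \<phi>" and \<phi>1: "\<phi> 1 = 1" by auto
 interpret \<phi>: Vector_Spaces.linear "\<lambda>(c::'a) x. to_ac c * x" "(*) :: 'a => 'a => 'a" \<phi> by (rule lin)
 show ?thesis by (rule that[of \<phi>]) (auto simp: \<phi>.add \<phi>.scale \<phi>1)
qed

definition lc :: "nat => 'b::field mat list => (nat => 'b) => 'b mat" where
 "lc n bs c = mat n n (\<lambda>(i, j). \<Sum>k<length bs. c k * (bs ! k) $$ (i, j))"

lemma mat_lincomb_lc: "mat_lincomb n bs c = lc n bs (($) c)" by (simp add: mat_lincomb_def lc_def)

lemma lc_carrier [simp]: "lc n bs c \<in> Mat n" by (simp add: lc_def)

lemma lc_dim [simp]: "dim_row (lc n bs c) = n" "dim_col (lc n bs c) = n" by (simp_all add: lc_def)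

lemma lc_index: "i < n ==> j < n ==> lc n bs c $$ (i, j) = (\<Sum>k<length bs. c k * (bs ! k) $$ (i, j))"
 by (simp add: lc_def)

lemma lc_cong: "(\<And>k. k < length bs ==> c k = d k) ==> lc n bs c = lc n bs d"
 by (auto simp: lc_def intro!: eq_matI sum.cong)

lemma lc_Nil: "lc n [] c = 0\<^sub>m n n" by (auto simp: lc_def)

lemma lc_snoc: "b \<in> Mat n ==> lc n (bs @ [b]) c = lc n bs c + c (length bs) \<cdot> b"
 by (intro eq_matI) (auto simp: lc_def nth_append intro!: sum.cong)

lemma lc_smult: "lc n bs (\<lambda>k. a * c k) = a \<cdot> lc n bs c"
 by (intro eq_matI) (auto simp: lc_def sum_distrib_left mult.assoc)

lemma lc_diff: "lc n bs (\<lambda>k. c k - d k) = lc n bs c - lc n bs d"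
 by (intro eq_matI) (auto simp: lc_def left_diff_distrib sum_subtractf)

lemma lc_lc:
 assumes "\<And>k. k < length bs ==> bs ! k = lc n cs (p k) + ws ! k"
  "length ws = length bs" "\<And>k. k < length bs ==> ws ! k \<in> Mat n"
 shows "lc n bs c = lc n cs (\<lambda>i. \<Sum>k<length bs. c k * p k i) + lc n ws c"
proof (intro eq_matI)
 fix i j assume "i < dim_row (lc n cs (\<lambda>i. \<Sum>k<length bs. c k * p k i) + lc n ws c)"
  "j < dim_col (lc n cs (\<lambda>i. \<Sum>k<length bs. c k * p k i) + lc n ws c)"
 hence ij: "i < n" "j < n" by (auto simp: lc_def)
 have "lc n bs c $$ (i, j) = (\<Sum>k<length bs. c k * ((\<Sum>l<length cs. p k l * (cs ! l) $$ (i, j)) + (ws ! k) $$ (i, j)))"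
  unfolding lc_index[OF ij]
 proof (intro sum.cong refl, goal_cases)
  case (1 k)
  thus ?case using assms(1)[of k] assms(3)[of k] ij by (simp add: lc_index)
 qed
 also have "\<dots> = (\<Sum>k<length bs. \<Sum>l<length cs. c k * p k l * (cs ! l) $$ (i, j)) + lc n ws c $$ (i, j)"
  using ij assms(2) by (simp add: lc_index distrib_left sum.distrib sum_distrib_left mult.assoc)
 also have "(\<Sum>k<length bs. \<Sum>l<length cs. c k * p k l * (cs ! l) $$ (i, j)) =
   lc n cs (\<lambda>i. \<Sum>k<length bs. c k * p k i) $$ (i, j)"
  unfolding lc_index[OF ij] sum_distrib_right by (rule sum.swap)
 finally show "lc n bs c $$ (i, j) = (lc n cs (\<lambda>i. \<Sum>k<length bs. c k * p k i) + lc n ws c) $$ (i, j)"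
  using ij by simp
qed (auto simp: lc_def)

section \<open>Subspaces of matrices and bases of quotients\<close>

definition msub :: "nat => 'b::field mat set => bool" where
 "msub n V \<longleftrightarrow> V \<subseteq> Mat n \<and> 0\<^sub>m n n \<in> V \<and>
   (\<forall>A\<in>V. \<forall>B\<in>V. A + B \<in> V) \<and> (\<forall>c. \<forall>A\<in>V. c \<cdot> A \<in> V)"

lemma msubD:
 assumes "msub n V"
 shows "A \<in> V ==> A \<in> Mat n" "0\<^sub>m n n \<in> V" "A \<in> V ==> B \<in> V ==> A + B \<in> V"
  "A \<in> V ==> c \<cdot> A \<in> V" "A \<in> V ==> B \<in> V ==> A - B \<in> V"
proof -
 show *: "A \<in> V ==> A \<in> Mat n" "0\<^sub>m n n \<in> V" "A \<in> V ==> B \<in> V ==> A + B \<in> V"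
  "A \<in> V ==> c \<cdot> A \<in> V" for A B c using assms by (auto simp: msub_def)
 assume "A \<in> V" "B \<in> V"
 hence "A + (-1) \<cdot> B \<in> V" using * by blast
 moreover have "A + (-1) \<cdot> B = A - B" using *(1)[OF \<open>A \<in> V\<close>] *(1)[OF \<open>B \<in> V\<close>] by (intro eq_matI) auto
 ultimately show "A - B \<in> V" by simp
qed

lemma lc_in: "msub n V ==> set bs \<subseteq> V ==> lc n bs c \<in> V"
proof (induction bs rule: rev_induct)
 case (snoc b bs)
 thus ?case using msubD[OF snoc(2)] by (subst lc_snoc) auto
qed (auto simp: lc_Nil msubD)

definition mlinear :: "nat => 'b::field mat set => ('b mat => 'b mat) => bool" where
 "mlinear n V f \<longleftrightarrow> (\<forall>A\<in>V. f A \<in> Mat n) \<and> (\<forall>A\<in>V. \<forall>B\<in>V. f (A + B) = f A + f B) \<and>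
   (\<forall>c. \<forall>A\<in>V. f (c \<cdot> A) = c \<cdot> f A)"

lemma mlinearD:
 assumes "mlinear n V f"
 shows "A \<in> V ==> f A \<in> Mat n" "A \<in> V ==> B \<in> V ==> f (A + B) = f A + f B"
  "A \<in> V ==> f (c \<cdot> A) = c \<cdot> f A" using assms by (auto simp: mlinear_def)

lemma mlinear_lc:
 assumes "msub n V" "mlinear n V f" "set bs \<subseteq> V"
 shows "f (lc n bs c) = lc n (map f bs) c" using assms(3)
proof (induction bs rule: rev_induct)
 case Nil
 have "f (0 \<cdot> 0\<^sub>m n n) = 0 \<cdot> f (0\<^sub>m n n)" by (rule mlinearD(3)[OF assms(2) msubD(2)[OF assms(1)]])
 moreover have "0 \<cdot> f (0\<^sub>m n n) = 0\<^sub>m n n"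
  using mlinearD(1)[OF assms(2) msubD(2)[OF assms(1)]] by (intro eq_matI) auto
 ultimately show ?case by (simp add: lc_Nil)
next
 case (snoc b bs)
 have b: "b \<in> V" "set bs \<subseteq> V" using snoc by auto
 have 1: "lc n (bs @ [b]) c = lc n bs c + c (length bs) \<cdot> b" by (rule lc_snoc) (rule msubD(1)[OF assms(1) b(1)])
 have 2: "lc n (map f bs @ [f b]) c = lc n (map f bs) c + c (length (map f bs)) \<cdot> f b"
  by (rule lc_snoc) (rule mlinearD(1)[OF assms(2) b(1)])
 have "f (lc n bs c + c (length bs) \<cdot> b) = f (lc n bs c) + f (c (length bs) \<cdot> b)"
  by (rule mlinearD(2)[OF assms(2) lc_in[OF assms(1) b(2)] msubD(4)[OF assms(1) b(1)]])
 thus ?case using 1 2 snoc.IH[OF b(2)] mlinearD(3)[OF assms(2) b(1)] by simp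
qed

lemma map_ac_lc: "set bs \<subseteq> Mat n ==>
 acm (lc n bs c) = lc n (map (acm) bs) (\<lambda>k. to_ac (c k))"
proof (intro eq_matI)
 fix i j assume s: "set bs \<subseteq> Mat n" and "i < dim_row (lc n (map (acm) bs) (\<lambda>k. to_ac (c k)))"
  "j < dim_col (lc n (map (acm) bs) (\<lambda>k. to_ac (c k)))"
 hence ij: "i < n" "j < n" by (auto simp: lc_def)
 have "acm (bs ! k) $$ (i, j) = to_ac ((bs ! k) $$ (i, j))" if "k < length bs" for k
 proof -
  have "bs ! k \<in> Mat n" using s that by auto
  thus ?thesis using ij by simp
 qed
 thus "acm (lc n bs c) $$ (i, j) = lc n (map (acm) bs) (\<lambda>k. to_ac (c k)) $$ (i, j)"
  using ij by (auto simp: lc_def to_ac_sum intro!: sum.cong)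
qed (auto simp: lc_def)

definition indep_mod :: "nat => 'b::field mat set => 'b mat list => bool" where
 "indep_mod n W bs \<longleftrightarrow> (\<forall>c. lc n bs c \<in> W --> (\<forall>k<length bs. c k = 0))"

text \<open>The entries of the matrices form the rows of a square matrix padded with zero rows. As
  there are more than \<open>n * n\<close> columns, at least one zero row occurs, so this matrix is
  singular and its kernel gives the relation.\<close>

lemma too_many_dependent:
 fixes bs :: "'b::field mat list"
 assumes "length bs > n * n"
 obtains c where "lc n bs c = 0\<^sub>m n n" "\<exists>k<length bs. c k \<noteq> 0"
proof -
 let ?d = "length bs"
 let ?A = "mat ?d ?d (\<lambda>(r, k). if r < n * n then (bs ! k) $$ (r div n, r mod n) else 0)"
 have A: "?A \<in> carrier_mat ?d ?d" by simp
 have AT: "?A\<^sup>T \<in> carrier_mat ?d ?d" by simp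
 have "?A\<^sup>T *\<^sub>v unit_vec ?d (n * n) = 0\<^sub>v ?d" using assms by (intro eq_vecI) auto
 moreover have "unit_vec ?d (n * n) \<noteq> (0\<^sub>v ?d :: 'b vec)"
  using assms by (metis index_unit_vec(2) index_zero_vec(1) zero_neq_one)
 ultimately have "det ?A\<^sup>T = 0" using det_0_iff_vec_prod_zero_field[OF AT] unit_vec_carrier by blast
 hence "det ?A = 0" using det_transpose[OF A] by simp
 with det_0_iff_vec_prod_zero_field[OF A] obtain v where
  v: "v \<in> carrier_vec ?d" "v \<noteq> 0\<^sub>v ?d" "?A *\<^sub>v v = 0\<^sub>v ?d" by blast
 have "lc n bs (($) v) = 0\<^sub>m n n"
 proof (intro eq_matI)
  fix i j assume "i < dim_row (0\<^sub>m n n :: 'b mat)" "j < dim_col (0\<^sub>m n n :: 'b mat)"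
  hence ij: "i < n" "j < n" by auto
  let ?r = "i * n + j"
  have r: "?r < n * n"
  proof -
   have "?r < i * n + n" using ij by simp
   also have "\<dots> = Suc i * n" by simp
   also have "\<dots> \<le> n * n" using ij by (intro mult_le_mono) auto
   finally show ?thesis .
  qed
  have dm: "?r div n = i" "?r mod n = j" using ij by auto
  have "(?A *\<^sub>v v) $ ?r = (\<Sum>k<?d. (bs ! k) $$ (i, j) * v $ k)"
   using r assms v(1) dm by (auto simp: scalar_prod_def lessThan_atLeast0 intro!: sum.cong)
  moreover have "(?A *\<^sub>v v) $ ?r = 0" using v(3) r assms by simp
  ultimately show "lc n bs (($) v) $$ (i, j) = 0\<^sub>m n n $$ (i, j)" using ij by (simp add: lc_index mult.commute)
 qed (auto simp: lc_def)
 moreover have "\<exists>k<?d. v $ k \<noteq> 0"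
 proof (rule ccontr)
  assume "\<not> ?thesis"
  hence "v = 0\<^sub>v ?d" using v(1) by (intro eq_vecI) auto
  thus False using v(2) by simp
 qed
 ultimately show ?thesis by (rule that)
qed

lemma indep_mod_length: "indep_mod n W bs ==> msub n W ==> length bs \<le> n * n"
proof (rule ccontr)
 assume i: "indep_mod n W bs" and W: "msub n W" and "\<not> length bs \<le> n * n"
 hence "length bs > n * n" by simp
 then obtain c where c: "lc n bs c = 0\<^sub>m n n" "\<exists>k<length bs. c k \<noteq> 0" by (rule too_many_dependent)
 hence "lc n bs c \<in> W" using msubD(2)[OF W] by simp
 thus False using c(2) i by (auto simp: indep_mod_def)
qed

definition mbasis :: "nat => 'b::field mat set => 'b mat set => 'b mat list => bool" where
 "mbasis n V W bs \<longleftrightarrow> set bs \<subseteq> V \<and> indep_mod n W bs \<and> (\<forall>M\<in>V. \<exists>c. M - lc n bs c \<in> W)"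

text \<open>A family of maximal length among those independent modulo \<open>W\<close> also spans
  modulo \<open>W\<close>; lengths are bounded by \<open>n * n\<close>.\<close>

lemma mbasis_exists:
 assumes V: "msub n V" and W: "msub n W"
 obtains bs where "mbasis n V W bs"
proof -
 define P where "P l \<longleftrightarrow> (\<exists>bs. set bs \<subseteq> V \<and> indep_mod n W bs \<and> length bs = l)" for l
 have P0: "P 0" by (auto simp: P_def indep_mod_def)
 have Ple: "l \<le> n * n" if "P l" for l using that indep_mod_length[OF _ W] unfolding P_def by blast
 define l where "l = Greatest P"
 have l: "P l" "P l' ==> l' \<le> l" for l'
  unfolding l_def using GreatestI_nat[of P, OF P0 Ple] Greatest_le_nat[of P, OF _ Ple] by blast+
 then obtain bs where bs: "set bs \<subseteq> V" "indep_mod n W bs" "length bs = l" unfolding P_def by blast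
 have "\<exists>c. M - lc n bs c \<in> W" if M: "M \<in> V" for M
 proof -
  have Mc: "M \<in> Mat n" using msubD(1)[OF V M] .
  have "\<not> indep_mod n W (bs @ [M])"
  proof
   assume "indep_mod n W (bs @ [M])"
   hence "P (Suc l)" using bs M unfolding P_def by (intro exI[of _ "bs @ [M]"]) auto
   from l(2)[OF this] show False by simp
  qed
  then obtain c k where c: "lc n (bs @ [M]) c \<in> W" "k < Suc l" "c k \<noteq> 0" using bs(3) by (auto simp: indep_mod_def)
  have e: "lc n (bs @ [M]) c = lc n bs c + c l \<cdot> M" using lc_snoc[OF Mc, of bs c] bs(3) by simp
  have cl: "c l \<noteq> 0"
  proof
   assume z: "c l = 0"
   hence "lc n bs c + c l \<cdot> M = lc n bs c" using Mc by (intro eq_matI) (auto simp: lc_def)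
   hence "lc n bs c \<in> W" using c(1) e by simp
   hence "\<forall>k<l. c k = 0" using bs(2,3) by (auto simp: indep_mod_def)
   thus False using c(2,3) z by (auto simp: less_Suc_eq)
  qed
  have "inverse (c l) \<cdot> (lc n bs c + c l \<cdot> M) \<in> W" using msubD(4)[OF W c(1)] e by simp
  moreover have "inverse (c l) \<cdot> (lc n bs c + c l \<cdot> M) = M - lc n bs (\<lambda>k. (- inverse (c l)) * c k)"
   unfolding lc_smult using Mc cl by (intro eq_matI) (auto simp: lc_def algebra_simps)
  ultimately show ?thesis by auto
 qed
 hence "mbasis n V W bs" using bs by (auto simp: mbasis_def)
 thus ?thesis by (rule that)
qed

lemma mbasis_quotient_basis:
 assumes V: "msub n V" and W: "msub n W"
 shows "quotient_basis n V W bs \<longleftrightarrow> mbasis n V W bs"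
proof
 assume m: "mbasis n V W bs"
 show "quotient_basis n V W bs" unfolding quotient_basis_def mat_lincomb_lc
 proof (intro conjI ballI)
  show "set bs \<subseteq> V" using m by (simp add: mbasis_def)
  fix M assume M: "M \<in> V"
  with m obtain c where c: "M - lc n bs c \<in> W" by (auto simp: mbasis_def)
  have "lc n bs (($) (vec (length bs) c)) = lc n bs c" by (rule lc_cong) simp
  show "\<exists>!c. c \<in> carrier_vec (length bs) \<and> M - lc n bs (($) c) \<in> W"
  proof (rule ex1I[of _ "vec (length bs) c"])
   show "vec (length bs) c \<in> carrier_vec (length bs) \<and> M - lc n bs (($) (vec (length bs) c)) \<in> W"
    using c \<open>lc n bs (($) (vec (length bs) c)) = lc n bs c\<close> by simp
   fix d assume d: "d \<in> carrier_vec (length bs) \<and> M - lc n bs (($) d) \<in> W"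
   have "(M - lc n bs c) - (M - lc n bs (($) d)) \<in> W" using c d msubD(5)[OF W] by blast
   moreover have "(M - lc n bs c) - (M - lc n bs (($) d)) = lc n bs (\<lambda>k. d $ k - c k)"
    unfolding lc_diff using msubD(1)[OF V M] by (intro eq_matI) (auto simp: lc_def)
   ultimately have "\<forall>k<length bs. d $ k - c k = 0" using m unfolding mbasis_def indep_mod_def by auto
   thus "d = vec (length bs) c" using d by (intro eq_vecI) auto
  qed
 qed
next
 assume q: "quotient_basis n V W bs"
 show "mbasis n V W bs" unfolding mbasis_def
 proof (intro conjI ballI)
  show bV: "set bs \<subseteq> V" using q by (simp add: quotient_basis_def)
  show "\<exists>c. M - lc n bs c \<in> W" if "M \<in> V" for M using q that unfolding quotient_basis_def mat_lincomb_lc by blast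
  show "indep_mod n W bs" unfolding indep_mod_def
  proof (intro allI impI)
   fix c k assume c: "lc n bs c \<in> W" and k: "k < length bs"
   have u: "\<exists>!d. d \<in> carrier_vec (length bs) \<and> 0\<^sub>m n n - lc n bs (($) d) \<in> W"
    using q msubD(2)[OF V] unfolding quotient_basis_def mat_lincomb_lc by blast
   have 1: "0\<^sub>m n n - lc n bs (($) (vec (length bs) c)) \<in> W"
   proof -
    have "lc n bs (($) (vec (length bs) c)) = lc n bs c" by (rule lc_cong) simp
    thus ?thesis using msubD(5)[OF W msubD(2)[OF W] c] by simp
   qed
   have 2: "0\<^sub>m n n - lc n bs (($) (0\<^sub>v (length bs))) \<in> W"
   proof -
    have "0\<^sub>m n n - lc n bs (($) (0\<^sub>v (length bs))) = 0\<^sub>m n n" by (intro eq_matI) (auto simp: lc_def)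
    thus ?thesis using msubD(2)[OF W] by simp
   qed
   have "vec (length bs) c = 0\<^sub>v (length bs)" using u 1 2 by (metis vec_carrier zero_carrier_vec)
   hence "vec (length bs) c $ k = 0" using k by simp
   thus "c k = 0" using k by simp
  qed
 qed
qed

text \<open>The trace compares the number of rows and columns of mutually inverse rectangular
 matrices, in characteristic zero.\<close>

lemma inverse_rect_square:
 fixes P Q :: "'b::field_char_0 mat"
 assumes "P \<in> carrier_mat d e" "Q \<in> carrier_mat e d" "P * Q = 1\<^sub>m d" "Q * P = 1\<^sub>m e"
 shows "d = e"
proof -
 have "(\<Sum>i<d. \<Sum>k<e. P $$ (i, k) * Q $$ (k, i)) = (\<Sum>i<d. (P * Q) $$ (i, i))"
  using assms(1,2) by (auto simp: scalar_prod_def lessThan_atLeast0 intro!: sum.cong)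
 also have "\<dots> = of_nat d" by (simp add: assms)
 finally have 1: "(\<Sum>i<d. \<Sum>k<e. P $$ (i, k) * Q $$ (k, i)) = of_nat d" .
 have "(\<Sum>k<e. \<Sum>i<d. Q $$ (k, i) * P $$ (i, k)) = (\<Sum>i<e. (Q * P) $$ (i, i))"
  using assms(1,2) by (auto simp: scalar_prod_def lessThan_atLeast0 intro!: sum.cong)
 also have "\<dots> = of_nat e" by (simp add: assms)
 finally have "(\<Sum>k<e. \<Sum>i<d. Q $$ (k, i) * P $$ (i, k)) = of_nat e" .
 moreover have "(\<Sum>k<e. \<Sum>i<d. Q $$ (k, i) * P $$ (i, k)) = (\<Sum>i<d. \<Sum>k<e. P $$ (i, k) * Q $$ (k, i))"
  by (subst sum.swap) (simp add: mult.commute)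
 ultimately show ?thesis using 1 by (metis of_nat_eq_iff)
qed

definition qmat :: "nat => ('b::field mat => 'b mat) => 'b mat set => 'b mat list => 'b mat => bool" where
 "qmat n f W bs A \<longleftrightarrow> A \<in> carrier_mat (length bs) (length bs) \<and>
   (\<forall>j<length bs. f (bs ! j) - lc n bs (\<lambda>i. A $$ (i, j)) \<in> W)"

lemma qmat_exists:
 assumes "mbasis n V W bs" "\<And>A. A \<in> V ==> f A \<in> V"
 obtains A where "qmat n f W bs A"
proof -
 have "\<exists>c. f (bs ! j) - lc n bs c \<in> W" if "j < length bs" for j
 proof -
  have "bs ! j \<in> V" using assms(1) that by (auto simp: mbasis_def)
  thus ?thesis using assms by (auto simp: mbasis_def)
 qed
 then obtain c where c: "\<And>j. j < length bs ==> f (bs ! j) - lc n bs (c j) \<in> W" by metis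
 let ?A = "mat (length bs) (length bs) (\<lambda>(i, j). c j i)"
 have "qmat n f W bs ?A" unfolding qmat_def
 proof (intro conjI allI impI)
  fix j assume j: "j < length bs"
  have "lc n bs (\<lambda>i. ?A $$ (i, j)) = lc n bs (c j)" by (rule lc_cong) (use j in simp)
  thus "f (bs ! j) - lc n bs (\<lambda>i. ?A $$ (i, j)) \<in> W" using c[OF j] by simp
 qed simp
 thus ?thesis by (rule that)
qed

lemma minus_add_cancel_sq: "A \<in> Mat n ==> B \<in> Mat n ==> A + (B - A) = B" for A B :: "'b::field mat"
 by (intro eq_matI) auto

lemma lc_change:
 assumes W: "msub n W" and "set bs \<subseteq> Mat n"
  and "\<And>k. k < length bs ==> bs ! k - lc n cs (p k) \<in> W"
 obtains w where "w \<in> W" "lc n bs c = lc n cs (\<lambda>i. \<Sum>k<length bs. c k * p k i) + w"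
proof -
 let ?ws = "map (\<lambda>k. bs ! k - lc n cs (p k)) [0..<length bs]"
 have bc: "bs ! k \<in> Mat n" if "k < length bs" for k using assms(2) that by auto
 have "lc n bs c = lc n cs (\<lambda>i. \<Sum>k<length bs. c k * p k i) + lc n ?ws c"
  by (rule lc_lc) (auto simp: minus_add_cancel_sq[of _ n] bc intro!: minus_carrier_mat)
 moreover have "set ?ws \<subseteq> W" using assms(3) by auto
 hence "lc n ?ws c \<in> W" by (rule lc_in[OF W])
 ultimately show ?thesis using that by blast
qed

lemma indep_mod_eq:
 assumes W: "msub n W" and i: "indep_mod n W bs" and "lc n bs c + w = lc n bs d + w'" "w \<in> W" "w' \<in> W"
  "k < length bs"
 shows "c k = d k"
proof -
 have "lc n bs (\<lambda>k. c k - d k) = w' - w"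
 proof (rule sq_eqI)
  fix i j assume "i < n" "j < n"
  moreover have "(lc n bs c + w) $$ (i, j) = (lc n bs d + w') $$ (i, j)" using assms(3) by simp
  ultimately show "lc n bs (\<lambda>k. c k - d k) $$ (i, j) = (w' - w) $$ (i, j)"
   using msubD(1)[OF W assms(4)] msubD(1)[OF W assms(5)] unfolding lc_diff
   by (simp add: sq_index[where n=n] algebra_simps)
 qed (use msubD(1)[OF W assms(4)] msubD(1)[OF W assms(5)] in auto)
 hence "lc n bs (\<lambda>k. c k - d k) \<in> W" using msubD(5)[OF W assms(5,4)] by simp
 hence "c k - d k = 0" using i assms(6) unfolding indep_mod_def by blast
 thus ?thesis by simp
qed

lemma lc_unit:
 assumes "k < length bs" "set bs \<subseteq> Mat n"
 shows "lc n bs (\<lambda>i. if i = k then 1 else 0) = bs ! k"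
proof (rule sq_eqI)
 show "bs ! k \<in> Mat n" using assms by auto
 fix i j assume "i < n" "j < n"
 thus "lc n bs (\<lambda>i. if i = k then 1 else 0) $$ (i, j) = (bs ! k) $$ (i, j)"
  using assms by (simp add: lc_index if_distrib[of "\<lambda>x. x * _"] cong: if_cong)
qed simp

lemma change_of_basis_inverse:
 assumes W: "msub n W"
  and u: "\<And>l. l < length ys ==> ys ! l - lc n zs (u l) \<in> W"
  and v: "\<And>l. l < length zs ==> zs ! l - lc n ys (v l) \<in> W"
  and zs: "set zs \<subseteq> Mat n" "indep_mod n W zs" and ys: "set ys \<subseteq> Mat n"
  and k: "k < length zs" "i < length zs"
 shows "(\<Sum>l<length ys. v k l * u l i) = (if i = k then 1 else 0)"
proof -
 obtain w where w: "w \<in> W" "lc n ys (v k) = lc n zs (\<lambda>i. \<Sum>l<length ys. v k l * u l i) + w"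
  by (rule lc_change[OF W ys u])
 let ?w = "zs ! k - lc n ys (v k)"
 have w': "?w \<in> W" using v k by blast
 have xk: "zs ! k \<in> Mat n" using zs k by auto
 have "lc n zs (\<lambda>i. \<Sum>l<length ys. v k l * u l i) + w = lc n zs (\<lambda>i. if i = k then 1 else 0) + (0\<^sub>m n n - ?w)"
  unfolding lc_unit[OF k(1) zs(1)] w(2)[symmetric] using xk by (intro sq_eqI[where n=n]) auto
 from indep_mod_eq[OF W zs(2) this w(1) msubD(5)[OF W msubD(2)[OF W] w'] k(2)]
 show ?thesis .
qed

text \<open>The two transition matrices are inverse to each other, so both bases have the same
  length, and \<open>P\<close> conjugates one representing matrix into the other. This makes the
  description in \<open>quotient_det\<close> unambiguous.\<close>

lemma qmat_det_unique:
 fixes f :: "'b::field_char_0 mat => 'b mat"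
 assumes V: "msub n V" and W: "msub n W" "W \<subseteq> V" and f: "mlinear n V f" "\<And>w. w \<in> W ==> f w \<in> W"
  and bs: "mbasis n V W bs" "qmat n f W bs A" and cs: "mbasis n V W cs" "qmat n f W cs B"
 shows "det A = det B"
proof -
 let ?d = "length bs" and ?e = "length cs"
 have ex: "\<exists>c. cs ! k - lc n bs c \<in> W" if "k < ?e" for k
  using bs(1) cs(1) nth_mem[OF that] unfolding mbasis_def by blast
 have ex': "\<exists>c. bs ! k - lc n cs c \<in> W" if "k < ?d" for k
  using bs(1) cs(1) nth_mem[OF that] unfolding mbasis_def by blast
 from ex obtain p where p: "\<And>k. k < ?e ==> cs ! k - lc n bs (p k) \<in> W" by metis
 from ex' obtain r where r: "\<And>k. k < ?d ==> bs ! k - lc n cs (r k) \<in> W" by metis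
 have bV: "set bs \<subseteq> V" "set cs \<subseteq> V" using bs cs by (auto simp: mbasis_def)
 have bC: "set bs \<subseteq> Mat n" "set cs \<subseteq> Mat n" using bV msubD(1)[OF V] by auto
 have ind: "indep_mod n W bs" "indep_mod n W cs" using bs cs by (auto simp: mbasis_def)
 define P where "P = mat ?d ?e (\<lambda>(i, k). p k i)"
 define R where "R = mat ?e ?d (\<lambda>(i, k). r k i)"
 have carr: "P \<in> carrier_mat ?d ?e" "R \<in> carrier_mat ?e ?d" "A \<in> carrier_mat ?d ?d" "B \<in> carrier_mat ?e ?e"
  using bs cs by (auto simp: P_def R_def qmat_def)
 have PR: "P * R = 1\<^sub>m ?d"
 proof (rule eq_matI)
  fix i k assume "i < dim_row (1\<^sub>m ?d :: 'b mat)" "k < dim_col (1\<^sub>m ?d :: 'b mat)"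
  hence ik: "i < ?d" "k < ?d" by auto
  have "(P * R) $$ (i, k) = (\<Sum>l<?e. r k l * p l i)"
   using ik by (auto simp: P_def R_def scalar_prod_def lessThan_atLeast0 mult.commute intro!: sum.cong)
  also have "\<dots> = (if i = k then 1 else 0)"
   by (rule change_of_basis_inverse[OF W(1) p r bC(1) ind(1) bC(2) ik(2,1)])
  finally show "(P * R) $$ (i, k) = 1\<^sub>m ?d $$ (i, k)" using ik by simp
 qed (use carr in auto)
 have RP: "R * P = 1\<^sub>m ?e"
 proof (rule eq_matI)
  fix i k assume "i < dim_row (1\<^sub>m ?e :: 'b mat)" "k < dim_col (1\<^sub>m ?e :: 'b mat)"
  hence ik: "i < ?e" "k < ?e" by auto
  have "(R * P) $$ (i, k) = (\<Sum>l<?d. p k l * r l i)"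
   using ik by (auto simp: P_def R_def scalar_prod_def lessThan_atLeast0 mult.commute intro!: sum.cong)
  also have "\<dots> = (if i = k then 1 else 0)"
   by (rule change_of_basis_inverse[OF W(1) r p bC(2) ind(2) bC(1) ik(2,1)])
  finally show "(R * P) $$ (i, k) = 1\<^sub>m ?e $$ (i, k)" using ik by simp
 qed (use carr in auto)
 have de: "?d = ?e" by (rule inverse_rect_square[OF carr(1,2) PR RP])
 have AP: "A * P = P * B"
 proof (rule eq_matI)
  fix i k assume "i < dim_row (P * B)" "k < dim_col (P * B)"
  hence ik: "i < ?d" "k < ?e" using carr by auto
  let ?wk = "cs ! k - lc n bs (p k)"
  have wk: "?wk \<in> W" using p ik by blast
  have ck: "cs ! k \<in> V" using bV ik by auto
  have lV: "lc n bs (p k) \<in> V" by (rule lc_in[OF V bV(1)])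
  have "f (cs ! k) = f (lc n bs (p k) + ?wk)" using minus_add_cancel_sq[OF lc_carrier msubD(1)[OF V ck]] by simp
  also have "\<dots> = f (lc n bs (p k)) + f ?wk" by (rule mlinearD(2)[OF f(1) lV]) (use wk W in blast)
  also have "f (lc n bs (p k)) = lc n (map f bs) (p k)" by (rule mlinear_lc[OF V f(1) bV(1)])
  finally have 1: "f (cs ! k) = lc n (map f bs) (p k) + f ?wk" .
  have "set (map f bs) \<subseteq> Mat n" using bV mlinearD(1)[OF f(1)] by auto
  moreover have "map f bs ! j - lc n bs (\<lambda>i. A $$ (i, j)) \<in> W" if "j < length (map f bs)" for j
   using bs(2) that by (simp add: qmat_def)
  ultimately obtain w1 where w1: "w1 \<in> W" "lc n (map f bs) (p k) = lc n bs (\<lambda>i. \<Sum>j<length (map f bs). p k j * A $$ (i, j)) + w1"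
   using lc_change[OF W(1), of "map f bs" bs "\<lambda>j i. A $$ (i, j)" "p k"] by blast
  define w2 where "w2 = f (cs ! k) - lc n cs (\<lambda>i. B $$ (i, k))"
  have w2: "w2 \<in> W" using cs(2) ik by (simp add: qmat_def w2_def)
  have fck: "f (cs ! k) \<in> Mat n" by (rule mlinearD(1)[OF f(1) ck])
  obtain w3 where w3: "w3 \<in> W" "lc n cs (\<lambda>i. B $$ (i, k)) = lc n bs (\<lambda>i. \<Sum>l<?e. B $$ (l, k) * p l i) + w3"
   using lc_change[OF W(1) bC(2) p] by blast
  have C: "w1 \<in> Mat n" "w3 \<in> Mat n" "f ?wk \<in> Mat n" "w2 \<in> Mat n"
   using w1 w3 w2 f(2)[OF wk] msubD(1)[OF W(1)] by auto
  have "lc n bs (\<lambda>i. \<Sum>j<?d. p k j * A $$ (i, j)) + (w1 + f ?wk) = lc n bs (\<lambda>i. \<Sum>l<?e. B $$ (l, k) * p l i) + (w3 + w2)"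
  proof -
   have "lc n bs (\<lambda>i. \<Sum>j<?d. p k j * A $$ (i, j)) + (w1 + f ?wk) = f (cs ! k)"
    unfolding 1 w1(2) using C by (simp add: assoc_add_mat[of _ n n])
   also have "\<dots> = lc n cs (\<lambda>i. B $$ (i, k)) + w2" unfolding w2_def using minus_add_cancel_sq[OF lc_carrier fck] by simp
   also have "\<dots> = lc n bs (\<lambda>i. \<Sum>l<?e. B $$ (l, k) * p l i) + (w3 + w2)"
    unfolding w3(2) using C by (simp add: assoc_add_mat[of _ n n])
   finally show ?thesis .
  qed
  from indep_mod_eq[OF W(1) ind(1) this msubD(3)[OF W(1) w1(1) f(2)[OF wk]] msubD(3)[OF W(1) w3(1) w2] ik(1)]
  have "(\<Sum>j<?d. p k j * A $$ (i, j)) = (\<Sum>l<?e. B $$ (l, k) * p l i)" .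
  moreover have "(A * P) $$ (i, k) = (\<Sum>j<?d. p k j * A $$ (i, j))"
   using ik carr by (auto simp: P_def scalar_prod_def lessThan_atLeast0 mult.commute intro!: sum.cong)
  moreover have "(P * B) $$ (i, k) = (\<Sum>l<?e. B $$ (l, k) * p l i)"
   using ik carr by (auto simp: P_def scalar_prod_def lessThan_atLeast0 mult.commute intro!: sum.cong)
  ultimately show "(A * P) $$ (i, k) = (P * B) $$ (i, k)" by simp
 qed (use carr in auto)
 have Pc: "P \<in> carrier_mat ?d ?d" "B \<in> carrier_mat ?d ?d" "R \<in> carrier_mat ?d ?d" using carr de by auto
 have "det A * det P = det P * det B"
  using arg_cong[OF AP, of det] det_mult[OF carr(3) Pc(1)] det_mult[OF Pc(1,2)] by simp
 moreover have "det P \<noteq> 0" using GL_inv_eqI(2)[OF Pc(1,3) PR] .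
 ultimately show ?thesis by simp
qed

lemma quotient_det_eq:
 fixes f :: "'b::field_char_0 mat => 'b mat"
 assumes V: "msub n V" and W: "msub n W" "W \<subseteq> V" and f: "mlinear n V f" "\<And>w. w \<in> W ==> f w \<in> W"
  and bs: "mbasis n V W bs" "qmat n f W bs A"
 shows "quotient_det n f V W = det A"
proof -
 have col: "lc n cs (\<lambda>i. B $$ (i, j)) = lc n cs (($) (col B j))"
  if "B \<in> carrier_mat (length cs) (length cs)" "j < length cs" for cs :: "'b mat list" and B j
  by (rule lc_cong) (use that in auto)
 have "qmat n f W cs B \<longleftrightarrow> B \<in> carrier_mat (length cs) (length cs) \<and>
   (\<forall>j<length cs. f (cs ! j) - lc n cs (($) (col B j)) \<in> W)" for cs B using col unfolding qmat_def by auto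
 hence eq: "(\<exists>bs A. quotient_basis n V W bs \<and> A \<in> carrier_mat (length bs) (length bs) \<and>
   (\<forall>j<length bs. f (bs ! j) - mat_lincomb n bs (col A j) \<in> W) \<and> D = det A) \<longleftrightarrow>
   (\<exists>bs A. mbasis n V W bs \<and> qmat n f W bs A \<and> D = det A)" for D
  unfolding mbasis_quotient_basis[OF V W(1)] mat_lincomb_lc by (simp only: conj_assoc)
 show ?thesis unfolding quotient_det_def eq
  by (rule the_equality) (use bs qmat_det_unique[OF V W f _ _ bs] in blast)+
qed

text \<open>The roots of the characteristic polynomial, kept in a multiset so that multiplicities
  count in the product; evaluation at \<open>0\<close> gives the determinant up to a sign that
  cancels.\<close>

lemma det_eigenvalues:
 fixes A :: "'b::alg_closed_field mat"
 assumes "A \<in> carrier_mat d d"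
 obtains \<mu>s where "size \<mu>s = d" "det A = prod_mset \<mu>s" "\<forall>\<mu>. \<mu> \<in># \<mu>s \<longleftrightarrow> eigenvalue A \<mu>"
proof -
 have mon: "Polynomial.degree (char_poly A) = d" "poly.coeff (char_poly A) d = 1" using degree_monic_char_poly[OF assms] by auto
 hence nz: "char_poly A \<noteq> 0" by auto
 from alg_closed_imp_factorization[OF nz] obtain \<mu>s where
  \<mu>s: "size \<mu>s = Polynomial.degree (char_poly A)" "char_poly A = Polynomial.smult (poly.coeff (char_poly A) (Polynomial.degree (char_poly A))) (\<Prod>x\<in>#\<mu>s. [:-x, 1:])" by blast
 have cp: "char_poly A = (\<Prod>x\<in>#\<mu>s. [:-x, 1:])" using \<mu>s(2) mon by simp
 have pm: "poly (\<Prod>x\<in>#M. [:-x, 1:]) t = (\<Prod>x\<in>#M. t - x)" for t and M :: "'b multiset"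
  by (induction M) (auto simp: algebra_simps)
 have "poly (char_poly A) 0 = det (- A)"
 proof -
  have "char_matrix A 0 = A" unfolding char_matrix_def using assms by (intro eq_matI) auto
  thus ?thesis using char_poly_matrix[OF assms, of 0] by simp
 qed
 also have "\<dots> = (- 1) ^ d * det A"
 proof -
  have "- A = (- 1) \<cdot> A" by (intro eq_matI) auto
  thus ?thesis using assms by simp
 qed
 finally have e: "poly (char_poly A) 0 = (- 1) ^ d * det A" .
 have "(- 1) ^ d * det A = (\<Prod>x\<in>#\<mu>s. 0 - x)" using e[unfolded cp pm] by (rule sym)
 moreover have "(\<Prod>x\<in>#M. 0 - x) = (- 1) ^ size M * prod_mset M" for M :: "'b multiset" by (induction M) auto
 ultimately have "(- 1) ^ d * det A = (- 1) ^ d * prod_mset \<mu>s" using \<mu>s(1) mon by simp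
 hence det: "det A = prod_mset \<mu>s" by simp
 have "\<mu> \<in># \<mu>s \<longleftrightarrow> eigenvalue A \<mu>" for \<mu>
  unfolding eigenvalue_root_char_poly[OF assms] cp pm by (auto simp: prod_mset_zero_iff)
 thus ?thesis using that[of \<mu>s] \<mu>s(1) mon det by simp
qed

text \<open>A nonzero coefficient over the closure can be scaled to \<open>1\<close>. The functional
  of \<open>to_ac_functional\<close>, which fixes \<open>1\<close>, then produces a nontrivial
  relation over \<open>F\<close>.\<close>

lemma indep_mod_ac:
 fixes bs :: "'a::field mat list"
 assumes W: "msub n W" and bs: "indep_mod n W bs" "set bs \<subseteq> Mat n" and ws: "set ws \<subseteq> W"
  and eq: "lc n (map (acm) bs) c = lc n (map (acm) ws) e" and k: "k < length bs"
 shows "c k = 0"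
proof (rule ccontr)
 assume ck: "c k \<noteq> 0"
 obtain \<phi> :: "'a alg_closure => 'a" where \<phi>: "\<forall>x y. \<phi> (x + y) = \<phi> x + \<phi> y"
  "\<forall>a x. \<phi> (to_ac a * x) = a * \<phi> x" "\<phi> 1 = 1" by (rule to_ac_functional)
 have \<phi>0: "\<phi> 0 = 0" using \<phi>(2)[rule_format, of 0 0] by simp
 have \<phi>sum: "\<phi> (sum g I) = (\<Sum>i\<in>I. \<phi> (g i))" if "finite I" for g and I :: "nat set"
  using that by (induction I) (auto simp: \<phi>0 \<phi>(1)[rule_format])
 have wc: "set ws \<subseteq> Mat n" using ws msubD(1)[OF W] by blast
 have ev: "\<phi> (inverse (c k) * lc n (map (acm) us) d $$ (i, j)) = lc n us (\<lambda>l. \<phi> (inverse (c k) * d l)) $$ (i, j)"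
  if "set us \<subseteq> Mat n" "i < n" "j < n" for us d i j
 proof -
  have uc: "us ! l \<in> Mat n" if "l < length us" for l using that \<open>set us \<subseteq> Mat n\<close> by auto
  have ui: "acm (us ! l) $$ (i, j) = to_ac ((us ! l) $$ (i, j))" if "l < length us" for l
   using uc[OF that] \<open>i < n\<close> \<open>j < n\<close> by simp
  have "inverse (c k) * lc n (map (acm) us) d $$ (i, j) =
    (\<Sum>l<length us. to_ac ((us ! l) $$ (i, j)) * (inverse (c k) * d l))"
   using that by (simp add: lc_index sum_distrib_left ui mult_ac)
  hence "\<phi> (inverse (c k) * lc n (map (acm) us) d $$ (i, j)) =
    (\<Sum>l<length us. (us ! l) $$ (i, j) * \<phi> (inverse (c k) * d l))"
   by (simp only: \<phi>sum finite_lessThan \<phi>(2)[rule_format])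
  thus ?thesis using that by (simp add: lc_index mult.commute)
 qed
 have "lc n bs (\<lambda>l. \<phi> (inverse (c k) * c l)) = lc n ws (\<lambda>l. \<phi> (inverse (c k) * e l))"
 proof (rule sq_eqI)
  fix i j assume "i < n" "j < n"
  from ev[OF bs(2) this, of c] ev[OF wc this, of e] eq
  show "lc n bs (\<lambda>l. \<phi> (inverse (c k) * c l)) $$ (i, j) = lc n ws (\<lambda>l. \<phi> (inverse (c k) * e l)) $$ (i, j)" by simp
 qed auto
 hence "lc n bs (\<lambda>l. \<phi> (inverse (c k) * c l)) \<in> W" using lc_in[OF W ws] by simp
 hence "\<phi> (inverse (c k) * c k) = 0" using bs(1) k unfolding indep_mod_def by blast
 thus False using ck \<phi>(3) by simp
qed

text \<open>The only access to the discriminants used later. The eigenvalues on the quotient are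
  eigenvalues of the extension \<open>fb\<close> on all matrices over the closure, which permits
  bounding them. Conversely an explicit eigenmatrix in the span of \<open>V\<close> with nonzero
  eigenvalue is guaranteed to contribute a factor.\<close>

lemma quotient_det_eigenvalues:
 fixes f :: "'a::field_char_0 mat => 'a mat"
 assumes V: "msub n V" and W: "msub n W" "W \<subseteq> V" and f: "mlinear n V f" "\<And>A. A \<in> V ==> f A \<in> V"
  and fW: "\<And>A. A \<in> W ==> f A = 0\<^sub>m n n" and ker: "\<And>A. A \<in> V ==> f A \<in> W ==> A \<in> W"
  and fb: "mlinear n (Mat n) fb" "\<And>A. A \<in> V ==> fb (acm A) = acm (f A)"
 obtains \<mu>s where "to_ac (quotient_det n f V W) = prod_mset \<mu>s" "size \<mu>s \<le> n * n"
  "\<forall>\<mu>. \<mu> \<in># \<mu>s --> \<mu> \<noteq> 0 \<and> (\<exists>N. N \<in> Mat n \<and> N \<noteq> 0\<^sub>m n n \<and> fb N = \<mu> \<cdot> N)"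
  "\<forall>\<mu> vs d. set vs \<subseteq> V --> \<mu> \<noteq> 0 --> lc n (map (acm) vs) d \<noteq> 0\<^sub>m n n -->
    fb (lc n (map (acm) vs) d) = \<mu> \<cdot> lc n (map (acm) vs) d --> \<mu> \<in># \<mu>s"
proof -
 let ?ac = "map (acm) :: 'a mat list => _"
 obtain bs where bs: "mbasis n V W bs" by (rule mbasis_exists[OF V W(1)])
 obtain A where A: "qmat n f W bs A" by (rule qmat_exists[OF bs f(2)])
 let ?d = "length bs"
 have D: "quotient_det n f V W = det A"
 proof (rule quotient_det_eq[OF V W f(1) _ bs A])
  show "f w \<in> W" if "w \<in> W" for w using fW[OF that] msubD(2)[OF W(1)] by simp
 qed
 have Ac: "A \<in> carrier_mat ?d ?d" using A by (simp add: qmat_def)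
 have ind: "indep_mod n W bs" and bV: "set bs \<subseteq> V" using bs by (auto simp: mbasis_def)
 have bC: "set bs \<subseteq> Mat n" using bV msubD(1)[OF V] by blast
 have msC: "msub n (Mat n :: 'a alg_closure mat set)" by (auto simp: msub_def)
 have f0: "fb (0\<^sub>m n n) = 0\<^sub>m n n" using mlinear_lc[OF msC fb(1), of "[]" "\<lambda>_. 0"] by (simp add: lc_Nil)
 let ?ws = "map (\<lambda>j. f (bs ! j) - lc n bs (\<lambda>i. A $$ (i, j))) [0..<?d]"
 have wW: "set ?ws \<subseteq> W" using A by (auto simp: qmat_def)
 have wC: "set ?ws \<subseteq> Mat n" using wW msubD(1)[OF W(1)] by blast
 have fbs: "f (bs ! j) \<in> Mat n" if "j < ?d" for j
  by (rule mlinearD(1)[OF f(1)]) (use bV nth_mem[OF that] in blast)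
 \<comment> \<open>A kernel vector of \<open>A\<close> would give an element of \<open>V\<close>
   that \<open>f\<close> sends into \<open>W\<close>; by \<open>ker\<close> it lies in
   \<open>W\<close>, against independence.\<close>
 have det0: "det A \<noteq> 0"
 proof
  assume "det A = 0"
  with det_0_iff_vec_prod_zero_field[OF Ac] obtain v where
   v: "v \<in> carrier_vec ?d" "v \<noteq> 0\<^sub>v ?d" "A *\<^sub>v v = 0\<^sub>v ?d" by blast
  have "f (lc n bs (($) v)) = lc n (map f bs) (($) v)" by (rule mlinear_lc[OF V f(1) bV])
  moreover have "set (map f bs) \<subseteq> Mat n" using bV mlinearD(1)[OF f(1)] by auto
  then obtain w where w: "w \<in> W" "lc n (map f bs) (($) v) = lc n bs (\<lambda>i. \<Sum>j<length (map f bs). v $ j * A $$ (i, j)) + w"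
   by (rule lc_change[OF W(1), of "map f bs" bs "\<lambda>j i. A $$ (i, j)" "($) v"]) (use A in "auto simp: qmat_def")
  moreover have "lc n bs (\<lambda>i. \<Sum>j<length (map f bs). v $ j * A $$ (i, j)) = lc n bs (\<lambda>i. 0 * 0)"
  proof (rule lc_cong)
   fix i assume i: "i < ?d"
   have "(A *\<^sub>v v) $ i = (\<Sum>j<?d. v $ j * A $$ (i, j))"
    using Ac v(1) i by (auto simp: scalar_prod_def lessThan_atLeast0 mult.commute intro!: sum.cong)
   thus "(\<Sum>j<length (map f bs). v $ j * A $$ (i, j)) = 0 * 0" using v(3) i by simp
  qed
  moreover have "lc n bs (\<lambda>i. 0 * 0) + w = w"
   unfolding lc_smult using msubD(1)[OF W(1) w(1)] by (intro eq_matI) auto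
  ultimately have "f (lc n bs (($) v)) \<in> W" by simp
  hence "lc n bs (($) v) \<in> W" by (rule ker[OF lc_in[OF V bV]])
  hence "\<forall>k<?d. v $ k = 0" using ind by (auto simp: indep_mod_def)
  hence "v = 0\<^sub>v ?d" using v(1) by (intro eq_vecI) auto
  thus False using v(2) by simp
 qed
 let ?A = "acm A"
 have Abc: "?A \<in> carrier_mat ?d ?d" using Ac by simp
 obtain \<mu>s where \<mu>s: "size \<mu>s = ?d" "det ?A = prod_mset \<mu>s" "\<forall>\<mu>. \<mu> \<in># \<mu>s \<longleftrightarrow> eigenvalue ?A \<mu>"
  by (rule det_eigenvalues[OF Abc])
 have action: "fb (lc n (?ac bs) c) = lc n (?ac bs) (\<lambda>i. \<Sum>k<?d. c k * ?A $$ (i, k)) + lc n (?ac ?ws) c" for c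
 proof -
  have "fb (lc n (?ac bs) c) = lc n (map fb (?ac bs)) c" by (rule mlinear_lc[OF msC fb(1)]) (use bC in auto)
  also have "map fb (?ac bs) = ?ac (map f bs)" using fb(2) bV by auto
  also have "lc n (?ac (map f bs)) c = lc n (?ac bs) (\<lambda>i. \<Sum>k<length (?ac (map f bs)). c k * ?A $$ (i, k)) + lc n (?ac ?ws) c"
  proof (rule lc_lc)
   fix k assume "k < length (?ac (map f bs))"
   hence k: "k < ?d" by simp
   have "f (bs ! k) = lc n bs (\<lambda>i. A $$ (i, k)) + ?ws ! k"
    using k minus_add_cancel_sq[OF lc_carrier fbs[OF k], of bs "\<lambda>i. A $$ (i, k)"] by simp
   hence "acm (f (bs ! k)) = acm (lc n bs (\<lambda>i. A $$ (i, k)) + ?ws ! k)" by simp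
   also have "\<dots> = acm (lc n bs (\<lambda>i. A $$ (i, k))) + acm (?ws ! k)" using fbs[OF k] k by (intro eq_matI) auto
   also have "acm (lc n bs (\<lambda>i. A $$ (i, k))) = lc n (?ac bs) (\<lambda>i. to_ac (A $$ (i, k)))"
    by (rule map_ac_lc[OF bC])
   also have "\<dots> = lc n (?ac bs) (\<lambda>i. ?A $$ (i, k))" by (rule lc_cong) (use Ac k in auto)
   finally show "?ac (map f bs) ! k = lc n (?ac bs) (\<lambda>i. ?A $$ (i, k)) + ?ac ?ws ! k" using k by simp
  next
   show "?ac ?ws ! k \<in> Mat n" if "k < length (?ac (map f bs))" for k
    using fbs that by (auto intro!: minus_carrier_mat)
  qed simp
  finally show ?thesis by simp
 qed
 have fbw: "fb (lc n (?ac us) c) = 0\<^sub>m n n" if "set us \<subseteq> W" for us c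
 proof -
  have "fb (lc n (?ac us) c) = lc n (map fb (?ac us)) c"
   by (rule mlinear_lc[OF msC fb(1)]) (use that msubD(1)[OF W(1)] in auto)
  also have "map fb (?ac us) = ?ac (map f us)" using fb(2) that W(2) by auto
  also have "map f us = map (\<lambda>_. 0\<^sub>m n n) us" using fW that by auto
  also have "lc n (?ac (map (\<lambda>_. 0\<^sub>m n n) us)) c = 0\<^sub>m n n" by (intro sq_eqI[where n=n]) (auto simp: lc_index)
  finally show ?thesis .
 qed
 show ?thesis
 proof (rule that[of \<mu>s])
  show "to_ac (quotient_det n f V W) = prod_mset \<mu>s" using \<mu>s(2) by (simp add: D)
  show "size \<mu>s \<le> n * n" using \<mu>s(1) indep_mod_length[OF ind W(1)] by simp
  show "\<forall>\<mu>. \<mu> \<in># \<mu>s --> \<mu> \<noteq> 0 \<and> (\<exists>N. N \<in> Mat n \<and> N \<noteq> 0\<^sub>m n n \<and> fb N = \<mu> \<cdot> N)"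
  proof (intro allI impI)
   fix \<mu> assume m: "\<mu> \<in># \<mu>s"
   have mu0: "\<mu> \<noteq> 0"
   proof
    assume "\<mu> = 0"
    with multi_member_split[OF m] have "prod_mset \<mu>s = 0" by auto
    hence "det ?A = 0" using \<mu>s(2) by (simp only:)
    thus False using det0 by simp
   qed
   from m \<mu>s(3) obtain v where v: "v \<in> carrier_vec ?d" "v \<noteq> 0\<^sub>v ?d" "?A *\<^sub>v v = \<mu> \<cdot>\<^sub>v v"
    using Abc by (auto simp: eigenvalue_def eigenvector_def)
   let ?M = "lc n (?ac bs) (($) v)" and ?w = "lc n (?ac ?ws) (($) v)"
   \<comment> \<open>The eigenvector lifts from the quotient only up to an error \<open>?w\<close>
     in the span of \<open>W\<close>. Since \<open>fb\<close> kills that span and \<mu> is nonzero,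
     adding \<open>inverse \<mu>\<close> times the error gives an exact eigenmatrix.\<close>
   let ?N = "?M + inverse \<mu> \<cdot> ?w"
   have s: "(\<Sum>k<?d. v $ k * ?A $$ (i, k)) = \<mu> * v $ i" if i: "i < ?d" for i
   proof -
    have "(?A *\<^sub>v v) $ i = (\<Sum>k<?d. v $ k * ?A $$ (i, k))"
     using Abc v(1) i by (auto simp: scalar_prod_def lessThan_atLeast0 mult.commute intro!: sum.cong)
    thus ?thesis using v i by simp
   qed
   have "lc n (?ac bs) (\<lambda>i. \<Sum>k<?d. v $ k * ?A $$ (i, k)) = lc n (?ac bs) (\<lambda>i. \<mu> * v $ i)"
    by (rule lc_cong) (use s in simp)
   hence fN0: "fb ?M = \<mu> \<cdot> ?M + ?w" unfolding action lc_smult by simp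
   have "fb ?N = fb ?M + fb (inverse \<mu> \<cdot> ?w)" by (rule mlinearD(2)[OF fb(1)]) auto
   also have "fb (inverse \<mu> \<cdot> ?w) = inverse \<mu> \<cdot> fb ?w" by (rule mlinearD(3)[OF fb(1)]) simp
   also have "fb ?w = 0\<^sub>m n n" by (rule fbw[OF wW])
   finally have "fb ?N = \<mu> \<cdot> ?N" unfolding fN0 using mu0 by (intro sq_eqI[where n=n]) (auto simp: distrib_left)
   moreover have "?N \<noteq> 0\<^sub>m n n"
   proof
    assume z: "?N = 0\<^sub>m n n"
    have "?M = lc n (?ac ?ws) (\<lambda>k. (- inverse \<mu>) * v $ k)" unfolding lc_smult
    proof (intro sq_eqI[where n=n])
     fix i j assume ij: "i < n" "j < n"
     have "?N $$ (i, j) = 0" using z ij by simp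
     thus "?M $$ (i, j) = (- inverse \<mu> \<cdot> lc n (?ac ?ws) (($) v)) $$ (i, j)" using ij by (simp add: add_eq_0_iff2)
    qed auto
    from indep_mod_ac[OF W(1) ind bC wW this] have "v = 0\<^sub>v ?d" using v(1) by (intro eq_vecI) auto
    thus False using v(2) by simp
   qed
   ultimately show "\<mu> \<noteq> 0 \<and> (\<exists>N. N \<in> Mat n \<and> N \<noteq> 0\<^sub>m n n \<and> fb N = \<mu> \<cdot> N)"
    using mu0 by (intro conjI exI[of _ ?N]) auto
  qed
  show "\<forall>\<mu> vs d. set vs \<subseteq> V --> \<mu> \<noteq> 0 --> lc n (?ac vs) d \<noteq> 0\<^sub>m n n -->
    fb (lc n (?ac vs) d) = \<mu> \<cdot> lc n (?ac vs) d --> \<mu> \<in># \<mu>s"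
  proof (intro allI impI)
   fix \<mu> vs d assume vs: "set vs \<subseteq> V" and mu0: "\<mu> \<noteq> 0" and N0: "lc n (?ac vs) d \<noteq> 0\<^sub>m n n"
    and ev: "fb (lc n (?ac vs) d) = \<mu> \<cdot> lc n (?ac vs) d"
   have "\<exists>p. vs ! l - lc n bs p \<in> W" if "l < length vs" for l
    using bs vs nth_mem[OF that] unfolding mbasis_def by blast
   then obtain p where p: "\<And>l. l < length vs ==> vs ! l - lc n bs (p l) \<in> W" by metis
   let ?us = "map (\<lambda>l. vs ! l - lc n bs (p l)) [0..<length vs]"
   have uW: "set ?us \<subseteq> W" using p by auto
   have vC: "vs ! l \<in> Mat n" if "l < length vs" for l by (rule msubD(1)[OF V]) (use vs nth_mem[OF that] in blast)
   define c where "c i = (\<Sum>l<length vs. d l * to_ac (p l i))" for i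
   have N: "lc n (?ac vs) d = lc n (?ac bs) c + lc n (?ac ?us) d"
   proof -
    have "lc n (?ac vs) d = lc n (?ac bs) (\<lambda>i. \<Sum>l<length (?ac vs). d l * to_ac (p l i)) + lc n (?ac ?us) d"
    proof (rule lc_lc)
     fix l assume "l < length (?ac vs)"
     hence l: "l < length vs" by simp
     have "vs ! l = lc n bs (p l) + ?us ! l" using l minus_add_cancel_sq[OF lc_carrier vC[OF l]] by simp
     hence "acm (vs ! l) = acm (lc n bs (p l) + ?us ! l)" by simp
     also have "\<dots> = acm (lc n bs (p l)) + acm (?us ! l)" using vC[OF l] l by (intro eq_matI) auto
     also have "acm (lc n bs (p l)) = lc n (?ac bs) (\<lambda>i. to_ac (p l i))" by (rule map_ac_lc[OF bC])
     finally show "?ac vs ! l = lc n (?ac bs) (\<lambda>i. to_ac (p l i)) + ?ac ?us ! l" using l by simp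
    next
     show "?ac ?us ! l \<in> Mat n" if "l < length (?ac vs)" for l using vC that by (auto intro!: minus_carrier_mat)
    qed simp
    moreover have "c = (\<lambda>i. \<Sum>l<length vs. d l * to_ac (p l i))" by (rule ext) (simp add: c_def)
    ultimately show ?thesis by simp
   qed
   let ?Ac = "\<lambda>i. \<Sum>k<?d. c k * ?A $$ (i, k)"
   have "fb (lc n (?ac bs) c + lc n (?ac ?us) d) = fb (lc n (?ac bs) c) + fb (lc n (?ac ?us) d)"
    by (rule mlinearD(2)[OF fb(1)]) auto
   also have "fb (lc n (?ac ?us) d) = 0\<^sub>m n n" by (rule fbw[OF uW])
   finally have 1: "lc n (?ac bs) ?Ac + lc n (?ac ?ws) c = \<mu> \<cdot> (lc n (?ac bs) c + lc n (?ac ?us) d)"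
    using ev unfolding N action by (simp add: right_add_zero_mat[of _ n n])
   let ?app = "\<lambda>k. if k < length ?us then \<mu> * d k else - c (k - length ?us)"
   have app: "lc n (?ac (?us @ ?ws)) ?app = \<mu> \<cdot> lc n (?ac ?us) d - lc n (?ac ?ws) c"
   proof (rule sq_eqI)
    fix i j assume ij: "i < n" "j < n"
    have split: "(\<Sum>k<a + b. g k) = (\<Sum>k<a. g k) + (\<Sum>k<b. g (a + k))" for a b :: nat and g :: "nat => 'a alg_closure"
     by (simp add: sum.nat_group[symmetric] lessThan_atLeast0 sum.atLeastLessThan_concat[of 0 a "a + b", symmetric] sum.shift_bounds_nat_ivl[of g 0 a b, simplified, symmetric] add.commute)
    show "lc n (?ac (?us @ ?ws)) ?app $$ (i, j) = (\<mu> \<cdot> lc n (?ac ?us) d - lc n (?ac ?ws) c) $$ (i, j)"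
     using ij by (simp add: lc_index split nth_append sum_distrib_left sum_negf mult.assoc)
   qed auto
   have "lc n (?ac bs) (\<lambda>i. ?Ac i - \<mu> * c i) = lc n (?ac (?us @ ?ws)) ?app" unfolding app lc_diff lc_smult
   proof (rule sq_eqI)
    fix i j assume ij: "i < n" "j < n"
    have "(lc n (?ac bs) ?Ac + lc n (?ac ?ws) c) $$ (i, j) = (\<mu> \<cdot> (lc n (?ac bs) c + lc n (?ac ?us) d)) $$ (i, j)"
     using 1 by simp
    thus "(lc n (?ac bs) ?Ac - \<mu> \<cdot> lc n (?ac bs) c) $$ (i, j) = (\<mu> \<cdot> lc n (?ac ?us) d - lc n (?ac ?ws) c) $$ (i, j)"
     using ij by (simp add: algebra_simps)
   qed auto
   from indep_mod_ac[OF W(1) ind bC _ this] uW wW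
   have eq: "?Ac k = \<mu> * c k" if "k < ?d" for k using that by auto
   \<comment> \<open>Otherwise the eigenmatrix would lie in the span of \<open>W\<close>, where
     \<open>fb\<close> vanishes, although \<mu> is nonzero.\<close>
   have "\<exists>k<?d. c k \<noteq> 0"
   proof (rule ccontr)
    assume "\<not> ?thesis"
    hence "lc n (?ac bs) c = 0\<^sub>m n n" by (intro sq_eqI[where n=n]) (auto simp: lc_index)
    hence "lc n (?ac vs) d = lc n (?ac ?us) d" unfolding N by (simp add: left_add_zero_mat[of _ n n])
    hence "\<mu> \<cdot> lc n (?ac vs) d = 0\<^sub>m n n" using ev fbw[OF uW] by simp
    hence "lc n (?ac vs) d $$ (i, j) = 0" if "i < n" "j < n" for i j
     using arg_cong[OF \<open>\<mu> \<cdot> lc n (?ac vs) d = 0\<^sub>m n n\<close>, of "\<lambda>M. M $$ (i, j)"] mu0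
     unfolding sq_index(4)[OF lc_carrier that] sq_index(5)[OF that] by simp
    hence "lc n (?ac vs) d = 0\<^sub>m n n" by (intro sq_eqI[where n=n]) auto
    thus False using N0 by simp
   qed
   moreover have "?A *\<^sub>v vec ?d c = \<mu> \<cdot>\<^sub>v vec ?d c"
    using eq Abc by (intro eq_vecI) (auto simp: scalar_prod_def lessThan_atLeast0 mult.commute)
   ultimately have "eigenvalue ?A \<mu>" unfolding eigenvalue_def eigenvector_def
    using Ac by (intro exI[of _ "vec ?d c"]) (auto simp: vec_eq_iff)
   thus "\<mu> \<in># \<mu>s" using \<mu>s(3) by blast
  qed
 qed
qed

section \<open>Spectra of regular elements\<close>

text \<open>A bordered block matrix is multiplied by a unipotent one from either side; the two
  products have block triangular shape with the two determinants in question. It is used to see that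
  a reflection has determinant \<open>- 1\<close>.\<close>

lemma det_one_plus_outer:
 fixes v y :: "'b::field vec"
 assumes v: "v \<in> Vec n" and y: "y \<in> Vec n"
 shows "det (Id n + outer v y) = 1 + y \<bullet> v"
proof -
 let ?A = "mat n 1 (\<lambda>(i, j). v $ i)" and ?Y = "mat 1 n (\<lambda>(i, j). y $ j)"
 have AY: "?A * ?Y = outer v y" using v y by (intro eq_matI) (auto simp: scalar_prod_def)
 have YA: "?Y * ?A = mat 1 1 (\<lambda>_. y \<bullet> v)" using v y by (intro eq_matI) (auto simp: scalar_prod_def)
 let ?K = "four_block_mat (Id n) (- ?A) ?Y (1\<^sub>m 1)" and ?L = "four_block_mat (Id n) (0\<^sub>m n 1) (- ?Y) (1\<^sub>m 1)"
 have c: "?K \<in> carrier_mat (n + 1) (n + 1)" "?L \<in> carrier_mat (n + 1) (n + 1)" by auto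
 have dL: "det ?L = 1" by (subst det_four_block_mat_upper_right_zero[of _ n _ 1]) auto
 have 1: "?L * ?K = four_block_mat (Id n) (- ?A) (0\<^sub>m 1 n) (1\<^sub>m 1 + ?Y * ?A)"
  by (subst mult_four_block_mat[of _ n n _ 1 _ 1]) (auto intro!: cong_four_block_mat eq_matI simp: scalar_prod_def)
 have 2: "?K * ?L = four_block_mat (Id n + ?A * ?Y) (- ?A) (0\<^sub>m 1 n) (1\<^sub>m 1)"
  by (subst mult_four_block_mat[of _ n n _ 1 _ 1]) (auto intro!: cong_four_block_mat eq_matI simp: scalar_prod_def)
 have "det ?K = det (1\<^sub>m 1 + ?Y * ?A)" using arg_cong[OF 1, of det] det_mult[OF c(2,1)] dL
  by (subst (asm) det_four_block_mat_lower_left_zero[of _ n _ 1]) auto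
 moreover have "det ?K = det (Id n + ?A * ?Y)" using arg_cong[OF 2, of det] det_mult[OF c] dL
  by (subst (asm) det_four_block_mat_lower_left_zero[of _ n _ 1]) auto
 moreover have "det (1\<^sub>m 1 + ?Y * ?A) = 1 + y \<bullet> v" unfolding YA by (subst det_single) auto
 ultimately show ?thesis unfolding AY by simp
qed

lemma det_pencil_poly:
 fixes A B :: "'b::field_char_0 mat"
 assumes "A \<in> Mat n" "B \<in> Mat n"
 obtains p where "\<forall>t. poly p t = det (A + t \<cdot> B)"
proof -
 let ?N = "mat n n (\<lambda>(i, j). [:A $$ (i, j), B $$ (i, j):])"
 have N: "map_mat (\<lambda>p. poly p t) ?N = A + t \<cdot> B" for t using assms by (auto intro!: eq_matI)
 have "poly (det ?N) t = det (A + t \<cdot> B)" for t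
  using comm_ring_hom.hom_det[OF poly_eval_hom, of t ?N] by (simp add: N)
 thus ?thesis using that by blast
qed

lemma poly_no_root_const:
 fixes p :: "'b::alg_closed_field poly"
 assumes "\<And>t. poly p t \<noteq> 0"
 obtains c where "c \<noteq> 0" "\<forall>t. poly p t = c"
proof -
 have "\<not> Polynomial.degree p > 0" using alg_closed_imp_poly_has_root[of p] assms by blast
 then obtain c where "p = [:c:]" using degree_eq_zeroE by blast
 thus ?thesis using that[of c] assms[of 0] by auto
qed

lemma det_nonzero_iff_inj:
 fixes A :: "'b::field mat"
 assumes "A \<in> Mat n"
 shows "det A \<noteq> 0 \<longleftrightarrow> (\<forall>x\<in>Vec n. A *\<^sub>v x = 0\<^sub>v n --> x = 0\<^sub>v n)"
 using det_0_iff_vec_prod_zero_field[OF assms] by blast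

text \<open>If \<open>g\<close> had no eigenvector in the kernel of \<open>e\<close>, then \<open>det ((a - g)(1 - e) + e)\<close> would be a
 polynomial in \<open>a\<close> without roots, hence constant; comparing with \<open>a = 1 / t\<close> as \<open>t \<rightarrow> 0\<close> makes
 \<open>e\<close> invertible.\<close>

lemma eigenvector_in_kernel:
 fixes g e :: "'b::{alg_closed_field,field_char_0} mat"
 assumes g: "g \<in> Mat n" and e: "e \<in> Mat n" "e * e = e" "e * g = g * e" "e \<noteq> Id n"
 obtains x l where "x \<in> Vec n" "x \<noteq> 0\<^sub>v n" "e *\<^sub>v x = 0\<^sub>v n" "g *\<^sub>v x = l \<cdot>\<^sub>v x"
proof -
 note cl = sq_closed[where n=n]
 let ?f = "Id n - e"
 have f: "?f \<in> Mat n" by (rule sq_closed(2)[OF sq_closed(7) e(1)])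
 have ef: "e * ?f = 0\<^sub>m n n" "?f * e = 0\<^sub>m n n" "?f * ?f = ?f"
  using e(1,2) by (auto simp: sq_distrib[where n=n] cl intro!: sq_eqI[where n=n])
 have ege: "e * (g * e) = g * e"
 proof -
  have "e * (g * e) = e * e * g" using g e(1) by (simp add: e(3)[symmetric])
  thus ?thesis by (simp add: e(2,3))
 qed
 have egf: "e * (g * ?f) = 0\<^sub>m n n" "?f * (g * ?f) = g * ?f"
  using g e(1) by (auto simp: sq_distrib[where n=n] cl ege e(3) intro!: sq_eqI[where n=n])
 show ?thesis
 proof (rule ccontr)
  assume none: "\<not> thesis"
  hence no: "x = 0\<^sub>v n" if "x \<in> Vec n" "e *\<^sub>v x = 0\<^sub>v n" "g *\<^sub>v x = l \<cdot>\<^sub>v x" for x l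
   using that \<open>\<And>x l. \<lbrakk>x \<in> Vec n; x \<noteq> 0\<^sub>v n; e *\<^sub>v x = 0\<^sub>v n; g *\<^sub>v x = l \<cdot>\<^sub>v x\<rbrakk> \<Longrightarrow> thesis\<close> by blast
  let ?K = "\<lambda>a. (e - g * ?f) + a \<cdot> ?f"
  have Kc: "?K a \<in> Mat n" for a using g e f by simp
  have "det (?K a) \<noteq> 0" for a unfolding det_nonzero_iff_inj[OF Kc]
  proof (intro ballI impI)
   fix x assume x: "x \<in> Vec n" "?K a *\<^sub>v x = 0\<^sub>v n"
   have "e * ?K a = e * (e - g * ?f) + e * (a \<cdot> ?f)" by (rule sq_distrib(3)) (use g e(1) f in auto)
   also have "e * (e - g * ?f) = e * e - e * (g * ?f)" by (rule sq_distrib(4)) (use g e(1) f in auto)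
   also have "e * (a \<cdot> ?f) = a \<cdot> (e * ?f)" by (rule sq_distrib(6)[OF e(1) f])
   finally have "e * ?K a = e" unfolding egf ef e(2) using e(1) by (auto intro!: sq_eqI[where n=n])
   moreover have "e *\<^sub>v (?K a *\<^sub>v x) = 0\<^sub>v n" using x e(1) by (auto intro!: eq_vecI simp: scalar_prod_def)
   ultimately have ex: "e *\<^sub>v x = 0\<^sub>v n" using sq_vec(1)[OF e(1) Kc[of a] x(1)] by simp
   have fx: "?f *\<^sub>v x = x" using e(1) x(1) ex by (simp add: sq_vec[where n=n] cl)
   have gfx: "(g * ?f) *\<^sub>v x = g *\<^sub>v x" using sq_vec(1)[OF g f x(1)] fx by simp
   have "?K a *\<^sub>v x = (e *\<^sub>v x - g *\<^sub>v x) + a \<cdot>\<^sub>v x"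
   proof -
    have "?K a *\<^sub>v x = (e - g * ?f) *\<^sub>v x + (a \<cdot> ?f) *\<^sub>v x" by (rule sq_vec(4)) (use g e f x in auto)
    also have "(e - g * ?f) *\<^sub>v x = e *\<^sub>v x - (g * ?f) *\<^sub>v x" by (rule sq_vec(5)) (use g e f x in auto)
    also have "(a \<cdot> ?f) *\<^sub>v x = a \<cdot>\<^sub>v (?f *\<^sub>v x)" by (rule sq_vec(3)[OF f x(1)])
    finally show ?thesis by (simp only: gfx fx)
   qed
   hence z: "(e *\<^sub>v x - g *\<^sub>v x) + a \<cdot>\<^sub>v x = 0\<^sub>v n" using x(2) by simp
   have "g *\<^sub>v x = a \<cdot>\<^sub>v x"
   proof (rule eq_vecI)
    fix i assume "i < dim_vec (a \<cdot>\<^sub>v x)"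
    hence i: "i < n" using x by simp
    have "((0\<^sub>v n - g *\<^sub>v x) + a \<cdot>\<^sub>v x) $ i = 0" using z i by (simp add: ex)
    thus "(g *\<^sub>v x) $ i = (a \<cdot>\<^sub>v x) $ i" using i x g by simp
   qed (use x g in auto)
   thus "x = 0\<^sub>v n" by (rule no[OF x(1) ex])
  qed
  moreover obtain p where p: "\<forall>t. poly p t = det (?K t)" by (rule det_pencil_poly[of "e - g * ?f" n ?f]) (use g e f in auto)
  ultimately have "poly p t \<noteq> 0" for t by simp
  then obtain k where k: "k \<noteq> 0" "\<forall>t. poly p t = k" by (rule poly_no_root_const)
  let ?M = "\<lambda>t. (e + ?f) + t \<cdot> (- (g * ?f))" and ?R = "\<lambda>t. e + t \<cdot> ?f"
  obtain p1 where p1: "\<forall>t. poly p1 t = det (?M t)" by (rule det_pencil_poly[of "e + ?f" n "- (g * ?f)"]) (use g e f in auto)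
  obtain p2 where p2: "\<forall>t. poly p2 t = det (?R t)" by (rule det_pencil_poly[of e n ?f]) (use g e f in auto)
  have "poly p1 t = k * poly p2 t" if "t \<noteq> 0" for t
  proof -
   have Rc: "?R t \<in> Mat n" using e f by simp
   have "?R t * ?K (1 / t) = ?M t"
   proof -
    have "?R t * ?K (1 / t) = ?R t * (e - g * ?f) + ?R t * ((1 / t) \<cdot> ?f)"
     by (rule sq_distrib(3)) (use g e f Rc in auto)
    also have "?R t * ((1 / t) \<cdot> ?f) = (1 / t) \<cdot> (?R t * ?f)" by (rule sq_distrib(6)[OF Rc f])
    also have "?R t * ?f = e * ?f + t \<cdot> (?f * ?f)"
     using sq_distrib(1)[OF e(1) sq_closed(5)[OF f] f] sq_distrib(5)[OF f f] by simp
    also have "\<dots> = t \<cdot> ?f" unfolding ef using f by (intro sq_eqI[where n=n]) (auto simp: cl)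
    also have "(1 / t) \<cdot> (t \<cdot> ?f) = ?f" using that f e(1) by (intro sq_eqI[where n=n]) (auto simp: cl)
    also have "?R t * (e - g * ?f) = ?R t * e - ?R t * (g * ?f)" by (rule sq_distrib(4)) (use g e f Rc in auto)
    also have "?R t * e = e * e + t \<cdot> (?f * e)"
     using sq_distrib(1)[OF e(1) sq_closed(5)[OF f] e(1)] sq_distrib(5)[OF f e(1)] by simp
    also have "\<dots> = e" unfolding ef e(2) using e(1) by (intro sq_eqI[where n=n]) (auto simp: cl)
    also have "?R t * (g * ?f) = e * (g * ?f) + t \<cdot> (?f * (g * ?f))"
     using sq_distrib(1)[OF e(1) sq_closed(5)[OF f] sq_closed(3)[OF g f]] sq_distrib(5)[OF f sq_closed(3)[OF g f]] by simp
    also have "\<dots> = t \<cdot> (g * ?f)" unfolding egf using g f by (intro sq_eqI[where n=n]) (auto simp: cl)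
    also have "e - t \<cdot> (g * ?f) + ?f = ?M t"
     using e(1) sq_closed(3)[OF g f] f by (intro sq_eqI[where n=n]) (auto simp: cl simp del: index_mult_mat(1))
    finally show ?thesis .
   qed
   hence "det (?M t) = det (?R t) * det (?K (1 / t))" using det_mult[OF Rc Kc] by metis
   thus ?thesis using p p1 p2 k by simp
  qed
  \<comment> \<open>The factor \<open>t\<close> extends the identity to \<open>t = 0\<close>; it can
    then be cancelled as a polynomial, and the remaining identity may be evaluated at
    \<open>0\<close>.\<close>
  hence "poly ([:0, 1:] * (p1 - Polynomial.smult k p2)) t = 0" for t by (cases "t = 0") auto
  hence "[:0, 1:] * (p1 - Polynomial.smult k p2) = 0" using poly_all_0_iff_0 by blast
  hence "p1 = Polynomial.smult k p2" by simp
  hence "poly p1 0 = k * poly p2 0" by simp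
  moreover have "?M 0 = Id n" using g e f by (intro sq_eqI[where n=n]) (auto simp: cl simp del: index_mult_mat(1))
  moreover have "?R 0 = e" using e f by (intro sq_eqI[where n=n]) auto
  ultimately have "1 = k * det e" using p1 p2 by simp
  hence "det e \<noteq> 0" by auto
  moreover have "e * e = e * Id n" using e by simp
  ultimately have "e = Id n" using mat_cancel_left[OF e(1) _ e(1)] by simp
  thus False using e(4) by simp
 qed
qed

lemma poly_funs_poly_curve:
 fixes u :: "'b::field => 'b mat"
 assumes "f \<in> poly_funs n UNIV" "\<And>i j. i < n ==> j < n ==> \<exists>p. \<forall>t. poly p t = u t $$ (i, j)"
 shows "\<exists>p. \<forall>t. poly p t = f (u t)" using assms(1)
proof (induction rule: poly_funs.induct)
 case (const k)
 show ?case by (rule exI[of _ "[:k:]"]) simp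
next
 case (add f g)
 then obtain p r where "\<forall>t. poly p t = f (u t)" "\<forall>t. poly r t = g (u t)" by blast
 thus ?case by (intro exI[of _ "p + r"]) simp
next
 case (mult f g)
 then obtain p r where "\<forall>t. poly p t = f (u t)" "\<forall>t. poly r t = g (u t)" by blast
 thus ?case by (intro exI[of _ "p * r"]) simp
qed (use assms(2) in auto)

lemma poly_unit_const:
 fixes p r :: "'b::field_char_0 poly"
 assumes "\<And>t. poly p t * poly r t = c" "c \<noteq> 0"
 shows "poly p t = poly p 0"
proof -
 have "poly (p * r) = poly [:c:]" using assms by auto
 hence "p * r = [:c:]" by (simp only: poly_eq_poly_eq_iff)
 hence "Polynomial.degree p + Polynomial.degree r = 0"
  using assms(2) by (metis degree_mult_eq degree_pCons_0 mult_zero_left mult_zero_right pCons_eq_0_iff)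
 hence "Polynomial.degree p = 0" by simp
 then obtain a where "p = [:a:]" using degree_eq_zeroE by blast
 thus ?thesis by simp
qed

text \<open>A one-parameter unipotent group with polynomial entries is mapped by an isomorphism with a
 diagonal torus to invertible polynomials, that is, to constants.\<close>

lemma torus_no_unipotent:
 fixes u :: "'b::field_char_0 => 'b mat"
 assumes iso: "algebraic_group_iso UNIV n T d (diagonal_torus d) f"
  and uT: "\<And>t. u t \<in> T" and uc: "\<And>t. u t \<in> Mat n"
  and u: "\<And>a b. u (a + b) = u a * u b" "u 0 = Id n"
  and pol: "\<And>i j. i < n ==> j < n ==> \<exists>p. \<forall>t. poly p t = u t $$ (i, j)"
 shows "u t = Id n"
proof -
 have hom: "f (x * y) = f x * f y" if "x \<in> T" "y \<in> T" for x y
  using iso that unfolding algebraic_group_iso_def iso_def hom_def by simp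
 have inj: "inj_on f T" and fT: "f x \<in> diagonal_torus d" if "x \<in> T" for x
  using iso that unfolding algebraic_group_iso_def iso_def bij_betw_def by auto
 have fc: "f x \<in> carrier_mat d d" "det (f x) \<noteq> 0" "diagonal_mat (f x)" if "x \<in> T" for x
  using fT[OF that] by (auto simp: diagonal_torus_def carrier_GL)
 have inv: "u t * u (- t) = Id n" for t using u(1)[of t "- t"] u(2) by simp
 have "\<exists>p \<in> poly_funs n UNIV. \<forall>A\<in>Mat n. det A = p A" by (rule poly_funs_det[OF poly_mat_id]) auto
 then obtain dt where dt: "dt \<in> poly_funs n UNIV" "\<forall>A\<in>Mat n. det A = (dt A :: 'b)" by (rule bexE)
 from poly_funs_poly_curve[OF dt(1) pol] obtain D where D: "\<forall>t. poly D t = dt (u t)" by blast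
 have Du: "poly D t = det (u t)" for t using D dt(2) uc by simp
 \<comment> \<open>The determinant along the curve is an invertible polynomial and hence constant.
   Therefore the denominators \<open>det g ^ e\<close> of regular functions disappear on the
   curve.\<close>
 have "poly D t * poly (D \<circ>\<^sub>p [:0, -1:]) t = 1" for t
 proof -
  have "poly D t * poly (D \<circ>\<^sub>p [:0, -1:]) t = det (u t) * det (u (- t))" by (simp add: poly_pcompose Du)
  also have "\<dots> = det (u t * u (- t))" by (rule det_mult[OF uc uc, symmetric])
  finally show ?thesis by (simp add: inv)
 qed
 from poly_unit_const[OF this] have det1: "det (u t) = 1" for t using Du u(2) by (metis det_one one_neq_zero)
 have f1: "f (Id n) = 1\<^sub>m d"
 proof -
  have T1: "Id n \<in> T" using uT[of 0] u(2) by simp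
  have "f (Id n) * f (Id n) = f (Id n) * 1\<^sub>m d" using hom[OF T1 T1] fc(1)[OF T1] by simp
  thus ?thesis by (rule mat_cancel_left[OF fc(1)[OF T1] one_carrier_mat fc(1,2)[OF T1]])
 qed
 have "f (u t) $$ (i, i) = 1" if i: "i < d" for i
 proof -
  have "regular_function_on UNIV n T (\<lambda>g. f g $$ (i, i))"
   using iso i unfolding algebraic_group_iso_def regular_map_on_def by blast
  then obtain p e where p: "p \<in> poly_funs n UNIV" "\<forall>g\<in>T. f g $$ (i, i) = p g / det g ^ e"
   unfolding regular_function_on_def by blast
  from poly_funs_poly_curve[OF p(1) pol] obtain P where P: "\<forall>t. poly P t = p (u t)" by blast
  have Pf: "poly P t = f (u t) $$ (i, i)" for t using P p(2) uT det1 by simp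
  have "poly P t * poly (P \<circ>\<^sub>p [:0, -1:]) t = 1" for t
  proof -
   have "f (u t) * f (u (- t)) = 1\<^sub>m d" using hom[OF uT uT, of t "- t"] inv f1 by simp
   hence "(f (u t) * f (u (- t))) $$ (i, i) = 1" using i by simp
   moreover have "(f (u t) * f (u (- t))) $$ (i, i) = (\<Sum>k<d. f (u t) $$ (i, k) * f (u (- t)) $$ (k, i))"
    by (rule sq_mult_index[OF fc(1)[OF uT] fc(1)[OF uT] i i])
   moreover have "\<dots> = (\<Sum>k<d. if k = i then f (u t) $$ (i, i) * f (u (- t)) $$ (i, i) else 0)"
    using fc(1,3)[OF uT, of t] i by (intro sum.cong refl) (auto simp: diagonal_mat_def)
   ultimately have "f (u t) $$ (i, i) * f (u (- t)) $$ (i, i) = 1" using i by simp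
   thus ?thesis by (simp add: poly_pcompose Pf)
  qed
  from poly_unit_const[OF this] have "poly P t = poly P 0" by simp
  thus ?thesis using Pf u(2) f1 i by simp
 qed
 hence "f (u t) = 1\<^sub>m d" using fc(1,3)[OF uT, of t] by (intro eq_matI) (auto simp: diagonal_mat_def)
 hence "f (u t) = f (u 0)" using u(2) f1 by simp
 thus ?thesis using inj_onD[OF inj[OF uT] _ uT uT] u(2) by metis
qed

lemma adjoint_sprod:
 fixes A :: "'b::field mat"
 assumes "A \<in> Mat n" "v \<in> Vec n" "w \<in> Vec n"
 shows "v \<bullet> (A *\<^sub>v w) = (A\<^sup>T *\<^sub>v v) \<bullet> w"
proof -
 have "v \<bullet> (A *\<^sub>v w) = (\<Sum>i<n. \<Sum>j<n. v $ i * A $$ (i, j) * w $ j)"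
  using assms by (auto simp: scalar_prod_def lessThan_atLeast0 sum_distrib_left mult.assoc intro!: sum.cong)
 also have "\<dots> = (\<Sum>j<n. \<Sum>i<n. v $ i * A $$ (i, j) * w $ j)" by (rule sum.swap)
 also have "\<dots> = (A\<^sup>T *\<^sub>v v) \<bullet> w"
  using assms by (auto simp: scalar_prod_def lessThan_atLeast0 sum_distrib_left sum_distrib_right mult_ac intro!: sum.cong)
 finally show ?thesis .
qed

text \<open>A form \<open>J\<close> of sign \<open>s\<close>, an isometry \<open>g\<close> of it whose centralizer is contained in a torus
 \<open>T\<close>, the torus being special orthogonal when \<open>s = 1\<close>.\<close>

locale regular_isometry =
 fixes n :: nat and J Ji g :: "'b::{alg_closed_field,field_char_0} mat" and s :: 'b
  and T :: "'b mat set" and d f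
 assumes J: "J \<in> Mat n" "Ji \<in> Mat n" "J * Ji = Id n"
  and s: "s = 1 \<or> s = - 1" and Jt: "J\<^sup>T = s \<cdot> J"
  and g: "g \<in> Mat n" "g * J * g\<^sup>T = J"
  and cent: "\<And>h. h \<in> Mat n ==> h * J * h\<^sup>T = J ==> h * g = g * h ==> h \<in> T"
  and special: "s = 1 ==> h \<in> T ==> det h = 1"
  and iso: "algebraic_group_iso UNIV n T d (diagonal_torus d) f"
begin

lemmas cl = sq_closed[where n=n]
lemmas as = sq_assoc[where n=n]
lemmas ds = sq_distrib[where n=n]
lemmas ix = sq_index[where n=n]
lemmas sqI = sq_eqI[where n=n]
lemmas tp = sq_transpose[where n=n]
lemmas vs = sq_vec[where n=n]

lemma ss: "s * s = 1" using s by auto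

lemma JiJ: "Ji * J = Id n" by (rule mat_mult_left_right_inverse[OF J])

lemma Jit: "Ji\<^sup>T = s \<cdot> Ji"
proof -
 have "Ji\<^sup>T * J\<^sup>T = Id n" using sq_transpose(3)[OF J(1,2)] by (simp add: J(3))
 hence "s \<cdot> (Ji\<^sup>T * J) = Id n" unfolding Jt using J by (simp add: ds cl)
 hence "s \<cdot> (Ji\<^sup>T * J) * Ji = Ji" using J by simp
 hence "s \<cdot> Ji\<^sup>T = Ji" using J by (simp add: ds cl as)
 hence "s \<cdot> (s \<cdot> Ji\<^sup>T) = s \<cdot> Ji" by simp
 moreover have "s \<cdot> (s \<cdot> Ji\<^sup>T) = Ji\<^sup>T" using J ss by (auto intro!: eq_matI simp flip: mult.assoc)
 ultimately show ?thesis by simp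
qed

abbreviation "gi \<equiv> J * g\<^sup>T * Ji"

lemma gi: "gi \<in> Mat n" "g * gi = Id n" "gi * g = Id n"
proof -
 show c: "gi \<in> Mat n" using J g by (intro sq_closed) auto
 have "g * gi = g * J * g\<^sup>T * Ji" using J g(1) by (simp add: as cl)
 thus 1: "g * gi = Id n" using J(3) by (simp only: g(2))
 show "gi * g = Id n" by (rule mat_mult_left_right_inverse[OF g(1) c 1])
qed

lemma gtJi: "g\<^sup>T * Ji = Ji * gi" using J g(1) sq_inv_cancel(2)[OF J, of "g\<^sup>T * Ji"] by (simp add: as cl)

lemma gtJig: "g\<^sup>T * Ji * g = Ji" unfolding gtJi using J g(1) gi by (simp add: as del: sq_closed)

lemma det_isometry_nonzero:
 assumes "h \<in> Mat n" "h * J * h\<^sup>T = J"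
 shows "det h \<noteq> 0"
proof
 assume "det h = 0"
 hence "det (h * J * h\<^sup>T) = 0" using assms(1) J(1) by (simp add: det_mult[of _ n])
 hence "det J = 0" by (simp only: assms(2))
 thus False using GL_inv_eqI(2)[OF J] by simp
qed

text \<open>The exponential of a nilpotent element of the Lie algebra would be unipotent.\<close>

lemma no_nilpotent:
 assumes N: "N \<in> Mat n" "N\<^sup>T = (- s) \<cdot> N" "g * N * g\<^sup>T = N"
  and nil: "(N * Ji) * ((N * Ji) * (N * Ji)) = 0\<^sub>m n n"
 shows "N = 0\<^sub>m n n"
proof -
 define M where "M = N * Ji"
 define Q where "Q = M * M"
 have M: "M \<in> Mat n" "Q \<in> Mat n" using N J by (auto simp: M_def Q_def intro!: cl)
 have MQ: "M * Q = 0\<^sub>m n n" using nil by (simp add: M_def Q_def)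
 have QM: "Q * M = 0\<^sub>m n n" using MQ M by (simp add: Q_def as)
 have QQ: "Q * Q = 0\<^sub>m n n"
 proof -
  have "Q * Q = M * (M * Q)" unfolding Q_def using M by (simp add: as cl)
  thus ?thesis using M MQ by simp
 qed
 let ?Mt = "M\<^sup>T" and ?Qt = "Q\<^sup>T"
 have t: "?Mt \<in> Mat n" "?Qt \<in> Mat n" using M by auto
 have tQ: "?Qt = ?Mt * ?Mt" unfolding Q_def using M by (simp add: tp)
 have Mt: "?Mt = - (Ji * N)"
 proof -
  have "?Mt = Ji\<^sup>T * N\<^sup>T" unfolding M_def by (rule sq_transpose(3)[OF N(1) J(2)])
  also have "\<dots> = (s * (- s)) \<cdot> (Ji * N)"
   unfolding Jit N(2) using J N by (simp add: ds cl) (auto intro!: sqI cl simp: ix cl simp del: index_mult_mat(1))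
  also have "\<dots> = - (Ji * N)" using ss J N by (auto intro!: sqI cl simp: ix cl simp del: index_mult_mat(1))
  finally show ?thesis .
 qed
 have MJ: "M * J = N" unfolding M_def using N(1) J JiJ by (simp add: as)
 have JMt: "J * ?Mt = - N" unfolding Mt using J N sq_inv_cancel(1)[OF J N(1)] by (simp add: ds cl)
 have MJ': "M * J = - (J * ?Mt)" unfolding MJ JMt by (intro sqI) (use N in auto)
 have QJ: "Q * J = J * ?Qt"
 proof -
  have "Q * J = M * (M * J)" unfolding Q_def by (rule as[OF M(1,1) J(1)])
  also have "\<dots> = M * (- (J * ?Mt))" by (simp only: MJ')
  also have "\<dots> = - (M * (J * ?Mt))" by (rule ds(8)) (use M J t in "auto intro!: cl")
  also have "M * (J * ?Mt) = M * J * ?Mt" by (rule as[OF M(1) J(1) t(1), symmetric])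
  also have "\<dots> = (- (J * ?Mt)) * ?Mt" by (simp only: MJ')
  also have "\<dots> = - (J * ?Mt * ?Mt)" by (rule ds(7)) (use J t in "auto intro!: cl")
  also have "- (- (J * ?Mt * ?Mt)) = J * ?Mt * ?Mt"
   using J t by (intro sqI) (auto intro!: cl simp: ix cl simp del: index_mult_mat(1))
  also have "\<dots> = J * (?Mt * ?Mt)" by (rule as[OF J(1) t(1,1)])
  finally show ?thesis by (simp only: tQ)
 qed
 have gM: "M * g = g * M"
 proof -
  have "M * g = (g * N * g\<^sup>T) * Ji * g" by (simp only: N(3) M_def)
  also have "\<dots> = g * (N * (g\<^sup>T * Ji * g))" using g(1) N(1) J by (simp add: as cl)
  also have "\<dots> = g * M" by (simp only: gtJig M_def)
  finally show ?thesis .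
 qed
 have gQ: "Q * g = g * Q"
 proof -
  have "Q * g = M * (M * g)" unfolding Q_def by (rule as[OF M(1,1) g(1)])
  also have "\<dots> = M * (g * M)" by (simp only: gM)
  also have "\<dots> = (M * g) * M" by (rule as[OF M(1) g(1) M(1), symmetric])
  also have "\<dots> = (g * M) * M" by (simp only: gM)
  also have "\<dots> = g * Q" unfolding Q_def by (rule as[OF g(1) M(1,1)])
  finally show ?thesis .
 qed
 \<comment> \<open>The exponential series stops after the quadratic term because the cube of
   \<open>M\<close> is zero.\<close>
 define u where "u t = Id n + (t \<cdot> M + (t * t / 2) \<cdot> Q)" for t
 have uc: "u t \<in> Mat n" for t using M by (simp add: u_def)
 have u_add: "u (a + b) = u a * u b" for a b
 proof -
  have "u a * u b = u b + ((a \<cdot> M) * u b + ((a * a / 2) \<cdot> Q) * u b)"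
   unfolding u_def[of a] using M uc[of b] by (simp add: ds cl)
  also have "(a \<cdot> M) * u b = a \<cdot> (M + b \<cdot> Q)"
  proof -
   have "M * u b = M + (b \<cdot> (M * M) + (b * b / 2) \<cdot> (M * Q))" unfolding u_def using M by (simp add: ds cl)
   also have "\<dots> = M + b \<cdot> Q" unfolding MQ Q_def[symmetric] using M by (auto intro!: sqI cl simp: ix cl)
   finally show ?thesis using ds(5)[OF M(1) uc] by simp
  qed
  also have "((a * a / 2) \<cdot> Q) * u b = (a * a / 2) \<cdot> Q"
  proof -
   have "Q * u b = Q + (b \<cdot> (Q * M) + (b * b / 2) \<cdot> (Q * Q))" unfolding u_def using M by (simp add: ds cl)
   also have "\<dots> = Q" unfolding QM QQ using M by (auto intro!: sqI cl simp: ix cl)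
   finally show ?thesis using ds(5)[OF M(2) uc] by simp
  qed
  also have "u b + (a \<cdot> (M + b \<cdot> Q) + (a * a / 2) \<cdot> Q) = u (a + b)"
   unfolding u_def using M by (intro sqI) (auto simp: algebra_simps add_divide_distrib)
  finally show ?thesis by simp
 qed
 have u0: "u 0 = Id n" unfolding u_def using M by (auto intro!: sqI)
 have iso_u: "u t * J * (u t)\<^sup>T = J" for t
 proof -
  let ?v = "Id n + ((- t) \<cdot> ?Mt + (t * t / 2) \<cdot> ?Qt)"
  have vc: "?v \<in> Mat n" using t by simp
  have "u t * J = J + (t \<cdot> (M * J) + (t * t / 2) \<cdot> (Q * J))" unfolding u_def using M J by (simp add: ds cl)
  also have "\<dots> = J + (t \<cdot> (- (J * ?Mt)) + (t * t / 2) \<cdot> (J * ?Qt))" by (simp only: MJ' QJ)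
  also have "\<dots> = J * ?v" using J t
   by (simp add: ds cl) (auto intro!: sqI cl simp: ix cl simp del: index_mult_mat(1))
  finally have 1: "u t * J = J * ?v" .
  have "?v = (u (- t))\<^sup>T" unfolding u_def using M by (auto intro!: eq_matI)
  hence "?v * (u t)\<^sup>T = (u t * u (- t))\<^sup>T" using sq_transpose(3)[OF uc uc, of t "- t"] by simp
  also have "u t * u (- t) = Id n" using u_add[of t "- t"] u0 by simp
  finally have 2: "?v * (u t)\<^sup>T = Id n" by simp
  have "u t * J * (u t)\<^sup>T = J * (?v * (u t)\<^sup>T)" unfolding 1 by (rule as[OF J(1) vc]) (use uc in simp)
  thus ?thesis unfolding 2 using J by simp
 qed
 have comm_u: "u t * g = g * u t" for t unfolding u_def using M g(1) by (simp add: ds cl gM gQ)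
 have uT: "u t \<in> T" for t by (rule cent[OF uc iso_u comm_u])
 have "\<exists>p. \<forall>t. poly p t = u t $$ (i, j)" if "i < n" "j < n" for i j
  by (rule exI[of _ "[:if i = j then 1 else 0, M $$ (i, j), Q $$ (i, j) / 2:]"])
   (use that M in "auto simp: u_def algebra_simps")
 from torus_no_unipotent[OF iso uT uc u_add u0 this] have "u 1 = Id n" by blast
 have z: "M + inverse 2 \<cdot> Q = 0\<^sub>m n n"
 proof (rule sq_eqI)
  fix i j assume ij: "i < n" "j < n"
  have "u 1 $$ (i, j) = Id n $$ (i, j)" using \<open>u 1 = Id n\<close> by simp
  thus "(M + inverse 2 \<cdot> Q) $$ (i, j) = 0\<^sub>m n n $$ (i, j)" using ij M by (simp add: u_def inverse_eq_divide)
 qed (use M in auto)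
 \<comment> \<open>As \<open>M * Q = 0\<close>, multiplying \<open>M + Q / 2 = 0\<close> by
   \<open>M\<close> leaves \<open>Q = 0\<close>, and then \<open>M = 0\<close>.\<close>
 have "M * (M + inverse 2 \<cdot> Q) = M * M + M * (inverse 2 \<cdot> Q)" by (rule ds(3)) (use M in auto)
 also have "M * (inverse 2 \<cdot> Q) = inverse 2 \<cdot> (M * Q)" by (rule ds(6)[OF M])
 also have "M * M + inverse 2 \<cdot> (M * Q) = Q" unfolding MQ Q_def[symmetric] using M by (auto intro!: sqI)
 finally have "Q = M * 0\<^sub>m n n" unfolding z by (rule sym)
 hence "Q = 0\<^sub>m n n" using M by simp
 hence "M = 0\<^sub>m n n" using z M by simp
 hence "0\<^sub>m n n * J = N" using MJ by simp
 thus ?thesis using J by simp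
qed

text \<open>The form with matrix \<open>Ji\<close> up to sign. The convention
  \<open>g * J * g\<^sup>T = J\<close> for isometries means that \<open>g\<close>, acting on column
  vectors, preserves the form of the inverse matrix.\<close>

definition b :: "'b vec => 'b vec => 'b" where
 "b v w = (Ji *\<^sub>v v) \<bullet> w"

lemma b_sym: "v \<in> Vec n ==> w \<in> Vec n ==> b v w = s * b w v"
proof -
 assume v: "v \<in> Vec n" and w: "w \<in> Vec n"
 have "b w v = v \<bullet> (Ji *\<^sub>v w)" unfolding b_def by (rule comm_scalar_prod[of _ n]) (use v w J in auto)
 also have "\<dots> = (Ji\<^sup>T *\<^sub>v v) \<bullet> w" by (rule adjoint_sprod[OF J(2) v w])
 also have "\<dots> = s * b v w" unfolding Jit b_def using v w J by (simp add: vs)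
 finally show ?thesis using ss by (simp flip: mult.assoc)
qed

lemma b_inv: "v \<in> Vec n ==> w \<in> Vec n ==> b (g *\<^sub>v v) (g *\<^sub>v w) = b v w"
proof -
 assume v: "v \<in> Vec n" and w: "w \<in> Vec n"
 have "b (g *\<^sub>v v) (g *\<^sub>v w) = (g\<^sup>T *\<^sub>v (Ji *\<^sub>v (g *\<^sub>v v))) \<bullet> w"
  unfolding b_def by (rule adjoint_sprod[OF g(1) _ w]) (use J g v in auto)
 also have "g\<^sup>T *\<^sub>v (Ji *\<^sub>v (g *\<^sub>v v)) = (g\<^sup>T * Ji * g) *\<^sub>v v" using J g v by (simp add: vs cl)
 finally show ?thesis by (simp only: gtJig b_def)
qed

lemma b_simps:
 assumes "v \<in> Vec n" "w \<in> Vec n" "x \<in> Vec n"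
 shows "b (c \<cdot>\<^sub>v v) w = c * b v w" "b v (c \<cdot>\<^sub>v w) = c * b v w" "b (v + x) w = b v w + b x w"
  "b v (w + x) = b v w + b v x" using assms J unfolding b_def
 by (simp_all add: vs add_scalar_prod_distrib[of _ n] scalar_prod_add_distrib[of _ n])

text \<open>With \<open>Ji\<close> on the right these are the elements of rank at most two in the
  Lie algebra of the isometry group: symmetric products for \<open>s = - 1\<close>, alternating ones
  for \<open>s = 1\<close>.\<close>

definition N :: "'b vec => 'b vec => 'b mat" where
 "N v w = outer v w + (- s) \<cdot> outer w v"

text \<open>If \<open>v\<close> is orthogonal to itself and to \<open>w\<close>, then
  \<open>N v w * Ji\<close> maps everything into the span of \<open>v\<close> and \<open>w\<close>,
  sends \<open>w\<close> to a multiple of \<open>v\<close> and kills \<open>v\<close>. Its cube is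
  zero, so \<open>no_nilpotent\<close> applies.\<close>

lemma N_zero:
 assumes v: "v \<in> Vec n" and w: "w \<in> Vec n" and bv: "b v v = 0" "b v w = 0"
  and inv: "g * N v w * g\<^sup>T = N v w"
 shows "N v w = 0\<^sub>m n n"
proof (rule no_nilpotent[OF _ _ inv])
 have vw: "outer v w \<in> Mat n" "outer w v \<in> Mat n" using v w by auto
 show c: "N v w \<in> Mat n" unfolding N_def using vw by simp
 show "(N v w)\<^sup>T = (- s) \<cdot> N v w" unfolding N_def using v w s by (intro sqI) auto
 let ?M = "N v w * Ji"
 have Mc: "?M \<in> Mat n" using c J by simp
 have Mx: "?M *\<^sub>v x = (s * b w x) \<cdot>\<^sub>v v + (- b v x) \<cdot>\<^sub>v w" if x: "x \<in> Vec n" for x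
 proof -
  have Jx: "Ji *\<^sub>v x \<in> Vec n" using J x by simp
  have *: "y \<bullet> (Ji *\<^sub>v x) = s * b y x" if y: "y \<in> Vec n" for y
   using adjoint_sprod[OF J(2) y x] J x y unfolding Jit b_def by (simp add: vs)
  have "?M *\<^sub>v x = N v w *\<^sub>v (Ji *\<^sub>v x)" by (rule sq_vec(1)[OF c J(2) x])
  also have "\<dots> = outer v w *\<^sub>v (Ji *\<^sub>v x) + ((- s) \<cdot> outer w v) *\<^sub>v (Ji *\<^sub>v x)"
   unfolding N_def by (rule sq_vec(4)) (use vw Jx in auto)
  also have "((- s) \<cdot> outer w v) *\<^sub>v (Ji *\<^sub>v x) = (- s) \<cdot>\<^sub>v (outer w v *\<^sub>v (Ji *\<^sub>v x))"
   by (rule sq_vec(3)[OF vw(2) Jx])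
  also have "outer v w *\<^sub>v (Ji *\<^sub>v x) = (s * b w x) \<cdot>\<^sub>v v" unfolding outer_mult_vec[OF v w Jx] *[OF w] ..
  also have "outer w v *\<^sub>v (Ji *\<^sub>v x) = (s * b v x) \<cdot>\<^sub>v w" unfolding outer_mult_vec[OF w v Jx] *[OF v] ..
  also have "(- s) \<cdot>\<^sub>v ((s * b v x) \<cdot>\<^sub>v w) = (- b v x) \<cdot>\<^sub>v w"
   using ss by (simp add: smult_smult_assoc flip: mult.assoc)
  finally show ?thesis .
 qed
 have bwv: "b w v = 0" using b_sym[OF w v] bv by simp
 have Mv: "?M *\<^sub>v v = 0\<^sub>v n" unfolding Mx[OF v] bwv bv using v w by (intro eq_vecI) auto
 have Mw: "?M *\<^sub>v w = (s * b w w) \<cdot>\<^sub>v v" unfolding Mx[OF w] bv using v w by (intro eq_vecI) auto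
 show "?M * (?M * ?M) = 0\<^sub>m n n"
 proof (rule mat_eq_via_vec)
  fix x :: "'b vec" assume x: "x \<in> Vec n"
  have c2: "?M * ?M \<in> Mat n" using Mc by simp
  have M0: "?M *\<^sub>v (c \<cdot>\<^sub>v v) = 0\<^sub>v n" for c unfolding sq_vec(2)[OF Mc v] Mv by (intro eq_vecI) auto
  have "(?M * (?M * ?M)) *\<^sub>v x = ?M *\<^sub>v (?M *\<^sub>v (?M *\<^sub>v x))"
   using sq_vec(1)[OF Mc c2 x] sq_vec(1)[OF Mc Mc x] by simp
  also have "?M *\<^sub>v (?M *\<^sub>v x) = ?M *\<^sub>v ((s * b w x) \<cdot>\<^sub>v v) + ?M *\<^sub>v ((- b v x) \<cdot>\<^sub>v w)"
   unfolding Mx[OF x] by (rule sq_vec(6)[OF Mc]) (use v w in auto)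
  also have "?M *\<^sub>v ((- b v x) \<cdot>\<^sub>v w) = ((- b v x) * (s * b w w)) \<cdot>\<^sub>v v"
   unfolding sq_vec(2)[OF Mc w] Mw by (simp add: smult_smult_assoc)
  also have "?M *\<^sub>v (?M *\<^sub>v ((s * b w x) \<cdot>\<^sub>v v) + ((- b v x) * (s * b w w)) \<cdot>\<^sub>v v) = 0\<^sub>v n"
  proof -
   have "0\<^sub>v n + ((- b v x) * (s * b w w)) \<cdot>\<^sub>v v = ((- b v x) * (s * b w w)) \<cdot>\<^sub>v v" using v by simp
   thus ?thesis using M0 by (simp only:)
  qed
  moreover have "0\<^sub>m n n *\<^sub>v x = 0\<^sub>v n" using x by (auto intro!: eq_vecI simp: scalar_prod_def)
  ultimately show "(?M * (?M * ?M)) *\<^sub>v x = 0\<^sub>m n n *\<^sub>v x" by (simp only:)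
 qed (use Mc in auto)
qed

lemma N_invariant:
 assumes v: "v \<in> Vec n" and w: "w \<in> Vec n"
 shows "g * N v w * g\<^sup>T = N (g *\<^sub>v v) (g *\<^sub>v w)"
proof -
 have o: "g * outer x y * g\<^sup>T = outer (g *\<^sub>v x) (g *\<^sub>v y)"
  if "x \<in> Vec n" "y \<in> Vec n" for x y using that g(1) by (simp add: mult_outer[of _ n] outer_mult[of _ n])
 have "g * N v w * g\<^sup>T = g * outer v w * g\<^sup>T + (- s) \<cdot> (g * outer w v * g\<^sup>T)"
  unfolding N_def using v w g(1) by (simp add: ds cl)
 thus ?thesis by (simp only: o[OF v w] o[OF w v] N_def)
qed

lemma N_zero_dependent:
 assumes v: "v \<in> Vec n" and w: "w \<in> Vec n" and "v \<noteq> 0\<^sub>v n" and "N v w = 0\<^sub>m n n"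
 shows "\<exists>c. w = c \<cdot>\<^sub>v v"
proof -
 obtain i where i: "i < n" "v $ i \<noteq> 0" using v assms(3) by (metis carrier_vecD eq_vecI index_zero_vec)
 have "w $ j = (s * w $ i / v $ i) * v $ j" if j: "j < n" for j
 proof -
  have "N v w $$ (i, j) = 0" using assms(4) i j by simp
  hence "v $ i * w $ j - s * (w $ i * v $ j) = 0" using i j v w by (simp add: N_def)
  thus ?thesis using i by (simp add: field_simps)
 qed
 hence "w = (s * w $ i / v $ i) \<cdot>\<^sub>v v" using v w by (intro eq_vecI) auto
 thus ?thesis by blast
qed

lemma eigenvalue_nonzero:
 assumes "v \<in> Vec n" "v \<noteq> 0\<^sub>v n" "g *\<^sub>v v = l \<cdot>\<^sub>v v"
 shows "l \<noteq> 0"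
proof
 assume "l = 0"
 hence "g *\<^sub>v v = 0\<^sub>v n" using assms by (auto intro!: eq_vecI)
 thus False using det_nonzero_iff_inj[OF g(1)] det_isometry_nonzero[OF g] assms by blast
qed

lemma adjoint_eigenvector:
 assumes v: "v \<in> Vec n" "g *\<^sub>v v = l \<cdot>\<^sub>v v" and l: "l * l = 1"
 shows "g\<^sup>T *\<^sub>v (Ji *\<^sub>v v) = l \<cdot>\<^sub>v (Ji *\<^sub>v v)"
proof -
 have "v = l \<cdot>\<^sub>v (g *\<^sub>v v)" using l v by (simp add: smult_smult_assoc)
 hence "g\<^sup>T *\<^sub>v (Ji *\<^sub>v v) = g\<^sup>T *\<^sub>v (Ji *\<^sub>v (l \<cdot>\<^sub>v (g *\<^sub>v v)))" by simp
 also have "\<dots> = l \<cdot>\<^sub>v (g\<^sup>T *\<^sub>v (Ji *\<^sub>v (g *\<^sub>v v)))" using J g v by (simp add: vs)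
 also have "g\<^sup>T *\<^sub>v (Ji *\<^sub>v (g *\<^sub>v v)) = (g\<^sup>T * Ji * g) *\<^sub>v v" using J g(1) v by (simp add: vs cl)
 finally show ?thesis by (simp only: gtJig)
qed

text \<open>For \<open>s = - 1\<close> every vector is isotropic and an eigenvector for
  \<open>1\<close> or \<open>- 1\<close> makes \<open>N v v\<close> invariant. For
  \<open>s = 1\<close> a non-isotropic eigenvector gives a reflection in the centralizer, so such
  eigenvectors are isotropic, and a second vector \<open>w\<close> with
  \<open>g w = l w + c v\<close> is needed to make \<open>N v w\<close> invariant and
  nonzero.\<close>

lemma eigenvalue_square:
 assumes v: "v \<in> Vec n" "v \<noteq> 0\<^sub>v n" "g *\<^sub>v v = l \<cdot>\<^sub>v v"
 shows "l * l \<noteq> 1"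
proof
 assume l: "l * l = 1"
 have l0: "l \<noteq> 0" by (rule eigenvalue_nonzero[OF v])
 show False
 proof (cases "s = 1")
  case False
  hence s1: "s = - 1" using s by simp
  have "b v v = - b v v" using b_sym[OF v(1) v(1)] s1 by simp
  hence bv: "b v v = 0" by simp
  have "N (l \<cdot>\<^sub>v v) (l \<cdot>\<^sub>v v) = (l * l) \<cdot> N v v"
   unfolding N_def using v(1) by (intro eq_matI) (auto simp: algebra_simps)
  also have "\<dots> = N v v" unfolding l N_def using v(1) by (intro eq_matI) auto
  finally have "g * N v v * g\<^sup>T = N v v" using N_invariant[OF v(1) v(1)] v(3) by simp
  from N_zero[OF v(1) v(1) bv bv this] have "N v v = 0\<^sub>m n n" .
  moreover have "N v v = 2 \<cdot> outer v v" unfolding N_def using v(1) s1 by (intro eq_matI) auto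
  ultimately have "2 \<cdot> outer v v = 0\<^sub>m n n" by simp
  moreover obtain i where i: "i < n" "v $ i \<noteq> 0" using v by (metis carrier_vecD eq_vecI index_zero_vec)
  ultimately have "(2 \<cdot> outer v v) $$ (i, i) = 0" by simp
  thus False using i v by simp
 next
  case True
  \<comment> \<open>The reflection in \<open>v\<close> preserves the form and commutes with
    \<open>g\<close> because \<open>l * l = 1\<close>. It would lie in the torus, although its
    determinant is \<open>- 1\<close>.\<close>
  have iso_l: "b v v = 0" if v: "v \<in> Vec n" "v \<noteq> 0\<^sub>v n" "g *\<^sub>v v = l \<cdot>\<^sub>v v" for v
  proof (rule ccontr)
   assume bv: "b v v \<noteq> 0"
   define z where "z = (- 2 / b v v) \<cdot>\<^sub>v (Ji *\<^sub>v v)"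
   let ?R = "Id n + outer v z"
   have y: "z \<in> Vec n" "Ji *\<^sub>v v \<in> Vec n" using J v by (auto simp: z_def)
   have oc: "outer v z \<in> Mat n" using v y by simp
   have Rc: "?R \<in> Mat n" using oc by simp
   have zv: "z \<bullet> v = - 2" using v J bv by (simp add: b_def z_def)
   hence "det ?R = - 1" using det_one_plus_outer[OF v(1) y(1)] zv by simp
   moreover have "?R \<in> T"
   proof (rule cent[OF Rc])
    have Jy: "J *\<^sub>v z = (- 2 / b v v) \<cdot>\<^sub>v v"
     using J v y sq_vec(1)[OF J(1,2) v(1)] by (simp add: sq_vec(2)[of _ n] J(3) z_def)
    have JRt: "J * ?R\<^sup>T = J + outer (J *\<^sub>v z) v"
    proof -
     have "?R\<^sup>T = Id n + outer z v" using sq_transpose(1)[OF one_carrier_mat oc] by (simp add: transpose_outer)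
     thus ?thesis using J y v mult_outer[OF J(1) y(1) v(1)] by (simp add: ds)
    qed
    have "?R * J * ?R\<^sup>T = ?R * (J * ?R\<^sup>T)" by (rule sq_assoc[OF Rc J(1)]) (use Rc in simp)
    also have "\<dots> = ?R * J + ?R * outer (J *\<^sub>v z) v" unfolding JRt by (rule sq_distrib(3)) (use J Rc v y in auto)
    finally have 1: "?R * J * ?R\<^sup>T = ?R * J + ?R * outer (J *\<^sub>v z) v" .
    have 2: "?R * J = J + outer v (J\<^sup>T *\<^sub>v z)"
     using sq_distrib(1)[OF one_carrier_mat oc J(1)] outer_mult[OF J(1) v(1) y(1)] J by simp
    have 3: "J\<^sup>T *\<^sub>v z = (- 2 / b v v) \<cdot>\<^sub>v v" unfolding Jt True using J by (simp add: sq_vec(3)[OF J(1) y(1)] Jy)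
    have 4: "?R * outer (J *\<^sub>v z) v = outer (?R *\<^sub>v (J *\<^sub>v z)) v"
     by (rule mult_outer[OF Rc _ v(1)]) (use J y in auto)
    have "?R *\<^sub>v v = v + (z \<bullet> v) \<cdot>\<^sub>v v"
     using sq_vec(4)[OF one_carrier_mat oc v(1)] outer_mult_vec[OF v(1) y(1) v(1)] v by simp
    also have "\<dots> = (- 1) \<cdot>\<^sub>v v" unfolding zv using v by (intro eq_vecI) auto
    finally have "?R *\<^sub>v v = (- 1) \<cdot>\<^sub>v v" .
    hence 5: "?R *\<^sub>v (J *\<^sub>v z) = (2 / b v v) \<cdot>\<^sub>v v"
     unfolding Jy sq_vec(2)[OF Rc v(1)] using v by (simp add: smult_smult_assoc)
    have "J + outer v ((- 2 / b v v) \<cdot>\<^sub>v v) + outer ((2 / b v v) \<cdot>\<^sub>v v) v = J"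
     using J v by (intro sqI) (auto simp: field_simps)
    hence "?R * J + ?R * outer (J *\<^sub>v z) v = J" unfolding 4 5 by (simp only: 2 3)
    with 1 show "?R * J * ?R\<^sup>T = J" by (rule trans)
    have "g * outer v z = outer v z * g"
    proof -
     have "g * outer v z = outer (l \<cdot>\<^sub>v v) z" using mult_outer[OF g(1) v(1) y(1)] v(3) by simp
     moreover have "outer v z * g = outer v (g\<^sup>T *\<^sub>v z)" by (rule outer_mult[OF g(1) v(1) y(1)])
     moreover have "g\<^sup>T *\<^sub>v (Ji *\<^sub>v v) = l \<cdot>\<^sub>v (Ji *\<^sub>v v)" by (rule adjoint_eigenvector[OF v(1,3) l])
     hence "g\<^sup>T *\<^sub>v z = l \<cdot>\<^sub>v z"
      using g y unfolding z_def by (simp add: sq_vec(2)[of _ n] smult_smult_assoc mult.commute)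
     ultimately show ?thesis by (simp only: outer_smult_left outer_smult_right)
    qed
    thus "?R * g = g * ?R" using g(1) oc by (simp add: ds)
   qed
   ultimately show False using special[OF True] by fastforce
  qed
  have bv: "b v v = 0" by (rule iso_l[OF v])
  define y where "y = Ji *\<^sub>v v"
  have y: "y \<in> Vec n" "y \<bullet> v = 0" using J v bv by (auto simp: y_def b_def)
  have y0: "y \<noteq> 0\<^sub>v n"
  proof
   assume "y = 0\<^sub>v n"
   moreover have "J *\<^sub>v y = v" unfolding y_def using sq_vec(1)[OF J(1,2) v(1)] J(3) v by simp
   ultimately show False using v J by (auto simp: scalar_prod_def intro!: eq_vecI)
  qed
  have yg: "g\<^sup>T *\<^sub>v y = l \<cdot>\<^sub>v y" unfolding y_def by (rule adjoint_eigenvector[OF v(1,3) l])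
  obtain i where i: "i < n" "v $ i \<noteq> 0" using v by (metis carrier_vecD eq_vecI index_zero_vec)
  let ?z = "inverse (v $ i) \<cdot>\<^sub>v unit_vec n i"
  have z: "?z \<in> Vec n" "?z \<bullet> v = 1" using i v by auto
  \<comment> \<open>The left eigenvector \<open>y\<close> annihilates the image of
    \<open>g - l\<close> and also \<open>v\<close>, because \<open>v\<close> is isotropic. So
    \<open>?B\<close> is singular, and a kernel vector \<open>w\<close> satisfies
    \<open>g w = l w + c v\<close>. The choice of \<open>?z\<close> with value \<open>1\<close> on
    \<open>v\<close> keeps \<open>w\<close> off the line of \<open>v\<close>.\<close>
  let ?B = "(g - l \<cdot> Id n) - outer v ?z"
  have Bc: "?B \<in> Mat n" using g v z by (intro sq_closed) auto
  have "?B\<^sup>T *\<^sub>v y = 0\<^sub>v n"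
  proof -
   have "?B\<^sup>T = (g\<^sup>T - l \<cdot> Id n) - outer ?z v" using g v z by (intro eq_matI) auto
   moreover have "((g\<^sup>T - l \<cdot> Id n) - outer ?z v) *\<^sub>v y
     = (g\<^sup>T *\<^sub>v y - (l \<cdot> Id n) *\<^sub>v y) - outer ?z v *\<^sub>v y"
    using g v z y sq_vec(5)[of "g\<^sup>T - l \<cdot> Id n" n "outer ?z v" y] sq_vec(5)[of "g\<^sup>T" n "l \<cdot> Id n" y]
    by (simp add: cl)
   moreover have "(l \<cdot> Id n) *\<^sub>v y = l \<cdot>\<^sub>v y" using sq_vec(3)[OF one_carrier_mat y(1)] y by simp
   moreover have "outer ?z v *\<^sub>v y = 0 \<cdot>\<^sub>v ?z"
    using outer_mult_vec[OF z(1) v(1) y(1)] y(2) comm_scalar_prod[OF v(1) y(1)] by simp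
   ultimately show ?thesis unfolding yg using y z by (auto intro!: eq_vecI)
  qed
  hence "det ?B\<^sup>T = 0" using det_nonzero_iff_inj[of "?B\<^sup>T" n] Bc y(1) y0 by auto
  hence "det ?B = 0" using det_transpose[OF Bc] by simp
  then obtain w where w: "w \<in> Vec n" "w \<noteq> 0\<^sub>v n" "?B *\<^sub>v w = 0\<^sub>v n"
   using det_0_iff_vec_prod_zero_field[OF Bc] by blast
  define c where "c = ?z \<bullet> w"
  have Bx: "?B *\<^sub>v x = (g *\<^sub>v x - l \<cdot>\<^sub>v x) - (?z \<bullet> x) \<cdot>\<^sub>v v" if x: "x \<in> Vec n" for x
  proof -
   have "?B *\<^sub>v x = (g *\<^sub>v x - (l \<cdot> Id n) *\<^sub>v x) - outer v ?z *\<^sub>v x"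
    using g v z x sq_vec(5)[of "g - l \<cdot> Id n" n "outer v ?z" x] sq_vec(5)[of g n "l \<cdot> Id n" x] by (simp add: cl)
   moreover have "(l \<cdot> Id n) *\<^sub>v x = l \<cdot>\<^sub>v x" using sq_vec(3)[OF one_carrier_mat x] x by simp
   ultimately show ?thesis using outer_mult_vec[OF v(1) z(1) x] by simp
  qed
  have gw: "g *\<^sub>v w = l \<cdot>\<^sub>v w + c \<cdot>\<^sub>v v"
  proof (rule eq_vecI)
   fix k assume "k < dim_vec (l \<cdot>\<^sub>v w + c \<cdot>\<^sub>v v)"
   hence k: "k < n" using v by simp
   have "(?B *\<^sub>v w) $ k = 0" using w(3) k by simp
   thus "(g *\<^sub>v w) $ k = (l \<cdot>\<^sub>v w + c \<cdot>\<^sub>v v) $ k"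
    unfolding Bx[OF w(1)] using k g v w(1) by (simp add: c_def algebra_simps del: index_mult_mat_vec)
  qed (use g v in auto)
  have indep: "w \<noteq> a \<cdot>\<^sub>v v" for a
  proof
   assume wa: "w = a \<cdot>\<^sub>v v"
   have "?B *\<^sub>v w = (- a) \<cdot>\<^sub>v v" unfolding Bx[OF w(1)] unfolding wa sq_vec(2)[OF g(1) v(1)] v(3) using v z
    by (intro eq_vecI) auto
   hence "(- a) \<cdot>\<^sub>v v = 0\<^sub>v n" using w(3) by simp
   hence "((- a) \<cdot>\<^sub>v v) $ i = 0" using i by simp
   hence "a = 0" using i v by simp
   thus False using wa w(2) v by (auto intro!: eq_vecI)
  qed
  \<comment> \<open>If \<open>c\<close> is nonzero, invariance of \<open>b w w\<close> forces this.
    If \<open>c = 0\<close>, then \<open>v\<close>, \<open>w\<close> and \<open>v + w\<close> are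
    all eigenvectors for \<open>l\<close>, hence isotropic, and polarization applies.\<close>
  have bvw: "b v w = 0"
  proof (cases "c = 0")
   case False
   have "b w w = b (l \<cdot>\<^sub>v w + c \<cdot>\<^sub>v v) (l \<cdot>\<^sub>v w + c \<cdot>\<^sub>v v)" using b_inv[OF w(1) w(1)] gw by simp
   also have "\<dots> = (l * l) * b w w + 2 * (l * c) * b v w + c * c * b v v"
    using v w b_sym[OF w(1) v(1)] True by (simp add: b_simps algebra_simps)
   finally have "2 * (l * c) * b v w = 0" using l bv by simp
   thus ?thesis using False l0 by simp
  next
   case True
   hence gw: "g *\<^sub>v w = l \<cdot>\<^sub>v w" using gw w v by (intro eq_vecI) auto
   have "g *\<^sub>v (v + w) = l \<cdot>\<^sub>v (v + w)"
    unfolding sq_vec(6)[OF g(1) v(1) w(1)] gw v(3) using v w by (simp add: smult_add_distrib_vec[of _ n])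
   moreover have "v + w \<noteq> 0\<^sub>v n"
   proof
    assume "v + w = 0\<^sub>v n"
    hence "w = (- 1) \<cdot>\<^sub>v v"
    proof (intro eq_vecI)
     fix k assume vw: "v + w = 0\<^sub>v n" and "k < dim_vec ((- 1) \<cdot>\<^sub>v v)"
     hence k: "k < n" using v by simp
     have "(v + w) $ k = 0" using vw k by simp
     thus "w $ k = ((- 1) \<cdot>\<^sub>v v) $ k" using k v w by (simp add: add_eq_0_iff)
    qed (use v w in auto)
    thus False using indep by blast
   qed
   ultimately have "b (v + w) (v + w) = 0" using v w by (intro iso_l) auto
   moreover have "b w w = 0" by (rule iso_l[OF w(1,2) gw])
   ultimately show ?thesis using v w bv b_sym[OF w(1) v(1)] \<open>s = 1\<close> by (simp add: b_simps)
  qed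
  have "N (l \<cdot>\<^sub>v v) (l \<cdot>\<^sub>v w + c \<cdot>\<^sub>v v) = (l * l) \<cdot> N v w"
   unfolding N_def using v w True by (intro eq_matI) (auto simp: algebra_simps)
  also have "\<dots> = N v w" unfolding l N_def using v w by (intro eq_matI) auto
  finally have "g * N v w * g\<^sup>T = N v w" using N_invariant[OF v(1) w(1)] v(3) gw by simp
  from N_zero_dependent[OF v(1) w(1) v(2) N_zero[OF v(1) w(1) bv bvw this]] indep show False by blast
 qed
qed

text \<open>This is simplicity of the eigenvalue in a form suited to splitting off eigenlines. If
  the pairing were zero, \<open>J y\<close> would be an eigenvector for \<open>inverse l\<close>
  orthogonal to \<open>v\<close>, so \<open>N v (J y)\<close> would be invariant and vanish. Then
  \<open>J y\<close> is a multiple of \<open>v\<close>, which forces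
  \<open>l * l = 1\<close>.\<close>

lemma left_right_eigenvectors:
 assumes v: "v \<in> Vec n" "v \<noteq> 0\<^sub>v n" "g *\<^sub>v v = l \<cdot>\<^sub>v v"
  and y: "y \<in> Vec n" "y \<noteq> 0\<^sub>v n" "g\<^sup>T *\<^sub>v y = l \<cdot>\<^sub>v y"
 shows "scalar_prod y v \<noteq> 0"
proof
 assume yv: "y \<bullet> v = 0"
 have l0: "l \<noteq> 0" and l1: "l * l \<noteq> 1" using eigenvalue_nonzero[OF v] eigenvalue_square[OF v] by auto
 define w where "w = J *\<^sub>v y"
 have w: "w \<in> Vec n" using J y by (simp add: w_def)
 have Jiw: "Ji *\<^sub>v w = y" unfolding w_def using sq_vec(1)[OF J(2,1) y(1)] JiJ y by simp
 have w0: "w \<noteq> 0\<^sub>v n"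
 proof
  assume "w = 0\<^sub>v n"
  hence "y = Ji *\<^sub>v 0\<^sub>v n" using Jiw by simp
  also have "\<dots> = 0\<^sub>v n" using J by (auto intro!: eq_vecI simp: scalar_prod_def)
  finally show False using y(2) by simp
 qed
 have "w = (g * J * g\<^sup>T) *\<^sub>v y" by (simp only: g(2) w_def)
 also have "\<dots> = g *\<^sub>v (J *\<^sub>v (g\<^sup>T *\<^sub>v y))" using J g(1) y by (simp add: vs cl)
 also have "\<dots> = l \<cdot>\<^sub>v (g *\<^sub>v w)" unfolding y(3) w_def using J g(1) y by (simp add: vs)
 finally have "inverse l \<cdot>\<^sub>v w = inverse l \<cdot>\<^sub>v (l \<cdot>\<^sub>v (g *\<^sub>v w))" by simp
 hence gw: "g *\<^sub>v w = inverse l \<cdot>\<^sub>v w" using l0 by (simp add: smult_smult_assoc)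
 have "b v v = (l * l) * b v v" using b_inv[OF v(1) v(1)] v by (simp add: b_simps)
 hence bv: "b v v = 0" using l1 by simp
 have "b w v = 0" unfolding b_def Jiw by (rule yv)
 hence bvw: "b v w = 0" using b_sym[OF v(1) w] by simp
 have "N (l \<cdot>\<^sub>v v) (inverse l \<cdot>\<^sub>v w) = N v w"
  unfolding N_def using v w l0 by (intro eq_matI) (auto simp: field_simps)
 hence "g * N v w * g\<^sup>T = N v w" using N_invariant[OF v(1) w] v(3) gw by simp
 from N_zero_dependent[OF v(1) w v(2) N_zero[OF v(1) w bv bvw this]] obtain c where c: "w = c \<cdot>\<^sub>v v" by blast
 obtain i where i: "i < n" "w $ i \<noteq> 0" using w w0 by (metis carrier_vecD eq_vecI index_zero_vec)
 have "g *\<^sub>v w = l \<cdot>\<^sub>v w" unfolding c sq_vec(2)[OF g(1) v(1)] v(3) by (simp add: smult_smult_assoc mult.commute)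
 hence "(inverse l \<cdot>\<^sub>v w) $ i = (l \<cdot>\<^sub>v w) $ i" using gw by simp
 hence "inverse l = l" using i w by simp
 hence "l * l = 1" using l0 by (metis right_inverse)
 thus False using l1 by simp
qed

end

section \<open>Diagonal matrices and the diagonalization of a regular isometry\<close>

definition dmat :: "nat => (nat => 'b::field) => 'b mat" where
 "dmat n l = mat n n (\<lambda>(i, j). if i = j then l i else 0)"

lemma dmat_carrier [simp]: "dmat n l \<in> Mat n" by (simp add: dmat_def)

lemma dmat_index [simp]: "i < n ==> j < n ==> dmat n l $$ (i, j) = (if i = j then l i else 0)" by (simp add: dmat_def)

lemma mult_dmat: "A \<in> carrier_mat k n ==> i < k ==> j < n ==> (A * dmat n l) $$ (i, j) = A $$ (i, j) * l j"
 for A :: "'b::field mat" by (auto simp: scalar_prod_def dmat_def if_distrib[of "\<lambda>x. _ * x"] cong: if_cong)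

lemma dmat_mult: "A \<in> carrier_mat n k ==> i < n ==> j < k ==> (dmat n l * A) $$ (i, j) = l i * A $$ (i, j)"
 for A :: "'b::field mat" by (auto simp: scalar_prod_def dmat_def if_distrib[of "\<lambda>x. x * _"] cong: if_cong)

lemma dmat_dmat: "dmat n l * dmat n k = dmat n (\<lambda>i. l i * k i)"
 by (intro sq_eqI[where n=n] sq_closed(3)) (auto simp: mult_dmat[of _ n n] simp del: index_mult_mat(1))

lemma det_dmat: "det (dmat n l) = (\<Prod>i<n. l i)"
proof -
 have "det (dmat n l) = prod_list (diag_mat (dmat n l))"
  by (rule det_upper_triangular[of _ n]) (auto simp: upper_triangular_def dmat_def)
 also have "\<dots> = (\<Prod>i<n. l i)" by (simp add: prod_list_diag_prod dmat_def lessThan_atLeast0)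
 finally show ?thesis .
qed

text \<open>For each eigenvalue one right and one left eigenvector are normalized to pair to
  \<open>1\<close>. They form rectangular matrices with \<open>Y V = 1\<close>, and
  \<open>V Y\<close> is an idempotent commuting with \<open>g\<close>. That it is the identity, and
  hence that there are \<open>n\<close> distinct eigenvalues, follows without generalized
  eigenspaces.\<close>

lemma (in regular_isometry) diagonalization:
 obtains V Vi l where "V \<in> Mat n" "Vi \<in> Mat n" "V * Vi = Id n"
  "g * V = V * dmat n l" "inj_on l {..<n}" "\<forall>i<n. l i * l i \<noteq> 1"
proof -
 define \<Lambda> where "\<Lambda> = {l. eigenvalue g l}"
 have "char_poly g \<noteq> 0" using degree_monic_char_poly[OF g(1)] by auto
 hence fin: "finite \<Lambda>" unfolding \<Lambda>_def eigenvalue_root_char_poly[OF g(1)] by (rule poly_roots_finite)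
 have ex: "\<exists>v y. v \<in> Vec n \<and> y \<in> Vec n \<and> g *\<^sub>v v = l \<cdot>\<^sub>v v \<and> v \<noteq> 0\<^sub>v n \<and>
   g\<^sup>T *\<^sub>v y = l \<cdot>\<^sub>v y \<and> scalar_prod y v = 1" if l: "l \<in> \<Lambda>" for l
 proof -
  from l obtain v where v: "v \<in> Vec n" "v \<noteq> 0\<^sub>v n" "g *\<^sub>v v = l \<cdot>\<^sub>v v"
   using g(1) unfolding \<Lambda>_def eigenvalue_def eigenvector_def by auto
  have gt: "g\<^sup>T \<in> Mat n" using g by simp
  have "eigenvalue g\<^sup>T l"
   using l unfolding \<Lambda>_def eigenvalue_root_char_poly[OF gt] char_poly_transpose_mat[OF g(1)]
   by (simp add: eigenvalue_root_char_poly[OF g(1)])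
  then obtain y where y: "y \<in> Vec n" "y \<noteq> 0\<^sub>v n" "g\<^sup>T *\<^sub>v y = l \<cdot>\<^sub>v y"
   using g(1) unfolding eigenvalue_def eigenvector_def by auto
  have yv: "scalar_prod y v \<noteq> 0" by (rule left_right_eigenvectors[OF v y])
  let ?y = "inverse (scalar_prod y v) \<cdot>\<^sub>v y"
  have "g\<^sup>T *\<^sub>v ?y = l \<cdot>\<^sub>v ?y" unfolding sq_vec(2)[OF gt y(1)] y(3) by (simp add: smult_smult_assoc mult.commute)
  moreover have "scalar_prod ?y v = 1" using v y yv by simp
  ultimately show ?thesis using v y by (intro exI[of _ v] exI[of _ ?y]) auto
 qed
 obtain h where h: "bij_betw h {0..<card \<Lambda>} \<Lambda>" using ex_bij_betw_nat_finite[OF fin] by blast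
 define K where "K = card \<Lambda>"
 have hL: "h k \<in> \<Lambda>" if "k < K" for k using bij_betwE[OF h] that by (simp add: K_def)
 have "\<forall>k. \<exists>v y. k < K --> v \<in> Vec n \<and> y \<in> Vec n \<and> g *\<^sub>v v = h k \<cdot>\<^sub>v v \<and> v \<noteq> 0\<^sub>v n \<and>
   g\<^sup>T *\<^sub>v y = h k \<cdot>\<^sub>v y \<and> scalar_prod y v = 1" using ex[OF hL] by blast
 from choice[OF this] obtain v where "\<forall>k. \<exists>y. k < K --> v k \<in> Vec n \<and> y \<in> Vec n \<and>
   g *\<^sub>v v k = h k \<cdot>\<^sub>v v k \<and> v k \<noteq> 0\<^sub>v n \<and> g\<^sup>T *\<^sub>v y = h k \<cdot>\<^sub>v y \<and> scalar_prod y (v k) = 1" by (rule exE)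
 from choice[OF this] obtain y where vy: "\<forall>k. k < K --> v k \<in> Vec n \<and> y k \<in> Vec n \<and>
   g *\<^sub>v v k = h k \<cdot>\<^sub>v v k \<and> v k \<noteq> 0\<^sub>v n \<and> g\<^sup>T *\<^sub>v y k = h k \<cdot>\<^sub>v y k \<and> scalar_prod (y k) (v k) = 1" by (rule exE)
 have P: "v k \<in> Vec n" "y k \<in> Vec n" "g *\<^sub>v v k = h k \<cdot>\<^sub>v v k" "v k \<noteq> 0\<^sub>v n"
  "g\<^sup>T *\<^sub>v y k = h k \<cdot>\<^sub>v y k" "scalar_prod (y k) (v k) = 1"
  "dim_vec (v k) = n" "dim_vec (y k) = n" if "k < K" for k using vy that by auto
 define V where "V = mat n K (\<lambda>(i, k). v k $ i)"
 define Y where "Y = mat K n (\<lambda>(k, j). y k $ j)"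
 have c: "V \<in> carrier_mat n K" "Y \<in> carrier_mat K n" by (auto simp: V_def Y_def)
 have colV: "col V k = v k" and rowY: "Matrix.row Y k = y k" if "k < K" for k
  using vy that by (auto simp: V_def Y_def intro!: eq_vecI)
 have YV: "Y * V = 1\<^sub>m K"
 proof (rule eq_matI)
  fix k m assume "k < dim_row (1\<^sub>m K :: 'b mat)" "m < dim_col (1\<^sub>m K :: 'b mat)"
  hence km: "k < K" "m < K" by auto
  have 1: "(Y * V) $$ (k, m) = scalar_prod (Matrix.row Y k) (col V m)"
   by (rule index_mult_mat(1)) (use c km in auto)
  have 2: "scalar_prod (y k) (v m) = (if k = m then 1 else 0)"
  proof (cases "k = m")
   case False
   have "h k = h m \<longleftrightarrow> k = m"
    by (rule inj_on_eq_iff[OF bij_betw_imp_inj_on[OF h]]) (use km in "simp_all add: K_def")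
   hence hk: "h k \<noteq> h m" using False by simp
   have a: "scalar_prod (y k) (g *\<^sub>v v m) = scalar_prod (g\<^sup>T *\<^sub>v y k) (v m)"
    by (rule adjoint_sprod[OF g(1) P(2)[OF km(1)] P(1)[OF km(2)]])
   have "scalar_prod (y k) (g *\<^sub>v v m) = h m * scalar_prod (y k) (v m)"
    unfolding P(3)[OF km(2)] by (simp add: P(7)[OF km(2)] P(8)[OF km(1)])
   moreover have "scalar_prod (g\<^sup>T *\<^sub>v y k) (v m) = h k * scalar_prod (y k) (v m)"
    unfolding P(5)[OF km(1)] by (simp add: P(7)[OF km(2)] P(8)[OF km(1)])
   ultimately have "h m * scalar_prod (y k) (v m) = h k * scalar_prod (y k) (v m)" using a by (simp only:)
   thus ?thesis using False hk mult_right_cancel[of "scalar_prod (y k) (v m)" "h m" "h k"] by auto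
  qed (simp add: P(6)[OF km(2)])
  show "(Y * V) $$ (k, m) = 1\<^sub>m K $$ (k, m)" unfolding 1 colV[OF km(2)] rowY[OF km(1)] 2 using km by simp
 qed (use c in auto)
 have gV: "g * V = V * dmat K h"
 proof (rule eq_matI)
  fix i k assume "i < dim_row (V * dmat K h)" "k < dim_col (V * dmat K h)"
  hence ik: "i < n" "k < K" using c by (auto simp: dmat_def)
  have "(g * V) $$ (i, k) = scalar_prod (Matrix.row g i) (col V k)"
   by (rule index_mult_mat(1)) (use g c ik in auto)
  also have "\<dots> = (g *\<^sub>v v k) $ i" using g ik by (simp add: colV[OF ik(2)])
  also have "\<dots> = h k * v k $ i" unfolding P(3)[OF ik(2)] using ik by (simp add: P(7)[OF ik(2)])
  also have "\<dots> = V $$ (i, k) * h k" using ik by (simp add: V_def)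
  also have "\<dots> = (V * dmat K h) $$ (i, k)" by (rule mult_dmat[OF c(1) ik, symmetric])
  finally show "(g * V) $$ (i, k) = (V * dmat K h) $$ (i, k)" .
 qed (use g c in "auto simp: dmat_def")
 have Yg: "Y * g = dmat K h * Y"
 proof (rule eq_matI)
  fix k j assume "k < dim_row (dmat K h * Y)" "j < dim_col (dmat K h * Y)"
  hence kj: "k < K" "j < n" using c by (auto simp: dmat_def)
  have yk: "y k \<in> Vec n" by (rule P(2)[OF kj(1)])
  have "(Y * g) $$ (k, j) = scalar_prod (Matrix.row Y k) (col g j)"
   by (rule index_mult_mat(1)) (use g c kj in auto)
  also have "\<dots> = scalar_prod (col g j) (y k)"
   unfolding rowY[OF kj(1)] by (rule comm_scalar_prod[OF yk]) (use g kj in auto)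
  also have "\<dots> = (g\<^sup>T *\<^sub>v y k) $ j" using g kj by simp
  also have "\<dots> = h k * y k $ j" unfolding P(5)[OF kj(1)] using kj by (simp add: P(8)[OF kj(1)])
  also have "\<dots> = h k * Y $$ (k, j)" using kj by (simp add: Y_def)
  also have "\<dots> = (dmat K h * Y) $$ (k, j)" by (rule dmat_mult[OF c(2) kj, symmetric])
  finally show "(Y * g) $$ (k, j) = (dmat K h * Y) $$ (k, j)" .
 qed (use g c in "auto simp: dmat_def")
 let ?e = "V * Y"
 have ec: "?e \<in> Mat n" using c by simp
 have Ye: "Y * ?e = Y"
 proof -
  have "Y * ?e = Y * V * Y" by (rule assoc_mult_mat[OF c(2,1,2), symmetric])
  thus ?thesis using c by (simp add: YV)
 qed
 have ee: "?e * ?e = ?e"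
 proof -
  have "?e * ?e = V * (Y * ?e)" by (rule assoc_mult_mat[OF c ec])
  thus ?thesis by (simp only: Ye)
 qed
 have eg: "?e * g = g * ?e"
 proof -
  have "?e * g = V * (Y * g)" by (rule assoc_mult_mat[OF c g(1)])
  also have "\<dots> = V * dmat K h * Y" unfolding Yg by (rule assoc_mult_mat[OF c(1) dmat_carrier c(2), symmetric])
  also have "\<dots> = g * ?e" unfolding gV[symmetric] by (rule assoc_mult_mat[OF g(1) c])
  finally show ?thesis .
 qed
 \<comment> \<open>Otherwise \<open>g\<close> has an eigenvector in the kernel of
   \<open>V Y\<close>. It is annihilated by every chosen left eigenvector, including the one for its
   own eigenvalue, which contradicts \<open>left_right_eigenvectors\<close>.\<close>
 have e1: "?e = Id n"
 proof (rule ccontr)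
  assume "?e \<noteq> Id n"
  from eigenvector_in_kernel[OF g(1) ec ee eg this] obtain x l where
   x: "x \<in> Vec n" "x \<noteq> 0\<^sub>v n" "?e *\<^sub>v x = 0\<^sub>v n" "g *\<^sub>v x = l \<cdot>\<^sub>v x" by blast
  have "l \<in> \<Lambda>" unfolding \<Lambda>_def eigenvalue_def eigenvector_def using x g(1) by auto
  then obtain k where k: "k < K" "l = h k" using h unfolding bij_betw_def K_def by (metis imageE atLeastLessThan_iff)
  have y0: "y k \<noteq> 0\<^sub>v n" using P(6)[OF k(1)] P(1)[OF k(1)] by auto
  have "scalar_prod (y k) x \<noteq> 0"
   by (rule left_right_eigenvectors[OF x(1,2,4) P(2)[OF k(1)] y0]) (simp add: P(5)[OF k(1)] k(2))
  moreover have "Y *\<^sub>v x = 0\<^sub>v K"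
  proof -
   have "Y *\<^sub>v x = (Y * ?e) *\<^sub>v x" by (simp only: Ye)
   also have "\<dots> = Y *\<^sub>v (?e *\<^sub>v x)" by (rule assoc_mult_mat_vec[OF c(2) ec x(1)])
   also have "\<dots> = 0\<^sub>v K" unfolding x(3) using c by (auto intro!: eq_vecI simp: scalar_prod_def)
   finally show ?thesis .
  qed
  hence "(Y *\<^sub>v x) $ k = 0" using k by simp
  hence "scalar_prod (y k) x = 0" using c k rowY[OF k(1)] by simp
  ultimately show False by simp
 qed
 have K: "n = K" by (rule inverse_rect_square[OF c e1 YV])
 show ?thesis
 proof (rule that[of V Y h])
  show "V \<in> Mat n" "Y \<in> Mat n" using c K by auto
  show "V * Y = Id n" by (rule e1)
  show "g * V = V * dmat n h" using gV K by simp
  show "inj_on h {..<n}" using bij_betw_imp_inj_on[OF h] K by (simp add: K_def lessThan_atLeast0)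
  show "\<forall>i<n. h i * h i \<noteq> 1"
  proof (intro allI impI)
   fix i assume "i < n"
   hence "i < K" using K by simp
   show "h i * h i \<noteq> 1" by (rule eigenvalue_square[OF P(1)[OF \<open>i < K\<close>] P(4)[OF \<open>i < K\<close>] P(3)[OF \<open>i < K\<close>]])
  qed
 qed
qed

section \<open>Discriminants in terms of eigenvalues\<close>

lemma conj_dmat:
 assumes V: "V \<in> Mat n" "Vi \<in> Mat n" "V * Vi = Id n"
  and K: "K \<in> Mat n" "K * V = V * dmat n l"
 shows "K = V * dmat n l * Vi" "Vi * K = dmat n l * Vi"
proof -
 have "K * (V * Vi) = V * dmat n l * Vi" unfolding K(2)[symmetric] by (rule sq_assoc[OF K(1) V(1,2), symmetric])
 thus 1: "K = V * dmat n l * Vi" using V(3) K(1) by simp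
 have "Vi * K = Vi * (V * (dmat n l * Vi))" unfolding 1 using sq_assoc[OF V(1) dmat_carrier V(2)] by simp
 thus "Vi * K = dmat n l * Vi" using sq_inv_cancel(2)[OF V sq_closed(3)[OF dmat_carrier V(2)]] by simp
qed

lemma commutator_entry:
 assumes V: "V \<in> Mat n" "Vi \<in> Mat n" "V * Vi = Id n"
  and K: "K \<in> Mat n" "K * V = V * dmat n l" and Z: "Z \<in> Mat n" and ij: "i < n" "j < n"
 shows "(Vi * (K * Z) * V) $$ (i, j) = l i * (Vi * Z * V) $$ (i, j)"
  "(Vi * (Z * K) * V) $$ (i, j) = (Vi * Z * V) $$ (i, j) * l j"
proof -
 have c: "Vi * Z * V \<in> Mat n" using V Z by simp
 have "Vi * (K * Z) * V = (Vi * K) * Z * V" using V K Z by (simp add: sq_assoc[where n=n])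
 also have "\<dots> = dmat n l * (Vi * Z * V)"
  unfolding conj_dmat(2)[OF V K] using V Z by (simp add: sq_assoc[where n=n])
 finally show "(Vi * (K * Z) * V) $$ (i, j) = l i * (Vi * Z * V) $$ (i, j)" by (simp only: dmat_mult[OF c ij])
 have "Vi * (Z * K) * V = Vi * Z * (K * V)" using V K Z by (simp add: sq_assoc[where n=n] sq_closed[where n=n])
 also have "\<dots> = (Vi * Z * V) * dmat n l"
  unfolding K(2) using V Z by (simp add: sq_assoc[where n=n] sq_closed[where n=n])
 finally show "(Vi * (Z * K) * V) $$ (i, j) = (Vi * Z * V) $$ (i, j) * l j" by (simp only: mult_dmat[OF c ij])
qed

lemma conj_zero:
 fixes V Vi Z :: "'b::field mat"
 assumes V: "V \<in> Mat n" "Vi \<in> Mat n" "V * Vi = Id n" and Z: "Z \<in> Mat n"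
  and "\<And>i j. i < n ==> j < n ==> (Vi * Z * V) $$ (i, j) = 0"
 shows "Z = 0\<^sub>m n n"
proof -
 have z: "Vi * Z * V = 0\<^sub>m n n" by (rule sq_eqI) (use V Z assms(5) in auto)
 have "V * (Vi * Z * V) * Vi = V * (Vi * (Z * (V * Vi)))" using V(1,2) Z by (simp add: sq_assoc[where n=n] sq_closed[where n=n])
 also have "\<dots> = Z" using sq_inv_cancel(1)[OF V Z] V(3) Z by simp
 finally show ?thesis unfolding z using V by simp
qed

lemma commuting_diagonal:
 assumes V: "V \<in> Mat n" "Vi \<in> Mat n" "V * Vi = Id n"
  and K: "K \<in> Mat n" "K * V = V * dmat n l" "inj_on l {..<n}"
  and Z: "Z \<in> Mat n" "Z * K = K * Z"
 shows "Vi * Z * V = dmat n (\<lambda>i. (Vi * Z * V) $$ (i, i))"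
proof (rule sq_eqI)
 fix i j assume ij: "i < n" "j < n"
 have "l i * (Vi * Z * V) $$ (i, j) = (Vi * Z * V) $$ (i, j) * l j"
  using commutator_entry[OF V K(1,2) Z(1) ij] by (simp only: Z(2))
 moreover have "l i \<noteq> l j" if "i \<noteq> j" using inj_on_eq_iff[OF K(3), of i j] ij that by simp
 ultimately have "(Vi * Z * V) $$ (i, j) = 0" if "i \<noteq> j" using that by (auto simp: mult.commute)
 thus "(Vi * Z * V) $$ (i, j) = dmat n (\<lambda>i. (Vi * Z * V) $$ (i, i)) $$ (i, j)" using ij by auto
qed (use V Z in auto)

text \<open>In the eigenbasis of \<open>K\<close> a commutator with \<open>K\<close> has zero
  diagonal, and a matrix commuting with \<open>K\<close> is diagonal. This replaces the statement
  that \<open>ad K\<close> is semisimple and makes the kernels modulo the small subspace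
  trivial.\<close>

lemma commutator_semisimple:
 assumes V: "V \<in> Mat n" "Vi \<in> Mat n" "V * Vi = Id n"
  and K: "K \<in> Mat n" "K * V = V * dmat n l" "inj_on l {..<n}"
  and M: "M \<in> Mat n" and Z: "Z = K * M - M * K" "Z * K = K * Z"
 shows "Z = 0\<^sub>m n n"
proof (rule conj_zero[OF V])
 show Zc: "Z \<in> Mat n" using K M by (simp add: Z(1) sq_closed[where n=n])
 fix i j assume ij: "i < n" "j < n"
 show "(Vi * Z * V) $$ (i, j) = 0"
 proof (cases "i = j")
  case True
  have KM: "K * M \<in> Mat n" "M * K \<in> Mat n" using K M by auto
  have "Vi * Z * V = Vi * (K * M) * V - Vi * (M * K) * V"
   unfolding Z(1) using V KM by (simp add: sq_distrib[where n=n] sq_closed[where n=n])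
  hence "(Vi * Z * V) $$ (i, j) = (Vi * (K * M) * V) $$ (i, j) - (Vi * (M * K) * V) $$ (i, j)"
   using sq_index(2)[OF _ _ ij, of "Vi * (K * M) * V" "Vi * (M * K) * V"] V KM by simp
  thus ?thesis unfolding commutator_entry[OF V K(1,2) M ij] using True by simp
 next
  case False
  thus ?thesis by (subst commuting_diagonal[OF V K Zc Z(2)]) (use ij in simp)
 qed
qed

text \<open>Conjugation by \<open>K\<close> scales the entries in the eigenbasis separately, so any
  nonzero entry of \<open>N\<close> exhibits the quotient.\<close>

lemma conj_eigenvalue:
 assumes V: "V \<in> Mat n" "Vi \<in> Mat n" "V * Vi = Id n"
  and K: "K \<in> Mat n" "K * V = V * dmat n l" "\<forall>i<n. l i \<noteq> 0"
  and N: "N \<in> Mat n" "N \<noteq> 0\<^sub>m n n" "K * N = c \<cdot> (N * K)"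
 obtains i j where "i < n" "j < n" "c = l i * inverse (l j)"
proof -
 have "\<exists>i<n. \<exists>j<n. (Vi * N * V) $$ (i, j) \<noteq> 0" using conj_zero[OF V N(1)] N(2) by blast
 then obtain i j where ij: "i < n" "j < n" "(Vi * N * V) $$ (i, j) \<noteq> 0" by blast
 have NK: "N * K \<in> Mat n" using N K by simp
 have "Vi * (K * N) * V = c \<cdot> (Vi * (N * K) * V)"
  unfolding N(3) using V NK by (simp add: sq_distrib[where n=n] sq_closed[where n=n])
 hence "(Vi * (K * N) * V) $$ (i, j) = c * (Vi * (N * K) * V) $$ (i, j)"
  using sq_index(4)[OF _ ij(1,2), of "Vi * (N * K) * V" c] V NK by simp
 hence "l i * (Vi * N * V) $$ (i, j) = c * ((Vi * N * V) $$ (i, j) * l j)"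
  unfolding commutator_entry[OF V K(1,2) N(1) ij(1,2)] .
 hence "l i = c * l j" using ij(3) by (simp add: algebra_simps)
 hence "c = l i * inverse (l j)" using K(3) ij(2) by (simp add: field_simps)
 thus ?thesis using that ij by blast
qed

text \<open>Spanning lists of matrices are indexed by one number below \<open>n * n\<close>, while
  their coefficients naturally carry two indices.\<close>

lemma sum_div_mod:
 fixes g :: "nat => nat => 'b::comm_monoid_add"
 shows "(\<Sum>k<n * n. g (k div n) (k mod n)) = (\<Sum>a<n. \<Sum>b<n. g a b)"
proof (cases "n = 0")
 case False
 have "(\<Sum>k<n * n. g (k div n) (k mod n)) = (\<Sum>(a, b)\<in>{..<n} \<times> {..<n}. g a b)"
 proof (rule sum.reindex_bij_witness[of _ "\<lambda>(a, b). a * n + b" "\<lambda>k. (k div n, k mod n)"])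
  show "(case p of (a, b) => a * n + b) \<in> {..<n * n}" if p: "p \<in> {..<n} \<times> {..<n}" for p
  proof -
   obtain a b where ab: "p = (a, b)" "a < n" "b < n" using p by auto
   have "a * n + b < a * n + n" using ab by simp
   also have "\<dots> = Suc a * n" by simp
   also have "\<dots> \<le> n * n" using ab by (intro mult_le_mono) auto
   finally show ?thesis using ab by simp
  qed
 qed (use False in "auto simp: less_mult_imp_div_less")
 thus ?thesis by (simp add: sum.cartesian_product)
qed simp

lemma div_mod_less: "k < n * n ==> k div n < n \<and> k mod n < n" for k n :: nat
 by (cases "n = 0") (auto simp: less_mult_imp_div_less)

lemma span_lc:
 assumes "N \<in> Mat n" "\<And>a b. a < n ==> b < n ==> G a b \<in> Mat n"
  and "\<And>i j. i < n ==> j < n ==> N $$ (i, j) = (\<Sum>a<n. \<Sum>b<n. x a b * to_ac (G a b $$ (i, j)))"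
 shows "N = lc n (map (acm) (map (\<lambda>k. G (k div n) (k mod n)) [0..<n * n])) (\<lambda>k. x (k div n) (k mod n))"
proof (rule sq_eqI[OF assms(1) lc_carrier])
  fix i j assume ij: "i < n" "j < n"
  have "(\<Sum>k<n * n. x (k div n) (k mod n) * to_ac (G (k div n) (k mod n) $$ (i, j))) = N $$ (i, j)"
   unfolding sum_div_mod[of "\<lambda>a b. x a b * to_ac (G a b $$ (i, j))"] by (rule assms(3)[OF ij, symmetric])
  moreover have "acm (G (k div n) (k mod n)) $$ (i, j) = to_ac (G (k div n) (k mod n) $$ (i, j))" if "k < n * n" for k
   using assms(2)[of "k div n" "k mod n"] div_mod_less[OF that] ij by auto
  ultimately show "N $$ (i, j) = lc n (map (acm) (map (\<lambda>k. G (k div n) (k mod n)) [0..<n * n]))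
    (\<lambda>k. x (k div n) (k mod n)) $$ (i, j)" using ij by (simp add: lc_index)
qed

context padic_field
begin

lemma abd_prod_mset: "(\<forall>x. x \<in># M --> abd c x) ==> abd (c ^ size M) (prod_mset M)"
proof (induction M)
 case (add x M)
 thus ?case using abd_mult[of c x "c ^ size M" "prod_mset M"] by auto
qed (simp add: abd_def integral_elt_1)

lemma abd_power_mono: "abd (c ^ k) x ==> 1 \<le> absv c ==> k \<le> k' ==> abd (c ^ k') x"
 by (rule abd_mono) (auto simp: absv_power intro: power_increasing)

text \<open>Each factor \<open>\<mu> i\<close> divides the product of all eigenvalues with integral quotient.\<close>

lemma discriminant_bound:
 assumes \<mu>s: "to_ac D = prod_mset \<mu>s" "size \<mu>s \<le> N" "\<forall>x. x \<in># \<mu>s --> x \<noteq> 0 \<and> abd c x"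
  and \<mu>: "\<And>i. i < n ==> \<mu> i \<in># \<mu>s" and e: "(\<Prod>i<n. \<mu> i) = to_ac a * e" "abd (c ^ n) e"
  and c: "1 \<le> absv c" and a: "a \<noteq> 0"
 shows "D \<noteq> 0" "absv D ^ n \<le> absv c ^ (N * n + n) * absv a"
proof -
 have "0 \<notin># \<mu>s" using \<mu>s(3) by blast
 hence "prod_mset \<mu>s \<noteq> 0" by (simp add: prod_mset_zero_iff)
 thus "D \<noteq> 0" using \<mu>s(1) by auto
 have c0: "c \<noteq> 0" using c by auto
 have rest: "\<exists>r. to_ac D = \<mu> i * r \<and> abd (c ^ N) r" if i: "i < n" for i
 proof -
  obtain M where M: "\<mu>s = add_mset (\<mu> i) M" using multi_member_split[OF \<mu>[OF i]] by blast
  have "abd (c ^ size M) (prod_mset M)" by (rule abd_prod_mset) (use \<mu>s(3) M in auto)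
  hence "abd (c ^ N) (prod_mset M)" by (rule abd_power_mono[OF _ c]) (use \<mu>s(2) M in auto)
  thus ?thesis using \<mu>s(1) M by auto
 qed
 then obtain r where r: "\<And>i. i < n ==> to_ac D = \<mu> i * r i" "\<And>i. i < n ==> abd (c ^ N) (r i)" by metis
 have "abd ((c ^ N) ^ card {..<n}) (\<Prod>i<n. r i)" by (rule abd_prod) (use r in auto)
 hence "abd (c ^ (N * n)) (\<Prod>i<n. r i)" by (simp add: power_mult)
 from abd_mult[OF this e(2)] have E: "abd (c ^ (N * n + n)) ((\<Prod>i<n. r i) * e)" by (simp add: power_add)
 have "to_ac D ^ n = (\<Prod>i<n. to_ac D)" by simp
 also have "\<dots> = (\<Prod>i<n. \<mu> i * r i)" by (rule prod.cong) (use r in auto)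
 also have "\<dots> = to_ac a * ((\<Prod>i<n. r i) * e)" by (simp add: prod.distrib e(1))
 finally have "to_ac (D ^ n / a) = (\<Prod>i<n. r i) * e" using a by (simp add: field_simps)
 with E have "abd (c ^ (N * n + n)) (to_ac (D ^ n / a))" by simp
 hence "absv (D ^ n / a) \<le> absv (c ^ (N * n + n))" by (rule abd_to_acD) (use c0 in simp)
 thus "absv D ^ n \<le> absv c ^ (N * n + n) * absv a"
  using absv_pos[OF a] by (simp add: absv_divide absv_power field_simps)
qed

end

text \<open>The form and the regular element live over \<open>F\<close>; only the eigenbasis
  \<open>V\<close> and the eigenvalues \<open>l\<close> live over the closure. Everything about a
  single torus is proved from this data.\<close>

locale spectral = padic_field absv for absv :: "'a::field_char_0 => real" +
 fixes n :: nat and J Ji \<gamma> \<gamma>i :: "'a mat" and s :: 'a and V Vi :: "'a alg_closure mat" and l :: "nat => 'a alg_closure"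
 assumes n0: "n > 0"
  and J: "J \<in> Mat n" "Ji \<in> Mat n" "J * Ji = Id n" "J\<^sup>T = s \<cdot> J"
  and s: "s = 1 \<or> s = - 1"
  and \<gamma>: "\<gamma> \<in> Mat n" "\<gamma>i \<in> Mat n" "\<gamma> * \<gamma>i = Id n" "\<gamma> * J * \<gamma>\<^sup>T = J"
  and V: "V \<in> Mat n" "Vi \<in> Mat n" "V * Vi = Id n"
  and l: "acm \<gamma> * V = V * dmat n l" "inj_on l {..<n}" "\<forall>i<n. l i * l i \<noteq> 1"
begin

lemmas cl = sq_closed[where n=n]
lemmas as = sq_assoc[where n=n]
lemmas ds = sq_distrib[where n=n]
lemmas ix = sq_index[where n=n]
lemmas sqI = sq_eqI[where n=n]
lemmas tp = sq_transpose[where n=n]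
lemmas vs = sq_vec[where n=n]

abbreviation "ac \<equiv> map_mat to_ac :: 'a mat => 'a alg_closure mat"

lemma ss: "s * s = 1" using s by auto

lemma inverses: "Ji * J = Id n" "\<gamma>i * \<gamma> = Id n" "Vi * V = Id n" "det J \<noteq> 0" "det Ji \<noteq> 0" "det \<gamma> \<noteq> 0" "det V \<noteq> 0" "det Vi \<noteq> 0"
 using mat_mult_left_right_inverse[OF J(1,2,3)] mat_mult_left_right_inverse[OF \<gamma>(1,2,3)] mat_mult_left_right_inverse[OF V]
  GL_inv_eqI(2,3)[OF J(1,2,3)] GL_inv_eqI(2,3)[OF \<gamma>(1,2,3)] GL_inv_eqI(2,3)[OF V] by auto

lemma l_nonzero: "i < n ==> l i \<noteq> 0"
proof
 assume i: "i < n" "l i = 0"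
 have "det (ac \<gamma>) * det V = det V * (\<Prod>i<n. l i)"
  using arg_cong[OF l(1), of det] det_mult[of "ac \<gamma>" n V] det_mult[of V n "dmat n l"] \<gamma> V by (simp add: det_dmat)
 moreover have "(\<Prod>i<n. l i) = 0" using i by auto
 ultimately show False using inverses by simp
qed

lemma l_ne_1: "i < n ==> l i \<noteq> 1" "i < n ==> l i \<noteq> - 1" using l(3) by auto

lemma det_conj:
 assumes "K \<in> Mat n" "K * V = V * dmat n k"
 shows "det K = (\<Prod>i<n. k i)"
proof -
 have "det K * det V = det (K * V)" by (rule det_mult[OF assms(1) V(1), symmetric])
 also have "\<dots> = det V * det (dmat n k)" unfolding assms(2) by (rule det_mult[OF V(1) dmat_carrier])
 finally have "det K * det V = (\<Prod>i<n. k i) * det V" by (simp only: det_dmat mult.commute)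
 thus ?thesis using mult_right_cancel[OF inverses(7)] by blast
qed

lemma det_minus_one: "to_ac (det (\<gamma> - Id n)) = (\<Prod>i<n. l i - 1)" "det (\<gamma> - Id n) \<noteq> 0"
proof -
 have c: "ac (\<gamma> - Id n) \<in> Mat n" "ac \<gamma> \<in> Mat n" using \<gamma> by auto
 have "ac (\<gamma> - Id n) = ac \<gamma> - Id n" using \<gamma> by (intro eq_matI) auto
 hence "ac (\<gamma> - Id n) * V = ac \<gamma> * V - V" using V c by (simp add: ds)
 also have "\<dots> = V * dmat n (\<lambda>i. l i - 1)" unfolding l(1) using V by (intro sqI)
   (auto simp: ix cl mult_dmat[OF V(1)] algebra_simps simp del: index_mult_mat(1) intro!: sq_closed)
 finally have "det (ac (\<gamma> - Id n)) = (\<Prod>i<n. l i - 1)" by (rule det_conj[OF c(1)])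
 thus 1: "to_ac (det (\<gamma> - Id n)) = (\<Prod>i<n. l i - 1)" by simp
 have "(\<Prod>i<n. l i - 1) \<noteq> 0" using l_ne_1 by auto
 thus "det (\<gamma> - Id n) \<noteq> 0" using 1 by auto
qed

lemma eigenvector_col: "i < n ==> K \<in> Mat n ==> K * V = V * dmat n k ==> K *\<^sub>v col V i = k i \<cdot>\<^sub>v col V i"
proof -
 assume i: "i < n" and K: "K \<in> Mat n" "K * V = V * dmat n k"
 have "K *\<^sub>v col V i = col (K * V) i" using K(1) V(1) i by (intro eq_vecI) auto
 also have "\<dots> = k i \<cdot>\<^sub>v col V i" unfolding K(2)
 proof (rule eq_vecI)
  have c: "V * dmat n k \<in> Mat n" by (rule sq_closed(3)[OF V(1) dmat_carrier])
  fix j assume "j < dim_vec (k i \<cdot>\<^sub>v col V i)"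
  hence j: "j < n" using V(1) by simp
  have "col (V * dmat n k) i $ j = (V * dmat n k) $$ (j, i)" by (rule index_col) (use c i j in auto)
  thus "col (V * dmat n k) i $ j = (k i \<cdot>\<^sub>v col V i) $ j" unfolding mult_dmat[OF V(1) j i] using V(1) i j by simp
 qed (use V(1) in simp)
 finally show ?thesis .
qed

lemma col_V_nonzero: "i < n ==> col V i \<noteq> 0\<^sub>v n"
proof
 assume i: "i < n" and z: "col V i = 0\<^sub>v n"
 have "V *\<^sub>v unit_vec n i = 0\<^sub>v n" using z V(1) i by (intro eq_vecI) (auto simp: col_def vec_eq_iff)
 thus False using det_nonzero_iff_inj[OF V(1)] inverses(7) unit_vec_carrier[of n i] i
  by (metis index_unit_vec(1) index_zero_vec(1) zero_neq_one)
qed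

text \<open>Conjugation by \<open>h\<close> moves the eigenvectors but not the eigenvalues.
  Compactness is known for the conjugate only, while the eigenvalues wanted are those of
  \<open>K\<close>.\<close>

lemma eigenvalue_abd:
 assumes c: "c \<noteq> 0" and h: "h \<in> Mat n" "hi \<in> Mat n" "h * hi = Id n"
  and K: "K \<in> Mat n" "ac K * V = V * dmat n k" "mbd n (absv c) (hi * K * h)" and i: "i < n"
 shows "abd c (k i)"
proof (rule abd_eigenvalue[OF K(3) c])
 let ?v = "ac hi *\<^sub>v col V i"
 have cc: "ac K \<in> Mat n" "ac h \<in> Mat n" "ac hi \<in> Mat n" using h K by auto
 have v: "col V i \<in> Vec n" using V by auto
 show "?v \<in> Vec n" using cc v by simp
 have hhi: "ac h * ac hi = Id n" using map_ac_mult[OF h(1,2)] h(3) by simp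
 have hv: "ac h *\<^sub>v ?v = col V i" using sq_vec(1)[OF cc(2,3) v] hhi v by simp
 show "?v \<noteq> 0\<^sub>v n"
 proof
  assume "?v = 0\<^sub>v n"
  hence "col V i = ac h *\<^sub>v 0\<^sub>v n" using hv by simp
  also have "\<dots> = 0\<^sub>v n" using cc by (auto intro!: eq_vecI simp: scalar_prod_def)
  finally show False using col_V_nonzero[OF i] by simp
 qed
 have "ac (hi * K * h) = ac hi * ac K * ac h" using map_ac_mult h K by (simp add: map_ac_mult[of _ n])
 hence "ac (hi * K * h) *\<^sub>v ?v = ac hi *\<^sub>v (ac K *\<^sub>v (ac h *\<^sub>v ?v))" using cc v by (simp add: vs cl)
 also have "\<dots> = ac hi *\<^sub>v (k i \<cdot>\<^sub>v col V i)" unfolding hv eigenvector_col[OF i cc(1) K(2)] ..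
 also have "\<dots> = k i \<cdot>\<^sub>v ?v" by (rule sq_vec(2)[OF cc(3) v])
 finally show "ac (hi * K * h) *\<^sub>v ?v = k i \<cdot>\<^sub>v ?v" .
qed

lemma gamma_inverse: "ac \<gamma>i * V = V * dmat n (\<lambda>i. inverse (l i))"
proof -
 have c: "ac \<gamma>i \<in> Mat n" "ac \<gamma> \<in> Mat n" using \<gamma> by auto
 have gg: "ac \<gamma>i * ac \<gamma> = Id n" using map_ac_mult[OF \<gamma>(2,1)] inverses(2) by simp
 have dd: "dmat n l * dmat n (\<lambda>i. inverse (l i)) = Id n" unfolding dmat_dmat using l_nonzero by (intro sqI) auto
 have "ac \<gamma>i * (ac \<gamma> * V) * dmat n (\<lambda>i. inverse (l i)) = ac \<gamma>i * V * (dmat n l * dmat n (\<lambda>i. inverse (l i)))"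
  unfolding l(1) using c V by (simp add: as cl)
 moreover have "ac \<gamma>i * (ac \<gamma> * V) = V" by (rule sq_inv_cancel(1)[OF c gg V(1)])
 ultimately show ?thesis using c V by (simp add: dd)
qed

end

text \<open>The square of \<open>M \<mapsto> B M^T B^(-1)\<close> is conjugation by the asymmetry
  \<open>K = B B^(-T)\<close> of the bilinear form \<open>B\<close>; the formula is written without
  an inverse of \<open>K\<close>.\<close>

lemma theta_theta:
 fixes B Bi K M :: "'b::field mat"
 assumes c: "B \<in> Mat n" "Bi \<in> Mat n" "K \<in> Mat n" "M \<in> Mat n"
  and B: "B * Bi = Id n" and K: "K * B\<^sup>T = B"
 shows "(B * (B * M\<^sup>T * Bi)\<^sup>T * Bi) * K = K * M"
proof -
 note as = sq_assoc[where n=n] and cl = sq_closed[where n=n]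
 let ?Bt = "B\<^sup>T" and ?Bit = "Bi\<^sup>T"
 have t: "?Bt \<in> Mat n" "?Bit \<in> Mat n" using c by auto
 have BiB: "Bi * B = Id n" by (rule mat_mult_left_right_inverse[OF c(1,2) B])
 have tt: "?Bt * ?Bit = Id n" using sq_transpose(3)[OF c(2,1)] BiB by simp
 have KB: "K = B * ?Bit"
 proof -
  have "B * ?Bit = K * (?Bt * ?Bit)" by (subst K[symmetric]) (rule as[OF c(3) t])
  thus ?thesis using c by (simp add: tt)
 qed
 have "K * (?Bt * Bi) = Id n" using as[OF c(3) t(1) c(2)] K B by simp
 hence inv: "(?Bt * Bi) * K = Id n" by (rule mat_mult_left_right_inverse[OF c(3) sq_closed(3)[OF t(1) c(2)]])
 have "(B * M\<^sup>T * Bi)\<^sup>T = ?Bit * (M * ?Bt)" using c by (simp add: sq_transpose[where n=n] cl)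
 hence "(B * (B * M\<^sup>T * Bi)\<^sup>T * Bi) * K = B * (?Bit * (M * ?Bt)) * Bi * K" by simp
 also have "\<dots> = (B * ?Bit) * M * ((?Bt * Bi) * K)" using c t by (simp add: as cl)
 also have "\<dots> = K * M" unfolding inv KB[symmetric] using c by simp
 finally show ?thesis .
qed

context spectral
begin


lemma gt: "\<gamma>\<^sup>T * Ji = Ji * \<gamma>i" "\<gamma>i * J = J * \<gamma>\<^sup>T"
 "Ji * \<gamma> * J = \<gamma>i\<^sup>T" "\<gamma>\<^sup>T * \<gamma>i\<^sup>T = Id n"
proof -
 have t: "\<gamma>\<^sup>T \<in> Mat n" "\<gamma>i\<^sup>T \<in> Mat n" using \<gamma> by auto
 have gi: "\<gamma>i * (\<gamma> * Z) = Z" if "Z \<in> Mat n" for Z by (rule sq_inv_cancel(1)[OF \<gamma>(2,1) inverses(2) that])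
 have "\<gamma>i * J = \<gamma>i * (\<gamma> * (J * \<gamma>\<^sup>T))" by (subst \<gamma>(4)[symmetric], subst as) (use J \<gamma> t in "auto intro!: cl")
 thus 1: "\<gamma>i * J = J * \<gamma>\<^sup>T" using gi[of "J * \<gamma>\<^sup>T"] J t by simp
 have "Ji * (\<gamma>i * J) * Ji = \<gamma>\<^sup>T * Ji" unfolding 1 using sq_inv_cancel(2)[OF J(1,2,3) t(1)] by simp
 moreover have "Ji * (\<gamma>i * J) * Ji = Ji * \<gamma>i" using J \<gamma> by (simp add: as cl)
 ultimately show 2: "\<gamma>\<^sup>T * Ji = Ji * \<gamma>i" by simp
 show 3: "\<gamma>\<^sup>T * \<gamma>i\<^sup>T = Id n" using sq_transpose(3)[OF \<gamma>(2,1)] inverses(2) by simp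
 have "\<gamma>\<^sup>T * (Ji * \<gamma> * J) = \<gamma>\<^sup>T * Ji * \<gamma> * J" using J \<gamma> t by (simp add: as cl)
 also have "\<dots> = Id n" unfolding 2 using J \<gamma> inverses(1,2) sq_inv_cancel(1)[OF \<gamma>(2,1) inverses(2) J(1)] by (simp add: as cl)
 also have "\<dots> = \<gamma>\<^sup>T * \<gamma>i\<^sup>T" by (simp only: 3)
 finally show "Ji * \<gamma> * J = \<gamma>i\<^sup>T"
  by (rule mat_cancel_left[rotated 4]) (use J \<gamma> t inverses(6) in "auto simp: det_transpose[OF \<gamma>(1)] intro!: cl")
qed

lemma ac_mult: "A \<in> Mat n ==> B \<in> Mat n ==> ac (A * B) = ac A * ac B" by (rule map_ac_mult)

lemma ac_diff: "A \<in> Mat n ==> B \<in> Mat n ==> ac (A - B) = ac A - ac B" by (intro eq_matI) auto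

lemma ac_uminus: "ac (- A) = - ac A" by (intro eq_matI) auto

lemma ac_carrier: "A \<in> Mat n ==> ac A \<in> Mat n" by simp

text \<open>The eigenvalues of conjugation are products of an eigenvalue and an inverse one, each
  bounded by \<open>c\<close>; passing to \<open>c * c\<close> gives one scale for all
  terms.\<close>

lemma abd_square:
 assumes c: "1 \<le> absv c"
 shows "1 \<le> absv (c * c)" "abd c 1" "abd c x ==> abd (c * c) x"
proof -
 have c0: "c \<noteq> 0" using c by auto
 show "1 \<le> absv (c * c)" using c by (simp add: absv_mult mult_ge1_I)
 show "abd c 1" using abd_to_ac[of 1 c] c c0 by simp
 have le: "absv c \<le> absv (c * c)" using c mult_left_mono[of 1 "absv c" "absv c"] by (simp add: absv_mult)
 show "abd (c * c) x" if "abd c x" by (rule abd_mono[OF that le]) (use c0 in auto)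
qed

text \<open>For an eigenvector \<open>v\<close> the matrix \<open>v v^T Ji\<close> lies in the Lie
  algebra over the closure and has eigenvalue \<open>l i * l i - 1\<close> under
  \<open>Ad \<gamma> - 1\<close>. The product of these numbers is \<open>det (\<gamma> - 1)\<close>
  times the integral product of the \<open>l i + 1\<close>, which is what
  \<open>discriminant_bound\<close> asks for.\<close>

lemma discriminant_symplectic:
 assumes s1: "s = - 1" and c: "1 \<le> absv c" and lc: "\<And>i. i < n ==> abd c (l i)" "\<And>i. i < n ==> abd c (inverse (l i))"
 defines "D \<equiv> quotient_det n (\<lambda>M. \<gamma> * M * \<gamma>i - M) {A \<in> Mat n. A * J = - (J * A\<^sup>T)}
   {A \<in> Mat n. A * J = - (J * A\<^sup>T) \<and> A * \<gamma> = \<gamma> * A}"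
 shows "D \<noteq> 0" "absv D ^ n \<le> absv (c * c) ^ (n * n * n + n) * absv (det (\<gamma> - Id n))"
proof -
 define h where "h = {A \<in> Mat n. A * J = - (J * A\<^sup>T)}"
 define W where "W = {A \<in> Mat n. A * J = - (J * A\<^sup>T) \<and> A * \<gamma> = \<gamma> * A}"
 define f where "f M = \<gamma> * M * \<gamma>i - M" for M
 define fb where "fb N = ac \<gamma> * N * ac \<gamma>i - N" for N
 have c0: "c \<noteq> 0" using c by auto
 have aC: "ac \<gamma> \<in> Mat n" "ac \<gamma>i \<in> Mat n" "ac J \<in> Mat n" "ac Ji \<in> Mat n" using \<gamma> J by auto
 have ag: "ac \<gamma> * ac \<gamma>i = Id n" "ac \<gamma>i * ac \<gamma> = Id n"
  using ac_mult[OF \<gamma>(1,2)] ac_mult[OF \<gamma>(2,1)] \<gamma>(3) inverses(2) by auto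
 have neg_add: "A + B = - (E + F)" if "A = - E" "B = - F" "E \<in> Mat n" "F \<in> Mat n" for A B E F :: "'a mat"
  using that by (auto intro!: sqI)
 have neg_smult: "k \<cdot> (- A) = - (k \<cdot> A)" if "A \<in> Mat n" for k and A :: "'a mat" using that by (auto intro!: sqI)
 have hsub: "msub n h" unfolding msub_def h_def
 proof (intro conjI ballI allI CollectI; (elim CollectE conjE)?)
  show "0\<^sub>m n n * J = - (J * (0\<^sub>m n n)\<^sup>T)" using J by (auto intro!: eq_matI)
  fix A B assume A: "A \<in> Mat n" "A * J = - (J * A\<^sup>T)" and B: "B \<in> Mat n" "B * J = - (J * B\<^sup>T)"
  have "(A + B) * J = A * J + B * J" by (rule ds(1)[OF A(1) B(1) J(1)])
  also have "\<dots> = - (J * A\<^sup>T + J * B\<^sup>T)" by (rule neg_add[OF A(2) B(2)]) (use A B J in auto)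
  also have "J * A\<^sup>T + J * B\<^sup>T = J * (A + B)\<^sup>T" using A B J by (simp add: tp ds cl)
  finally show "(A + B) * J = - (J * (A + B)\<^sup>T)" .
 next
  fix k A assume A: "A \<in> Mat n" "A * J = - (J * A\<^sup>T)"
  have "(k \<cdot> A) * J = k \<cdot> (- (J * A\<^sup>T))" using ds(5)[OF A(1) J(1)] A(2) by simp
  also have "\<dots> = - (k \<cdot> (J * A\<^sup>T))" by (rule neg_smult) (use A J in auto)
  also have "k \<cdot> (J * A\<^sup>T) = J * (k \<cdot> A)\<^sup>T" using A J by (simp add: tp ds cl)
  finally show "(k \<cdot> A) * J = - (J * (k \<cdot> A)\<^sup>T)" .
 qed (use J in auto)
 have Wsub: "msub n W"
 proof -
  have "W = {A \<in> h. A * \<gamma> = \<gamma> * A}" by (auto simp: W_def h_def)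
  thus ?thesis unfolding msub_def
   using msubD[OF hsub] \<gamma>(1) by (auto simp: ds(1)[OF _ _ \<gamma>(1)] ds(3)[OF _ _ \<gamma>(1)] ds(5)[OF _ \<gamma>(1)] ds(6)[OF \<gamma>(1)])
 qed
 have Wh: "W \<subseteq> h" by (auto simp: W_def h_def)
 have hC: "A \<in> Mat n" if "A \<in> h" for A using that by (simp add: h_def)
 have flin: "mlinear n h f" unfolding mlinear_def
 proof (intro conjI ballI allI)
  fix A assume A: "A \<in> h"
  show "f A \<in> Mat n" using hC[OF A] \<gamma> by (auto simp: f_def intro!: cl)
  show "f (k \<cdot> A) = k \<cdot> f A" for k
   unfolding f_def using hC[OF A] \<gamma> by (simp add: ds cl) (auto intro!: sqI cl simp: ix cl algebra_simps simp del: index_mult_mat(1))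
  fix B assume B: "B \<in> h"
  show "f (A + B) = f A + f B"
   unfolding f_def using hC[OF A] hC[OF B] \<gamma> by (simp add: ds cl) (auto intro!: sqI cl simp: ix cl algebra_simps simp del: index_mult_mat(1))
 qed
 have fh: "f A \<in> h" if A: "A \<in> h" for A
 proof -
  have Ac: "A \<in> Mat n" "A * J = - (J * A\<^sup>T)" using A by (auto simp: h_def)
  have "\<gamma> * A * \<gamma>i \<in> h" unfolding h_def
  proof (intro CollectI conjI)
   show "\<gamma> * A * \<gamma>i \<in> Mat n" using Ac \<gamma> by (intro cl)
   have t: "\<gamma>\<^sup>T \<in> Mat n" "\<gamma>i\<^sup>T \<in> Mat n" "A\<^sup>T \<in> Mat n" using \<gamma> Ac by auto
   have Jg: "J * \<gamma>i\<^sup>T = \<gamma> * J"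
   proof -
    have "J * \<gamma>i\<^sup>T = J * (Ji * (\<gamma> * J))" unfolding gt(3)[symmetric] using J \<gamma> by (simp add: as cl)
    thus ?thesis using sq_inv_cancel(1)[OF J(1,2,3), of "\<gamma> * J"] J \<gamma> by simp
   qed
   have "\<gamma> * A * \<gamma>i * J = \<gamma> * A * (\<gamma>i * J)" by (rule as) (use Ac \<gamma> J in "auto intro!: cl")
   also have "\<dots> = \<gamma> * (A * J) * \<gamma>\<^sup>T" unfolding gt(2) using Ac(1) \<gamma>(1) J(1) t by (simp add: as cl)
   also have "\<dots> = - (\<gamma> * J * A\<^sup>T * \<gamma>\<^sup>T)" unfolding Ac(2) using \<gamma>(1) J(1) t by (simp add: as ds cl)
   also have "\<gamma> * J * A\<^sup>T * \<gamma>\<^sup>T = J * (\<gamma> * A * \<gamma>i)\<^sup>T"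
    unfolding Jg[symmetric] using Ac \<gamma> J t by (simp add: tp as cl)
   finally show "\<gamma> * A * \<gamma>i * J = - (J * (\<gamma> * A * \<gamma>i)\<^sup>T)" .
  qed
  thus ?thesis unfolding f_def by (rule msubD(5)[OF hsub _ A])
 qed
 have f_gamma: "f A * \<gamma> = \<gamma> * A - A * \<gamma>" if A: "A \<in> Mat n" for A
 proof -
  have "f A * \<gamma> = \<gamma> * A * \<gamma>i * \<gamma> - A * \<gamma>" unfolding f_def by (rule ds(2)) (use A \<gamma> in "auto intro!: cl")
  also have "\<gamma> * A * \<gamma>i * \<gamma> = \<gamma> * A * (\<gamma>i * \<gamma>)" by (rule as) (use A \<gamma> in "auto intro!: cl")
  finally show ?thesis unfolding inverses(2) using A \<gamma> by simp
 qed
 have fW: "f A = 0\<^sub>m n n" if "A \<in> W" for A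
 proof -
  have A: "A \<in> Mat n" "A * \<gamma> = \<gamma> * A" using that by (auto simp: W_def)
  have "f A * \<gamma> = 0\<^sub>m n n * \<gamma>" unfolding f_gamma[OF A(1)] A(2) using A \<gamma> by (auto intro!: sqI)
  from mat_cancel_right[OF _ _ \<gamma>(1) inverses(6) this] show ?thesis using A \<gamma> by (auto simp: f_def intro!: cl)
 qed
 \<comment> \<open>The commutator of \<gamma> with \<open>A\<close> is
   \<open>f A * \<gamma>\<close>, which commutes with \<gamma>. Such a commutator vanishes.\<close>
 have ker: "A \<in> W" if A: "A \<in> h" and fA: "f A \<in> W" for A
 proof -
  have Ac: "A \<in> Mat n" using hC[OF A] .
  define Z where "Z = \<gamma> * A - A * \<gamma>"
  have Zc: "Z \<in> Mat n" using Ac \<gamma> by (auto simp: Z_def intro!: cl)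
  have Zf: "Z = f A * \<gamma>" using f_gamma[OF Ac] by (simp add: Z_def)
  have fc: "f A \<in> Mat n" "f A * \<gamma> = \<gamma> * f A" using fA by (auto simp: W_def)
  have Zg: "Z * \<gamma> = \<gamma> * Z"
  proof -
   have "Z * \<gamma> = (\<gamma> * f A) * \<gamma>" by (simp only: Zf fc(2))
   also have "\<dots> = \<gamma> * Z" unfolding Zf by (rule as[OF \<gamma>(1) fc(1) \<gamma>(1)])
   finally show ?thesis .
  qed
  have "ac Z = 0\<^sub>m n n"
  proof (rule commutator_semisimple[OF V aC(1) l(1,2)])
   show "ac A \<in> Mat n" using Ac by simp
   have "ac Z = ac (\<gamma> * A) - ac (A * \<gamma>)" unfolding Z_def by (rule ac_diff) (use Ac \<gamma> in "auto intro!: cl")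
   thus "ac Z = ac \<gamma> * ac A - ac A * ac \<gamma>" by (simp only: ac_mult[OF \<gamma>(1) Ac] ac_mult[OF Ac \<gamma>(1)])
   show "ac Z * ac \<gamma> = ac \<gamma> * ac Z" using Zg ac_mult[OF Zc \<gamma>(1)] ac_mult[OF \<gamma>(1) Zc] by simp
  qed
  moreover have "ac (0\<^sub>m n n) = 0\<^sub>m n n" by (intro eq_matI) auto
  ultimately have "Z = 0\<^sub>m n n" using map_mat_inj by metis
  hence "\<gamma> * A - A * \<gamma> = 0\<^sub>m n n" by (simp add: Z_def)
  hence "(\<gamma> * A) $$ (i, j) - (A * \<gamma>) $$ (i, j) = 0" if "i < n" "j < n" for i j
   using arg_cong[of _ _ "\<lambda>M. M $$ (i, j)", OF \<open>\<gamma> * A - A * \<gamma> = 0\<^sub>m n n\<close>] ix(2)[of "\<gamma> * A" "A * \<gamma>"] Ac \<gamma> that by (simp add: cl del: index_mult_mat(1))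
  hence "A * \<gamma> = \<gamma> * A" by (intro sqI) (use Ac \<gamma> in "auto simp del: index_mult_mat(1) intro!: cl")
  thus ?thesis using A by (simp add: W_def h_def)
 qed
 have fblin: "mlinear n (Mat n) fb" unfolding mlinear_def fb_def
  using aC by (auto simp: ds cl intro!: sqI cl) (auto simp: ix cl algebra_simps simp del: index_mult_mat(1))
 have fbac: "fb (ac A) = ac (f A)" if "A \<in> h" for A
  unfolding fb_def f_def using hC[OF that] \<gamma> by (simp add: ac_diff ac_mult cl)
 obtain \<mu>s where \<mu>s: "to_ac (quotient_det n f h W) = prod_mset \<mu>s" "size \<mu>s \<le> n * n"
  "\<forall>\<mu>. \<mu> \<in># \<mu>s --> \<mu> \<noteq> 0 \<and> (\<exists>N. N \<in> Mat n \<and> N \<noteq> 0\<^sub>m n n \<and> fb N = \<mu> \<cdot> N)"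
  "\<forall>\<mu> vs d. set vs \<subseteq> h --> \<mu> \<noteq> 0 --> lc n (map ac vs) d \<noteq> 0\<^sub>m n n -->
    fb (lc n (map ac vs) d) = \<mu> \<cdot> lc n (map ac vs) d --> \<mu> \<in># \<mu>s"
  by (rule quotient_det_eigenvalues[OF hsub Wsub Wh flin fh fW ker fblin fbac])
 have DD: "D = quotient_det n f h W" unfolding D_def f_def h_def W_def ..
 note cc = abd_square(1)[OF c] and abd1 = abd_square(2)[OF c] and up = abd_square(3)[OF c]
 have m1: "\<forall>x. x \<in># \<mu>s --> x \<noteq> 0 \<and> abd (c * c) x"
 proof (intro allI impI)
  fix x assume x: "x \<in># \<mu>s"
  with \<mu>s(3) obtain N where N: "x \<noteq> 0" "N \<in> Mat n" "N \<noteq> 0\<^sub>m n n" "fb N = x \<cdot> N" by blast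
  have gN: "ac \<gamma> * N = (x + 1) \<cdot> (N * ac \<gamma>)"
  proof -
   have "ac \<gamma> * N * ac \<gamma>i = fb N + N" unfolding fb_def using aC N by (auto intro!: sqI cl simp: ix cl simp del: index_mult_mat(1))
   also have "\<dots> = (x + 1) \<cdot> N" unfolding N(4) using N by (intro sqI) (auto simp: algebra_simps)
   finally have "ac \<gamma> * N * ac \<gamma>i * ac \<gamma> = (x + 1) \<cdot> (N * ac \<gamma>)" using ds(5)[OF N(2) aC(1)] by simp
   moreover have "ac \<gamma> * N * ac \<gamma>i * ac \<gamma> = ac \<gamma> * N * (ac \<gamma>i * ac \<gamma>)" by (rule as) (use aC N in "auto intro!: cl")
   ultimately show ?thesis unfolding ag(2) using aC N by simp
  qed
  have "\<forall>i<n. l i \<noteq> 0" using l_nonzero by blast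
  then obtain i j where ij: "i < n" "j < n" "x + 1 = l i * inverse (l j)"
   by (rule conj_eigenvalue[OF V aC(1) l(1) _ N(2,3) gN])
  have "abd (c * c) (x + 1)" unfolding ij(3) by (rule abd_mult) (use lc ij in auto)
  hence "abd (c * c) ((x + 1) + (- 1))" by (rule abd_add) (rule abd_minus[OF up[OF abd1]])
  thus "x \<noteq> 0 \<and> abd (c * c) x" using N(1) by simp
 qed
 have m2: "l i * l i - 1 \<in># \<mu>s" if i: "i < n" for i
 proof -
  let ?v = "col V i"
  have v: "?v \<in> Vec n" using V by auto
  have gv: "ac \<gamma> *\<^sub>v ?v = l i \<cdot>\<^sub>v ?v" by (rule eigenvector_col[OF i aC(1) l(1)])
  let ?N = "outer ?v ?v * ac Ji"
  have oc: "outer ?v ?v \<in> Mat n" using v by simp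
  have Nc: "?N \<in> Mat n" using oc aC by simp
  \<comment> \<open>\<open>G a b\<close> is \<open>(E_ab + E_ba) Ji\<close>, an element of the Lie
    algebra over \<open>F\<close>. The eigenmatrix is a combination of these with coefficients
    \<open>v_a v_b / 2\<close>, the half because the sum runs over ordered pairs.\<close>
  define G where "G a b = mat n n (\<lambda>(i, j). (if i = a then Ji $$ (b, j) else 0) + (if i = b then Ji $$ (a, j) else 0))" for a b
  have Gh: "G a b \<in> h" if ab: "a < n" "b < n" for a b
  proof -
   have Gc: "G a b \<in> Mat n" by (simp add: G_def)
   let ?E = "mat n n (\<lambda>(i, j). (if i = a then if j = b then 1 else 0 else 0) + (if i = b then if j = a then 1 else 0 else 0)) :: 'a mat"
   have GE: "G a b = ?E * Ji"
   proof (rule sq_eqI[OF Gc])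
    fix i j assume ij: "i < n" "j < n"
    have "(?E * Ji) $$ (i, j) = (\<Sum>k<n. ((if i = a then if k = b then 1 else 0 else 0) + (if i = b then if k = a then 1 else 0 else 0)) * Ji $$ (k, j))"
     using sq_mult_index[of ?E n Ji i j] J ij by simp
    also have "\<dots> = (\<Sum>k<n. (if k = b then (if i = a then Ji $$ (k, j) else 0) else 0) + (if k = a then (if i = b then Ji $$ (k, j) else 0) else 0))"
     by (intro sum.cong) auto
    also have "\<dots> = G a b $$ (i, j)" using ab ij by (simp add: G_def sum.distrib)
    finally show "G a b $$ (i, j) = (?E * Ji) $$ (i, j)" by simp
   qed (use J in "auto intro!: cl")
   have Ec: "?E \<in> Mat n" by simp
   have Et: "?E\<^sup>T = ?E" by (intro eq_matI) auto
   have 1: "G a b * J = ?E" unfolding GE using as[OF Ec J(2,1)] inverses(1) by simp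
   have "J * (G a b)\<^sup>T = (G a b * J\<^sup>T)\<^sup>T" using sq_transpose(3)[OF Gc, of "J\<^sup>T"] J(1) by simp
   also have "G a b * J\<^sup>T = (- 1) \<cdot> ?E" unfolding J(4) s1 using ds(6)[OF Gc J(1)] 1 by simp
   also have "((- 1) \<cdot> ?E)\<^sup>T = (- 1) \<cdot> ?E" using sq_transpose(4)[OF Ec] Et by simp
   finally have "J * (G a b)\<^sup>T = (- 1) \<cdot> ?E" .
   moreover have "?E = - ((- 1) \<cdot> ?E)" by (intro eq_matI) auto
   ultimately have "G a b * J = - (J * (G a b)\<^sup>T)" using 1 by simp
   thus ?thesis using Gc by (simp add: h_def)
  qed
  have ent: "?N $$ (p, r) = (\<Sum>a<n. \<Sum>b<n. (?v $ a * ?v $ b / 2) * to_ac (G a b $$ (p, r)))" if pr: "p < n" "r < n" for p r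
  proof -
   define S where "S = (\<Sum>b<n. ?v $ p * ?v $ b * to_ac (Ji $$ (b, r)))"
   have 1: "?N $$ (p, r) = S" using sq_mult_index[OF oc aC(4) pr] pr v J V(1) by (simp add: S_def)
   have 2: "(\<Sum>a<n. \<Sum>b<n. (?v $ a * ?v $ b / 2) * to_ac (G a b $$ (p, r))) =
    (\<Sum>a<n. \<Sum>b<n. (if a = p then ?v $ a * ?v $ b / 2 * to_ac (Ji $$ (b, r)) else 0)) +
    (\<Sum>a<n. \<Sum>b<n. (if b = p then ?v $ a * ?v $ b / 2 * to_ac (Ji $$ (a, r)) else 0))"
    unfolding sum.distrib[symmetric] by (intro sum.cong refl) (use pr in "auto simp: G_def algebra_simps")
   have 3: "(\<Sum>a<n. \<Sum>b<n. (if a = p then ?v $ a * ?v $ b / 2 * to_ac (Ji $$ (b, r)) else 0)) = S / 2"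
    by (subst sum.swap) (use pr in "simp add: S_def sum_divide_distrib")
   have 4: "(\<Sum>a<n. \<Sum>b<n. (if b = p then ?v $ a * ?v $ b / 2 * to_ac (Ji $$ (a, r)) else 0)) = S / 2"
    using pr by (simp add: S_def sum_divide_distrib mult_ac)
   show ?thesis unfolding 1 2 3 4 by simp
  qed
  let ?vs = "map (\<lambda>k. G (k div n) (k mod n)) [0..<n * n]" and ?d = "\<lambda>k. ?v $ (k div n) * ?v $ (k mod n) / 2"
  have N_lc: "?N = lc n (map ac ?vs) ?d"
   by (rule span_lc[where x="\<lambda>a b. ?v $ a * ?v $ b / 2", OF Nc]) (use hC Gh ent in blast)+
  have vsh: "set ?vs \<subseteq> h" using Gh div_mod_less by auto
  have fbN: "fb ?N = (l i * l i - 1) \<cdot> ?N"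
  proof -
   have Jg: "ac Ji * ac \<gamma>i = (ac \<gamma>)\<^sup>T * ac Ji"
    using arg_cong[OF gt(1), of ac] ac_mult[OF J(2) \<gamma>(2)] ac_mult[of "\<gamma>\<^sup>T" Ji] J \<gamma> by simp
   have t: "(ac \<gamma>)\<^sup>T \<in> Mat n" using aC by simp
   have "ac \<gamma> * ?N * ac \<gamma>i = (ac \<gamma> * outer ?v ?v) * (ac Ji * ac \<gamma>i)" using aC oc by (simp add: as cl)
   also have "\<dots> = (ac \<gamma> * outer ?v ?v * (ac \<gamma>)\<^sup>T) * ac Ji" unfolding Jg using aC oc t by (simp add: as cl)
   also have "ac \<gamma> * outer ?v ?v = outer (l i \<cdot>\<^sub>v ?v) ?v" using mult_outer[OF aC(1) v v] gv by simp
   also have "outer (l i \<cdot>\<^sub>v ?v) ?v * (ac \<gamma>)\<^sup>T = outer (l i \<cdot>\<^sub>v ?v) (l i \<cdot>\<^sub>v ?v)"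
    using outer_mult[OF t _ v, of "l i \<cdot>\<^sub>v ?v"] v gv by simp
   also have "\<dots> = (l i * l i) \<cdot> outer ?v ?v" using v by (intro eq_matI) auto
   also have "((l i * l i) \<cdot> outer ?v ?v) * ac Ji = (l i * l i) \<cdot> ?N" by (rule ds(5)[OF oc aC(4)])
   finally have "fb ?N = (l i * l i) \<cdot> ?N - ?N" by (simp add: fb_def)
   also have "\<dots> = (l i * l i - 1) \<cdot> ?N" using Nc
    by (intro sqI) (auto simp: ix cl algebra_simps simp del: index_mult_mat(1) intro!: cl)
   finally show ?thesis .
  qed
  have N0: "?N \<noteq> 0\<^sub>m n n"
  proof
   assume "?N = 0\<^sub>m n n"
   hence "?N = 0\<^sub>m n n * ac Ji" using aC by simp
   hence "outer ?v ?v = 0\<^sub>m n n" by (rule mat_cancel_right[rotated 4]) (use oc aC inverses(5) in auto)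
   thus False using outer_zero_iff[OF v v] col_V_nonzero[OF i] by simp
  qed
  show ?thesis by (rule \<mu>s(4)[rule_format, OF vsh, of _ ?d, folded N_lc, OF _ N0 fbN]) (use l(3) i in auto)
 qed
 \<comment> \<open>The factor \<open>l i - 1\<close> goes into the determinant of
   \<open>\<gamma> - 1\<close>, the factor \<open>l i + 1\<close> into the integral
   remainder.\<close>
 have e1: "(\<Prod>i<n. l i * l i - 1) = to_ac (det (\<gamma> - Id n)) * (\<Prod>i<n. l i + 1)"
  unfolding det_minus_one(1) prod.distrib[symmetric] by (intro prod.cong) (auto simp: algebra_simps)
 have "abd ((c * c) ^ card {..<n}) (\<Prod>i<n. l i + 1)"
  by (rule abd_prod) (use lc(1) abd1 in "auto intro: up abd_add")
 hence e2: "abd ((c * c) ^ n) (\<Prod>i<n. l i + 1)" by simp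
 show "D \<noteq> 0" "absv D ^ n \<le> absv (c * c) ^ (n * n * n + n) * absv (det (\<gamma> - Id n))"
  unfolding DD using discriminant_bound[OF \<mu>s(1,2) m1 m2 e1 e2 cc det_minus_one(2)] by auto
qed

end

lemma mat_double_diff:
 fixes A B :: "'b::field mat"
 assumes "A \<in> Mat n" "B \<in> Mat n"
 shows "A + (B + B) - A = 2 \<cdot> B" using assms by (intro eq_matI) auto

text \<open>Both sides are \<open>2 - a - inverse a\<close> times \<open>E\<close>.\<close>

lemma mat_smult_identity:
 fixes E :: "'b::field mat"
 assumes "E \<in> Mat n" "a \<noteq> 0"
 shows "- ((a - 1) \<cdot> E) - (inverse a - 1) \<cdot> E = (a - 1) \<cdot> ((inverse a - 1) \<cdot> E)"
 using assms by (intro eq_matI) (auto simp: field_simps)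

lemma uminus_mult_dmat:
 fixes W :: "'b::field mat"
 assumes "W \<in> Mat n"
 shows "- (W * dmat n l) = W * dmat n (\<lambda>i. - l i)"
 using assms by (intro eq_matI) (auto simp: mult_dmat[OF assms] carrier_matD[OF dmat_carrier] simp del: index_mult_mat(1))

context spectral
begin

text \<open>\<open>B\<close> will be \<open>S(\<gamma>)\<close> times the matrix of the dagger, and
  then the operator is the twisted adjoint action minus the identity. It is an endomorphism of all
  of \<open>Mat n\<close>, so its eigenvalues are found indirectly: the square of the twisted action
  is conjugation by the asymmetry of \<open>B\<close>.\<close>

lemma discriminant_orthogonal:
 assumes s1: "s = 1" and c: "1 \<le> absv c" and lc: "\<And>i. i < n ==> abd c (l i)" "\<And>i. i < n ==> abd c (inverse (l i))"
  and Q: "Q \<in> Mat n" "Qi \<in> Mat n" "Q * Qi = Id n"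
  and B: "B = Q * ((\<gamma> - Id n) * J) * Q\<^sup>T" "Bi \<in> Mat n" "B * Bi = Id n"
 defines "D \<equiv> quotient_det n (\<lambda>M. - (B * M\<^sup>T * Bi) - M) (Mat n)
   {A \<in> Mat n. A * B = - (B * A\<^sup>T)}"
 shows "D \<noteq> 0" "absv D ^ n \<le> absv (c * c) ^ (n * n * n + n) * absv (det (\<gamma> - Id n))"
proof -
 define W where "W = {A \<in> Mat n. A * B = - (B * A\<^sup>T)}"
 define f where "f M = - (B * M\<^sup>T * Bi) - M" for M
 define fb where "fb N = - (ac B * N\<^sup>T * ac Bi) - N" for N
 let ?Qt = "Q\<^sup>T"
 have c0: "c \<noteq> 0" using c by auto
 have Qt: "?Qt \<in> Mat n" using Q by simp
 have g1: "\<gamma> - Id n \<in> Mat n" "(\<gamma> - Id n) * J \<in> Mat n" using \<gamma> J by (auto intro!: cl)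
 have Bc: "B \<in> Mat n" unfolding B(1) by (rule sq_closed(3)[OF sq_closed(3)[OF Q(1) g1(2)] Qt])
 have BiB: "Bi * B = Id n" by (rule mat_mult_left_right_inverse[OF Bc B(2,3)])
 have QiQ: "Qi * Q = Id n" by (rule mat_mult_left_right_inverse[OF Q])
 define K where "K = - (Q * \<gamma> * Qi)"
 have Kc: "K \<in> Mat n" unfolding K_def using Q \<gamma> by (intro cl)
 have gJ: "\<gamma> * (J * \<gamma>\<^sup>T - J) = - ((\<gamma> - Id n) * J)"
 proof -
  have t: "\<gamma>\<^sup>T \<in> Mat n" using \<gamma> by simp
  have "\<gamma> * (J * \<gamma>\<^sup>T - J) = \<gamma> * J * \<gamma>\<^sup>T - \<gamma> * J" using \<gamma>(1) J(1) t by (simp add: ds as cl)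
  also have "\<dots> = J - \<gamma> * J" by (simp only: \<gamma>(4))
  also have "\<dots> = - (\<gamma> * J - J)" using \<gamma>(1) J(1) by (auto intro!: sqI cl simp: ix cl simp del: index_mult_mat(1))
  also have "\<gamma> * J - J = (\<gamma> - Id n) * J" using \<gamma>(1) J(1) by (simp add: ds cl)
  finally show ?thesis .
 qed
 have Bt: "B\<^sup>T = Q * (J * \<gamma>\<^sup>T - J) * ?Qt"
 proof -
  have "((\<gamma> - Id n) * J)\<^sup>T = J * \<gamma>\<^sup>T - J"
  proof -
   have t: "\<gamma>\<^sup>T \<in> Mat n" using \<gamma> by simp
   have "((\<gamma> - Id n) * J)\<^sup>T = J\<^sup>T * (\<gamma> - Id n)\<^sup>T" by (rule sq_transpose(3)[OF g1(1) J(1)])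
   also have "J\<^sup>T = J" unfolding J(4) s1 using J(1) by (intro eq_matI) auto
   also have "(\<gamma> - Id n)\<^sup>T = \<gamma>\<^sup>T - Id n" using sq_transpose(2)[OF \<gamma>(1) one_carrier_mat] by simp
   also have "J * (\<gamma>\<^sup>T - Id n) = J * \<gamma>\<^sup>T - J" using J(1) t by (simp add: ds cl)
   finally show ?thesis .
  qed
  thus ?thesis unfolding B(1) using Q(1) Qt g1 by (simp add: tp as cl)
 qed
 have KB: "K * B\<^sup>T = B"
 proof -
  have c2: "J * \<gamma>\<^sup>T - J \<in> Mat n" using J \<gamma> by (auto intro!: cl)
  have "Q * \<gamma> * Qi * (Q * (J * \<gamma>\<^sup>T - J) * ?Qt) = Q * (\<gamma> * (Qi * (Q * ((J * \<gamma>\<^sup>T - J) * ?Qt))))"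
   using Q(1,2) \<gamma>(1) c2 Qt by (simp add: as cl del: transpose_carrier_mat)
  also have "Qi * (Q * ((J * \<gamma>\<^sup>T - J) * ?Qt)) = (J * \<gamma>\<^sup>T - J) * ?Qt"
   by (rule sq_inv_cancel(1)[OF Q(2,1) QiQ]) (use c2 Qt in "auto intro!: cl")
  also have "\<gamma> * ((J * \<gamma>\<^sup>T - J) * ?Qt) = \<gamma> * (J * \<gamma>\<^sup>T - J) * ?Qt" by (rule as[OF \<gamma>(1) c2 Qt, symmetric])
  also have "Q * (\<gamma> * (J * \<gamma>\<^sup>T - J) * ?Qt) = - B" unfolding gJ B(1) using Q(1) Qt g1 by (simp add: as ds cl)
  finally have "K * B\<^sup>T = - (- B)"
   unfolding K_def Bt using ds(7)[OF sq_closed(3)[OF sq_closed(3)[OF Q(1) \<gamma>(1)] Q(2)], of "Q * (J * \<gamma>\<^sup>T - J) * ?Qt"]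
    Q(1) c2 Qt by (simp add: cl)
  also have "\<dots> = B" using Bc by (intro eq_matI) auto
  finally show ?thesis .
 qed
 have aC: "ac Q \<in> Mat n" "ac Qi \<in> Mat n" "ac K \<in> Mat n" "ac \<gamma> \<in> Mat n"
  "ac B \<in> Mat n" "ac Bi \<in> Mat n" "ac J \<in> Mat n" "ac Ji \<in> Mat n" using Q \<gamma> Kc Bc B J by auto
 have aQ: "ac Q * ac Qi = Id n" "ac Qi * ac Q = Id n" using ac_mult[OF Q(1,2)] ac_mult[OF Q(2,1)] Q(3) QiQ by auto
 have aB: "ac B * ac Bi = Id n" "ac Bi * ac B = Id n"
  using ac_mult[OF Bc B(2)] ac_mult[OF B(2) Bc] B(3) BiB by auto
 have aKB: "ac K * (ac B)\<^sup>T = ac B" using arg_cong[OF KB, of ac] ac_mult[of K "B\<^sup>T"] Kc Bc by simp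
 \<comment> \<open>\<open>K\<close> is the asymmetry of the bilinear form \<open>B\<close>; it is conjugate to \<open>- \<gamma>\<close>.\<close>
 have QV: "ac Q * V \<in> Mat n" "Vi * ac Qi \<in> Mat n" using aC V by (auto intro!: cl)
 have QV1: "(ac Q * V) * (Vi * ac Qi) = Id n"
 proof -
  have "(ac Q * V) * (Vi * ac Qi) = ac Q * (V * (Vi * ac Qi))" by (rule as[OF aC(1) V(1) QV(2)])
  also have "V * (Vi * ac Qi) = ac Qi" by (rule sq_inv_cancel(1)[OF V aC(2)])
  finally show ?thesis by (simp only: aQ)
 qed
 define k where "k i = - l i" for i
 have KV: "ac K * (ac Q * V) = (ac Q * V) * dmat n k"
 proof -
  have Kd: "ac K = - (ac Q * ac \<gamma> * ac Qi)" unfolding K_def ac_uminus using Q \<gamma> by (simp add: ac_mult cl)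
  have "ac Q * ac \<gamma> * ac Qi * (ac Q * V) = ac Q * (ac \<gamma> * (ac Qi * (ac Q * V)))" using aC V by (simp add: as cl)
  also have "ac Qi * (ac Q * V) = V" by (rule sq_inv_cancel(1)[OF aC(2,1) aQ(2) V(1)])
  also have "ac Q * (ac \<gamma> * V) = ac Q * V * dmat n l" unfolding l(1) by (rule as[OF aC(1) V(1) dmat_carrier, symmetric])
  finally have "ac K * (ac Q * V) = - (ac Q * V * dmat n l)" unfolding Kd using aC V by (simp add: ds cl)
  also have "\<dots> = (ac Q * V) * dmat n k" unfolding k_def by (rule uminus_mult_dmat[OF QV(1)])
  finally show ?thesis .
 qed
 have kinj: "inj_on k {..<n}" using l(2) by (auto simp: inj_on_def k_def)
 have k0: "\<forall>i<n. k i \<noteq> 0" using l_nonzero by (auto simp: k_def)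
 have Csub: "msub n (Mat n :: 'a mat set)" by (auto simp: msub_def)
 have neg_smult: "k \<cdot> (- A) = - (k \<cdot> A)" if "A \<in> Mat n" for k and A :: "'a mat" using that by (auto intro!: sqI)
 have neg_add: "- E + - F = - (E + F)" if "E \<in> Mat n" "F \<in> Mat n" for E F :: "'a mat"
  using that by (auto intro!: sqI)
 have Wsub: "msub n W" unfolding msub_def W_def using Bc by (auto simp: ds cl tp neg_add neg_smult)
 have WC: "W \<subseteq> Mat n" by (auto simp: W_def)
 have flin: "mlinear n (Mat n) f" unfolding mlinear_def f_def
  using Bc B(2) by (auto simp: ds cl tp intro!: sqI cl) (auto simp: ix cl algebra_simps simp del: index_mult_mat(1))
 have fblin: "mlinear n (Mat n) fb" unfolding mlinear_def fb_def
  using aC by (auto simp: ds cl tp intro!: sqI cl) (auto simp: ix cl algebra_simps simp del: index_mult_mat(1))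
 have fC: "f A \<in> Mat n" if "A \<in> Mat n" for A unfolding f_def using that Bc B(2) by (auto intro!: cl)
 have W_theta: "A \<in> W \<longleftrightarrow> - (B * A\<^sup>T * Bi) = A" if A: "A \<in> Mat n" for A
 proof -
  have t: "A\<^sup>T \<in> Mat n" using A by simp
  have BA: "B * A\<^sup>T \<in> Mat n" by (rule sq_closed(3)[OF Bc t])
  have e: "- (B * A\<^sup>T * Bi) * B = - (B * A\<^sup>T)"
   using as[OF BA B(2) Bc] ds(7)[OF sq_closed(3)[OF BA B(2)] Bc] right_mult_one_mat[OF BA] by (simp only: BiB)
  show ?thesis
  proof
   assume "A \<in> W"
   hence "- (B * A\<^sup>T * Bi) * B = A * B" unfolding e by (simp add: W_def)
   thus "- (B * A\<^sup>T * Bi) = A"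
    by (rule mat_cancel_right[rotated 4]) (use A BA B(2) Bc GL_inv_eqI(2)[OF Bc B(2,3)] in "auto intro!: cl")
  next
   assume "- (B * A\<^sup>T * Bi) = A"
   hence "A * B = - (B * A\<^sup>T)" using e by simp
   thus "A \<in> W" using A by (simp add: W_def)
  qed
 qed
 have fW: "f A = 0\<^sub>m n n" if "A \<in> W" for A
 proof -
  have "A \<in> Mat n" using that WC by blast
  thus ?thesis using W_theta that unfolding f_def by simp
 qed
 \<comment> \<open>Write \<theta> for \<open>M \<mapsto> B M^T B^(-1)\<close> and \<open>M'\<close>
   for \<open>f A\<close>. From \<open>\<theta> A = - (A + M')\<close> and
   \<open>\<theta> M' = - M'\<close> one gets \<open>\<theta> (\<theta> A) = A + 2 M'\<close>, hence
   \<open>K A - A K = 2 M' K\<close>. This commutator commutes with \<open>K\<close>, so it is zero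
   and \<open>M'\<close> vanishes.\<close>
 have ker: "A \<in> W" if A: "A \<in> Mat n" and fA: "f A \<in> W" for A
 proof -
  define M' where "M' = f A"
  have M': "M' \<in> Mat n" unfolding M'_def by (rule fC[OF A])
  let ?\<theta> = "\<lambda>M. B * M\<^sup>T * Bi"
  have thc: "?\<theta> M \<in> Mat n" if "M \<in> Mat n" for M using that Bc B(2) by (auto intro!: cl)
  have tA: "?\<theta> A = - (A + M')"
   unfolding M'_def f_def using thc[OF A] A by (intro sqI) (auto simp: ix cl simp del: index_mult_mat(1) intro!: cl)
  have tM: "- ?\<theta> M' = M'" using W_theta[OF M'] fA by (simp add: M'_def)
  hence tM': "?\<theta> M' = - M'" using thc[OF M'] M' by (metis uminus_uminus_mat)
  have neg: "?\<theta> (- M) = - ?\<theta> M" if M: "M \<in> Mat n" for M using M Bc B(2) by (simp add: tp ds cl)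
  have th_add: "?\<theta> (M + N) = ?\<theta> M + ?\<theta> N" if "M \<in> Mat n" "N \<in> Mat n" for M N
   using that Bc B(2) by (simp add: tp ds cl)
  have "?\<theta> (?\<theta> A) = ?\<theta> (- (A + M'))" by (rule arg_cong[of _ _ ?\<theta>]) (rule tA)
  also have "\<dots> = - (?\<theta> A + ?\<theta> M')" using neg[of "A + M'"] th_add[OF A M'] A M' by simp
  also have "\<dots> = A + (M' + M')" unfolding tA tM' using A M' by (intro sqI) auto
  finally have ttA: "?\<theta> (?\<theta> A) = A + (M' + M')" .
  have 1: "(A + (M' + M')) * K = K * A" using theta_theta[OF Bc B(2) Kc A B(3) KB] by (simp only: ttA)
  have ttM: "?\<theta> (?\<theta> M') = M'" unfolding tM' neg[OF M'] using M' by (intro sqI) auto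
  have 2: "M' * K = K * M'" using theta_theta[OF Bc B(2) Kc M' B(3) KB] by (simp only: ttM)
  define Z where "Z = K * A - A * K"
  have MK: "M' * K \<in> Mat n" "K * A \<in> Mat n" "A * K \<in> Mat n" using M' Kc A by (auto intro!: cl)
  have ZM: "Z = 2 \<cdot> (M' * K)"
  proof -
   have "(A + (M' + M')) * K = A * K + (M' * K + M' * K)" using A M' Kc by (simp add: ds cl)
   hence "Z = A * K + (M' * K + M' * K) - A * K" using 1 by (simp add: Z_def)
   also have "\<dots> = 2 \<cdot> (M' * K)" by (rule mat_double_diff[OF MK(3,1)])
   finally show ?thesis .
  qed
  have Zc: "Z \<in> Mat n" unfolding ZM using MK by simp
  have "Z * K = 2 \<cdot> (M' * K * K)" unfolding ZM by (rule ds(5)[OF MK(1) Kc])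
  also have "M' * K * K = K * (M' * K)" using 2 as[OF Kc M' Kc] by simp
  also have "2 \<cdot> (K * (M' * K)) = K * Z" unfolding ZM by (rule ds(6)[OF Kc MK(1), symmetric])
  finally have ZK: "Z * K = K * Z" .
  have "ac Z = 0\<^sub>m n n"
  proof (rule commutator_semisimple[OF QV QV1 aC(3) KV kinj])
   show "ac A \<in> Mat n" using A by simp
   show "ac Z = ac K * ac A - ac A * ac K"
    using ac_diff[OF MK(2,3)] by (simp add: Z_def ac_mult[OF Kc A] ac_mult[OF A Kc])
   show "ac Z * ac K = ac K * ac Z" using ZK ac_mult[OF Zc Kc] ac_mult[OF Kc Zc] by simp
  qed
  moreover have "ac (0\<^sub>m n n) = 0\<^sub>m n n" by (intro eq_matI) auto
  ultimately have Z0: "Z = 0\<^sub>m n n" using map_mat_inj by metis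
  have "(M' * K) $$ (i, j) = 0" if "i < n" "j < n" for i j
   using ix(4)[OF MK(1) that, of 2] Z0 that unfolding ZM by simp
  hence "M' * K = 0\<^sub>m n n * K" using MK Kc by (intro sqI) (auto simp del: index_mult_mat(1))
  moreover have "det K \<noteq> 0"
  proof
   assume "det K = 0"
   hence "det B = 0" using arg_cong[OF KB, of det] det_mult[of K n "B\<^sup>T"] Kc Bc by simp
   thus False using GL_inv_eqI(2)[OF Bc B(2,3)] by simp
  qed
  ultimately have "M' = 0\<^sub>m n n" using mat_cancel_right[OF M' zero_carrier_mat Kc] by blast
  hence "f A = 0\<^sub>m n n" by (simp add: M'_def)
  hence "- ?\<theta> A = A"
  proof -
   assume z: "f A = 0\<^sub>m n n"
   have "(- ?\<theta> A) $$ (i, j) - A $$ (i, j) = 0" if "i < n" "j < n" for i j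
    using arg_cong[OF z, of "\<lambda>M. M $$ (i, j)"] ix(2)[OF sq_closed(4)[OF thc[OF A]] A that] that unfolding f_def by simp
   thus ?thesis using A thc[OF A] by (intro sqI) (auto simp del: index_mult_mat(1) index_uminus_mat(1) intro!: cl)
  qed
  thus ?thesis using W_theta[OF A] by blast
 qed
 have fbac: "fb (ac A) = ac (f A)" if "A \<in> Mat n" for A
 proof -
  have c2: "B * A\<^sup>T * Bi \<in> Mat n" "B * A\<^sup>T \<in> Mat n" "A\<^sup>T \<in> Mat n" using that Bc B(2) by (auto intro!: cl)
  have "ac (f A) = - ac (B * A\<^sup>T * Bi) - ac A"
   unfolding f_def using ac_diff[OF sq_closed(4)[OF c2(1)] that] by (simp add: ac_uminus)
  thus ?thesis unfolding fb_def ac_mult[OF c2(2) B(2)] ac_mult[OF Bc c2(3)] by simp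
 qed
 obtain \<mu>s where \<mu>s: "to_ac (quotient_det n f (Mat n) W) = prod_mset \<mu>s" "size \<mu>s \<le> n * n"
  "\<forall>\<mu>. \<mu> \<in># \<mu>s --> \<mu> \<noteq> 0 \<and> (\<exists>N. N \<in> Mat n \<and> N \<noteq> 0\<^sub>m n n \<and> fb N = \<mu> \<cdot> N)"
  "\<forall>\<mu> vs d. set vs \<subseteq> Mat n --> \<mu> \<noteq> 0 --> lc n (map ac vs) d \<noteq> 0\<^sub>m n n -->
    fb (lc n (map ac vs) d) = \<mu> \<cdot> lc n (map ac vs) d --> \<mu> \<in># \<mu>s"
  by (rule quotient_det_eigenvalues[OF Csub Wsub WC flin fC fW ker fblin fbac])
 have DD: "D = quotient_det n f (Mat n) W" unfolding D_def f_def W_def ..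
 note cc = abd_square(1)[OF c] and abd1 = abd_square(2)[OF c] and up = abd_square(3)[OF c]
 have m1: "\<forall>x. x \<in># \<mu>s --> x \<noteq> 0 \<and> abd (c * c) x"
 proof (intro allI impI)
  fix x assume x: "x \<in># \<mu>s"
  with \<mu>s(3) obtain N where N: "x \<noteq> 0" "N \<in> Mat n" "N \<noteq> 0\<^sub>m n n" "fb N = x \<cdot> N" by blast
  let ?\<theta> = "\<lambda>M. ac B * M\<^sup>T * ac Bi"
  have thc: "?\<theta> N \<in> Mat n" using N aC by (auto intro!: cl)
  let ?y = "- (x + 1)"
  have th: "?\<theta> N = ?y \<cdot> N"
  proof (rule sq_eqI[OF thc])
   fix i j assume ij: "i < n" "j < n"
   have "(fb N) $$ (i, j) = x * N $$ (i, j)" unfolding N(4) using N(2) ij by simp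
   hence "- (?\<theta> N $$ (i, j)) - N $$ (i, j) = x * N $$ (i, j)"
    unfolding fb_def ix(2)[OF sq_closed(4)[OF thc] N(2) ij] ix(3)[OF thc ij] .
   moreover have "a = - (x + 1) * b" if "- a - b = x * b" for a b :: "'a alg_closure" using that by (simp add: algebra_simps) (metis add.commute add_diff_cancel_right' diff_add_cancel minus_diff_eq add.inverse_inverse diff_minus_eq_add)
   ultimately show "?\<theta> N $$ (i, j) = (?y \<cdot> N) $$ (i, j)" unfolding ix(4)[OF N(2) ij] by blast
  qed (use N in auto)
  have "?\<theta> (?\<theta> N) = ?y \<cdot> (?y \<cdot> N)"
  proof -
   have "?\<theta> (?y \<cdot> N) = ?y \<cdot> ?\<theta> N" using N(2) aC by (simp add: tp ds cl)
   thus ?thesis by (simp only: th)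
  qed
  also have "\<dots> = ((x + 1) ^ 2) \<cdot> N" using N(2) by (intro sqI) (auto simp: power2_eq_square algebra_simps)
  finally have tt: "?\<theta> (?\<theta> N) = ((x + 1) ^ 2) \<cdot> N" .
  have "ac K * N = ?\<theta> (?\<theta> N) * ac K" by (rule theta_theta[OF aC(5,6,3) N(2) aB(1) aKB, symmetric])
  also have "\<dots> = ((x + 1) ^ 2) \<cdot> (N * ac K)" unfolding tt by (rule ds(5)[OF N(2) aC(3)])
  finally have KN: "ac K * N = ((x + 1) ^ 2) \<cdot> (N * ac K)" .
  obtain i j where ij: "i < n" "j < n" "(x + 1) ^ 2 = k i * inverse (k j)"
   by (rule conj_eigenvalue[OF QV QV1 aC(3) KV k0 N(2,3) KN])
  have "(x + 1) ^ 2 = l i * inverse (l j)" unfolding ij(3) by (simp add: k_def)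
  hence "abd (c * c) ((x + 1) ^ 2)" using abd_mult[OF lc(1)[OF ij(1)] lc(2)[OF ij(2)]] by simp
  \<comment> \<open>Only the square of \<open>x + 1\<close> is known, as a quotient of two
    eigenvalues; integrality passes to the square root.\<close>
  hence "integral_elt (((x + 1) / to_ac c) ^ 2)" by (simp add: abd_def power2_eq_square)
  hence "abd c (x + 1)" unfolding abd_def by (rule integral_elt_sqrt)
  hence "abd c ((x + 1) + (- 1))" by (rule abd_add) (rule abd_minus[OF abd1])
  hence "abd c x" by simp
  thus "x \<noteq> 0 \<and> abd (c * c) x" using N(1) up by simp
 qed
 have m2: "l i - 1 \<in># \<mu>s" if i: "i < n" for i
 proof -
  let ?v = "col V i"
  have v: "?v \<in> Vec n" using V by auto
  have gv: "ac \<gamma> *\<^sub>v ?v = l i \<cdot>\<^sub>v ?v" "ac \<gamma>i *\<^sub>v ?v = inverse (l i) \<cdot>\<^sub>v ?v"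
   using eigenvector_col[OF i _ l(1)] eigenvector_col[OF i _ gamma_inverse] \<gamma> by auto
  let ?o = "outer ?v ?v" and ?q = "ac Q" and ?qt = "(ac Q)\<^sup>T"
  have oc: "?o \<in> Mat n" using v by simp
  have qt: "?qt \<in> Mat n" "(ac \<gamma>)\<^sup>T \<in> Mat n" "(ac \<gamma>i)\<^sup>T \<in> Mat n" using aC \<gamma> by auto
  define E where "E = ?q * ?o * ?qt"
  have Ec: "E \<in> Mat n" unfolding E_def using aC oc qt by (intro cl)
  have Et: "E\<^sup>T = E" unfolding E_def using aC oc qt by (simp add: tp transpose_outer as cl)
  \<comment> \<open>Multiplied on the right by \<open>B\<close> and by its transpose, this matrix
    becomes \<open>inverse (l i) - 1\<close> and \<open>l i - 1\<close> times the same symmetric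
    matrix \<open>E\<close>. Both terms of \<open>fb ?N\<close> are thus multiples of
    \<open>E\<close> times the inverse of \<open>B\<close>, and they combine by
    \<open>mat_smult_identity\<close>.\<close>
  let ?N = "?q * ?o * (ac Ji * ac Qi)"
  have JQ: "ac Ji * ac Qi \<in> Mat n" "?q * ?o \<in> Mat n" using aC oc by (auto intro!: cl)
  have Nc: "?N \<in> Mat n" by (rule sq_closed(3)[OF JQ(2,1)])
  have og: "?o * (ac \<gamma>)\<^sup>T = l i \<cdot> ?o" "?o * (ac \<gamma>i)\<^sup>T = inverse (l i) \<cdot> ?o"
   using outer_mult[OF qt(2) v v] outer_mult[OF qt(3) v v] gv by (simp_all add: outer_smult_right)
  have JQB: "ac Ji * ac Qi * (?q * Y * ?qt) = ac Ji * Y * ?qt" if Y: "Y \<in> Mat n" for Y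
  proof -
   have "ac Ji * ac Qi * (?q * Y * ?qt) = ac Ji * (ac Qi * (?q * (Y * ?qt)))" using aC qt Y by (simp add: as cl)
   also have "ac Qi * (?q * (Y * ?qt)) = Y * ?qt" by (rule sq_inv_cancel(1)[OF aC(2,1) aQ(2)]) (use Y qt in "auto intro!: cl")
   finally show ?thesis using aC qt Y by (simp add: as cl)
  qed
  have acB: "ac B = ?q * ac ((\<gamma> - Id n) * J) * ?qt" unfolding B(1) using Q(1) Qt g1 by (simp add: ac_mult cl)
  have "ac Ji * ac ((\<gamma> - Id n) * J) = (ac \<gamma>i)\<^sup>T - Id n"
  proof -
   have "Ji * ((\<gamma> - Id n) * J) = \<gamma>i\<^sup>T - Id n"
   proof -
    have "Ji * ((\<gamma> - Id n) * J) = Ji * \<gamma> * J - Ji * J" using J(1,2) \<gamma>(1) by (simp add: ds as cl)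
    thus ?thesis by (simp only: gt(3) inverses(1))
   qed
   hence "ac Ji * ac ((\<gamma> - Id n) * J) = ac (\<gamma>i\<^sup>T - Id n)" using ac_mult[OF J(2) g1(2)] by simp
   also have "\<dots> = ac \<gamma>i\<^sup>T - ac (Id n)" by (rule ac_diff) (use \<gamma> in auto)
   finally show ?thesis by simp
  qed
  hence NB: "?N * ac B = (inverse (l i) - 1) \<cdot> E"
  proof -
   assume e: "ac Ji * ac ((\<gamma> - Id n) * J) = (ac \<gamma>i)\<^sup>T - Id n"
   have "?N * ac B = ?q * ?o * (ac Ji * ac Qi * ac B)" by (rule as[OF JQ(2,1) aC(5)])
   also have "ac Ji * ac Qi * ac B = ((ac \<gamma>i)\<^sup>T - Id n) * ?qt" unfolding acB JQB[OF ac_carrier[OF g1(2)]] e ..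
   also have "?q * ?o * (((ac \<gamma>i)\<^sup>T - Id n) * ?qt) = ?q * (?o * (ac \<gamma>i)\<^sup>T - ?o) * ?qt"
    using aC oc qt by (simp add: as ds cl)
   also have "?o * (ac \<gamma>i)\<^sup>T - ?o = (inverse (l i) - 1) \<cdot> ?o" unfolding og(2) using v by (intro eq_matI) (auto simp: algebra_simps)
   also have "?q * ((inverse (l i) - 1) \<cdot> ?o) * ?qt = (inverse (l i) - 1) \<cdot> E" unfolding E_def using aC oc qt by (simp add: ds cl)
   finally show ?thesis .
  qed
  have acBt: "(ac B)\<^sup>T = ?q * ac (J * \<gamma>\<^sup>T - J) * ?qt"
  proof -
   have "J * \<gamma>\<^sup>T - J \<in> Mat n" using J \<gamma> by (auto intro!: cl)
   hence "ac B\<^sup>T = ?q * ac (J * \<gamma>\<^sup>T - J) * ?qt" unfolding Bt using Q(1) Qt by (simp add: ac_mult cl)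
   thus ?thesis by simp
  qed
  have NBt: "?N * (ac B)\<^sup>T = (l i - 1) \<cdot> E"
  proof -
   have JtJ: "J * \<gamma>\<^sup>T - J \<in> Mat n" "\<gamma>\<^sup>T \<in> Mat n" using J \<gamma> by (auto intro!: cl)
   have "Ji * (J * \<gamma>\<^sup>T - J) = \<gamma>\<^sup>T - Id n"
   proof -
    have "Ji * (J * \<gamma>\<^sup>T - J) = Ji * (J * \<gamma>\<^sup>T) - Ji * J" by (rule ds(4)) (use J JtJ in "auto intro!: cl")
    thus ?thesis by (simp only: sq_inv_cancel(1)[OF J(2,1) inverses(1) JtJ(2)] inverses(1))
   qed
   hence e: "ac Ji * ac (J * \<gamma>\<^sup>T - J) = (ac \<gamma>)\<^sup>T - Id n"
    using ac_mult[OF J(2) JtJ(1)] ac_diff[OF JtJ(2) one_carrier_mat] by simp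
   have "?N * (ac B)\<^sup>T = ?q * ?o * (ac Ji * ac Qi * (ac B)\<^sup>T)" by (rule as[OF JQ(2,1)]) (use aC in simp)
   also have "ac Ji * ac Qi * (ac B)\<^sup>T = ((ac \<gamma>)\<^sup>T - Id n) * ?qt" unfolding acBt JQB[OF ac_carrier[OF JtJ(1)]] e ..
   also have "?q * ?o * (((ac \<gamma>)\<^sup>T - Id n) * ?qt) = ?q * (?o * (ac \<gamma>)\<^sup>T - ?o) * ?qt"
    using aC oc qt by (simp add: as ds cl)
   also have "?o * (ac \<gamma>)\<^sup>T - ?o = (l i - 1) \<cdot> ?o" unfolding og(1) using v by (intro eq_matI) (auto simp: algebra_simps)
   also have "?q * ((l i - 1) \<cdot> ?o) * ?qt = (l i - 1) \<cdot> E" unfolding E_def using aC oc qt by (simp add: ds cl)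
   finally show ?thesis .
  qed
  have fbN: "fb ?N = (l i - 1) \<cdot> ?N"
  proof -
   have "ac B * ?N\<^sup>T = (?N * (ac B)\<^sup>T)\<^sup>T" using sq_transpose(3)[OF Nc, of "(ac B)\<^sup>T"] aC by simp
   also have "\<dots> = (l i - 1) \<cdot> E" unfolding NBt using sq_transpose(4)[OF Ec] Et by simp
   finally have 1: "ac B * ?N\<^sup>T * ac Bi = (l i - 1) \<cdot> (E * ac Bi)" using ds(5)[OF Ec aC(6)] by simp
   have "?N = ?N * ac B * ac Bi" using as[OF Nc aC(5,6)] right_mult_one_mat[OF Nc] by (simp only: aB(1))
   also have "\<dots> = (inverse (l i) - 1) \<cdot> (E * ac Bi)" unfolding NB by (rule ds(5)[OF Ec aC(6)])
   finally have 2: "?N = (inverse (l i) - 1) \<cdot> (E * ac Bi)" .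
   have EB: "E * ac Bi \<in> Mat n" using Ec aC by (auto intro!: cl)
   have "fb ?N = - ((l i - 1) \<cdot> (E * ac Bi)) - (inverse (l i) - 1) \<cdot> (E * ac Bi)"
    unfolding fb_def 1 by (subst (1) 2) (rule refl)
   also have "\<dots> = (l i - 1) \<cdot> ((inverse (l i) - 1) \<cdot> (E * ac Bi))"
    by (rule mat_smult_identity[OF EB l_nonzero[OF i]])
   finally show ?thesis by (simp only: 2[symmetric])
  qed
  have N0: "?N \<noteq> 0\<^sub>m n n"
  proof
   assume "?N = 0\<^sub>m n n"
   hence "?q * ?o * (ac Ji * ac Qi) = 0\<^sub>m n n * (ac Ji * ac Qi)" using left_mult_zero_mat[OF JQ(1), of n] by (simp only:)
   moreover have "det (ac Ji * ac Qi) \<noteq> 0" using det_mult[OF aC(8,2)] inverses(5) GL_inv_eqI(3)[OF Q] by simp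
   ultimately have "?q * ?o = 0\<^sub>m n n" using mat_cancel_right[OF JQ(2) zero_carrier_mat JQ(1)] by blast
   hence "?q * ?o = ?q * 0\<^sub>m n n" using aC by simp
   hence "?o = 0\<^sub>m n n" using mat_cancel_left[OF oc zero_carrier_mat aC(1)] GL_inv_eqI(2)[OF Q] by simp
   thus False using outer_zero_iff[OF v v] col_V_nonzero[OF i] by simp
  qed
  define G :: "nat => nat => 'a mat" where "G a b = mat n n (\<lambda>(i, j). if i = a then if j = b then 1 else 0 else 0)" for a b
  let ?vs = "map (\<lambda>k. G (k div n) (k mod n)) [0..<n * n]" and ?d = "\<lambda>k. ?N $$ (k div n, k mod n)"
  have N_lc: "?N = lc n (map ac ?vs) ?d"
  proof (rule span_lc[where x="\<lambda>a b. ?N $$ (a, b)", OF Nc])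
   show "G a b \<in> Mat n" for a b by (simp add: G_def)
   fix p r assume pr: "p < n" "r < n"
   have "(\<Sum>a<n. \<Sum>b<n. ?N $$ (a, b) * to_ac (G a b $$ (p, r))) =
     (\<Sum>a<n. \<Sum>b<n. if b = r then (if a = p then ?N $$ (a, b) else 0) else 0)"
    by (intro sum.cong refl) (use pr in "auto simp: G_def")
   also have "\<dots> = ?N $$ (p, r)" using pr by (simp del: index_mult_mat(1))
   finally show "?N $$ (p, r) = (\<Sum>a<n. \<Sum>b<n. ?N $$ (a, b) * to_ac (G a b $$ (p, r)))" by simp
  qed
  have vsh: "set ?vs \<subseteq> Mat n" by (auto simp: G_def)
  show ?thesis
   by (rule \<mu>s(4)[rule_format, OF vsh, of _ ?d, folded N_lc, OF _ N0 fbN]) (use l_ne_1(1)[OF i] in auto)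
 qed
 have e1: "(\<Prod>i<n. l i - 1) = to_ac (det (\<gamma> - Id n)) * 1" unfolding det_minus_one(1) by simp
 have e2: "abd ((c * c) ^ n) 1"
 proof -
  have "1 \<le> absv ((c * c) ^ n)" unfolding absv_power using cc by (rule one_le_power)
  thus ?thesis using abd_to_ac[of 1 "(c * c) ^ n"] c0 by simp
 qed
 show "D \<noteq> 0" "absv D ^ n \<le> absv (c * c) ^ (n * n * n + n) * absv (det (\<gamma> - Id n))"
  unfolding DD using discriminant_bound[OF \<mu>s(1,2) m1 m2 e1 e2 cc det_minus_one(2)] by auto
qed

end

section \<open>The commutant of a regular element\<close>

context spectral
begin

text \<open>The commutant over the closure, with coordinates given by the eigenvalues:
  \<open>cj\<close> turns it into an algebra of functions on the \<open>n\<close> indices.\<close>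

definition cj :: "(nat => 'a alg_closure) => 'a alg_closure mat" where
 "cj d = V * dmat n d * Vi"

lemma cj_carrier [simp]: "cj d \<in> Mat n"
 unfolding cj_def by (rule sq_closed(3)[OF sq_closed(3)[OF V(1) dmat_carrier] V(2)])

lemma cj_cong: "(\<And>i. i < n ==> d i = d' i) ==> cj d = cj d'"
 unfolding cj_def by (rule arg_cong[of _ _ "\<lambda>D. V * D * Vi"]) (auto intro!: sqI)

lemma cj_V: "cj d * V = V * dmat n d"
proof -
 have "cj d * V = V * dmat n d * (Vi * V)" unfolding cj_def by (rule as) (simp_all add: V cl)
 thus ?thesis unfolding inverses(3) using right_mult_one_mat[OF sq_closed(3)[OF V(1) dmat_carrier]] by simp
qed

lemma cj_mult: "cj d * cj d' = cj (\<lambda>i. d i * d' i)"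
proof -
 have "cj d * cj d' = V * (dmat n d * (Vi * (V * (dmat n d' * Vi))))"
  unfolding cj_def using V by (simp add: as cl)
 also have "Vi * (V * (dmat n d' * Vi)) = dmat n d' * Vi"
  by (rule sq_inv_cancel(1)[OF V(2,1) inverses(3)]) (simp add: cl V)
 also have "V * (dmat n d * (dmat n d' * Vi)) = V * (dmat n d * dmat n d') * Vi" using V by (simp add: as cl)
 finally show ?thesis by (simp add: cj_def dmat_dmat)
qed

lemma cj_one: "cj (\<lambda>_. 1) = Id n"
proof -
 have "dmat n (\<lambda>_. 1) = (Id n :: 'a alg_closure mat)" by (intro eq_matI) (auto simp: dmat_def)
 thus ?thesis unfolding cj_def using V by simp
qed

lemma cj_add: "cj d + cj d' = cj (\<lambda>i. d i + d' i)"
proof -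
 have "V * (dmat n d + dmat n d') * Vi = cj d + cj d'" unfolding cj_def using V by (simp add: ds cl)
 moreover have "dmat n d + dmat n d' = dmat n (\<lambda>i. d i + d' i)" by (intro eq_matI) (auto simp: dmat_def)
 ultimately show ?thesis by (simp add: cj_def)
qed

lemma cj_smult: "x \<cdot> cj d = cj (\<lambda>i. x * d i)"
proof -
 have "V * (x \<cdot> dmat n d) * Vi = x \<cdot> cj d" unfolding cj_def using V by (simp add: ds cl)
 moreover have "x \<cdot> dmat n d = dmat n (\<lambda>i. x * d i)" by (intro eq_matI) (auto simp: dmat_def)
 ultimately show ?thesis by (simp add: cj_def)
qed

lemma cj_diff: "cj d - cj d' = cj (\<lambda>i. d i - d' i)"
proof -
 have "cj d - cj d' = cj d + (- 1) \<cdot> cj d'" by (intro sqI) (auto simp: ix cl simp del: index_mult_mat(1))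
 thus ?thesis by (simp add: cj_smult cj_add)
qed

lemma cj_zero: "cj (\<lambda>_. 0) = 0\<^sub>m n n"
proof -
 have "(0 :: 'a alg_closure) \<cdot> cj (\<lambda>_. 0) = 0\<^sub>m n n" by (intro sqI) (auto simp: ix(4)[OF cj_carrier] cl)
 thus ?thesis by (simp add: cj_smult)
qed

lemma cj_eqD: "cj d = cj d' ==> i < n ==> d i = d' i"
proof -
 assume e: "cj d = cj d'" and i: "i < n"
 have "V * dmat n d = V * dmat n d'" using e cj_V by metis
 hence "dmat n d = dmat n d'" by (rule mat_cancel_left[OF dmat_carrier dmat_carrier V(1) inverses(7)])
 hence "dmat n d $$ (i, i) = dmat n d' $$ (i, i)" by simp
 thus "d i = d' i" using i by simp
qed

lemma det_cj: "det (cj d) = (\<Prod>i<n. d i)" by (rule det_conj[OF cj_carrier cj_V])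

lemma gamma_cj: "ac \<gamma> = cj l" unfolding cj_def by (rule conj_dmat(1)[OF V _ l(1)]) (use \<gamma> in simp)

section \<open>The commutant over \<open>F\<close> as a product of fields\<close>

definition comm :: "'a mat set" where
 "comm = {a \<in> Mat n. a * \<gamma> = \<gamma> * a}"

text \<open>The eigenvalue of \<open>a\<close> on the \<open>i\<close>-th column of
  \<open>V\<close>. For fixed \<open>i\<close> this is a character of the commutant, and all of them
  together separate its elements.\<close>

definition ev :: "'a mat => nat => 'a alg_closure" where
 "ev a i = (Vi * ac a * V) $$ (i, i)"

lemma comm_carrier: "a \<in> comm ==> a \<in> Mat n" by (simp add: comm_def)

lemma comm_cj: "a \<in> comm ==> ac a = cj (ev a)"
proof -
 assume a: "a \<in> comm"
 have ac: "ac a \<in> Mat n" using comm_carrier[OF a] by simp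
 have "ac a * ac \<gamma> = ac \<gamma> * ac a" using a \<gamma>(1) by (simp add: comm_def flip: ac_mult)
 hence "Vi * ac a * V = dmat n (ev a)" using commuting_diagonal[OF V _ l(1,2) ac] \<gamma>(1) unfolding ev_def by simp
 hence "V * (Vi * ac a * V) * Vi = cj (ev a)" by (simp add: cj_def)
 moreover have "V * (Vi * ac a * V) * Vi = (V * (Vi * ac a)) * (V * Vi)" using V ac by (simp add: as cl del: V(3))
 moreover have "V * (Vi * ac a) = ac a" by (rule sq_inv_cancel(1)[OF V ac])
 ultimately show ?thesis using ac right_mult_one_mat[OF ac] by (simp add: V(3))
qed

lemma cj_comm: "a \<in> Mat n ==> ac a = cj d ==> a \<in> comm" "a \<in> Mat n ==> ac a = cj d ==> i < n ==> ev a i = d i"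
proof -
 assume a: "a \<in> Mat n" "ac a = cj d"
 have "ac (a * \<gamma>) = ac (\<gamma> * a)"
  unfolding ac_mult[OF a(1) \<gamma>(1)] ac_mult[OF \<gamma>(1) a(1)] a(2) gamma_cj cj_mult by (simp add: mult.commute)
 thus c: "a \<in> comm" using a(1) by (simp add: comm_def map_mat_inj)
 show "i < n ==> ev a i = d i" by (rule cj_eqD) (use comm_cj[OF c] a(2) in simp_all)
qed

lemma comm_eqI: "a \<in> comm ==> b \<in> comm ==> (\<And>i. i < n ==> ev a i = ev b i) ==> a = b"
 using comm_cj[of a] comm_cj[of b] cj_cong[of "ev a" "ev b"] map_mat_inj by metis

lemma comm_mult: "a \<in> comm ==> b \<in> comm ==> a * b \<in> comm \<and> (\<forall>i<n. ev (a * b) i = ev a i * ev b i)"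
proof -
 assume a: "a \<in> comm" "b \<in> comm"
 note c = comm_carrier[OF a(1)] comm_carrier[OF a(2)]
 have "ac (a * b) = cj (\<lambda>i. ev a i * ev b i)" unfolding ac_mult[OF c] comm_cj[OF a(1)] comm_cj[OF a(2)] by (rule cj_mult)
 from cj_comm[OF sq_closed(3)[OF c] this] show ?thesis by blast
qed

lemma comm_add: "a \<in> comm ==> b \<in> comm ==> a + b \<in> comm \<and> (\<forall>i<n. ev (a + b) i = ev a i + ev b i)"
proof -
 assume a: "a \<in> comm" "b \<in> comm"
 note c = comm_carrier[OF a(1)] comm_carrier[OF a(2)]
 have "ac (a + b) = ac a + ac b" using c by (intro eq_matI) auto
 hence "ac (a + b) = cj (\<lambda>i. ev a i + ev b i)" unfolding comm_cj[OF a(1)] comm_cj[OF a(2)] cj_add .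
 from cj_comm[OF sq_closed(1)[OF c] this] show ?thesis by blast
qed

lemma comm_diff: "a \<in> comm ==> b \<in> comm ==> a - b \<in> comm \<and> (\<forall>i<n. ev (a - b) i = ev a i - ev b i)"
proof -
 assume a: "a \<in> comm" "b \<in> comm"
 note c = comm_carrier[OF a(1)] comm_carrier[OF a(2)]
 have "ac (a - b) = cj (\<lambda>i. ev a i - ev b i)" unfolding ac_diff[OF c] comm_cj[OF a(1)] comm_cj[OF a(2)] by (rule cj_diff)
 from cj_comm[OF sq_closed(2)[OF c] this] show ?thesis by blast
qed

lemma comm_smult: "a \<in> comm ==> x \<cdot> a \<in> comm \<and> (\<forall>i<n. ev (x \<cdot> a) i = to_ac x * ev a i)"
proof -
 assume a: "a \<in> comm"
 note c = comm_carrier[OF a]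
 have "ac (x \<cdot> a) = to_ac x \<cdot> ac a" using c by (intro eq_matI) auto
 hence "ac (x \<cdot> a) = cj (\<lambda>i. to_ac x * ev a i)" unfolding comm_cj[OF a] cj_smult .
 from cj_comm[OF sq_closed(5)[OF c] this] show ?thesis by blast
qed

lemma comm_one: "Id n \<in> comm \<and> (\<forall>i<n. ev (Id n) i = 1)"
proof -
 have "ac (Id n) = cj (\<lambda>_. 1)" by (simp add: cj_one)
 from cj_comm[OF one_carrier_mat this] show ?thesis by blast
qed

lemma comm_zero: "0\<^sub>m n n \<in> comm \<and> (\<forall>i<n. ev (0\<^sub>m n n) i = 0)"
proof -
 have "ac (0\<^sub>m n n) = cj (\<lambda>_. 0)" unfolding cj_zero by (intro eq_matI) auto
 from cj_comm[OF zero_carrier_mat this] show ?thesis by blast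
qed

lemma comm_det: "a \<in> comm ==> to_ac (det a) = (\<Prod>i<n. ev a i)"
 using det_cj[of "ev a"] comm_cj[of a] by (metis det_map_ac)

lemma comm_commute: "a \<in> comm ==> b \<in> comm ==> a * b = b * a" by (rule comm_eqI) (auto simp: comm_mult mult.commute)

text \<open>A linear system over \<open>F\<close> solvable over the algebraic closure is solvable over \<open>F\<close>; here the
 system says that \<open>b\<close> is a generalized inverse of \<open>a\<close> in the commutant.\<close>

lemma comm_generalized_inverse:
 assumes a: "a \<in> comm"
 obtains b where "b \<in> comm" "a * b * a = a"
proof -
 note ac = comm_carrier[OF a]
 obtain \<phi> :: "'a alg_closure => 'a" where \<phi>: "\<forall>x y. \<phi> (x + y) = \<phi> x + \<phi> y"
  "\<forall>a x. \<phi> (to_ac a * x) = a * \<phi> x" "\<phi> 1 = 1" by (rule to_ac_functional)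
 have \<phi>0: "\<phi> 0 = 0" using \<phi>(2)[rule_format, of 0 0] by simp
 have \<phi>sum: "\<phi> (sum g I) = (\<Sum>i\<in>I. \<phi> (g i))" if "finite I" for g and I :: "nat set"
  using that by (induction I) (auto simp: \<phi>0 \<phi>(1)[rule_format])
 have \<phi>l: "map_mat \<phi> (ac M * N) = M * map_mat \<phi> N" if c: "M \<in> Mat n" "N \<in> Mat n" for M N
 proof (rule sqI)
  fix i j assume ij: "i < n" "j < n"
  have "map_mat \<phi> (ac M * N) $$ (i, j) = \<phi> ((ac M * N) $$ (i, j))" using c ij by simp
  also have "\<dots> = (M * map_mat \<phi> N) $$ (i, j)"
   using c ij sq_mult_index[OF ac_carrier[OF c(1)] c(2) ij] sq_mult_index[of M n "map_mat \<phi> N" i j]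
   by (simp add: \<phi>sum \<phi>(2)[rule_format] del: index_mult_mat(1))
  finally show "map_mat \<phi> (ac M * N) $$ (i, j) = (M * map_mat \<phi> N) $$ (i, j)" .
 qed (use c in auto)
 have \<phi>r: "map_mat \<phi> (N * ac M) = map_mat \<phi> N * M" if c: "M \<in> Mat n" "N \<in> Mat n" for M N
 proof (rule sqI)
  fix i j assume ij: "i < n" "j < n"
  have "map_mat \<phi> (N * ac M) $$ (i, j) = \<phi> ((N * ac M) $$ (i, j))" using c ij by simp
  also have "\<dots> = (map_mat \<phi> N * M) $$ (i, j)"
   using c ij sq_mult_index[OF c(2) ac_carrier[OF c(1)] ij] sq_mult_index[of "map_mat \<phi> N" n M i j]
   by (simp add: \<phi>sum \<phi>(2)[rule_format] mult.commute[of _ "to_ac _"] mult.commute[of _ "M $$ _"] del: index_mult_mat(1))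
  finally show "map_mat \<phi> (N * ac M) $$ (i, j) = (map_mat \<phi> N * M) $$ (i, j)" .
 qed (use c in auto)
 define d where "d i = (if ev a i = 0 then 0 else inverse (ev a i))" for i
 let ?b = "map_mat \<phi> (cj d)"
 have bc: "?b \<in> Mat n" using cj_carrier[of d] by simp
 have id: "map_mat \<phi> (ac M) = M" if "M \<in> Mat n" for M
  using that \<phi>(2)[rule_format, of _ 1] \<phi>(3) by (intro eq_matI) auto
 have "?b * \<gamma> = \<gamma> * ?b"
  unfolding \<phi>l[OF \<gamma>(1) cj_carrier, symmetric] \<phi>r[OF \<gamma>(1) cj_carrier, symmetric] gamma_cj cj_mult by (simp add: mult.commute)
 hence "?b \<in> comm" using bc by (simp add: comm_def)
 moreover have "a * ?b * a = a"
 proof -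
  have 1: "ac a * cj d \<in> Mat n" by (rule sq_closed(3)[OF ac_carrier[OF ac] cj_carrier])
  have "ac a * cj d * ac a = ac a" unfolding comm_cj[OF a] cj_mult by (rule cj_cong) (simp add: d_def)
  hence "map_mat \<phi> (ac a * cj d * ac a) = a" using id[OF ac] by simp
  thus ?thesis unfolding \<phi>r[OF ac 1] \<phi>l[OF ac cj_carrier] .
 qed
 ultimately show ?thesis by (rule that)
qed

text \<open>Idempotents of the commutant are encoded by their supports: \<open>U\<close> is
  admissible when the projector onto the eigenlines with index in \<open>U\<close> has entries in
  \<open>F\<close>. Inclusion of sets then replaces divisibility of idempotents.\<close>

definition idem :: "nat set => bool" where
 "idem U \<longleftrightarrow> U \<subseteq> {..<n} \<and> (\<exists>e \<in> comm. \<forall>i<n. ev e i = (if i \<in> U then 1 else 0))"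

definition idm :: "nat set => 'a mat" where
 "idm U = (SOME e. e \<in> comm \<and> (\<forall>i<n. ev e i = (if i \<in> U then 1 else 0)))"

lemma idm: "idem U ==> idm U \<in> comm" "idem U ==> i < n ==> ev (idm U) i = (if i \<in> U then 1 else 0)"
proof -
 assume "idem U"
 hence "\<exists>e. e \<in> comm \<and> (\<forall>i<n. ev e i = (if i \<in> U then 1 else 0))" by (auto simp: idem_def)
 from someI_ex[OF this] show "idm U \<in> comm" "i < n ==> ev (idm U) i = (if i \<in> U then 1 else 0)"
  unfolding idm_def by blast+
qed

lemma idemI: "U \<subseteq> {..<n} ==> e \<in> comm ==> (\<And>i. i < n ==> ev e i = (if i \<in> U then 1 else 0)) ==> idem U"
 unfolding idem_def by blast

lemma idem_sub: "idem U ==> U \<subseteq> {..<n}" by (simp add: idem_def)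

text \<open>If \<open>b\<close> is a generalized inverse of \<open>a\<close>, then
  \<open>a * b\<close> has eigenvalue \<open>1\<close> where \<open>a\<close> is invertible and
  \<open>0\<close> elsewhere.\<close>

lemma idem_support:
 assumes a: "a \<in> comm"
 shows "idem {i. i < n \<and> ev a i \<noteq> 0}"
proof -
 obtain b where b: "b \<in> comm" "a * b * a = a" by (rule comm_generalized_inverse[OF a])
 have ab: "a * b \<in> comm" "\<forall>i<n. ev (a * b) i = ev a i * ev b i" using comm_mult[OF a b(1)] by blast+
 have "\<forall>i<n. ev (a * b * a) i = ev a i * ev b i * ev a i" using comm_mult[OF ab(1) a] ab(2) by simp
 hence 1: "ev a i * ev b i * ev a i = ev a i" if "i < n" for i using that b(2) by simp
 show ?thesis
 proof (rule idemI[OF _ ab(1)])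
  fix i assume i: "i < n"
  show "ev (a * b) i = (if i \<in> {i. i < n \<and> ev a i \<noteq> 0} then 1 else 0)" using 1[OF i] i ab(2) by auto
 qed auto
qed

lemma idem_Int: "idem U ==> idem W ==> idem (U \<inter> W)"
 by (rule idemI[of _ "idm U * idm W"]) (auto simp: idm comm_mult dest: idem_sub)

lemma idem_Diff: "idem U ==> idem W ==> idem (U - W)"
 by (rule idemI[of _ "idm U - idm U * idm W"]) (auto simp: idm comm_mult comm_diff dest: idem_sub)

lemma idem_full: "idem {..<n}" by (rule idemI[of _ "Id n"]) (auto simp: comm_one)

text \<open>The supports of the primitive idempotents, hence the field factors of the
  commutant.\<close>

definition atom :: "nat set => bool" where
 "atom U \<longleftrightarrow> idem U \<and> U \<noteq> {} \<and> (\<forall>W. idem W --> W \<subseteq> U --> W = {} \<or> W = U)"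

lemma atomD: "atom U ==> idem U" "atom U ==> U \<noteq> {}" "atom U ==> U \<subseteq> {..<n}" "atom U ==> finite U"
 unfolding atom_def idem_def using finite_subset[of U "{..<n}"] by auto

lemma atom_disjoint: "atom U ==> atom W ==> i \<in> U ==> i \<in> W ==> U = W"
proof -
 assume U: "atom U" "atom W" and i: "i \<in> U" "i \<in> W"
 have "idem (U \<inter> W)" using U by (intro idem_Int atomD)
 hence "U \<inter> W = U" "U \<inter> W = W" using U i unfolding atom_def by blast+
 thus "U = W" by blast
qed

text \<open>An admissible set of least cardinality containing \<open>i\<close> is an atom: a smaller
  admissible part either contains \<open>i\<close> itself or has a complement that does.\<close>

lemma atom_exists:
 assumes "i < n"
 obtains U where "atom U" "i \<in> U"
proof -
 define P where "P U \<longleftrightarrow> idem U \<and> i \<in> U" for U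
 have "P {..<n}" using idem_full assms by (simp add: P_def)
 then obtain U where U: "P U" "\<And>W. P W ==> card U \<le> card W" using ex_has_least_nat[of P "{..<n}" card] by blast
 have fU: "finite U" using U(1) finite_subset[of U "{..<n}"] by (auto simp: P_def idem_def)
 have "W = {} \<or> W = U" if W: "idem W" "W \<subseteq> U" for W
 proof (cases "i \<in> W")
  case True
  hence "card U \<le> card W" using W U(2) by (simp add: P_def)
  thus ?thesis using W fU card_seteq by blast
 next
  case False
  have "idem (U - W)" using U(1) W by (intro idem_Diff) (auto simp: P_def)
  hence "card U \<le> card (U - W)" using U False by (simp add: P_def)
  hence "U - W = U" using fU by (intro card_seteq) auto
  thus ?thesis using W by blast
 qed
 hence "atom U" using U(1) by (auto simp: atom_def P_def)
 thus thesis using that U(1) by (simp add: P_def)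
qed

text \<open>The factor at an atom is a field: the support of \<open>a\<close> cuts out an admissible
  part of \<open>U\<close>, which is all of \<open>U\<close> or empty.\<close>

lemma atom_ev:
 assumes "atom U" "a \<in> comm" "i \<in> U" "ev a i = 0" "j \<in> U"
 shows "ev a j = 0"
proof (rule ccontr)
 assume j: "ev a j \<noteq> 0"
 let ?W = "U \<inter> {i. i < n \<and> ev a i \<noteq> 0}"
 have "idem ?W" by (rule idem_Int[OF atomD(1)[OF assms(1)] idem_support[OF assms(2)]])
 moreover have "j \<in> ?W" "i \<notin> ?W" using assms j atomD(3)[OF assms(1)] by auto
 ultimately show False using assms(1,3) unfolding atom_def by blast
qed

text \<open>The norm to \<open>F\<close> of the component at \<open>U\<close>. The summand
  \<open>Id n - idm U\<close> acts as \<open>1\<close> on all other components, so the determinant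
  sees only those eigenvalues with index in \<open>U\<close>.\<close>

definition nrm :: "nat set => 'a mat => 'a" where
 "nrm U a = det (a * idm U + (Id n - idm U))"

lemma nrm_ev:
 assumes U: "idem U" and a: "a \<in> comm"
 shows "to_ac (nrm U a) = (\<Prod>i\<in>U. ev a i)"
proof -
 note e = idm[OF U] comm_one
 have 1: "a * idm U \<in> comm" "\<forall>i<n. ev (a * idm U) i = ev a i * ev (idm U) i" using comm_mult[OF a e(1)] by blast+
 have 2: "Id n - idm U \<in> comm" "\<forall>i<n. ev (Id n - idm U) i = 1 - ev (idm U) i" using comm_diff[of "Id n", OF _ e(1)] comm_one by auto
 have 3: "a * idm U + (Id n - idm U) \<in> comm" "\<forall>i<n. ev (a * idm U + (Id n - idm U)) i = (if i \<in> U then ev a i else 1)"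
  using comm_add[OF 1(1) 2(1)] 1(2) 2(2) idm(2)[OF U] by auto
 have "to_ac (nrm U a) = (\<Prod>i<n. if i \<in> U then ev a i else 1)"
  unfolding nrm_def comm_det[OF 3(1)] using 3(2) by (intro prod.cong) auto
 also have "\<dots> = (\<Prod>i\<in>{..<n} \<inter> U. ev a i)" by (rule prod.inter_restrict[symmetric]) simp
 also have "{..<n} \<inter> U = U" using idem_sub[OF U] by blast
 finally show ?thesis .
qed

lemma nrm_mult:
 assumes "idem U" "a \<in> comm" "b \<in> comm"
 shows "nrm U (a * b) = nrm U a * nrm U b"
proof -
 have "to_ac (nrm U (a * b)) = to_ac (nrm U a) * to_ac (nrm U b)"
  using comm_mult[OF assms(2,3)] idem_sub[OF assms(1)] nrm_ev[OF assms(1)] assms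
  by (simp flip: prod.distrib) (intro prod.cong, auto)
 thus ?thesis by (metis to_ac_mult to_ac_eq_iff)
qed

lemma nrm_one: "idem U ==> nrm U (Id n) = 1"
proof -
 assume U: "idem U"
 have "to_ac (nrm U (Id n)) = (\<Prod>i\<in>U. 1)"
  unfolding nrm_ev[OF U conjunct1[OF comm_one]] using comm_one idem_sub[OF U] by (intro prod.cong) auto
 thus ?thesis by simp
qed

lemma nrm_smult: "idem U ==> a \<in> comm ==> nrm U (x \<cdot> a) = x ^ card U * nrm U a"
proof -
 assume U: "idem U" and a: "a \<in> comm"
 have xa: "x \<cdot> a \<in> comm" "\<forall>i<n. ev (x \<cdot> a) i = to_ac x * ev a i" using comm_smult[OF a] by blast+
 have "to_ac (nrm U (x \<cdot> a)) = (\<Prod>i\<in>U. to_ac x * ev a i)"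
  unfolding nrm_ev[OF U xa(1)] using xa(2) idem_sub[OF U] by (intro prod.cong) auto
 also have "\<dots> = to_ac (x ^ card U * nrm U a)" unfolding to_ac_mult nrm_ev[OF U a] prod.distrib by simp
 finally show ?thesis by (simp only: to_ac_eq_iff)
qed

end

context padic_field
begin

text \<open>Limits inherit polynomial identities by continuity; commutants and isometry groups are
  seen to be closed in this way.\<close>

lemma mconv_poly_eq:
 assumes FG: "poly_mat n UNIV F" "poly_mat n UNIV G" and \<sigma>: "mconv n \<sigma> L" "\<And>k. F (\<sigma> k) = G (\<sigma> k)"
 shows "F L = G L"
proof -
 have s: "\<sigma> k \<in> Mat n" "L \<in> Mat n" for k using \<sigma>(1) by (auto simp: mconv_def)
 have 1: "mconv n (\<lambda>k. F (\<sigma> k)) (F L)" "mconv n (\<lambda>k. F (\<sigma> k)) (G L)"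
  using poly_mat_mconv[OF FG(1) \<sigma>(1)] poly_mat_mconv[OF FG(2) \<sigma>(1)] by (simp_all add: \<sigma>(2))
 show ?thesis
 proof (rule sq_eqI[OF poly_matD(1)[OF FG(1) s(2)] poly_matD(1)[OF FG(2) s(2)]])
  fix i j assume ij: "i < n" "j < n"
  have 2: "(\<lambda>k. absv (F (\<sigma> k) $$ (i, j) - F L $$ (i, j))) \<longlonglongrightarrow> 0" "(\<lambda>k. absv (F (\<sigma> k) $$ (i, j) - G L $$ (i, j))) \<longlonglongrightarrow> 0"
   using 1 ij by (auto simp: mconv_def)
  have "(\<lambda>k. absv (F (\<sigma> k) $$ (i, j) - F L $$ (i, j)) + absv (F (\<sigma> k) $$ (i, j) - G L $$ (i, j))) \<longlonglongrightarrow> 0 + 0"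
   by (rule tendsto_add[OF 2])
  hence lim: "(\<lambda>k. absv (F (\<sigma> k) $$ (i, j) - F L $$ (i, j)) + absv (F (\<sigma> k) $$ (i, j) - G L $$ (i, j))) \<longlonglongrightarrow> 0" by simp
  have "absv (F L $$ (i, j) - G L $$ (i, j)) \<le> 0"
  proof (rule LIMSEQ_le_const[OF lim], intro exI allI impI)
   fix k
   have "absv (F L $$ (i, j) - G L $$ (i, j)) \<le> max (absv (F L $$ (i, j) - F (\<sigma> k) $$ (i, j))) (absv (F (\<sigma> k) $$ (i, j) - G L $$ (i, j)))"
    by (rule absv_dist_triangle)
   also have "\<dots> \<le> absv (F (\<sigma> k) $$ (i, j) - F L $$ (i, j)) + absv (F (\<sigma> k) $$ (i, j) - G L $$ (i, j))"
    using absv_nonneg absv_commute[of "F L $$ (i, j)"] by (simp add: max_def)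
   finally show "absv (F L $$ (i, j) - G L $$ (i, j)) \<le> absv (F (\<sigma> k) $$ (i, j) - F L $$ (i, j)) + absv (F (\<sigma> k) $$ (i, j) - G L $$ (i, j))" .
  qed
  hence "absv (F L $$ (i, j) - G L $$ (i, j)) = 0" using absv_nonneg by (intro antisym) auto
  thus "F L $$ (i, j) = G L $$ (i, j)" by (simp add: absv_eq_0_iff)
 qed
qed

lemma mconv_mbd:
 assumes \<sigma>: "mconv n \<sigma> L" "\<And>k. mbd n R (\<sigma> k)"
 shows "mbd n R L" unfolding mbd_def
proof (intro conjI allI impI)
 show "L \<in> Mat n" using \<sigma> by (simp add: mconv_def)
 fix i j assume ij: "i < n" "j < n"
 have "(\<lambda>k. absv (\<sigma> k $$ (i, j) - L $$ (i, j))) \<longlonglongrightarrow> 0" using \<sigma> ij by (simp add: mconv_def)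
 from LIMSEQ_le_const2[OF tendsto_absv_bounded[OF this], of R] show "absv (L $$ (i, j)) \<le> R"
  using mbd_index[OF \<sigma>(2) ij] by blast
qed

end

section \<open>The adjoint involution and the isometries in the commutant\<close>

context spectral
begin

text \<open>The adjoint with respect to \<open>J\<close>, so that an isometry is an element whose
  adjoint is its inverse. It is an involution because \<open>J\<close> is symmetric up to the sign
  \<open>s\<close>.\<close>

definition star :: "'a mat => 'a mat" where
 "star a = J * a\<^sup>T * Ji"

lemma star_carrier: "a \<in> Mat n ==> star a \<in> Mat n" unfolding star_def using J by (auto intro!: cl)

lemma star_mult: "a \<in> Mat n ==> b \<in> Mat n ==> star (a * b) = star b * star a"
proof -
 assume a: "a \<in> Mat n" "b \<in> Mat n"
 have t: "a\<^sup>T \<in> Mat n" "b\<^sup>T \<in> Mat n" using a by auto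
 have "star b * star a = J * (b\<^sup>T * (Ji * (J * (a\<^sup>T * Ji))))"
  unfolding star_def using J(1,2) t by (simp add: as cl)
 also have "Ji * (J * (a\<^sup>T * Ji)) = a\<^sup>T * Ji"
  by (rule sq_inv_cancel(1)[OF J(2,1) inverses(1)]) (use J t in "auto intro!: cl")
 finally show ?thesis unfolding star_def using a J(1,2) t by (simp add: tp as cl)
qed

lemma star_add: "a \<in> Mat n ==> b \<in> Mat n ==> star (a + b) = star a + star b"
 unfolding star_def using J(1,2) by (simp add: tp ds cl)

lemma star_diff: "a \<in> Mat n ==> b \<in> Mat n ==> star (a - b) = star a - star b"
 unfolding star_def using J(1,2) by (simp add: tp ds cl)

lemma star_one: "star (Id n) = Id n" unfolding star_def using J by simp

lemma det_star: "a \<in> Mat n ==> det (star a) = det a"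
proof -
 assume a: "a \<in> Mat n"
 have t: "a\<^sup>T \<in> Mat n" using a by simp
 have "det J * det Ji = 1" using det_mult[OF J(1,2)] J(3) by simp
 thus ?thesis unfolding star_def det_mult[OF sq_closed(3)[OF J(1) t] J(2)] det_mult[OF J(1) t] det_transpose[OF a]
  by (simp add: mult_ac)
qed

lemma ss_smult: "s \<cdot> (s \<cdot> M) = M" using ss by (intro eq_matI) (auto simp flip: mult.assoc)

lemma transpose_Ji: "Ji\<^sup>T = s \<cdot> Ji"
proof -
 have t: "Ji\<^sup>T \<in> Mat n" using J by simp
 have "Ji\<^sup>T * J = Ji\<^sup>T * (s \<cdot> J\<^sup>T)" by (simp only: J(4) ss_smult)
 also have "\<dots> = s \<cdot> (J * Ji)\<^sup>T" using J(1,2) t by (simp add: tp ds cl)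
 also have "\<dots> = (s \<cdot> Ji) * J" unfolding J(3) ds(5)[OF J(2,1)] inverses(1) by simp
 finally show ?thesis by (rule mat_cancel_right[OF t sq_closed(5)[OF J(2)] J(1) inverses(4)])
qed

lemma star_star: "a \<in> Mat n ==> star (star a) = a"
proof -
 assume a: "a \<in> Mat n"
 have t: "a\<^sup>T \<in> Mat n" using a by simp
 have 1: "(J * a\<^sup>T * Ji)\<^sup>T = (s \<cdot> Ji) * (a * (s \<cdot> J))"
  unfolding transpose_Ji[symmetric] J(4)[symmetric] using J(1,2) a t by (simp add: tp as cl)
 also have "\<dots> = Ji * (a * J)" using J(1,2) a by (simp add: ds cl ss_smult)
 finally have "star (star a) = J * (Ji * (a * J)) * Ji" unfolding star_def by simp
 also have "J * (Ji * (a * J)) = a * J" by (rule sq_inv_cancel(1)[OF J(1,2,3) sq_closed(3)[OF a J(1)]])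
 also have "a * J * Ji = a" using as[OF a J(1,2)] a J(3) by simp
 finally show ?thesis .
qed

text \<open>The adjoint of \<gamma> is its inverse, and commuting with \<gamma> is the same as
  commuting with the inverse.\<close>

lemma star_comm: "a \<in> comm ==> star a \<in> comm"
proof -
 assume a: "a \<in> comm"
 note ac = comm_carrier[OF a]
 have ag: "a * \<gamma>i = \<gamma>i * a"
 proof -
  have "\<gamma>i \<in> comm" using \<gamma>(1-3) inverses(2) by (simp add: comm_def)
  thus ?thesis by (rule comm_commute[OF a])
 qed
 have t: "a\<^sup>T \<in> Mat n" "\<gamma>i\<^sup>T \<in> Mat n" using ac \<gamma> by auto
 have gJ: "\<gamma> * J = J * \<gamma>i\<^sup>T"
 proof -
  have "J * \<gamma>i\<^sup>T = J * (Ji * (\<gamma> * J))" unfolding gt(3)[symmetric] using J \<gamma> by (simp add: as cl)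
  thus ?thesis using sq_inv_cancel(1)[OF J(1,2,3) sq_closed(3)[OF \<gamma>(1) J(1)]] by simp
 qed
 have Jig: "Ji * \<gamma> = \<gamma>i\<^sup>T * Ji"
 proof -
  have "\<gamma>i\<^sup>T * Ji = Ji * \<gamma> * J * Ji" by (simp only: gt(3))
  also have "\<dots> = Ji * \<gamma> * (J * Ji)" by (rule as) (use J \<gamma> in "auto intro!: cl")
  finally show ?thesis unfolding J(3) using right_mult_one_mat[OF sq_closed(3)[OF J(2) \<gamma>(1)]] by simp
 qed
 have "star a * \<gamma> = J * (a\<^sup>T * (Ji * \<gamma>))" unfolding star_def using J(1,2) t \<gamma>(1) by (simp add: as cl)
 also have "\<dots> = J * (a\<^sup>T * \<gamma>i\<^sup>T) * Ji" unfolding Jig using J(1,2) t by (simp add: as cl)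
 also have "a\<^sup>T * \<gamma>i\<^sup>T = \<gamma>i\<^sup>T * a\<^sup>T"
  using arg_cong[OF ag, of transpose_mat] sq_transpose(3)[OF ac \<gamma>(2)] sq_transpose(3)[OF \<gamma>(2) ac] by simp
 also have "J * (\<gamma>i\<^sup>T * a\<^sup>T) * Ji = (J * \<gamma>i\<^sup>T) * a\<^sup>T * Ji" using J(1,2) t by (simp add: as cl)
 also have "\<dots> = \<gamma> * star a" unfolding gJ[symmetric] star_def using J(1,2) t \<gamma>(1) by (simp add: as cl)
 finally show ?thesis using star_carrier[OF ac] by (simp add: comm_def)
qed

lemma comm_idempotent:
 assumes e: "e \<in> comm" "e * e = e"
 shows "idem {i. i < n \<and> ev e i \<noteq> 0}" "idm {i. i < n \<and> ev e i \<noteq> 0} = e"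
proof -
 let ?U = "{i. i < n \<and> ev e i \<noteq> 0}"
 have "ev e i * ev e i = ev e i" if "i < n" for i using comm_mult[OF e(1,1)] e(2) that by simp
 hence 1: "ev e i = (if i \<in> ?U then 1 else 0)" if "i < n" for i using that by auto
 show I: "idem ?U" by (rule idemI[OF _ e(1) 1]) auto
 show "idm ?U = e"
 proof (rule comm_eqI[OF idm(1)[OF I] e(1)])
  show "ev (idm ?U) i = ev e i" if "i < n" for i by (rule trans[OF idm(2)[OF I that] 1[OF that, symmetric]])
 qed
qed

lemma idm_idempotent: "idem U ==> idm U * idm U = idm U" by (rule comm_eqI) (auto simp: idm comm_mult)

text \<open>The action of the adjoint involution on idempotents, transported to their supports. It
  permutes the atoms and is of order two there.\<close>

definition st :: "nat set => nat set" where
 "st U = {i. i < n \<and> ev (star (idm U)) i \<noteq> 0}"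

lemma st_idem:
 assumes U: "idem U"
 shows "idem (st U)" "idm (st U) = star (idm U)"
proof -
 note c = comm_carrier[OF idm(1)[OF U]]
 have "star (idm U) * star (idm U) = star (idm U)" using star_mult[OF c c] idm_idempotent[OF U] by simp
 from comm_idempotent[OF star_comm[OF idm(1)[OF U]] this]
 show "idem (st U)" "idm (st U) = star (idm U)" by (simp_all add: st_def)
qed

lemma st_st: "idem U ==> st (st U) = U"
proof -
 assume U: "idem U"
 have "st (st U) = {i. i < n \<and> ev (idm U) i \<noteq> 0}"
  unfolding st_def[of "st U"] st_idem(2)[OF U] star_star[OF comm_carrier[OF idm(1)[OF U]]] ..
 also have "\<dots> = U" using idm(2)[OF U] idem_sub[OF U] by (auto split: if_splits)
 finally show ?thesis .
qed

lemma st_mono: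
 assumes "idem U" "idem W" "U \<subseteq> W"
 shows "st U \<subseteq> st W"
proof
 fix i assume "i \<in> st U"
 hence i: "i < n" "ev (star (idm U)) i \<noteq> 0" by (auto simp: st_def)
 have "idm W * idm U = idm U"
 proof (rule comm_eqI)
  show "ev (idm W * idm U) j = ev (idm U) j" if "j < n" for j
   using comm_mult[OF idm(1)[OF assms(2)] idm(1)[OF assms(1)]] idm(2)[OF assms(1) that] idm(2)[OF assms(2) that] assms(3) that by auto
 qed (use assms idm comm_mult in blast)+
 hence A: "star (idm U) * star (idm W) = star (idm U)"
  using star_mult[OF comm_carrier[OF idm(1)[OF assms(2)]] comm_carrier[OF idm(1)[OF assms(1)]]] by simp
 have "ev (star (idm U) * star (idm W)) i = ev (star (idm U)) i * ev (star (idm W)) i"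
  using comm_mult[OF star_comm[OF idm(1)[OF assms(1)]] star_comm[OF idm(1)[OF assms(2)]]] i by blast
 hence "ev (star (idm W)) i \<noteq> 0" unfolding A using i by auto
 thus "i \<in> st W" using i by (simp add: st_def)
qed

lemma idem_empty: "idem {}" by (rule idemI[of _ "0\<^sub>m n n"]) (auto simp: comm_zero)

lemma st_empty: "st {} = {}"
proof -
 have "idm {} = 0\<^sub>m n n" by (rule comm_eqI) (auto simp: idm[OF idem_empty] comm_zero)
 hence "star (idm {}) = 0\<^sub>m n n" using J by (auto simp: star_def)
 thus ?thesis by (auto simp: st_def comm_zero)
qed

lemma st_atom: "atom U ==> atom (st U)"
proof -
 assume U: "atom U"
 have "st U \<noteq> {}" using st_st[OF atomD(1)[OF U]] st_empty atomD(2)[OF U] by metis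
 moreover have "W = {} \<or> W = st U" if W: "idem W" "W \<subseteq> st U" for W
 proof -
  have "st W \<subseteq> U" using st_mono[OF W(1) st_idem(1)[OF atomD(1)[OF U]] W(2)] st_st[OF atomD(1)[OF U]] by simp
  hence "st W = {} \<or> st W = U" using U st_idem(1)[OF W(1)] by (simp add: atom_def)
  thus ?thesis using st_st[OF W(1)] st_empty by metis
 qed
 ultimately show ?thesis using st_idem(1)[OF atomD(1)[OF U]] by (simp add: atom_def)
qed

lemma nrm_star:
 assumes U: "idem U" and a: "a \<in> comm"
 shows "nrm (st U) (star a) = nrm U a"
proof -
 note c = comm_carrier[OF a] comm_carrier[OF idm(1)[OF U]]
 let ?m = "idm U * a + (Id n - idm U)"
 have m: "?m \<in> Mat n" "Id n - idm U \<in> Mat n" using c by (auto intro!: cl)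
 have "star ?m = star (idm U * a) + star (Id n - idm U)" by (rule star_add) (use c m in "auto intro!: cl")
 also have "\<dots> = star a * idm (st U) + (Id n - idm (st U))"
  unfolding star_mult[OF c(2,1)] star_diff[OF one_carrier_mat c(2)] star_one st_idem(2)[OF U] ..
 finally have "nrm (st U) (star a) = det ?m" unfolding nrm_def det_star[OF m(1), symmetric] by simp
 also have "\<dots> = nrm U a" unfolding nrm_def comm_commute[OF a idm(1)[OF U]] ..
 finally show ?thesis .
qed

text \<open>The isometries in the commutant over \<open>F\<close>;
  \<open>F_points_torus_group\<close> identifies them with the \<open>F\<close>-points of the
  torus.\<close>

definition TF :: "'a mat set" where
 "TF = {t \<in> Mat n. t * \<gamma> = \<gamma> * t \<and> t * J * t\<^sup>T = J}"

lemma TF_iff: "t \<in> TF \<longleftrightarrow> t \<in> comm \<and> t * star t = Id n"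
proof (cases "t \<in> Mat n")
 case True
 hence tt: "t\<^sup>T \<in> Mat n" "t * J * t\<^sup>T \<in> Mat n" using J by (auto intro!: cl)
 have 1: "t * star t = t * J * t\<^sup>T * Ji" unfolding star_def using True J(1,2) tt by (simp add: as cl)
 have "t * J * t\<^sup>T = J \<longleftrightarrow> t * star t = Id n"
  unfolding 1 using J(3) mat_cancel_right[OF tt(2) J(1,2) inverses(5)] by auto
 thus ?thesis using True by (simp add: TF_def comm_def)
qed (auto simp: TF_def comm_def)

lemma TF_comm: "t \<in> TF ==> t \<in> comm" "t \<in> TF ==> t \<in> Mat n" "t \<in> TF ==> t * star t = Id n" "t \<in> TF ==> star t * t = Id n"
 using comm_commute[of t "star t"] star_comm[of t] by (auto simp: TF_iff comm_def)

lemma TF_mult: "t \<in> TF ==> u \<in> TF ==> t * u \<in> TF"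
proof -
 assume t: "t \<in> TF" "u \<in> TF"
 note c = TF_comm(2)[OF t(1)] TF_comm(2)[OF t(2)]
 note d = star_carrier[OF c(1)] star_carrier[OF c(2)]
 have "t * u * star (t * u) = t * (u * (star u * star t))" unfolding star_mult[OF c] using c d by (simp add: as cl)
 also have "u * (star u * star t) = star t" by (rule sq_inv_cancel(1)[OF c(2) d(2) TF_comm(3)[OF t(2)] d(1)])
 also have "t * star t = Id n" by (rule TF_comm[OF t(1)])
 finally show ?thesis using comm_mult[OF TF_comm(1)[OF t(1)] TF_comm(1)[OF t(2)]] by (simp add: TF_iff)
qed

lemma TF_star: "t \<in> TF ==> star t \<in> TF"
proof -
 assume t: "t \<in> TF"
 show ?thesis unfolding TF_iff
  using star_comm[OF TF_comm(1)[OF t]] star_star[OF TF_comm(2)[OF t]] TF_comm(4)[OF t] by simp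
qed

lemma TF_one: "Id n \<in> TF" by (simp add: TF_iff star_one comm_one)

lemma TF_inv:
 assumes t: "t \<in> TF"
 shows "inv\<^bsub>GL n\<^esub> t = star t" "det t \<noteq> 0"
proof -
 note c = TF_comm(2)[OF t]
 show "inv\<^bsub>GL n\<^esub> t = star t" "det t \<noteq> 0" using GL_inv_eqI(1,2)[OF c star_carrier[OF c] TF_comm(3)[OF t]] by blast+
qed

text \<open>The relation \<open>t * star t = 1\<close> makes the norms at \<open>U\<close> and at
  \<open>st U\<close> inverse to each other. At an atom fixed by \<open>st\<close> the norm
  therefore has absolute value one, and only exchanged pairs can carry valuations.\<close>

lemma nrm_TF: "idem U ==> t \<in> TF ==> nrm (st U) t * nrm U t = 1"
proof -
 assume U: "idem U" and t: "t \<in> TF"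
 have "nrm (st U) (t * star t) = nrm (st U) t * nrm U t"
  unfolding nrm_mult[OF st_idem(1)[OF U] TF_comm(1)[OF t] star_comm[OF TF_comm(1)[OF t]]] nrm_star[OF U TF_comm(1)[OF t]] ..
 thus ?thesis by (simp add: TF_comm(3)[OF t] nrm_one st_idem(1)[OF U])
qed

lemma nrm_TF_star: "idem U ==> t \<in> TF ==> nrm U t * nrm U (star t) = 1"
proof -
 assume U: "idem U" and t: "t \<in> TF"
 show ?thesis
  unfolding nrm_mult[OF U TF_comm(1)[OF t] star_comm[OF TF_comm(1)[OF t]], symmetric] TF_comm(3)[OF t] by (rule nrm_one[OF U])
qed

end

section \<open>Compact subgroups\<close>

context spectral
begin

lemma nrm_poly:
 assumes "idem U"
 shows "\<exists>f \<in> poly_funs n UNIV. \<forall>a \<in> Mat n. nrm U a = f a"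
proof -
 have c: "idm U \<in> Mat n" "Id n - idm U \<in> Mat n" using comm_carrier[OF idm(1)[OF assms]] by (auto intro!: cl)
 have "poly_mat n UNIV (\<lambda>a. a * idm U + (Id n - idm U))"
  by (intro poly_mat_add poly_mat_mult poly_mat_id poly_mat_const) (use c in auto)
 thus ?thesis unfolding nrm_def by (rule poly_funs_det) auto
qed

lemma nrm_mconv:
 assumes "idem U" "mconv n \<sigma> a"
 shows "(\<lambda>k. absv (nrm U (\<sigma> k))) \<longlonglongrightarrow> absv (nrm U a)"
proof -
 obtain f where f: "f \<in> poly_funs n UNIV" "\<forall>a \<in> Mat n. nrm U a = f a" using nrm_poly[OF assms(1)] by blast
 have c: "\<forall>k. \<sigma> k \<in> Mat n" "a \<in> Mat n" using assms(2) by (auto simp: mconv_def)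
 show ?thesis using tendsto_absv_bounded[OF poly_funs_mconv[OF f(1) assms(2)]] f(2) c by simp
qed

lemma comm_closed_seq: "mconv n \<sigma> a ==> \<forall>k. \<sigma> k \<in> comm ==> a \<in> comm"
proof -
 assume c: "mconv n \<sigma> a" and k: "\<forall>k. \<sigma> k \<in> comm"
 have "a * \<gamma> = \<gamma> * a" by (rule mconv_poly_eq[OF _ _ c, of "\<lambda>a. a * \<gamma>" "\<lambda>a. \<gamma> * a"])
   (use \<gamma> k in "auto intro!: poly_mat_mult poly_mat_id poly_mat_const simp: comm_def")
 thus ?thesis using c by (simp add: comm_def mconv_def)
qed

lemma idm_part:
 assumes U: "idem U" and a: "a \<in> comm"
 shows "a * idm U \<in> comm" "i < n ==> ev (a * idm U) i = (if i \<in> U then ev a i else 0)"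
  "a * idm U * idm U = a * idm U" "nrm U (a * idm U) = nrm U a"
proof -
 note e = idm(1)[OF U]
 show c: "a * idm U \<in> comm" using comm_mult[OF a e] by blast
 show v: "i < n ==> ev (a * idm U) i = (if i \<in> U then ev a i else 0)" for i using comm_mult[OF a e] idm(2)[OF U] by simp
 show 1: "a * idm U * idm U = a * idm U"
  using as[OF comm_carrier[OF a] comm_carrier[OF e] comm_carrier[OF e]] idm_idempotent[OF U] by simp
 show "nrm U (a * idm U) = nrm U a" unfolding nrm_def 1 ..
qed

text \<open>The component of the commutant at an atom is a field on which \<open>nrm\<close> is a nonvanishing
 homogeneous polynomial, so that the compactness of the unit sphere bounds its unit ball.\<close>

lemma nrm_bounded:
 assumes U: "atom U"
 obtains R where "R \<ge> 1" "\<forall>a\<in>comm. absv (nrm U a) \<le> 1 --> mbd n R (a * idm U)"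
proof (rule ccontr)
 assume no: "\<not> thesis"
 note iU = atomD(1)[OF U]
 have "\<exists>a\<in>comm. absv (nrm U a) \<le> 1 \<and> \<not> mbd n (real k + 1) (a * idm U)" for k :: nat
 proof (rule ccontr)
  assume "\<not> ?thesis"
  hence "\<forall>a\<in>comm. absv (nrm U a) \<le> 1 --> mbd n (real k + 1) (a * idm U)" by blast
  from that[OF _ this] show False using no by simp
 qed
 then obtain a where a: "\<forall>k. a k \<in> comm \<and> absv (nrm U (a k)) \<le> 1 \<and> \<not> mbd n (real k + 1) (a k * idm U)" by metis
 define b where "b k = a k * idm U" for k
 have b: "b k \<in> comm" "b k * idm U = b k" "absv (nrm U (b k)) \<le> 1" "\<not> mbd n (real k + 1) (b k)" for k
  using idm_part[OF iU, of "a k"] a[rule_format, of k] by (simp_all add: b_def)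
 have bc: "b k \<in> Mat n" for k by (rule comm_carrier[OF b(1)])
 \<comment> \<open>\<open>y\<close> is an entry of largest absolute value. Dividing by it puts the
   sequence on the unit sphere, with an entry exactly \<open>1\<close>, while the norm, being
   homogeneous of positive degree, tends to zero.\<close>
 have "\<exists>y. y \<noteq> 0 \<and> absv y \<ge> real k + 1 \<and> mbd n (absv y) (b k) \<and> (\<exists>i<n. \<exists>j<n. b k $$ (i, j) = y)" for k
 proof -
  let ?S = "(\<lambda>(i, j). absv (b k $$ (i, j))) ` ({..<n} \<times> {..<n})"
  have fin: "finite ?S" "?S \<noteq> {}" using n0 by auto
  obtain i j where ij: "i < n" "j < n" "Max ?S = absv (b k $$ (i, j))" using Max_in[OF fin] by auto
  let ?y = "b k $$ (i, j)"
  have m: "mbd n (absv ?y) (b k)" unfolding mbd_def ij(3)[symmetric] using bc fin by (auto intro!: Max_ge)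
  have ge: "absv ?y > real k + 1"
  proof (rule ccontr)
   assume "\<not> ?thesis"
   with mbd_mono[OF m, of "real k + 1"] b(4)[of k] show False by simp
  qed
  hence "?y \<noteq> 0" using absv_0 by (metis add_nonneg_pos less_numeral_extra(1) not_less_iff_gr_or_eq of_nat_0_le_iff)
  thus ?thesis using m ge ij by (intro exI[of _ ?y]) auto
 qed
 then obtain y where y: "\<forall>k. y k \<noteq> 0 \<and> absv (y k) \<ge> real k + 1 \<and> mbd n (absv (y k)) (b k) \<and> (\<exists>i<n. \<exists>j<n. b k $$ (i, j) = y k)" by metis
 define z where "z k = inverse (y k) \<cdot> b k" for k
 have z: "z k \<in> comm" "z k * idm U = z k" "mbd n 1 (z k)" "\<exists>i<n. \<exists>j<n. z k $$ (i, j) = 1" "absv (nrm U (z k)) \<le> 1 / (real k + 1)" for k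
 proof -
  show zc: "z k \<in> comm" unfolding z_def using comm_smult[OF b(1)] by blast
  show "z k * idm U = z k" unfolding z_def using ds(5)[OF bc comm_carrier[OF idm(1)[OF iU]]] b(2) by simp
  have "mbd n (absv (inverse (y k)) * absv (y k)) (z k)" unfolding z_def by (rule mbd_smult) (use y absv_nonneg in auto)
  moreover have "absv (inverse (y k)) * absv (y k) = 1" using y absv_pos[of "y k"] by (simp add: absv_inverse)
  ultimately show "mbd n 1 (z k)" by simp
  obtain i j where ij: "i < n" "j < n" "b k $$ (i, j) = y k" using y by blast
  hence "z k $$ (i, j) = 1" unfolding z_def using bc[of k] y by simp
  thus "\<exists>i<n. \<exists>j<n. z k $$ (i, j) = 1" using ij by blast
  have cU: "card U \<ge> 1" using atomD(2,4)[OF U] by (simp add: Suc_le_eq card_gt_0_iff)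
  have yi: "absv (inverse (y k)) \<le> 1 / (real k + 1)" unfolding absv_inverse using y[rule_format, of k] by (simp add: field_simps)
  have y1: "absv (inverse (y k)) \<le> 1" by (rule order_trans[OF yi]) simp
  have "absv (nrm U (z k)) = absv (inverse (y k)) ^ card U * absv (nrm U (b k))"
   unfolding z_def nrm_smult[OF iU b(1)] absv_mult absv_power ..
  also have "\<dots> \<le> absv (inverse (y k)) ^ 1 * 1"
   by (intro mult_mono power_decreasing) (use cU y1 absv_nonneg b(3) in auto)
  finally show "absv (nrm U (z k)) \<le> 1 / (real k + 1)" using yi by simp
 qed
 have compact: "compactin (mat_topology absv n) {A. mbd n 1 A}"
  by (rule compactin_closed_bounded[OF n0, of _ 1]) (auto intro: mconv_mbd)
 obtain A r where A: "A \<in> {A. mbd n 1 A}" "strict_mono r" "mconv n (\<lambda>k. z (r k)) A"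
  by (rule compactin_subseq[OF n0 compact, of z]) (use z(3) in auto)
 have Ac: "A \<in> comm" by (rule comm_closed_seq[OF A(3)]) (use z(1) in blast)
 have Ae: "A * idm U = A" by (rule mconv_poly_eq[OF _ _ A(3), of "\<lambda>a. a * idm U" "\<lambda>a. a"])
   (use z(2) comm_carrier[OF idm(1)[OF iU]] in "auto intro!: poly_mat_mult poly_mat_id poly_mat_const")
 \<comment> \<open>A limit of norm zero has a zero eigenvalue in \<open>U\<close>, hence vanishes on
   the whole atom and is the zero matrix, whereas every member of the sequence has an entry
   \<open>1\<close>.\<close>
 have "absv (nrm U A) \<le> 0"
 proof (rule LIMSEQ_le[OF nrm_mconv[OF iU A(3)], of "\<lambda>k. 1 / (real (r k) + 1)"])
  have "(\<lambda>k. 1 / (real k + 1)) \<longlonglongrightarrow> 0" using LIMSEQ_inverse_real_of_nat by (simp add: inverse_eq_divide add.commute)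
  from LIMSEQ_subseq_LIMSEQ[OF this A(2)] show "(\<lambda>k. 1 / (real (r k) + 1)) \<longlonglongrightarrow> 0" by (simp add: o_def)
 qed (use z(5) in blast)
 hence "nrm U A = 0" using absv_nonneg[of "nrm U A"] absv_eq_0_iff by force
 hence "(\<Prod>i\<in>U. ev A i) = 0" using nrm_ev[OF iU Ac] by simp
 then obtain i where i: "i \<in> U" "ev A i = 0" using atomD(4)[OF U] by auto
 have "ev A j = 0" if "j < n" for j
 proof (cases "j \<in> U")
  case True
  show ?thesis by (rule atom_ev[OF U Ac i True])
 next
  case False
  thus ?thesis using idm_part(2)[OF iU Ac that] Ae by simp
 qed
 hence "A = 0\<^sub>m n n" using comm_zero by (intro comm_eqI[OF Ac]) auto
 moreover have "\<forall>\<^sub>F k in sequentially. \<forall>i\<in>{..<n}. \<forall>j\<in>{..<n}. absv (z (r k) $$ (i, j) - A $$ (i, j)) < 1"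
 proof (intro eventually_ball_finite ballI)
  fix i j assume "i \<in> {..<n}" "j \<in> {..<n}"
  hence "(\<lambda>k. absv (z (r k) $$ (i, j) - A $$ (i, j))) \<longlonglongrightarrow> 0" using A(3) by (simp add: mconv_def)
  thus "\<forall>\<^sub>F k in sequentially. absv (z (r k) $$ (i, j) - A $$ (i, j)) < 1" by (rule order_tendstoD) simp
 qed auto
 ultimately obtain k where k: "\<forall>i\<in>{..<n}. \<forall>j\<in>{..<n}. absv (z (r k) $$ (i, j)) < 1"
  unfolding eventually_sequentially by force
 obtain i j where "i < n" "j < n" "z (r k) $$ (i, j) = 1" using z(4)[of "r k"] by blast
 thus False using k by force
qed

lemma ac_index: "A \<in> Mat n ==> i < n ==> j < n ==> ac A $$ (i, j) = to_ac (A $$ (i, j))" by (intro index_map_mat) auto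

lemma cj_index: "i < n ==> j < n ==> cj d $$ (i, j) = (\<Sum>k<n. V $$ (i, k) * d k * Vi $$ (k, j))"
proof -
 assume ij: "i < n" "j < n"
 have c: "V * dmat n d \<in> Mat n" by (rule sq_closed(3)[OF V(1) dmat_carrier])
 show ?thesis unfolding cj_def sq_mult_index[OF c V(2) ij]
  by (intro sum.cong refl) (use ij mult_dmat[OF V(1)] in auto)
qed

lemma finite_atoms: "finite {U. atom U}" by (rule finite_subset[of _ "Pow {..<n}"]) (auto dest: atomD(3))

lemma cj_atoms:
 assumes ij: "i < n" "j < n"
 shows "cj d $$ (i, j) = (\<Sum>U | atom U. cj (\<lambda>k. if k \<in> U then d k else 0) $$ (i, j))"
proof -
 have "(\<Sum>U | atom U. V $$ (i, k) * (if k \<in> U then d k else 0) * Vi $$ (k, j)) = V $$ (i, k) * d k * Vi $$ (k, j)" if k: "k < n" for k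
 proof -
  obtain W where W: "atom W" "k \<in> W" by (rule atom_exists[OF k])
  have "(\<Sum>U | atom U. V $$ (i, k) * (if k \<in> U then d k else 0) * Vi $$ (k, j)) =
   (\<Sum>U | atom U. if U = W then V $$ (i, k) * d k * Vi $$ (k, j) else 0)"
  proof (rule sum.cong[OF refl])
   fix U assume "U \<in> {U. atom U}"
   hence U: "atom U" by simp
   have "k \<in> U \<longleftrightarrow> U = W"
   proof
    assume "k \<in> U"
    thus "U = W" by (rule atom_disjoint[OF U W(1) _ W(2)])
   qed (use W(2) in simp)
   thus "V $$ (i, k) * (if k \<in> U then d k else 0) * Vi $$ (k, j) = (if U = W then V $$ (i, k) * d k * Vi $$ (k, j) else 0)" by simp
  qed
  thus ?thesis using finite_atoms W(1) by simp
 qed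
 hence "(\<Sum>k<n. \<Sum>U | atom U. V $$ (i, k) * (if k \<in> U then d k else 0) * Vi $$ (k, j)) = (\<Sum>k<n. V $$ (i, k) * d k * Vi $$ (k, j))"
  by (intro sum.cong refl) auto
 thus ?thesis unfolding cj_index[OF ij] by (subst sum.swap) (rule sym)
qed

lemma atom_decomposition:
 assumes a: "a \<in> comm" and ij: "i < n" "j < n"
 shows "a $$ (i, j) = (\<Sum>U | atom U. (a * idm U) $$ (i, j))"
proof -
 have "cj (\<lambda>k. if k \<in> U then ev a k else 0) $$ (i, j) = to_ac ((a * idm U) $$ (i, j))" if "atom U" for U
 proof -
  note p = idm_part[OF atomD(1)[OF that] a]
  have "cj (ev (a * idm U)) = cj (\<lambda>k. if k \<in> U then ev a k else 0)" by (rule cj_cong) (rule p(2))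
  thus ?thesis using ac_index[OF comm_carrier[OF p(1)] ij] comm_cj[OF p(1)] by simp
 qed
 hence "ac a $$ (i, j) = to_ac (\<Sum>U | atom U. (a * idm U) $$ (i, j))"
  unfolding comm_cj[OF a] cj_atoms[OF ij, of "ev a"] to_ac_sum by (intro sum.cong refl) auto
 thus ?thesis unfolding ac_index[OF comm_carrier[OF a] ij] by (simp only: to_ac_eq_iff)
qed

text \<open>The elements that are units in every field factor. By
  \<open>maximal_compact_unique\<close> this is the maximal compact subgroup, and it is described by
  norms, so cosets are detected by valuations.\<close>

definition K0 :: "'a mat set" where
 "K0 = {t \<in> TF. \<forall>U. atom U --> absv (nrm U t) = 1}"

text \<open>\<open>nrm_bounded\<close> controls each component and the components add up to the
  element; the defining conditions are continuous, so the set is also closed.\<close>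

lemma K0_compact: "compactin (mat_topology absv n) K0"
proof -
 have "\<forall>U. \<exists>R. atom U --> R \<ge> 1 \<and> (\<forall>a\<in>comm. absv (nrm U a) \<le> 1 --> mbd n R (a * idm U))" using nrm_bounded by metis
 then obtain R where R: "\<forall>U. atom U --> R U \<ge> 1 \<and> (\<forall>a\<in>comm. absv (nrm U a) \<le> 1 --> mbd n (R U) (a * idm U))" by metis
 define B where "B = (\<Sum>U | atom U. R U)"
 have RB: "R U \<le> B" if "atom U" for U unfolding B_def
  by (rule member_le_sum) (use that R finite_atoms in "auto intro: order_trans[of 0 1]")
 have B0: "0 \<le> B" unfolding B_def by (rule sum_nonneg) (use R in "auto intro: order_trans[of 0 1]")
 show ?thesis
 proof (rule compactin_closed_bounded[OF n0, of _ B])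
  fix t assume t: "t \<in> K0"
  hence tc: "t \<in> comm" by (auto simp: K0_def TF_comm)
  show "mbd n B t" unfolding mbd_def
  proof (intro conjI allI impI)
   show "t \<in> Mat n" by (rule comm_carrier[OF tc])
   fix i j assume ij: "i < n" "j < n"
   show "absv (t $$ (i, j)) \<le> B" unfolding atom_decomposition[OF tc ij]
   proof (rule absv_sum_le[OF _ B0])
    fix U assume "U \<in> {U. atom U}"
    hence U: "atom U" by simp
    have "mbd n (R U) (t * idm U)" using R U tc t by (simp add: K0_def)
    from mbd_index[OF mbd_mono[OF this RB[OF U]] ij] show "absv ((t * idm U) $$ (i, j)) \<le> B" .
   qed
  qed
 next
  fix \<sigma> :: "nat => 'a mat" and t assume \<sigma>: "\<And>k. \<sigma> k \<in> K0" "mconv n \<sigma> t"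
  have tc: "t \<in> comm" by (rule comm_closed_seq[OF \<sigma>(2)]) (use \<sigma>(1) in "auto simp: K0_def TF_comm")
  have "t * J * t\<^sup>T = J" by (rule mconv_poly_eq[OF _ _ \<sigma>(2), of "\<lambda>t. t * J * t\<^sup>T" "\<lambda>t. J"])
    (use J(1) \<sigma>(1) in "auto intro!: poly_mat_mult poly_mat_transpose poly_mat_id poly_mat_const simp: K0_def TF_def")
  hence "t \<in> TF" using tc by (simp add: TF_def comm_def)
  moreover have "absv (nrm U t) = 1" if "atom U" for U
  proof -
   have e: "(\<lambda>k. absv (nrm U (\<sigma> k))) = (\<lambda>k. 1)" using \<sigma>(1) that by (auto simp: K0_def)
   show ?thesis using nrm_mconv[OF atomD(1)[OF that] \<sigma>(2)] unfolding e by (rule LIMSEQ_unique[OF _ tendsto_const])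
  qed
  ultimately show "t \<in> K0" by (simp add: K0_def)
 qed
qed

lemma K0_mult: "t \<in> K0 ==> u \<in> K0 ==> t * u \<in> K0"
proof -
 assume t: "t \<in> K0" "u \<in> K0"
 hence T: "t \<in> TF" "u \<in> TF" by (auto simp: K0_def)
 have "absv (nrm U (t * u)) = 1" if "atom U" for U
  unfolding nrm_mult[OF atomD(1)[OF that] TF_comm(1)[OF T(1)] TF_comm(1)[OF T(2)]] absv_mult using t that by (simp add: K0_def)
 thus ?thesis using TF_mult[OF T] by (simp add: K0_def)
qed

lemma K0_star: "t \<in> K0 ==> star t \<in> K0"
proof -
 assume t: "t \<in> K0"
 hence T: "t \<in> TF" by (auto simp: K0_def)
 have "absv (nrm U (star t)) = 1" if "atom U" for U
  using arg_cong[OF nrm_TF_star[OF atomD(1)[OF that] T], of absv] t that by (simp add: K0_def absv_mult)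
 thus ?thesis using TF_star[OF T] by (simp add: K0_def)
qed

lemma K0_subgroup: "subgroup K0 (GL n)"
proof (rule group.subgroupI[OF group_GL])
 have KT: "t \<in> TF" if "t \<in> K0" for t using that by (simp add: K0_def)
 show "K0 \<subseteq> carrier (GL n)" using KT TF_comm(2) TF_inv(2) by (auto simp: carrier_GL)
 have "Id n \<in> K0" using TF_one nrm_one atomD(1) by (simp add: K0_def)
 thus "K0 \<noteq> {}" by blast
 show "inv\<^bsub>GL n\<^esub> a \<in> K0" if "a \<in> K0" for a using TF_inv(1)[OF KT[OF that]] K0_star[OF that] by simp
 show "a \<otimes>\<^bsub>GL n\<^esub> b \<in> K0" if "a \<in> K0" "b \<in> K0" for a b using K0_mult[OF that] by simp
qed

text \<open>All powers of \<open>t\<close> stay in the bounded set \<open>K\<close>, so the powers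
  of its norm are bounded.\<close>

lemma compact_subgroup_nrm:
 assumes K: "subgroup K (GL n)" "K \<subseteq> TF" "compactin (mat_topology absv n) K" and t: "t \<in> K" and U: "idem U"
 shows "absv (nrm U t) \<le> 1"
proof (rule ccontr)
 assume gt: "\<not> ?thesis"
 obtain R where R: "R \<ge> 1" "\<forall>A\<in>K. mbd n R A"
 proof (rule compactin_bounded[OF n0 K(3)])
  fix R assume R: "1 \<le> R" "\<And>A. A \<in> K ==> mbd n R A"
  show thesis by (rule that[OF R(1)]) (rule ballI, rule R(2))
 qed
 obtain R' where R': "R' \<ge> 1" "mbd n R' (idm U)" using mbd_exists[OF comm_carrier[OF idm(1)[OF U]]] by blast
 obtain R'' where R'': "R'' \<ge> 1" "mbd n R'' (Id n - idm U)"
  using mbd_exists[OF sq_closed(2)[OF one_carrier_mat comm_carrier[OF idm(1)[OF U]]]] by blast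
 define M where "M = R * R' + R''"
 have M: "R * R' \<le> M" "R'' \<le> M" "0 \<le> M" using R R' R'' by (auto simp: M_def)
 have bound: "absv (nrm U x) \<le> M ^ n" if "x \<in> K" for x unfolding nrm_def
  by (intro mbd_det mbd_add mbd_mono[OF mbd_mult[OF R(2)[rule_format, OF that] R'(2)] M(1)] mbd_mono[OF R''(2) M(2)]) (use M R R' in auto)
 have pw: "\<exists>x\<in>K. nrm U x = nrm U t ^ k" for k
 proof (induction k)
  case 0
  have "Id n \<in> K" using subgroup.one_closed[OF K(1)] by simp
  thus ?case using nrm_one[OF U] by auto
 next
  case (Suc k)
  then obtain x where x: "x \<in> K" "nrm U x = nrm U t ^ k" by blast
  have "t * x \<in> K" using subgroup.m_closed[OF K(1) t x(1)] by simp
  moreover have "t \<in> comm" "x \<in> comm" using t x K(2) TF_comm(1) by blast+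
  ultimately show ?case using nrm_mult[OF U, of t x] x by auto
 qed
 obtain k where k: "M ^ n < absv (nrm U t) ^ k" using real_arch_pow[of "absv (nrm U t)" "M ^ n"] gt by auto
 obtain x where x: "x \<in> K" "nrm U x = nrm U t ^ k" using pw by blast
 show False using bound[OF x(1)] k unfolding x(2) absv_power by simp
qed

text \<open>In a compact subgroup both \<open>t\<close> and its inverse have norms of absolute value
  at most one. So \<open>K\<close> lies in the compact subgroup \<open>K0\<close>, and maximality
  gives equality.\<close>

lemma maximal_compact_unique:
 assumes "maximal_compact_subgroup absv n TF K"
 shows "K = K0"
proof -
 have K: "subgroup K (GL n)" "compactin (mat_topology absv n) K" "K \<subseteq> TF"
  and max: "\<forall>K'. compact_subgroup absv n TF K' \<and> K \<subseteq> K' --> K' = K"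
  using assms by (auto simp: maximal_compact_subgroup_def compact_subgroup_def compactin_subtopology)
 have "K \<subseteq> K0"
 proof
  fix t assume t: "t \<in> K"
  hence T: "t \<in> TF" using K by blast
  have "star t \<in> K" using subgroup.m_inv_closed[OF K(1) t] TF_inv(1)[OF T] by simp
  have "absv (nrm U t) = 1" if "atom U" for U
  proof -
   note iU = atomD(1)[OF that]
   have 1: "absv (nrm U t) \<le> 1" "absv (nrm U (star t)) \<le> 1"
    by (rule compact_subgroup_nrm[OF K(1,3,2) _ iU], fact)+
   have 2: "absv (nrm U t) * absv (nrm U (star t)) = 1"
    using arg_cong[OF nrm_TF_star[OF iU T], of absv] by (simp add: absv_mult)
   have "absv (nrm U t) * absv (nrm U (star t)) \<le> absv (nrm U t) * 1"
    by (rule mult_left_mono[OF 1(2) absv_nonneg])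
   thus ?thesis using 1 2 by simp
  qed
  thus "t \<in> K0" using T by (simp add: K0_def)
 qed
 moreover have "compact_subgroup absv n TF K0"
  using K0_subgroup K0_compact by (auto simp: compact_subgroup_def compactin_subtopology K0_def)
 ultimately show ?thesis using max by blast
qed

end

section \<open>Split subtori\<close>

context spectral
begin

text \<open>The form \<open>J\<close> in the coordinates of the eigenbasis:
  \<open>J = V gram V^T\<close>.\<close>

definition gram :: "'a alg_closure mat" where
 "gram = Vi * ac J * Vi\<^sup>T"

text \<open>In eigenbasis coordinates the adjunction relation becomes a condition on each nonzero
  entry of \<open>gram\<close>; only the support of the Gram matrix matters.\<close>

lemma transpose_cj:
 "ac J * (cj d)\<^sup>T = cj d' * ac J \<longleftrightarrow> (\<forall>i<n. \<forall>j<n. gram $$ (i, j) \<noteq> 0 --> d j = d' i)"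
proof -
 let ?Vt = "V\<^sup>T" and ?Vit = "Vi\<^sup>T"
 have t: "?Vt \<in> Mat n" "?Vit \<in> Mat n" using V by auto
 have aJ: "ac J \<in> Mat n" using J by simp
 have G: "gram \<in> Mat n" unfolding gram_def by (rule sq_closed(3)[OF sq_closed(3)[OF V(2) aJ] t(2)])
 have dt: "(dmat n d)\<^sup>T = dmat n d" by (intro eq_matI) (auto simp: dmat_def)
 have VG: "V * gram = ac J * ?Vit"
 proof -
  have "V * gram = V * (Vi * (ac J * ?Vit))" unfolding gram_def using V(1,2) aJ t by (simp add: as cl)
  thus ?thesis using sq_inv_cancel(1)[OF V sq_closed(3)[OF aJ t(2)]] by simp
 qed
 have GV: "gram * ?Vt = Vi * ac J"
 proof -
  have "?Vit * ?Vt = Id n" using sq_transpose(3)[OF V(1,2)] V(3) by simp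
  moreover have "gram * ?Vt = Vi * ac J * (?Vit * ?Vt)" unfolding gram_def by (rule as[OF sq_closed(3)[OF V(2) aJ] t(2,1)])
  ultimately show ?thesis using right_mult_one_mat[OF sq_closed(3)[OF V(2) aJ]] by simp
 qed
 have c: "gram * dmat n d \<in> Mat n" "dmat n d' * gram \<in> Mat n" using G by (auto intro!: cl)
 have c2: "V * (gram * dmat n d) \<in> Mat n" "V * (dmat n d' * gram) \<in> Mat n"
  by (rule sq_closed(3)[OF V(1) c(1)], rule sq_closed(3)[OF V(1) c(2)])
 have "(cj d)\<^sup>T = ?Vit * dmat n d * ?Vt" unfolding cj_def using V(1,2) t dt by (simp add: tp cl as)
 hence "ac J * (cj d)\<^sup>T = ac J * ?Vit * dmat n d * ?Vt" using aJ t by (simp add: as cl)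
 hence 1: "ac J * (cj d)\<^sup>T = V * (gram * dmat n d) * ?Vt"
  unfolding VG[symmetric] using V(1) G t by (simp add: as cl)
 have "cj d' * ac J = V * dmat n d' * (Vi * ac J)" unfolding cj_def using V(1,2) aJ by (simp add: as cl)
 hence 2: "cj d' * ac J = V * (dmat n d' * gram) * ?Vt" unfolding GV[symmetric] using V(1) G t by (simp add: as cl)
 have "det ?Vt \<noteq> 0" using inverses(7) det_transpose[OF V(1)] by simp
 hence "ac J * (cj d)\<^sup>T = cj d' * ac J \<longleftrightarrow> gram * dmat n d = dmat n d' * gram"
  unfolding 1 2 using mat_cancel_right[OF c2 t(1)] mat_cancel_left[OF c V(1) inverses(7)] by auto
 also have "\<dots> \<longleftrightarrow> (\<forall>i<n. \<forall>j<n. (gram * dmat n d) $$ (i, j) = (dmat n d' * gram) $$ (i, j))"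
  using sq_eqI[OF c] by auto
 also have "\<dots> \<longleftrightarrow> (\<forall>i<n. \<forall>j<n. gram $$ (i, j) \<noteq> 0 --> d j = d' i)"
 proof -
  have "(gram * dmat n d) $$ (i, j) = (dmat n d' * gram) $$ (i, j) \<longleftrightarrow> (gram $$ (i, j) \<noteq> 0 --> d j = d' i)" if "i < n" "j < n" for i j
   unfolding mult_dmat[OF G that] dmat_mult[OF G that] by (auto simp: mult.commute)
  thus ?thesis by blast
 qed
 finally show ?thesis .
qed

lemma ac_idm: "idem U ==> ac (idm U) = cj (\<lambda>i. if i \<in> U then 1 else 0)"
 unfolding comm_cj[OF idm(1)] by (rule cj_cong) (rule idm(2))

text \<open>The adjunction of \<open>idm U\<close> and \<open>idm (st U)\<close>, read through
  \<open>transpose_cj\<close>: the form pairs the eigenlines of \<open>U\<close> only with those of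
  \<open>st U\<close>.\<close>

lemma gram_st:
 assumes U: "idem U" and ij: "i < n" "j < n" "gram $$ (i, j) \<noteq> 0"
 shows "j \<in> U \<longleftrightarrow> i \<in> st U"
proof -
 note c = comm_carrier[OF idm(1)[OF U]] comm_carrier[OF idm(1)[OF st_idem(1)[OF U]]]
 have t: "(idm U)\<^sup>T \<in> Mat n" using c by simp
 have "idm (st U) * J = J * (idm U)\<^sup>T * Ji * J" unfolding st_idem(2)[OF U] star_def ..
 also have "\<dots> = J * (idm U)\<^sup>T"
  using as[OF sq_closed(3)[OF J(1) t] J(2,1)] right_mult_one_mat[OF sq_closed(3)[OF J(1) t]] by (simp add: inverses(1))
 finally have "ac (J * (idm U)\<^sup>T) = ac (idm (st U) * J)" by simp
 hence "ac J * (ac (idm U))\<^sup>T = ac (idm (st U)) * ac J" unfolding ac_mult[OF J(1) t] ac_mult[OF c(2) J(1)] by simp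
 hence "(if j \<in> U then 1 else 0) = (if i \<in> st U then 1 else (0 :: 'a alg_closure))"
  unfolding ac_idm[OF U] ac_idm[OF st_idem(1)[OF U]] transpose_cj using ij by blast
 thus ?thesis by (simp split: if_splits)
qed

text \<open>One atom out of each pair exchanged by \<open>st\<close>, namely the one with the
  smaller least index; atoms fixed by \<open>st\<close> are excluded by the strict
  inequality.\<close>

definition P1 :: "nat set set" where
 "P1 = {U. atom U \<and> Min U < Min (st U)}"

lemma P1_atom: "U \<in> P1 ==> atom U" "U \<in> P1 ==> idem U" by (auto simp: P1_def atomD)

lemma finite_P1: "finite P1" by (rule finite_subset[OF _ finite_atoms]) (auto simp: P1_def)

lemma atom_Min: "atom U ==> Min U \<in> U" "atom U ==> Min U < n"
proof -
 assume U: "atom U"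
 show "Min U \<in> U" by (rule Min_in[OF atomD(4,2)[OF U]])
 thus "Min U < n" using atomD(3)[OF U] by auto
qed

lemma card_P1: "card P1 \<le> n"
proof -
 have "inj_on Min P1"
 proof (rule inj_onI)
  fix U W assume "U \<in> P1" "W \<in> P1" "Min U = Min W"
  thus "U = W" using atom_Min(1)[of U] atom_Min(1)[of W] atom_disjoint[of U W "Min U"] by (simp add: P1_def)
 qed
 moreover have "Min ` P1 \<subseteq> {..<n}" using atom_Min(2) by (auto simp: P1_def)
 ultimately show ?thesis using card_inj_on_le[of Min P1 "{..<n}"] by simp
qed

lemma P1_st: "U \<in> P1 ==> W \<in> P1 ==> st W \<noteq> U"
proof
 assume U: "U \<in> P1" "W \<in> P1" and e: "st W = U"
 have "st U = W" using st_st[OF P1_atom(2)[OF U(2)]] e by simp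
 thus False using U e by (simp add: P1_def)
qed

text \<open>An atom is in \<open>P1\<close>, or its partner is and has the inverse norm, or it is
  its own partner and the square of the absolute value is one.\<close>

lemma P1_cases:
 assumes "atom U" "\<forall>W\<in>P1. absv (nrm W t) = 1" "t \<in> TF"
 shows "absv (nrm U t) = 1"
proof -
 note iU = atomD(1)[OF assms(1)]
 have e: "absv (nrm (st U) t) * absv (nrm U t) = 1"
  using arg_cong[OF nrm_TF[OF iU assms(3)], of absv] by (simp add: absv_mult)
 consider "Min U < Min (st U)" | "Min (st U) < Min U" | "Min U = Min (st U)" by linarith
 thus ?thesis
 proof cases
  case 1
  thus ?thesis using assms by (simp add: P1_def)
 next
  case 2
  hence "st U \<in> P1" using st_atom[OF assms(1)] st_st[OF iU] by (simp add: P1_def)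
  thus ?thesis using e assms(2) by simp
 next
  case 3
  have "st U = U" by (rule atom_disjoint[OF st_atom[OF assms(1)] assms(1) atom_Min(1)[OF st_atom[OF assms(1)]]])
    (use 3 atom_Min(1)[OF assms(1)] in simp)
  hence "absv (nrm U t) ^ 2 = 1" using e by (simp add: power2_eq_square)
  thus ?thesis using absv_nonneg[of "nrm U t"] by (simp add: power2_eq_1_iff)
 qed
qed

end

lemma regular_function_onI:
 "f \<in> poly_funs n K ==> (\<And>g. g \<in> M ==> h g = f g / det g ^ e) ==> regular_function_on K n M h"
 unfolding regular_function_on_def by blast

context spectral
begin

definition torus_group :: "'a alg_closure mat set" where
 "torus_group = {g \<in> carrier (GL n). g * ac J * g\<^sup>T = ac J \<and> g * ac \<gamma> = ac \<gamma> * g}"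

text \<open>The subtorus consists of the elements acting by a scalar \<open>x j\<close> on the
  \<open>j\<close>-th atom of \<open>P1\<close>, by its inverse on the partner and trivially
  elsewhere. It is split over \<open>F\<close> because the idempotents have entries in
  \<open>F\<close>. Its existence gives \<open>card P1 \<le> r\<close>.\<close>

lemma split_subtorus: "\<exists>S \<subseteq> torus_group. split_torus n (card P1) S"
proof -
 define p where "p = card P1"
 obtain b where b: "bij_betw b {0..<p} P1" using ex_bij_betw_nat_finite[OF finite_P1] by (auto simp: p_def)
 have bP: "b j \<in> P1" if "j < p" for j using b that by (auto simp: bij_betw_def)
 have binj: "b j = b j' ==> j = j'" if "j < p" "j' < p" for j j' using b that by (auto simp: bij_betw_def inj_on_def)
 have ba: "atom (b j)" "idem (b j)" if "j < p" for j using bP[OF that] P1_atom by auto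
 have disj: "i \<notin> st (b j')" if "j < p" "j' < p" "i \<in> b j" for i j j'
  using atom_disjoint[OF ba(1)[OF that(1)] st_atom[OF ba(1)[OF that(2)]] that(3)] P1_st[OF bP[OF that(1)] bP[OF that(2)]] by auto
 \<comment> \<open>All the sets \<open>b j\<close> and \<open>st (b j)\<close> are pairwise
   disjoint, so at most one factor differs from \<open>1\<close>. The product form is multiplicative
   in \<open>x\<close> without case distinctions.\<close>
 define wt where "wt x i = (\<Prod>j<p. if i \<in> b j then x j else if i \<in> st (b j) then inverse (x j) else 1)" for x :: "nat => 'a alg_closure" and i
 define nz where "nz x \<longleftrightarrow> (\<forall>j<p. x j \<noteq> 0)" for x :: "nat => 'a alg_closure"
 define el where "el x = cj (wt x)" for x
 define S where "S = el ` {x. nz x}"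
 have wt_b: "wt x i = x j" if j: "j < p" and i: "i \<in> b j" for x i j
 proof -
  have "wt x i = (\<Prod>j'<p. if j' = j then x j else 1)" unfolding wt_def
  proof (rule prod.cong[OF refl])
   fix j' assume "j' \<in> {..<p}"
   hence j': "j' < p" by simp
   have "i \<in> b j' \<longleftrightarrow> j' = j" using atom_disjoint[OF ba(1)[OF j] ba(1)[OF j'] i] binj[OF j j'] i by auto
   thus "(if i \<in> b j' then x j' else if i \<in> st (b j') then inverse (x j') else 1) = (if j' = j then x j else 1)"
    using disj[OF j j' i] by auto
  qed
  thus ?thesis using j by simp
 qed
 have wt_st: "wt x i = inverse (x j)" if j: "j < p" and i: "i \<in> st (b j)" for x i j
 proof -
  have "wt x i = (\<Prod>j'<p. if j' = j then inverse (x j) else 1)" unfolding wt_def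
  proof (rule prod.cong[OF refl])
   fix j' assume "j' \<in> {..<p}"
   hence j': "j' < p" by simp
   have "i \<in> st (b j') \<longleftrightarrow> j' = j"
   proof
    assume "i \<in> st (b j')"
    hence "st (b j) = st (b j')" by (rule atom_disjoint[OF st_atom[OF ba(1)[OF j]] st_atom[OF ba(1)[OF j']] i])
    hence "b j = b j'" using st_st[OF ba(2)[OF j]] st_st[OF ba(2)[OF j']] by metis
    thus "j' = j" using binj[OF j j'] by simp
   qed (use i in simp)
   moreover have "i \<notin> b j'" using disj[OF j' j] i by blast
   ultimately show "(if i \<in> b j' then x j' else if i \<in> st (b j') then inverse (x j') else 1) = (if j' = j then inverse (x j) else 1)"
    by auto
  qed
  thus ?thesis using j by simp
 qed
 have wt_other: "wt x i = 1" if "\<forall>j<p. i \<notin> b j \<and> i \<notin> st (b j)" for x i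
  unfolding wt_def using that by (intro prod.neutral) auto
 have wt_mult: "wt (\<lambda>j. x j * y j) i = wt x i * wt y i" for x y i
  unfolding wt_def prod.distrib[symmetric] by (intro prod.cong) auto
 have wt_inv: "wt (\<lambda>j. inverse (x j)) i = inverse (wt x i)" for x i
  unfolding wt_def prod_inversef[symmetric] o_def by (intro prod.cong) auto
 have wt_nz: "wt x i \<noteq> 0" if "nz x" for x i using that by (auto simp: wt_def nz_def)
 have wt_const: "wt x i = wt x i'" if U: "atom U" "i \<in> U" "i' \<in> U" for x U i i'
 proof -
  have "i \<in> b j \<longleftrightarrow> i' \<in> b j" "i \<in> st (b j) \<longleftrightarrow> i' \<in> st (b j)" if "j < p" for j
   using atom_disjoint[OF U(1) ba(1)[OF that]] atom_disjoint[OF U(1) st_atom[OF ba(1)[OF that]]] U(2,3) by blast+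
  thus ?thesis unfolding wt_def by (intro prod.cong) auto
 qed
 have elc: "el x \<in> Mat n" for x by (simp add: el_def)
 have el_mult: "el x * el y = el (\<lambda>j. x j * y j)" for x y
  unfolding el_def cj_mult by (rule cj_cong) (simp add: wt_mult)
 have el_one: "el (\<lambda>_. 1) = Id n"
  unfolding el_def cj_one[symmetric] by (rule cj_cong) (auto simp: wt_def intro!: prod.neutral)
 have el_cong: "el x = el y" if "\<forall>j<p. x j = y j" for x y
  unfolding el_def wt_def using that by (intro cj_cong prod.cong) auto
 have el_inv: "el x * el (\<lambda>j. inverse (x j)) = Id n" if "nz x" for x
  unfolding el_mult el_one[symmetric] by (rule el_cong) (use that in "auto simp: nz_def")
 have aJ: "ac J \<in> Mat n" using J by simp
 have el_GL: "el x \<in> carrier (GL n)" if "nz x" for x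
  using elc[of x] wt_nz[OF that] by (auto simp: carrier_GL el_def det_cj)
 have el_T: "el x \<in> torus_group" if x: "nz x" for x
 proof -
  have eg: "el x * ac \<gamma> = ac \<gamma> * el x" unfolding gamma_cj el_def cj_mult by (rule cj_cong) simp
  \<comment> \<open>A nonzero entry of \<open>gram\<close> pairs an index of \<open>b k\<close> with
    one of \<open>st (b k)\<close>, and these carry inverse weights.\<close>
  have "ac J * (el x)\<^sup>T = el (\<lambda>j. inverse (x j)) * ac J" unfolding el_def transpose_cj
  proof (intro allI impI)
   fix i j assume ij: "i < n" "j < n" "gram $$ (i, j) \<noteq> 0"
   have 1: "j \<in> b k \<longleftrightarrow> i \<in> st (b k)" "j \<in> st (b k) \<longleftrightarrow> i \<in> b k" if "k < p" for k
    using gram_st[OF ba(2)[OF that] ij] gram_st[OF st_idem(1)[OF ba(2)[OF that]] ij] st_st[OF ba(2)[OF that]] by auto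
   show "wt x j = wt (\<lambda>j. inverse (x j)) i" unfolding wt_def
   proof (rule prod.cong[OF refl])
    fix k assume "k \<in> {..<p}"
    hence k: "k < p" by simp
    show "(if j \<in> b k then x k else if j \<in> st (b k) then inverse (x k) else 1) =
     (if i \<in> b k then inverse (x k) else if i \<in> st (b k) then inverse (inverse (x k)) else 1)"
     unfolding 1[OF k] using disj[OF k k, of i] by auto
   qed
  qed
  hence "el x * ac J * (el x)\<^sup>T = el x * (el (\<lambda>j. inverse (x j)) * ac J)"
   using as[OF elc aJ, of "(el x)\<^sup>T" x] elc[of x] by simp
  also have "\<dots> = ac J" by (rule sq_inv_cancel(1)[OF elc elc el_inv[OF x] aJ])
  finally show ?thesis using el_GL[OF x] eg by (simp add: torus_group_def)
 qed
 have nz_mult: "nz (\<lambda>j. x j * y j)" if "nz x" "nz y" for x y using that by (simp add: nz_def)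
 have nz_inv: "nz (\<lambda>j. inverse (x j))" if "nz x" for x using that by (simp add: nz_def)
 have S_sub: "subgroup S (GL n)"
 proof (rule group.subgroupI[OF group_GL])
  show "S \<subseteq> carrier (GL n)" using el_GL by (auto simp: S_def)
  have "nz (\<lambda>_. 1)" by (simp add: nz_def)
  thus "S \<noteq> {}" by (auto simp: S_def)
  show "inv\<^bsub>GL n\<^esub> a \<in> S" if "a \<in> S" for a
  proof -
   from that obtain x where x: "nz x" "a = el x" by (auto simp: S_def)
   show ?thesis unfolding x(2) GL_inv_eqI(1)[OF elc elc el_inv[OF x(1)]] S_def using nz_inv[OF x(1)] by blast
  qed
  show "a \<otimes>\<^bsub>GL n\<^esub> c \<in> S" if "a \<in> S" "c \<in> S" for a c
  proof -
   from that obtain x y where x: "nz x" "a = el x" "nz y" "c = el y" by (auto simp: S_def)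
   show ?thesis unfolding x(2,4) mult_GL el_mult S_def using nz_mult[OF x(1,3)] by blast
  qed
 qed
 \<comment> \<open>The scalar by which an element of \<open>S\<close> acts on the component at \<open>U\<close>, read off from a
  nonzero entry of the idempotent.\<close>
 have "\<exists>a c. a < n \<and> c < n \<and> idm U $$ (a, c) \<noteq> 0" if U: "atom U" for U
 proof (rule ccontr)
  assume "\<not> ?thesis"
  hence "idm U = 0\<^sub>m n n" using comm_carrier[OF idm(1)[OF atomD(1)[OF U]]] by (intro sqI) auto
  hence "ev (idm U) (Min U) = 0" using comm_zero atom_Min(2)[OF U] by simp
  thus False using idm(2)[OF atomD(1)[OF U] atom_Min(2)[OF U]] atom_Min(1)[OF U] by simp
 qed
 then obtain ra ca where rc: "\<forall>U. atom U --> ra U < n \<and> ca U < n \<and> idm U $$ (ra U, ca U) \<noteq> 0" by metis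
 define y where "y U g = to_ac (inverse (idm U $$ (ra U, ca U))) * (g * ac (idm U)) $$ (ra U, ca U)" for U g
 have Ec: "ac (idm U) \<in> Mat n" if "atom U" for U using comm_carrier[OF idm(1)[OF atomD(1)[OF that]]] by simp
 have Epoly: "poly_mat n ground_field (\<lambda>g. g * ac (idm U))" if "atom U" for U
  by (intro poly_mat_mult poly_mat_id poly_mat_const Ec[OF that]) (use comm_carrier[OF idm(1)[OF atomD(1)[OF that]]] in auto)
 have y_poly: "\<exists>f \<in> poly_funs n ground_field. \<forall>g \<in> Mat n. y U g = f g" if U: "atom U" for U
 proof -
  obtain f where f: "f \<in> poly_funs n ground_field" "\<forall>g \<in> Mat n. (g * ac (idm U)) $$ (ra U, ca U) = f g"
   using poly_matD(2)[OF Epoly[OF U], of "ra U" "ca U"] rc U by blast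
  show ?thesis
  proof (rule bexI[of _ "\<lambda>g. to_ac (inverse (idm U $$ (ra U, ca U))) * f g"])
   show "(\<lambda>g. to_ac (inverse (idm U $$ (ra U, ca U))) * f g) \<in> poly_funs n ground_field"
    by (intro poly_funs.mult poly_funs.const ground_field_closed(1) f(1))
  qed (use f(2) in "simp add: y_def del: index_mult_mat(1)")
 qed
 have el_E: "el x * ac (idm U) = wt x i \<cdot> ac (idm U)" if U: "atom U" "i \<in> U" for x U i
  unfolding ac_idm[OF atomD(1)[OF U(1)]] el_def cj_mult cj_smult
  by (rule cj_cong) (use wt_const[OF U(1) _ U(2)] in auto)
 have y_el: "y U (el x) = wt x i" if U: "atom U" "i \<in> U" for x U i
 proof -
  have r: "ra U < n" "ca U < n" "idm U $$ (ra U, ca U) \<noteq> 0" using rc U(1) by auto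
  have "(el x * ac (idm U)) $$ (ra U, ca U) = wt x i * to_ac (idm U $$ (ra U, ca U))"
   unfolding el_E[OF U] ix(4)[OF Ec[OF U(1)] r(1,2)] ac_index[OF comm_carrier[OF idm(1)[OF atomD(1)[OF U(1)]]] r(1,2)] ..
  thus ?thesis using r(3) by (simp add: y_def)
 qed
 \<comment> \<open>All polynomials over \<open>F\<close> that vanish on \<open>S\<close> are taken.
   It remains to see that their common zeros are in \<open>S\<close>: being scalar on each
   component, having inverse scalars on partners, and acting trivially elsewhere are all polynomial
   conditions over \<open>F\<close>.\<close>
 define P where "P = {f \<in> poly_funs n ground_field. \<forall>g\<in>S. f g = 0}"
 have vanish: "F g = 0" if F: "\<exists>f \<in> poly_funs n ground_field. \<forall>g \<in> Mat n. F g = f g" "\<forall>g\<in>S. F g = 0"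
  and g: "g \<in> Mat n" "\<forall>f\<in>P. f g = 0" for F g
 proof -
  obtain f where f: "f \<in> poly_funs n ground_field" "\<forall>g \<in> Mat n. F g = f g" using F by blast
  have "f \<in> P" using f F(2) elc by (auto simp: P_def S_def)
  thus ?thesis using f(2) g by simp
 qed
 have S_eq: "S = {g \<in> carrier (GL n). \<forall>f\<in>P. f g = 0}"
 proof
  show "S \<subseteq> {g \<in> carrier (GL n). \<forall>f\<in>P. f g = 0}" using el_GL by (auto simp: S_def P_def)
  show "{g \<in> carrier (GL n). \<forall>f\<in>P. f g = 0} \<subseteq> S"
  proof
   fix g assume "g \<in> {g \<in> carrier (GL n). \<forall>f\<in>P. f g = 0}"
   hence g: "g \<in> Mat n" "\<forall>f\<in>P. f g = 0" by (auto simp: carrier_GL)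
   have c1: "(g * ac (idm U)) $$ (i, j) = y U g * ac (idm U) $$ (i, j)" if U: "atom U" and ij: "i < n" "j < n" for U i j
   proof -
    have "(g * ac (idm U)) $$ (i, j) + (- 1) * (y U g * ac (idm U) $$ (i, j)) = 0"
    proof (rule vanish[OF _ _ g])
     obtain f where f: "f \<in> poly_funs n ground_field" "\<forall>g \<in> Mat n. (g * ac (idm U)) $$ (i, j) = f g"
      using poly_matD(2)[OF Epoly[OF U] ij] by blast
     obtain f' where f': "f' \<in> poly_funs n ground_field" "\<forall>g \<in> Mat n. y U g = f' g" using y_poly[OF U] by blast
     have m: "ac (idm U) $$ (i, j) \<in> ground_field"
      unfolding ac_index[OF comm_carrier[OF idm(1)[OF atomD(1)[OF U]]] ij] by simp
     show "\<exists>f \<in> poly_funs n ground_field. \<forall>g \<in> Mat n. (g * ac (idm U)) $$ (i, j) + (- 1) * (y U g * ac (idm U) $$ (i, j)) = f g"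
     proof (rule bexI)
      show "(\<lambda>g. f g + (- 1) * (f' g * ac (idm U) $$ (i, j))) \<in> poly_funs n ground_field"
       by (intro poly_funs.add poly_funs.mult poly_funs.const f(1) f'(1) m ground_field_closed)
     qed (use f(2) f'(2) in "simp del: index_mult_mat(1) index_map_mat(1)")
     show "\<forall>g\<in>S. (g * ac (idm U)) $$ (i, j) + (- 1) * (y U g * ac (idm U) $$ (i, j)) = 0"
     proof
      fix g assume "g \<in> S"
      then obtain x where x: "g = el x" by (auto simp: S_def)
      show "(g * ac (idm U)) $$ (i, j) + (- 1) * (y U g * ac (idm U) $$ (i, j)) = 0"
       unfolding x el_E[OF U atom_Min(1)[OF U]] y_el[OF U atom_Min(1)[OF U]] ix(4)[OF Ec[OF U] ij] by simp
     qed
    qed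
    thus ?thesis by simp
   qed
   have c2: "y (b j) g * y (st (b j)) g = 1" if j: "j < p" for j
   proof -
    note U = ba(1)[OF j] st_atom[OF ba(1)[OF j]]
    have "y (b j) g * y (st (b j)) g + (- 1) = 0"
    proof (rule vanish[OF _ _ g])
     obtain f where f: "f \<in> poly_funs n ground_field" "\<forall>g \<in> Mat n. y (b j) g = f g" using y_poly[OF U(1)] by blast
     obtain f' where f': "f' \<in> poly_funs n ground_field" "\<forall>g \<in> Mat n. y (st (b j)) g = f' g" using y_poly[OF U(2)] by blast
     show "\<exists>f \<in> poly_funs n ground_field. \<forall>g \<in> Mat n. y (b j) g * y (st (b j)) g + (- 1) = f g"
     proof (rule bexI)
      show "(\<lambda>g. f g * f' g + (- 1)) \<in> poly_funs n ground_field"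
       by (intro poly_funs.add poly_funs.mult poly_funs.const f(1) f'(1) ground_field_closed)
     qed (use f(2) f'(2) in simp)
     show "\<forall>g\<in>S. y (b j) g * y (st (b j)) g + (- 1) = 0"
     proof
      fix g assume "g \<in> S"
      then obtain x where x: "g = el x" "nz x" by (auto simp: S_def)
      show "y (b j) g * y (st (b j)) g + (- 1) = 0"
       unfolding x(1) y_el[OF U(1) atom_Min(1)[OF U(1)]] y_el[OF U(2) atom_Min(1)[OF U(2)]]
        wt_b[OF j atom_Min(1)[OF U(1)]] wt_st[OF j atom_Min(1)[OF U(2)]] using x(2) j by (simp add: nz_def)
     qed
    qed
    thus ?thesis by simp
   qed
   have c3: "y U g = 1" if U: "atom U" "\<forall>j<p. U \<noteq> b j \<and> U \<noteq> st (b j)" for U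
   proof -
    have "y U g + (- 1) = 0"
    proof (rule vanish[OF _ _ g])
     obtain f where f: "f \<in> poly_funs n ground_field" "\<forall>g \<in> Mat n. y U g = f g" using y_poly[OF U(1)] by blast
     show "\<exists>f \<in> poly_funs n ground_field. \<forall>g \<in> Mat n. y U g + (- 1) = f g"
     proof (rule bexI)
      show "(\<lambda>g. f g + (- 1)) \<in> poly_funs n ground_field"
       by (intro poly_funs.add poly_funs.const f(1) ground_field_closed)
     qed (use f(2) in simp)
     have m: "\<forall>j<p. Min U \<notin> b j \<and> Min U \<notin> st (b j)"
      using atom_disjoint[OF U(1) ba(1) atom_Min(1)[OF U(1)]] atom_disjoint[OF U(1) st_atom[OF ba(1)] atom_Min(1)[OF U(1)]] U(2) by blast
     show "\<forall>g\<in>S. y U g + (- 1) = 0"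
     proof
      fix g assume "g \<in> S"
      then obtain x where x: "g = el x" "nz x" by (auto simp: S_def)
      show "y U g + (- 1) = 0" unfolding x(1) y_el[OF U(1) atom_Min(1)[OF U(1)]] wt_other[OF m] by simp
     qed
    qed
    thus ?thesis by simp
   qed
   define x where "x j = y (b j) g" for j
   have x: "nz x" unfolding nz_def x_def using c2 by fastforce
   have y_wt: "y U g = wt x i" if U: "atom U" "i \<in> U" for U i
   proof -
    consider j where "j < p" "U = b j" | j where "j < p" "U = st (b j)" | "\<forall>j<p. U \<noteq> b j \<and> U \<noteq> st (b j)" by blast
    thus ?thesis
    proof cases
     case (1 j)
     thus ?thesis using wt_b[of j i x] U by (simp add: x_def)
    next
     case (2 j)
     have "y (b j) g \<noteq> 0" "y (b j) g * y (st (b j)) g = 1" using c2[OF 2(1)] by auto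
     hence "y (st (b j)) g = inverse (y (b j) g)" by (simp add: field_simps)
     thus ?thesis using wt_st[of j i x] 2 U by (simp add: x_def)
    next
     case 3
     have "\<forall>j<p. i \<notin> b j \<and> i \<notin> st (b j)"
      using atom_disjoint[OF U(1) ba(1) U(2)] atom_disjoint[OF U(1) st_atom[OF ba(1)] U(2)] 3 by blast
     thus ?thesis using wt_other[of i x] c3[OF U(1) 3] by simp
    qed
   qed
   have gV: "g * V = V * dmat n (wt x)"
   proof (rule sq_eqI[OF sq_closed(3)[OF g(1) V(1)] sq_closed(3)[OF V(1) dmat_carrier]])
    fix i j assume ij: "i < n" "j < n"
    obtain U where U: "atom U" "j \<in> U" by (rule atom_exists[OF ij(2)])
    let ?\<chi> = "\<lambda>i. if i \<in> U then 1 else (0 :: 'a alg_closure)"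
    have "g * ac (idm U) = y U g \<cdot> ac (idm U)"
     by (rule sq_eqI[OF sq_closed(3)[OF g(1) Ec[OF U(1)]] sq_closed(5)[OF Ec[OF U(1)]]])
      (simp only: ix(4)[OF Ec[OF U(1)]] c1[OF U(1)])
    hence "g * ac (idm U) * V = y U g \<cdot> (ac (idm U) * V)" using ds(5)[OF Ec[OF U(1)] V(1)] by simp
    moreover have "ac (idm U) * V = V * dmat n ?\<chi>" unfolding ac_idm[OF atomD(1)[OF U(1)]] by (rule cj_V)
    moreover have "g * ac (idm U) * V = g * (ac (idm U) * V)" by (rule as[OF g(1) Ec[OF U(1)] V(1)])
    moreover have "g * (V * dmat n ?\<chi>) = g * V * dmat n ?\<chi>" by (rule as[OF g(1) V(1) dmat_carrier, symmetric])
    ultimately have "(g * V * dmat n ?\<chi>) $$ (i, j) = (y U g \<cdot> (V * dmat n ?\<chi>)) $$ (i, j)" by simp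
    thus "(g * V) $$ (i, j) = (V * dmat n (wt x)) $$ (i, j)"
     unfolding mult_dmat[OF sq_closed(3)[OF g(1) V(1)] ij] ix(4)[OF sq_closed(3)[OF V(1) dmat_carrier] ij] mult_dmat[OF V(1) ij]
     using U(2) y_wt[OF U] by (simp add: mult.commute)
   qed
   have "g = el x" unfolding el_def cj_def by (rule conj_dmat(1)[OF V g(1) gV])
   thus "g \<in> S" using x by (simp add: S_def)
  qed
 qed
 have algebraic: "algebraic_group_over ground_field n S"
  unfolding algebraic_group_over_def by (intro conjI S_sub exI[of _ P] S_eq) (simp add: P_def)
 define f where "f g = dmat p (\<lambda>j. y (b j) g)" for g
 have f_el: "f (el x) = dmat p x" for x
  unfolding f_def by (intro sq_eqI[where n=p]) (use y_el[OF ba(1) atom_Min(1)[OF ba(1)]] wt_b[OF _ atom_Min(1)[OF ba(1)]] in auto)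
 have dmat_GL: "dmat p x \<in> diagonal_torus p \<longleftrightarrow> nz x" for x
 proof -
  have "diagonal_mat (dmat p x)" by (auto simp: diagonal_mat_def dmat_def)
  thus ?thesis by (auto simp: diagonal_torus_def carrier_GL det_dmat nz_def)
 qed
 have diag: "D = dmat p (\<lambda>j. D $$ (j, j))" if "D \<in> diagonal_torus p" for D :: "'a alg_closure mat"
  using that by (intro sq_eqI[where n=p]) (auto simp: diagonal_torus_def carrier_GL diagonal_mat_def)
 have f_inj: "inj_on f S"
 proof (rule inj_onI)
  fix g h assume "g \<in> S" "h \<in> S" and e: "f g = f h"
  then obtain x z where x: "g = el x" "h = el z" by (auto simp: S_def)
  have "x j = z j" if "j < p" for j using arg_cong[OF e, of "\<lambda>M. M $$ (j, j)"] that by (simp add: x f_el)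
  thus "g = h" unfolding x by (intro el_cong) blast
 qed
 have f_img: "f ` S = diagonal_torus p"
 proof
  show "f ` S \<subseteq> diagonal_torus p" using dmat_GL by (auto simp: S_def f_el)
  show "diagonal_torus p \<subseteq> f ` S"
  proof
   fix D :: "'a alg_closure mat" assume D: "D \<in> diagonal_torus p"
   have "dmat p (\<lambda>j. D $$ (j, j)) \<in> diagonal_torus p" unfolding diag[OF D, symmetric] by (rule D)
   hence "nz (\<lambda>j. D $$ (j, j))" by (simp only: dmat_GL)
   moreover have "D = f (el (\<lambda>j. D $$ (j, j)))" unfolding f_el by (rule diag[OF D])
   ultimately show "D \<in> f ` S" by (auto simp: S_def)
  qed
 qed
 have f_iso: "f \<in> iso (GL n \<lparr>carrier := S\<rparr>) (GL p \<lparr>carrier := diagonal_torus p\<rparr>)"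
 proof -
  have "f (g * h) = f g * f h" if "g \<in> S" "h \<in> S" for g h using that by (auto simp: S_def el_mult f_el dmat_dmat)
  thus ?thesis using f_inj f_img by (auto simp: iso_def hom_def bij_betw_def)
 qed
 have f_reg: "regular_map_on ground_field n S p f" unfolding regular_map_on_def
 proof (intro allI impI)
  fix i j assume ij: "i < p" "j < p"
  show "regular_function_on ground_field n S (\<lambda>g. f g $$ (i, j))"
  proof (cases "i = j")
   case True
   obtain h where h: "h \<in> poly_funs n ground_field" "\<forall>g \<in> Mat n. y (b j) g = h g" using y_poly[OF ba(1)[OF ij(2)]] by blast
   show ?thesis by (rule regular_function_onI[OF h(1), of _ _ 0]) (use h(2) ij True elc in "auto simp: f_def S_def")
  next
   case False
   have "(\<lambda>_. 0) \<in> poly_funs n (ground_field :: 'a alg_closure set)" by (rule poly_funs.const) simp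
   thus ?thesis by (rule regular_function_onI[of _ _ _ _ _ 0]) (use ij False in "auto simp: f_def")
  qed
 qed
 have el_entry: "el x $$ (i, j) = (\<Sum>U | atom U. wt x (Min U) * to_ac (idm U $$ (i, j)))" if ij: "i < n" "j < n" for x i j
  unfolding el_def cj_atoms[OF ij, of "wt x"]
 proof (rule sum.cong[OF refl])
  fix U assume "U \<in> {U. atom U}"
  hence U: "atom U" by simp
  have "cj (\<lambda>k. if k \<in> U then wt x k else 0) = wt x (Min U) \<cdot> ac (idm U)"
   unfolding ac_idm[OF atomD(1)[OF U]] cj_smult by (rule cj_cong) (use wt_const[OF U _ atom_Min(1)[OF U]] in auto)
  thus "cj (\<lambda>k. if k \<in> U then wt x k else 0) $$ (i, j) = wt x (Min U) * to_ac (idm U $$ (i, j))"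
   using ix(4)[OF Ec[OF U] ij] ac_index[OF comm_carrier[OF idm(1)[OF atomD(1)[OF U]]] ij] by simp
 qed
 \<comment> \<open>Multiplying the weight by the product of all coordinates clears the inverses:
   \<open>x j\<close>, its inverse and \<open>1\<close> become \<open>x j * x j\<close>,
   \<open>1\<close> and \<open>x j\<close>. That product is the determinant of the diagonal matrix,
   so the inverse map is regular with exponent \<open>1\<close>.\<close>
 define c where "c U x = (\<Prod>j<p. if Min U \<in> b j then x j * x j else if Min U \<in> st (b j) then 1 else x j)"
  for U and x :: "nat => 'a alg_closure"
 have c: "wt x (Min U) = c U x / (\<Prod>j<p. x j)" if "nz x" for U x
  unfolding c_def wt_def prod_dividef[symmetric] by (intro prod.cong refl) (use that in "auto simp: nz_def field_simps")
 have g_reg: "regular_map_on ground_field p (diagonal_torus p) n (inv_into S f)" unfolding regular_map_on_def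
 proof (intro allI impI)
  fix i j assume ij: "i < n" "j < n"
  show "regular_function_on ground_field p (diagonal_torus p) (\<lambda>D. inv_into S f D $$ (i, j))"
  proof (rule regular_function_onI[of "\<lambda>D. \<Sum>U | atom U. c U (\<lambda>j. D $$ (j, j)) * to_ac (idm U $$ (i, j))" _ _ _ _ 1])
   have e: "(\<lambda>D :: 'a alg_closure mat. D $$ (k, k)) \<in> poly_funs p ground_field" if "k < p" for k using that by (intro poly_funs.entry)
   show "(\<lambda>D. \<Sum>U | atom U. c U (\<lambda>j. D $$ (j, j)) * to_ac (idm U $$ (i, j))) \<in> poly_funs p ground_field"
    unfolding c_def
   proof (intro poly_funs_sum poly_funs.mult poly_funs_prod poly_funs.const ground_field_closed)
    fix U k assume "k \<in> {..<p}"
    hence k: "k < p" by simp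
    show "(\<lambda>D :: 'a alg_closure mat. if Min U \<in> b k then D $$ (k, k) * D $$ (k, k) else if Min U \<in> st (b k) then 1 else D $$ (k, k)) \<in> poly_funs p ground_field"
     using e[OF k] poly_funs.mult[OF e[OF k] e[OF k]] poly_funs.const[of 1 ground_field p] by (cases "Min U \<in> b k"; cases "Min U \<in> st (b k)") simp_all
   qed
   fix D :: "'a alg_closure mat" assume D: "D \<in> diagonal_torus p"
   define x where "x = (\<lambda>j. D $$ (j, j))"
   have Dx: "D = dmat p x" unfolding x_def by (rule diag[OF D])
   have x: "nz x" using D unfolding Dx dmat_GL .
   have "inv_into S f D = el x" by (rule inv_into_f_eq[OF f_inj]) (use x in "auto simp: S_def f_el Dx")
   hence "inv_into S f D $$ (i, j) = el x $$ (i, j)" by simp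
   also have "\<dots> = (\<Sum>U | atom U. c U x / (\<Prod>j<p. x j) * to_ac (idm U $$ (i, j)))"
    unfolding el_entry[OF ij] c[OF x] ..
   also have "\<dots> = (\<Sum>U | atom U. c U x * to_ac (idm U $$ (i, j))) / (\<Prod>j<p. x j)"
    unfolding sum_divide_distrib by simp
   also have "(\<Prod>j<p. x j) = det D ^ 1" by (simp add: Dx det_dmat)
   finally show "inv_into S f D $$ (i, j) = (\<Sum>U | atom U. c U (\<lambda>j. D $$ (j, j)) * to_ac (idm U $$ (i, j))) / det D ^ 1"
    by (simp only: x_def)
  qed
 qed
 have "split_torus n p S"
  unfolding split_torus_def algebraic_group_iso_def using algebraic f_iso f_reg g_reg by blast
 moreover have "S \<subseteq> torus_group" using el_T by (auto simp: S_def)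
 ultimately show ?thesis by (auto simp: p_def)
qed

end

section \<open>Counting cosets\<close>

context spectral
begin

text \<open>The norm is a product of at most \<open>n\<close> eigenvalues, and the eigenvalues of
  \<open>t\<close> are those of its bounded conjugate.\<close>

lemma nrm_le:
 assumes U: "idem U" and t: "t \<in> comm" and c: "1 \<le> absv c"
  and h: "h \<in> Mat n" "hi \<in> Mat n" "h * hi = Id n" "mbd n (absv c) (hi * t * h)"
 shows "absv (nrm U t) \<le> absv c ^ n"
proof -
 have c0: "c \<noteq> 0" using c by auto
 have tV: "ac t * V = V * dmat n (ev t)" unfolding comm_cj[OF t] by (rule cj_V)
 have "abd c (ev t i)" if "i \<in> U" for i
  by (rule eigenvalue_abd[OF c0 h(1-3) comm_carrier[OF t] tV h(4)]) (use that idem_sub[OF U] in auto)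
 hence "abd (c ^ card U) (\<Prod>i\<in>U. ev t i)" by (rule abd_prod)
 hence "abd (c ^ card U) (to_ac (nrm U t))" by (simp only: nrm_ev[OF U t])
 hence "absv (nrm U t) \<le> absv (c ^ card U)" by (rule abd_to_acD) (use c0 in simp)
 also have "\<dots> \<le> absv c ^ n" unfolding absv_power
  by (rule power_increasing[OF _ c]) (use card_mono[OF _ idem_sub[OF U]] in simp)
 finally show ?thesis .
qed

definition vl :: "nat set => 'a mat => int" where
 "vl U t = (SOME k. absv (nrm U t) = q powi k)"

lemma vl:
 assumes "idem U" "t \<in> TF"
 shows "absv (nrm U t) = q powi vl U t"
proof -
 have "nrm U t \<noteq> 0" using nrm_TF_star[OF assms] by auto
 then obtain k where "absv (nrm U t) = q powi k" by (rule absv_discrete)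
 thus ?thesis unfolding vl_def by (rule someI)
qed

lemma nrm_quotient:
 assumes U: "idem U" and t: "t \<in> TF" "u \<in> TF"
 shows "absv (nrm U (star t * u)) = q powi (vl U u - vl U t)"
proof -
 have 1: "nrm U (star t * u) = nrm U (star t) * nrm U u"
  by (rule nrm_mult[OF U TF_comm(1)[OF TF_star[OF t(1)]] TF_comm(1)[OF t(2)]])
 have "absv (nrm U t) * absv (nrm U (star t)) = 1"
  using arg_cong[OF nrm_TF_star[OF U t(1)], of absv] by (simp add: absv_mult)
 hence 2: "absv (nrm U (star t)) = inverse (q powi vl U t)" unfolding vl[OF U t(1)] by (simp add: inverse_unique)
 show ?thesis unfolding 1 absv_mult 2 vl[OF U t(2)] using q_gt_1 by (simp add: power_int_diff divide_inverse)
qed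

text \<open>Elements of \<open>E\<close> with the same valuations at \<open>P1\<close> differ by an
  element of \<open>K\<close>, and every translate of \<open>K\<close> has the volume of
  \<open>K\<close>. So the measure is at most the number of valuation vectors times that
  volume.\<close>

lemma measure_coset_bound:
 assumes haar: "haar_measure_on absv n TF \<mu>" and K: "maximal_compact_subgroup absv n TF K"
  and Vol: "emeasure \<mu> K = ennreal Vol" "Vol > 0"
  and E: "E \<subseteq> TF" and h: "h \<in> Mat n" "hi \<in> Mat n" "h * hi = Id n"
  and c: "absv c = q ^ b" and bound: "\<forall>t\<in>E. \<forall>u\<in>E. mbd n (absv c) (hi * (star t * u) * h)"
 shows "measure \<mu> E \<le> Vol * (2 * real n * real b + 1) ^ card P1"
proof (cases "E \<in> sets \<mu> \<and> E \<noteq> {}")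
 case False
 hence "measure \<mu> E = 0" by (auto simp: measure_notin_sets)
 thus ?thesis using Vol by simp
next
 case True
 hence Es: "E \<in> sets \<mu>" by blast
 obtain t0 where t0: "t0 \<in> E" using True by blast
 have c1: "1 \<le> absv c" unfolding c using q_gt_1 by simp
 have KK: "K = K0" by (rule maximal_compact_unique[OF K])
 have inv: "emeasure \<mu> ((\<lambda>x. t * x) ` A) = emeasure \<mu> A" if "t \<in> TF" "A \<in> sets \<mu>" for t A
  using haar that by (auto simp: haar_measure_on_def)
 \<comment> \<open>\<open>emeasure\<close> is zero outside the measurable sets, so a positive value
   forces measurability. The same argument serves for the translates.\<close>
 have Ks: "K \<in> sets \<mu>"
 proof (rule ccontr)
  assume "K \<notin> sets \<mu>"
  hence "ennreal Vol = 0" using emeasure_notin_sets Vol(1) by metis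
  thus False using Vol(2) by simp
 qed
 have eK: "emeasure \<mu> ((\<lambda>x. t * x) ` K) = ennreal Vol" if "t \<in> TF" for t using inv[OF that Ks] Vol(1) by simp
 have sK: "(\<lambda>x. t * x) ` K \<in> sets \<mu>" if "t \<in> TF" for t
 proof (rule ccontr)
  assume "(\<lambda>x. t * x) ` K \<notin> sets \<mu>"
  hence "ennreal Vol = 0" using emeasure_notin_sets eK[OF that] by metis
  thus False using Vol(2) by simp
 qed
 let ?m = "int (b * n)"
 have le: "vl U u - vl U t \<le> ?m" if "idem U" "t \<in> E" "u \<in> E" for U t u
 proof -
  have T: "t \<in> TF" "u \<in> TF" using that E by auto
  have "q powi (vl U u - vl U t) \<le> absv c ^ n" unfolding nrm_quotient[OF that(1) T, symmetric]
   by (rule nrm_le[OF that(1) _ c1 h]) (use bound that TF_comm(1)[OF TF_mult[OF TF_star[OF T(1)] T(2)]] in auto)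
  also have "\<dots> = q powi ?m" unfolding c power_mult[symmetric] by (simp only: power_int_of_nat)
  finally show ?thesis using q_gt_1 power_int_strict_increasing[of ?m "vl U u - vl U t" q] by (meson linorder_not_le)
 qed
 \<comment> \<open>Valuations relative to the base point \<open>t0\<close>. Both orders of a pair of
   elements are bounded, so each component is one of the \<open>2 * b * n + 1\<close> integers of
   absolute value at most \<open>b * n\<close>.\<close>
 define v where "v t = restrict (\<lambda>U. vl U t - vl U t0) P1" for t
 have vE: "v ` E \<subseteq> PiE P1 (\<lambda>_. {- ?m..?m})"
 proof
  fix w assume "w \<in> v ` E"
  then obtain t where t: "t \<in> E" "w = v t" by blast
  have "vl U t - vl U t0 \<in> {- ?m..?m}" if "U \<in> P1" for U
   using le[OF P1_atom(2)[OF that] t0 t(1)] le[OF P1_atom(2)[OF that] t(1) t0] by simp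
  thus "w \<in> PiE P1 (\<lambda>_. {- ?m..?m})" unfolding t(2) v_def by (rule restrict_PiE_iff[THEN iffD2, rule_format])
 qed
 have finP: "finite (PiE P1 (\<lambda>_. {- ?m..?m}))" by (rule finite_PiE[OF finite_P1]) simp
 hence fin: "finite (v ` E)" by (rule finite_subset[OF vE])
 have "card (v ` E) \<le> card (PiE P1 (\<lambda>_. {- ?m..?m}))" by (rule card_mono[OF finP vE])
 also have "\<dots> = (2 * b * n + 1) ^ card P1"
 proof -
  have "card {- ?m..?m} = 2 * b * n + 1" by (simp add: nat_eq_iff)
  thus ?thesis by (simp only: card_PiE[OF finite_P1] prod_constant)
 qed
 finally have "real (card (v ` E)) \<le> real ((2 * b * n + 1) ^ card P1)" by (simp only: of_nat_le_iff)
 also have "\<dots> = (2 * real n * real b + 1) ^ card P1" by (simp add: ac_simps)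
 finally have card: "real (card (v ` E)) \<le> (2 * real n * real b + 1) ^ card P1" .
 have coset: "star t * u \<in> K" if tu: "t \<in> E" "u \<in> E" "v t = v u" for t u
 proof -
  have T: "t \<in> TF" "u \<in> TF" "star t * u \<in> TF" using tu E TF_mult[OF TF_star] by auto
  have "absv (nrm W (star t * u)) = 1" if W: "W \<in> P1" for W
  proof -
   have "v t W = v u W" using tu(3) by simp
   hence "vl W u - vl W t = 0" using W by (simp add: v_def)
   thus ?thesis unfolding nrm_quotient[OF P1_atom(2)[OF W] T(1,2)] by simp
  qed
  hence "\<forall>W\<in>P1. absv (nrm W (star t * u)) = 1" by blast
  hence "absv (nrm U (star t * u)) = 1" if "atom U" for U by (rule P1_cases[OF that _ T(3)])
  thus ?thesis using T(3) by (simp add: KK K0_def)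
 qed
 have "\<forall>w\<in>v ` E. \<exists>t\<in>E. v t = w" by blast
 then obtain \<tau> where \<tau>: "\<forall>w\<in>v ` E. \<tau> w \<in> E \<and> v (\<tau> w) = w" by metis
 have \<tau>T: "\<tau> w \<in> TF" if "w \<in> v ` E" for w using \<tau> that E by blast
 have cover: "E \<subseteq> (\<Union>w\<in>v ` E. (\<lambda>x. \<tau> w * x) ` K)"
 proof
  fix t assume t: "t \<in> E"
  have w: "\<tau> (v t) \<in> E" "v (\<tau> (v t)) = v t" using \<tau> t by auto
  have T: "\<tau> (v t) \<in> TF" "t \<in> TF" using w t E by auto
  have "t = \<tau> (v t) * (star (\<tau> (v t)) * t)"
   by (rule sq_inv_cancel(1)[OF TF_comm(2)[OF T(1)] TF_comm(2)[OF TF_star[OF T(1)]] TF_comm(3)[OF T(1)] TF_comm(2)[OF T(2)], symmetric])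
  moreover have "star (\<tau> (v t)) * t \<in> K" by (rule coset[OF w(1) t w(2)])
  ultimately show "t \<in> (\<Union>w\<in>v ` E. (\<lambda>x. \<tau> w * x) ` K)" using t by blast
 qed
 have us: "(\<Union>w\<in>v ` E. (\<lambda>x. \<tau> w * x) ` K) \<in> sets \<mu>" by (rule sets.finite_UN[OF fin]) (rule sK[OF \<tau>T])
 have "emeasure \<mu> E \<le> emeasure \<mu> (\<Union>w\<in>v ` E. (\<lambda>x. \<tau> w * x) ` K)" by (rule emeasure_mono[OF cover us])
 also have "\<dots> \<le> (\<Sum>w\<in>v ` E. emeasure \<mu> ((\<lambda>x. \<tau> w * x) ` K))"
  by (rule emeasure_subadditive_finite[OF fin]) (use sK[OF \<tau>T] in blast)
 also have "\<dots> = (\<Sum>w\<in>v ` E. ennreal Vol)" by (rule sum.cong[OF refl]) (rule eK[OF \<tau>T])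
 also have "\<dots> = ennreal (real (card (v ` E)) * Vol)" using Vol(2) by (simp add: ennreal_of_nat_eq_real_of_nat ennreal_mult')
 finally have "measure \<mu> E \<le> real (card (v ` E)) * Vol"
  unfolding measure_def using Vol(2) by (intro enn2real_leI) auto
 also have "\<dots> \<le> (2 * real n * real b + 1) ^ card P1 * Vol" by (rule mult_right_mono[OF card]) (use Vol(2) in simp)
 finally show ?thesis by (simp only: mult.commute)
qed

text \<open>With \<open>Z = g t h\<close> and \<open>W = h^(-1) (\<gamma> - 1)^(-1) h\<close>, the
  relation \<open>Z W J Z^T = g (\<gamma> - 1)^(-1) J g^T\<close> holds because \<open>t\<close> and
  \<open>h\<close> preserve \<open>J\<close> and \<open>t\<close> commutes with \<gamma>. It
  expresses the inverse of \<open>Z\<close> through its transpose. The only unbounded factor is the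
  denominator \<open>det (\<gamma> - 1)\<close> from the adjugate bound on \<open>W\<close>.\<close>

lemma quotient_bound:
 assumes g: "g \<in> Mat n" "gi \<in> Mat n" "g * gi = Id n"
  and h: "h \<in> Mat n" "hi \<in> Mat n" "h * hi = Id n" "h * J * h\<^sup>T = J"
  and RH: "1 \<le> RH" "mbd n RH (hi * \<gamma> * h)"
  and RJ: "0 \<le> RJ" "mbd n RJ J"
  and \<gamma>1: "\<gamma>1 \<in> Mat n" "(\<gamma> - Id n) * \<gamma>1 = Id n"
  and Y: "Yi \<in> Mat n" "g * \<gamma>1 * J * g\<^sup>T * Yi = Id n" "0 \<le> RY" "mbd n RY Yi"
  and t: "t \<in> TF" "mbd n \<rho> (g * t * h)" "0 \<le> \<rho>" and u: "u \<in> TF" "mbd n \<rho> (g * u * h)"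
 shows "mbd n (\<rho> * \<rho> * (RH ^ n * RJ * RY) / absv (det (\<gamma> - Id n))) (hi * (star t * u) * h)"
proof -
 note tc = TF_comm(2)[OF t(1)] and uc = TF_comm(2)[OF u(1)] and sc = TF_comm(2)[OF TF_star[OF t(1)]]
 have gt: "g\<^sup>T \<in> Mat n" "h\<^sup>T \<in> Mat n" "t\<^sup>T \<in> Mat n" using g h tc by auto
 have g1: "\<gamma> - Id n \<in> Mat n" using \<gamma>(1) by (auto intro!: cl)
 have gig: "gi * g = Id n" by (rule mat_mult_left_right_inverse[OF g])
 have hih: "hi * h = Id n" by (rule mat_mult_left_right_inverse[OF h(1-3)])
 let ?Z = "g * t * h" and ?W = "hi * \<gamma>1 * h" and ?\<delta> = "absv (det (\<gamma> - Id n))"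
 have Zc: "?Z \<in> Mat n" using g tc h by (auto intro!: cl)
 have Wc: "?W \<in> Mat n" using h \<gamma>1 by (auto intro!: cl)
 let ?\<gamma>h = "hi * (\<gamma> - Id n) * h"
 have \<gamma>hc: "?\<gamma>h \<in> Mat n" using h g1 by (auto intro!: cl)
 have \<gamma>h: "?\<gamma>h = hi * \<gamma> * h - Id n" using h(1,2) \<gamma>(1) by (simp add: ds cl hih)
 have m1: "mbd n RH ?\<gamma>h" unfolding \<gamma>h by (intro mbd_minus mbd_one RH)
 have dh: "det hi * det h = 1" using det_mult[OF h(2,1)] hih by simp
 have d1: "det ?\<gamma>h = det (\<gamma> - Id n)"
  unfolding det_mult[OF sq_closed(3)[OF h(2) g1] h(1)] det_mult[OF h(2) g1] using dh by (simp add: mult_ac)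
 have W1: "?\<gamma>h * ?W = Id n"
 proof -
  have "?\<gamma>h * ?W = hi * ((\<gamma> - Id n) * (h * (hi * (\<gamma>1 * h))))" using h(1,2) g1 \<gamma>1(1) by (simp add: as cl)
  also have "h * (hi * (\<gamma>1 * h)) = \<gamma>1 * h" by (rule sq_inv_cancel(1)[OF h(1-3) sq_closed(3)[OF \<gamma>1(1) h(1)]])
  also have "(\<gamma> - Id n) * (\<gamma>1 * h) = h" by (rule sq_inv_cancel(1)[OF g1 \<gamma>1 h(1)])
  finally show ?thesis by (simp only: hih)
 qed
 have mW: "mbd n (RH ^ n / ?\<delta>) ?W"
  using mbd_inverse[OF m1 RH(1)] det_minus_one(2) unfolding d1 GL_inv_eqI(1)[OF \<gamma>hc Wc W1] by blast
 have \<gamma>1c: "\<gamma>1 * t = t * \<gamma>1"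
 proof -
  have "\<gamma>1 \<in> comm"
  proof -
   have a: "(\<gamma> - Id n) * \<gamma> = \<gamma> * (\<gamma> - Id n)" using \<gamma>(1) by (simp add: ds cl)
   have "\<gamma>1 * \<gamma> = \<gamma> * \<gamma>1" by (rule commute_inverse[OF g1 \<gamma>(1) \<gamma>1(1) a \<gamma>1(2)])
   thus ?thesis using \<gamma>1(1) by (simp add: comm_def)
  qed
  thus ?thesis by (rule comm_commute) (rule TF_comm(1)[OF t(1)])
 qed
 have tJ: "t * J * t\<^sup>T = J" using t(1) by (simp add: TF_def)
 have ZY: "?Z * (?W * J * ?Z\<^sup>T) = g * \<gamma>1 * J * g\<^sup>T"
 proof -
  have Zt: "?Z\<^sup>T = h\<^sup>T * (t\<^sup>T * g\<^sup>T)" using g(1) h(1) tc by (simp add: tp cl)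
  have "?Z * (?W * J * ?Z\<^sup>T) = g * (t * (h * (hi * (\<gamma>1 * (h * J * h\<^sup>T * (t\<^sup>T * g\<^sup>T))))))"
   unfolding Zt using g(1) h(1,2) tc \<gamma>1(1) J(1) gt by (simp add: as cl)
  also have "h * J * h\<^sup>T = J" by (rule h(4))
  also have "h * (hi * (\<gamma>1 * (J * (t\<^sup>T * g\<^sup>T)))) = \<gamma>1 * (J * (t\<^sup>T * g\<^sup>T))"
   by (rule sq_inv_cancel(1)[OF h(1-3)]) (use \<gamma>1(1) J(1) gt in "auto intro!: cl")
  also have "g * (t * (\<gamma>1 * (J * (t\<^sup>T * g\<^sup>T)))) = g * (t * \<gamma>1) * J * (t\<^sup>T * g\<^sup>T)"
   using g(1) tc \<gamma>1(1) J(1) gt by (simp add: as cl)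
  also have "\<dots> = g * \<gamma>1 * (t * J * t\<^sup>T) * g\<^sup>T"
   unfolding \<gamma>1c[symmetric] using g(1) tc \<gamma>1(1) J(1) gt by (simp add: as cl)
  finally show ?thesis unfolding tJ .
 qed
 \<comment> \<open>This is the inverse of \<open>?Z\<close>; multiplied by \<open>g * u * h\<close>
   it gives the conjugate of \<open>star t * u\<close>, since the factors \<open>g\<close>
   cancel.\<close>
 let ?Zi = "?W * J * ?Z\<^sup>T * Yi"
 have Mc: "?W * J * ?Z\<^sup>T \<in> Mat n" "?Z\<^sup>T \<in> Mat n" "?W * J \<in> Mat n"
  using Wc J(1) Zc by (auto intro!: cl simp del: transpose_carrier_mat)
 have Zic: "?Zi \<in> Mat n" by (rule sq_closed(3)[OF Mc(1) Y(1)])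
 have ZZi: "?Z * ?Zi = Id n" using as[OF Zc Mc(1) Y(1)] unfolding ZY Y(2) by simp
 have Zi: "?Zi = hi * star t * gi"
 proof (rule mat_cancel_left[OF Zic _ Zc])
  show "hi * star t * gi \<in> Mat n" using h sc g by (auto intro!: cl)
  show "det ?Z \<noteq> 0" by (rule GL_inv_eqI(2)[OF Zc Zic ZZi])
  have "?Z * (hi * star t * gi) = g * (t * (h * (hi * (star t * gi))))" using g(1,2) tc h(1,2) sc by (simp add: as cl)
  also have "h * (hi * (star t * gi)) = star t * gi" by (rule sq_inv_cancel(1)[OF h(1-3) sq_closed(3)[OF sc g(2)]])
  also have "t * (star t * gi) = gi" by (rule sq_inv_cancel(1)[OF tc sc TF_comm(3)[OF t(1)] g(2)])
  finally show "?Z * ?Zi = ?Z * (hi * star t * gi)" using ZZi g(3) by simp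
 qed
 have d0: "0 \<le> RH ^ n / ?\<delta>" using RH(1) absv_nonneg by simp
 have A0: "mbd n (RH ^ n / ?\<delta> * RJ * \<rho> * RY) ?Zi"
  by (intro mbd_mult mW RJ mbd_transpose[OF t(2)] Y(4) mult_nonneg_nonneg d0 t(3) Y(3))
 have A: "mbd n (RH ^ n / ?\<delta> * RJ * \<rho> * RY * \<rho>) (?Zi * (g * u * h))"
  by (rule mbd_mult[OF A0 u(2)]) (intro mult_nonneg_nonneg d0 t(3) Y(3) RJ)+
 have B: "?Zi * (g * u * h) = hi * (star t * u) * h"
 proof -
  have "hi * star t * gi * (g * u * h) = hi * (star t * (gi * (g * (u * h))))" using h(1,2) sc g(1,2) uc by (simp add: as cl)
  also have "gi * (g * (u * h)) = u * h" by (rule sq_inv_cancel(1)[OF g(2,1) gig sq_closed(3)[OF uc h(1)]])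
  finally show ?thesis unfolding Zi using h(1,2) sc uc by (simp add: as cl)
 qed
 have "RH ^ n / ?\<delta> * RJ * \<rho> * RY * \<rho> = \<rho> * \<rho> * (RH ^ n * RJ * RY) / ?\<delta>" by (simp add: mult_ac)
 thus ?thesis using A unfolding B by (simp only:)
qed

text \<open>The passage from the multiplicative bound \<open>N\<close> to the linear expression
  \<open>x\<close>: \<open>log q N\<close> is bounded by \<open>x - 1\<close>, and the number of
  cosets is polynomial in that logarithm.\<close>

lemma measure_bound:
 assumes haar: "haar_measure_on absv n TF \<mu>" and K: "maximal_compact_subgroup absv n TF K"
  and Vol: "emeasure \<mu> K = ennreal Vol" "Vol > 0" and \<pi>: "uniformizer absv \<pi>"
  and g: "g \<in> Mat n" "gi \<in> Mat n" "g * gi = Id n"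
  and h: "h \<in> Mat n" "hi \<in> Mat n" "h * hi = Id n" "h * J * h\<^sup>T = J"
  and RH: "1 \<le> RH" "mbd n RH (hi * \<gamma> * h)"
  and RJ: "1 \<le> RJ" "mbd n RJ J"
  and \<gamma>1: "\<gamma>1 \<in> Mat n" "(\<gamma> - Id n) * \<gamma>1 = Id n"
  and Y: "Yi \<in> Mat n" "g * \<gamma>1 * J * g\<^sup>T * Yi = Id n" "1 \<le> RY" "mbd n RY Yi"
  and RL: "1 \<le> RL" and E: "E \<subseteq> TF" "\<forall>t\<in>E. mbd n (q powi k * RL) (g * t * h)"
  and M: "1 \<le> M" "1 \<le> C2" "inverse (absv (det (\<gamma> - Id n))) \<le> C2 * M ^ n"
  and x: "x \<ge> 2 * real_of_int k + log q (RL * RL * (RH ^ n * RJ * RY) * C2) + real n * log q M + 1"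
  and r: "card P1 \<le> r"
 shows "(x < 0 --> measure \<mu> E = 0) \<and> (0 \<le> x --> measure \<mu> E \<le> Vol * (2 * real n + 1) ^ n * x ^ r)"
proof (cases "E = {}")
 case True
 thus ?thesis using Vol(2) by simp
next
 case False
 then obtain t0 where t0: "t0 \<in> E" by blast
 let ?\<rho> = "q powi k * RL" and ?\<delta> = "absv (det (\<gamma> - Id n))" and ?R = "RH ^ n * RJ * RY"
 define N where "N = ?\<rho> * ?\<rho> * ?R / ?\<delta>"
 have q0: "q > 1" "q > 0" using q_gt_1 by auto
 have \<rho>0: "0 \<le> ?\<rho>" using q0 RL by simp
 have qb: "mbd n N (hi * (star t * u) * h)" if "t \<in> E" "u \<in> E" for t u unfolding N_def
  by (rule quotient_bound[OF g h RH _ RJ(2) \<gamma>1 Y(1,2) _ Y(4) _ _ \<rho>0]) (use that E RJ(1) Y(3) in auto)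
 have \<delta>0: "?\<delta> > 0" by (rule absv_pos[OF det_minus_one(2)])
 have R1: "1 \<le> ?R" using RH(1) RJ(1) Y(3) by (intro mult_ge1_I one_le_power) auto
 \<comment> \<open>For \<open>u = t\<close> the conjugated quotient is the identity matrix, whose
   diagonal entries have absolute value one.\<close>
 have N1: "1 \<le> N"
 proof -
  have T: "t0 \<in> TF" using t0 E by blast
  have "hi * (star t0 * t0) * h = Id n"
   unfolding TF_comm(4)[OF T] using h(1,2) mat_mult_left_right_inverse[OF h(1-3)] by simp
  hence "mbd n N (Id n)" using qb[OF t0 t0] by simp
  from mbd_index[OF this n0 n0] n0 show ?thesis by simp
 qed
 have Nle: "N \<le> q powi k * q powi k * (RL * RL * ?R * C2) * M ^ n"
 proof -
  have "N = q powi k * q powi k * (RL * RL * ?R) * inverse ?\<delta>" by (simp add: N_def divide_inverse mult_ac)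
  also have "\<dots> \<le> q powi k * q powi k * (RL * RL * ?R) * (C2 * M ^ n)"
   by (rule mult_left_mono[OF M(3)]) (use q0 RL R1 in auto)
  finally show ?thesis by (simp add: mult_ac)
 qed
 have C: "1 \<le> RL * RL * ?R * C2" by (rule mult_ge1_I[OF mult_ge1_I[OF mult_ge1_I[OF RL RL] R1] M(2)])
 have C0: "0 < RL * RL * ?R * C2" using C by linarith
 have "log q N \<le> log q (q powi k * q powi k * (RL * RL * ?R * C2) * M ^ n)" using Nle N1 q0 by simp
 also have "\<dots> = 2 * real_of_int k + log q (RL * RL * ?R * C2) + real n * log q M"
 proof -
  have lk: "log q (q powi k) = real_of_int k" using q0 powr_real_of_int'[of q k] log_powr_cancel[of q "real_of_int k"] by simp
  have gen: "log q (a * a * d * e) = log q a + log q a + log q d + log q e" if "0 < a" "0 < d" "0 < e" for a d e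
   using that by (simp add: log_mult)
  have "log q (q powi k * q powi k * (RL * RL * ?R * C2) * M ^ n) =
   log q (q powi k) + log q (q powi k) + log q (RL * RL * ?R * C2) + log q (M ^ n)"
   by (rule gen[OF _ C0]) (use q0 M(1) in auto)
  also have "log q (M ^ n) = real n * log q M" using M by (simp add: log_nat_power)
  finally show ?thesis unfolding lk by simp
 qed
 finally have lN: "log q N \<le> x - 1" using x by simp
 have l0: "0 \<le> log q N" using N1 q0 by simp
 \<comment> \<open>The valuation argument needs a power of \<open>q\<close>, hence the rounding up.
   The unit reserved in the hypothesis on \<open>x\<close> absorbs it.\<close>
 define b where "b = nat \<lceil>log q N\<rceil>"
 have b: "real b \<le> x" "log q N \<le> real b" using l0 lN by (auto simp: b_def) linarith+
 have "N = q powr log q N" using N1 q0 by simp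
 also have "\<dots> \<le> q powr real b" using b(2) q0 by simp
 also have "\<dots> = q ^ b" using q0 by (simp add: powr_realpow)
 finally have Nb: "N \<le> q ^ b" .
 define c where "c = inverse \<pi> ^ b"
 have c: "absv c = q ^ b" unfolding c_def absv_power absv_inverse uniformizer_absv[OF \<pi>] by simp
 have "measure \<mu> E \<le> Vol * (2 * real n * real b + 1) ^ card P1"
  by (rule measure_coset_bound[OF haar K Vol E(1) h(1-3) c]) (unfold c, intro ballI mbd_mono[OF qb Nb])
 also have "\<dots> \<le> Vol * ((2 * real n + 1) * x) ^ card P1"
 proof (intro mult_left_mono power_mono)
  have x1: "1 \<le> x" using l0 lN by simp
  have "2 * real n * real b \<le> 2 * real n * x" by (rule mult_left_mono[OF b(1)]) simp
  thus "2 * real n * real b + 1 \<le> (2 * real n + 1) * x" using x1 by (simp add: algebra_simps)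
 qed (use Vol(2) in auto)
 \<comment> \<open>The constant is raised to the power \<open>n\<close> so that it is the same for
   all tori; the power of \<open>x\<close> is raised to \<open>r\<close>, which is allowed because
   \<open>x \<ge> 1\<close>.\<close>
 also have "\<dots> \<le> Vol * ((2 * real n + 1) ^ n * x ^ r)" unfolding power_mult_distrib
  using l0 lN Vol(2) card_P1 r by (intro mult_left_mono mult_mono power_increasing) auto
 finally show ?thesis using l0 lN by (simp add: mult_ac)
qed

end

section \<open>The forms\<close>

lemma w_mat:
 "w_mat n \<in> Mat n" "w_mat n * w_mat n = (Id n :: 'a::field mat)" "(w_mat n)\<^sup>T = (w_mat n :: 'a mat)"
proof -
 show c: "w_mat k \<in> carrier_mat k k" for k by (simp add: w_mat_def)
 show "w_mat n * w_mat n = (Id n :: 'a mat)"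
 proof (rule sq_eqI[OF sq_closed(3)[OF c c] one_carrier_mat])
  fix i j assume ij: "i < n" "j < n"
  have "(w_mat n * w_mat n) $$ (i, j) = (\<Sum>k<n. if k = n - 1 - i then if i = j then 1 else (0 :: 'a) else 0)"
   unfolding sq_mult_index[OF c c ij] by (intro sum.cong refl) (use ij in "auto simp: w_mat_def")
  thus "(w_mat n * w_mat n) $$ (i, j) = (Id n :: 'a mat) $$ (i, j)" using ij by simp
 qed
 show "(w_mat n)\<^sup>T = (w_mat n :: 'a mat)" by (intro eq_matI) (auto simp: w_mat_def add.commute)
qed

text \<open>For even \<open>n\<close> the indices \<open>i\<close> and \<open>j\<close> of an
  antidiagonal place have opposite parity. So the signs in transposed places are opposite, which
  makes the matrix skew with inverse \<open>- u_mat n\<close>.\<close>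

lemma u_mat:
 assumes "even n"
 shows "u_mat n \<in> Mat n" "u_mat n * (- u_mat n) = (Id n :: 'a::field mat)" "(u_mat n)\<^sup>T = (- 1) \<cdot> (u_mat n :: 'a mat)"
proof -
 show c: "u_mat k \<in> carrier_mat k k" for k by (simp add: u_mat_def)
 have sgn: "(- 1) ^ j = - ((- 1) ^ i :: 'a)" if "i + j + 1 = n" for i j
 proof -
  have "odd (i + j)" using assms that by (metis even_add odd_one)
  thus ?thesis by (cases "even i") auto
 qed
 show "u_mat n * (- u_mat n) = (Id n :: 'a mat)"
 proof (rule sq_eqI[OF sq_closed(3)[OF c sq_closed(4)[OF c]] one_carrier_mat])
  fix i j assume ij: "i < n" "j < n"
  have "(u_mat n * (- u_mat n)) $$ (i, j) = (\<Sum>k<n. if k = n - 1 - i then if i = j then 1 else (0 :: 'a) else 0)"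
   unfolding sq_mult_index[OF c sq_closed(4)[OF c] ij]
  proof (intro sum.cong refl)
   fix k assume "k \<in> {..<n}"
   hence k: "k < n" by simp
   show "u_mat n $$ (i, k) * (- u_mat n) $$ (k, j) = (if k = n - 1 - i then if i = j then 1 else (0 :: 'a) else 0)"
   proof (cases "k = n - 1 - i")
    case True
    hence "i + k + 1 = n" using ij by simp
    have "(- 1) ^ i * (- 1) ^ i = (1 :: 'a)" by (simp flip: power_mult_distrib)
    hence s: "(- 1) ^ i * - ((- 1) ^ k) = (1 :: 'a)" unfolding sgn[OF \<open>i + k + 1 = n\<close>] by simp
    have kj: "k + j + 1 = n \<longleftrightarrow> i = j" using ij True by auto
    have A: "u_mat n $$ (i, k) = ((- 1) ^ i :: 'a)" using ij k \<open>i + k + 1 = n\<close> by (simp add: u_mat_def)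
    have B: "(- u_mat n) $$ (k, j) = (if i = j then - ((- 1) ^ k) else (0 :: 'a))" using ij k kj by (simp add: u_mat_def)
    show ?thesis unfolding A B if_P[OF True] using s by auto
   qed (use ij k in "auto simp: u_mat_def")
  qed
  thus "(u_mat n * (- u_mat n)) $$ (i, j) = (Id n :: 'a mat) $$ (i, j)" using ij by simp
 qed
 show "(u_mat n)\<^sup>T = (- 1) \<cdot> (u_mat n :: 'a mat)" by (intro eq_matI) (auto simp: u_mat_def add.commute sgn)
qed

text \<open>The antidiagonal part is its own inverse and the rows of the central block meet only the
  central block, so inverting \<open>J_mat m \<Lambda>\<close> amounts to inverting \<Lambda>. The
  proof separates central and other rows.\<close>

lemma J_mat:
 assumes m: "m \<ge> 1"
 shows "J_mat m \<Lambda> \<in> Mat (2 * m)"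
  "\<Lambda> \<in> carrier_mat 2 2 ==> \<Lambda>' \<in> carrier_mat 2 2 ==> \<Lambda> * \<Lambda>' = 1\<^sub>m 2 ==> J_mat m \<Lambda> * J_mat m \<Lambda>' = (1\<^sub>m (2 * m) :: 'a::field mat)"
  "\<Lambda> \<in> carrier_mat 2 2 ==> \<Lambda>\<^sup>T = \<Lambda> ==> (J_mat m \<Lambda>)\<^sup>T = (J_mat m \<Lambda> :: 'a mat)"
proof -
 show c: "J_mat m A \<in> Mat (2 * m)" for A by (simp add: J_mat_def)
 show "(J_mat m \<Lambda>)\<^sup>T = (J_mat m \<Lambda> :: 'a mat)" if L: "\<Lambda> \<in> carrier_mat 2 2" "\<Lambda>\<^sup>T = \<Lambda>"
 proof (rule sq_eqI[OF sq_closed(6)[OF c] c])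
  fix i j assume ij: "i < 2 * m" "j < 2 * m"
  have s: "\<Lambda> $$ (a, b) = \<Lambda> $$ (b, a)" if "a < 2" "b < 2" for a b
   using arg_cong[OF L(2), of "\<lambda>M. M $$ (b, a)"] L(1) that by simp
  have b: "k - (m - 1) < 2" if "k \<in> {m - 1, m}" for k using that by auto
  show "(J_mat m \<Lambda>)\<^sup>T $$ (i, j) = J_mat m \<Lambda> $$ (i, j)"
   using ij s[OF b b, of i j] by (auto simp: J_mat_def add.commute)
 qed
 show "J_mat m \<Lambda> * J_mat m \<Lambda>' = (1\<^sub>m (2 * m) :: 'a mat)"
  if L: "\<Lambda> \<in> carrier_mat 2 2" "\<Lambda>' \<in> carrier_mat 2 2" "\<Lambda> * \<Lambda>' = 1\<^sub>m 2"
 proof (rule sq_eqI[OF sq_closed(3)[OF c c] one_carrier_mat])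
  fix i j assume ij: "i < 2 * m" "j < 2 * m"
  let ?B = "{m - 1, m}"
  have out: "J_mat m A $$ (a, b) = (if a + b + 1 = 2 * m then 1 else 0)" if "a < 2 * m" "b < 2 * m" "a \<notin> ?B \<or> b \<notin> ?B"
   for A :: "'a mat" and a b
  proof -
   have "\<not> (a \<in> ?B \<and> b \<in> ?B)" using that(3) by blast
   thus ?thesis unfolding J_mat_def using that(1,2) by (simp only: index_mat split if_False)
  qed
  have inn: "J_mat m A $$ (a, b) = A $$ (a - (m - 1), b - (m - 1))" if "a < 2 * m" "b < 2 * m" "a \<in> ?B" "b \<in> ?B"
   for A :: "'a mat" and a b using that by (simp add: J_mat_def)
  have B2: "m - 1 < 2 * m" "m < 2 * m" using m by auto
  have e: "(J_mat m \<Lambda> * J_mat m \<Lambda>') $$ (i, j) = (\<Sum>k<2 * m. J_mat m \<Lambda> $$ (i, k) * J_mat m \<Lambda>' $$ (k, j))"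
   by (rule sq_mult_index[OF c c ij])
  show "(J_mat m \<Lambda> * J_mat m \<Lambda>') $$ (i, j) = (1\<^sub>m (2 * m) :: 'a mat) $$ (i, j)"
  proof (cases "i \<in> ?B")
   case False
   have "(\<Sum>k<2 * m. J_mat m \<Lambda> $$ (i, k) * J_mat m \<Lambda>' $$ (k, j)) = (\<Sum>k<2 * m. if k = 2 * m - 1 - i then if i = j then 1 else (0 :: 'a) else 0)"
   proof (rule sum.cong[OF refl])
    fix k assume "k \<in> {..<2 * m}"
    hence k: "k < 2 * m" by simp
    have 1: "J_mat m \<Lambda> $$ (i, k) = (if k = 2 * m - 1 - i then 1 else 0)"
     unfolding out[OF ij(1) k disjI1[OF False]] using ij k by auto
    have 2: "J_mat m \<Lambda>' $$ (k, j) = (if i = j then 1 else 0)" if k': "k = 2 * m - 1 - i"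
    proof -
     have "k \<notin> ?B" using False k' ij(1) by simp linarith
     moreover have "k + j + 1 = 2 * m \<longleftrightarrow> i = j" using k' ij by auto
     ultimately show ?thesis using out[OF k ij(2)] by simp
    qed
    show "J_mat m \<Lambda> $$ (i, k) * J_mat m \<Lambda>' $$ (k, j) = (if k = 2 * m - 1 - i then if i = j then 1 else (0 :: 'a) else 0)"
     unfolding 1 using 2 by simp
   qed
   thus ?thesis unfolding e using ij by simp
  next
   case True
   have "(\<Sum>k<2 * m. J_mat m \<Lambda> $$ (i, k) * J_mat m \<Lambda>' $$ (k, j)) = (\<Sum>k\<in>?B. J_mat m \<Lambda> $$ (i, k) * J_mat m \<Lambda>' $$ (k, j))"
   proof (rule sum.mono_neutral_right)
    show "?B \<subseteq> {..<2 * m}" using B2 by simp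
    show "\<forall>k\<in>{..<2 * m} - ?B. J_mat m \<Lambda> $$ (i, k) * J_mat m \<Lambda>' $$ (k, j) = 0"
    proof
     fix k assume k: "k \<in> {..<2 * m} - ?B"
     hence "i + k + 1 \<noteq> 2 * m" using True m by auto
     thus "J_mat m \<Lambda> $$ (i, k) * J_mat m \<Lambda>' $$ (k, j) = 0" using out[OF ij(1), of k \<Lambda>] k by simp
    qed
   qed simp
   also have "\<dots> = J_mat m \<Lambda> $$ (i, m - 1) * J_mat m \<Lambda>' $$ (m - 1, j) + J_mat m \<Lambda> $$ (i, m) * J_mat m \<Lambda>' $$ (m, j)"
    using m by simp
   also have "\<dots> = (if i = j then 1 else 0)"
   proof (cases "j \<in> ?B")
    case j: True
    have ab: "i - (m - 1) < 2" "j - (m - 1) < 2" using True j by auto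
    have "(\<Lambda> * \<Lambda>') $$ (i - (m - 1), j - (m - 1)) = (\<Sum>k<2. \<Lambda> $$ (i - (m - 1), k) * \<Lambda>' $$ (k, j - (m - 1)))"
     by (rule sq_mult_index[OF L(1,2) ab])
    also have "\<dots> = \<Lambda> $$ (i - (m - 1), 0) * \<Lambda>' $$ (0, j - (m - 1)) + \<Lambda> $$ (i - (m - 1), 1) * \<Lambda>' $$ (1, j - (m - 1))"
     by (simp add: numeral_2_eq_2)
    finally have "\<dots> = (if i - (m - 1) = j - (m - 1) then 1 else 0)" unfolding L(3) using ab by simp
    moreover have "i - (m - 1) = j - (m - 1) \<longleftrightarrow> i = j" using True j m by auto
    moreover have "m - (m - 1) = 1" using m by simp
    ultimately show ?thesis using inn[OF ij(1) B2(1) True] inn[OF ij(1) B2(2) True] inn[OF B2(1) ij(2) _ j] inn[OF B2(2) ij(2) _ j] by simp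
   next
    case False
    have "m - 1 + j + 1 \<noteq> 2 * m" "m + j + 1 \<noteq> 2 * m" "i \<noteq> j" using False True m by auto
    thus ?thesis using out[OF B2(1) ij(2) disjI2[OF False]] out[OF B2(2) ij(2) disjI2[OF False]] by simp
   qed
   finally show ?thesis unfolding e using ij by simp
  qed
 qed
qed

text \<open>The sign under transposition, shared by the matrix of the form and the matrix of the
  dagger in each case. This common sign allows both cases to be treated by the same
  formulas.\<close>

fun form_sign :: "'a::field form_case => 'a" where
 "form_sign (Orthogonal \<Lambda>) = 1"
| "form_sign Symplectic = - 1"

lemma form_mat:
 assumes m: "m \<ge> 1" and C: "valid_case C"
 obtains Ji where "form_mat m C \<in> Mat (2 * m)" "Ji \<in> Mat (2 * m)"
  "form_mat m C * Ji = 1\<^sub>m (2 * m)" "(form_mat m C)\<^sup>T = form_sign C \<cdot> form_mat m C"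
proof (cases C)
 case (Orthogonal \<Lambda>)
 hence L: "\<Lambda> \<in> carrier_mat 2 2" "det \<Lambda> \<noteq> 0" "\<Lambda>\<^sup>T = \<Lambda>" using C by (auto simp: carrier_GL)
 note i = GL_inv[OF L(1,2)]
 have one: "1 \<cdot> A = A" for A :: "'a mat" by (intro eq_matI) auto
 show ?thesis by (rule that[of "J_mat m (inv\<^bsub>GL 2\<^esub> \<Lambda>)"])
   (simp_all add: Orthogonal one J_mat(1)[OF m] J_mat(2)[OF m L(1) i(1,2)] J_mat(3)[OF m L(1,3)])
next
 case Symplectic
 have e: "even (2 * m)" by simp
 show ?thesis by (rule that[of "- u_mat (2 * m)"]) (use u_mat[OF e] Symplectic in auto)
qed

lemma dagger_mat:
 obtains Pi where "dagger_mat m C \<in> Mat (2 * m)" "Pi \<in> Mat (2 * m)"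
  "dagger_mat m C * Pi = 1\<^sub>m (2 * m)" "(dagger_mat m C)\<^sup>T = form_sign C \<cdot> dagger_mat m C"
proof (cases C)
 case (Orthogonal \<Lambda>)
 have one: "1 \<cdot> A = A" for A :: "'a mat" by (intro eq_matI) auto
 show ?thesis by (rule that[of "w_mat (2 * m)"]) (simp_all add: Orthogonal one w_mat)
next
 case Symplectic
 have e: "even (2 * m)" by simp
 show ?thesis by (rule that[of "- u_mat (2 * m)"]) (use u_mat[OF e] Symplectic in auto)
qed

text \<open>In the symplectic case the matrices of dagger and form coincide, so the extra factor is
  the identity and one formula serves both cases.\<close>

lemma S_map_eq:
 assumes m: "m \<ge> 1" and C: "valid_case C" and \<gamma>: "\<gamma> \<in> Mat (2 * m)"
 shows "S_map m C \<gamma> = dagger_mat m C * inv\<^bsub>GL (2 * m)\<^esub> (form_mat m C) * (\<gamma> - 1\<^sub>m (2 * m))"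
proof (cases C)
 case Symplectic
 have "even (2 * m)" by simp
 note u = u_mat[OF this]
 have "(u_mat (2 * m) :: 'a mat) * inv\<^bsub>GL (2 * m)\<^esub> (u_mat (2 * m)) = 1\<^sub>m (2 * m)"
  unfolding GL_inv_eqI(1)[OF u(1) sq_closed(4)[OF u(1)] u(2)] by (rule u(2))
 thus ?thesis using Symplectic \<gamma> by simp
qed simp

text \<open>The map is evaluated only at basis elements, which lie in \<open>U\<close>.\<close>

lemma quotient_det_cong:
 assumes "\<And>M. M \<in> U ==> f M = f' M"
 shows "quotient_det n f U W = quotient_det n f' U W"
proof -
 have "(\<forall>j<length bs. f (bs ! j) - mat_lincomb n bs (col A j) \<in> W) \<longleftrightarrow> (\<forall>j<length bs. f' (bs ! j) - mat_lincomb n bs (col A j) \<in> W)"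
  if "quotient_basis n U W bs" for bs A
 proof -
  have "bs ! j \<in> U" if "j < length bs" for j
   using \<open>quotient_basis n U W bs\<close> nth_mem[OF that] by (auto simp: quotient_basis_def)
  thus ?thesis using assms by simp
 qed
 hence "(\<lambda>D. \<exists>bs A. quotient_basis n U W bs \<and> A \<in> carrier_mat (length bs) (length bs) \<and>
   (\<forall>j<length bs. f (bs ! j) - mat_lincomb n bs (col A j) \<in> W) \<and> D = det A) =
  (\<lambda>D. \<exists>bs A. quotient_basis n U W bs \<and> A \<in> carrier_mat (length bs) (length bs) \<and>
   (\<forall>j<length bs. f' (bs ! j) - mat_lincomb n bs (col A j) \<in> W) \<and> D = det A)" by (intro ext) blast
 thus ?thesis unfolding quotient_det_def by simp
qed

text \<open>The description over the closure, restricted to matrices over \<open>F\<close>, where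
  the equations may be compared before extension of scalars.\<close>

lemma Lie_isometry:
 fixes B :: "'a::field_char_0 mat"
 assumes B: "B \<in> Mat n" "det B \<noteq> 0"
 shows "Lie n {g \<in> carrier (GL n). g * acm B * g\<^sup>T = acm B} =
  {A \<in> Mat n. A * B = - (B * A\<^sup>T)}"
  and "K \<in> Mat n ==>
  Lie n {g \<in> carrier (GL n). g * acm B * g\<^sup>T = acm B \<and> g * acm K = acm K * g} =
  {A \<in> Mat n. A * B = - (B * A\<^sup>T) \<and> A * K = K * A}"
proof -
 have Bc: "acm B \<in> Mat n" "det (acm B) \<noteq> 0" using B by auto
 have um: "acm (- M) = - acm M" for M :: "'a mat" by (intro eq_matI) auto
 have e: "acm A * acm B = - (acm B * (acm A)\<^sup>T) \<longleftrightarrow> A * B = - (B * A\<^sup>T)"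
  if A: "A \<in> Mat n" for A
 proof -
  have t: "A\<^sup>T \<in> Mat n" using A by simp
  show ?thesis
   unfolding map_ac_transpose[symmetric] map_ac_mult[OF A B(1), symmetric] map_ac_mult[OF B(1) t, symmetric] um[symmetric] map_mat_inj ..
 qed
 have e2: "acm A * acm K = acm K * acm A \<longleftrightarrow> A * K = K * A"
  if A: "A \<in> Mat n" and K: "K \<in> Mat n" for A K :: "'a mat"
  unfolding map_ac_mult[OF A K, symmetric] map_ac_mult[OF K A, symmetric] map_mat_inj ..
 show 2: "Lie n {g \<in> carrier (GL n). g * acm B * g\<^sup>T = acm B \<and> g * acm K = acm K * g} =
  {A \<in> Mat n. A * B = - (B * A\<^sup>T) \<and> A * K = K * A}" if K: "K \<in> Mat n" for K
 proof -
  have Kc: "acm K \<in> Mat n" using K by simp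
  show ?thesis unfolding Lie_isometry_centralizer[OF Bc Kc] using e e2[OF _ K] by blast
 qed
 have "{g \<in> carrier (GL n). g * acm B * g\<^sup>T = acm B} =
  {g \<in> carrier (GL n). g * acm B * g\<^sup>T = acm B \<and> g * acm (Id n) = acm (Id n) * g}" by (auto simp: carrier_GL)
 moreover have "{A \<in> Mat n. A * B = - (B * A\<^sup>T) \<and> A * Id n = Id n * A} = {A \<in> Mat n. A * B = - (B * A\<^sup>T)}" by auto
 ultimately show "Lie n {g \<in> carrier (GL n). g * acm B * g\<^sup>T = acm B} =
  {A \<in> Mat n. A * B = - (B * A\<^sup>T)}" using 2[OF one_carrier_mat] by simp
qed

lemma isometry_det:
 fixes h :: "'b::field mat"
 assumes "h \<in> Mat n" "J \<in> Mat n" "det J \<noteq> 0" "h * J * h\<^sup>T = J"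
 shows "det h \<noteq> 0"
proof
 assume z: "det h = 0"
 have "det J = det (h * J) * det h\<^sup>T"
  using arg_cong[OF assms(4), of det] det_mult[OF sq_closed(3)[OF assms(1,2)] sq_closed(6)[OF assms(1)]] by simp
 also have "det (h * J) = det h * det J" by (rule det_mult[OF assms(1,2)])
 finally show False using z assms(3) by simp
qed

context padic_field
begin

text \<open>Regularity says that the centralizer of \<gamma> in the full isometry group is the
  torus. This is the hypothesis of \<open>regular_isometry\<close> over the closure, and its
  diagonalization is handed to \<open>spectral\<close>.\<close>

lemma regular_spectral:
 assumes m: "m \<ge> 1" and n: "n = 2 * m" and C: "valid_case C" and T: "maximal_torus n (H_group m C) T"
  and \<gamma>: "\<gamma> \<in> regular_elements m C T"
  and Ji: "form_mat m C \<in> Mat n" "Ji \<in> Mat n" "form_mat m C * Ji = Id n"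
   "(form_mat m C)\<^sup>T = form_sign C \<cdot> form_mat m C"
 shows "\<exists>V Vi l. spectral absv n (form_mat m C) Ji \<gamma> (inv\<^bsub>GL n\<^esub> \<gamma>) (form_sign C) V Vi l"
  and "T = {g \<in> carrier (GL n). g * acm (form_mat m C) * g\<^sup>T = acm (form_mat m C) \<and>
   g * acm \<gamma> = acm \<gamma> * g}"
proof -
 let ?J = "form_mat m C" and ?s = "form_sign C"
 have dJ: "det ?J \<noteq> 0" by (rule GL_inv_eqI(2)[OF Ji(1-3)])
 show Teq: "T = {g \<in> carrier (GL n). g * acm ?J * g\<^sup>T = acm ?J \<and> g * acm \<gamma> = acm \<gamma> * g}"
  using \<gamma> unfolding regular_elements_def H_plus_def n by auto
 have \<gamma>T: "\<gamma> \<in> Mat n" "acm \<gamma> \<in> T" using \<gamma> by (auto simp: regular_elements_def F_points_def n)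
 have g2: "acm \<gamma> * acm ?J * (acm \<gamma>)\<^sup>T = acm ?J" using \<gamma>T(2) Teq by blast
 have aJ: "acm ?J \<in> Mat n" "acm Ji \<in> Mat n" "acm ?J * acm Ji = Id n" using Ji map_ac_mult[OF Ji(1,2)] by auto
 have aJt: "(acm ?J)\<^sup>T = to_ac ?s \<cdot> acm ?J"
  unfolding map_ac_transpose[symmetric] Ji(4) using Ji(1) by (intro eq_matI) auto
 have s: "to_ac ?s = 1 \<or> to_ac ?s = - 1" "?s = 1 \<or> ?s = - 1" by (cases C; simp)+
 obtain d f where f: "algebraic_group_iso UNIV n T d (diagonal_torus d) f"
  using T by (auto simp: maximal_torus_def torus_def)
 have cent: "h \<in> T" if h: "h \<in> Mat n" "h * acm ?J * h\<^sup>T = acm ?J" "h * acm \<gamma> = acm \<gamma> * h" for h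
 proof -
  have "det h \<noteq> 0" by (rule isometry_det[OF h(1) aJ(1) _ h(2)]) (use dJ in simp)
  thus ?thesis unfolding Teq using h by (simp add: carrier_GL)
 qed
 \<comment> \<open>In the orthogonal case the torus lies in the special orthogonal group by
   definition; in the symplectic case the sign is \<open>- 1\<close> and the premise is false in
   characteristic zero.\<close>
 have special: "det h = 1" if h: "to_ac ?s = 1" "h \<in> T" for h
 proof (cases C)
  case (Orthogonal \<Lambda>)
  have "h \<in> H_group m C" using T h(2) by (auto simp: maximal_torus_def)
  thus ?thesis using Orthogonal by simp
 next
  case Symplectic
  hence "(- 1 :: 'a alg_closure) = 1" using h(1) by simp
  thus ?thesis by simp
 qed
 have \<gamma>a: "acm \<gamma> \<in> Mat n" using \<gamma>T(1) by simp
 interpret R: regular_isometry n "acm ?J" "acm Ji" "acm \<gamma>" "to_ac ?s" T d f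
  by (unfold_locales; (rule aJ s aJt \<gamma>a g2 cent special f; assumption)?)
 obtain V Vi l where V: "V \<in> Mat n" "Vi \<in> Mat n" "V * Vi = Id n"
  "acm \<gamma> * V = V * dmat n l" "inj_on l {..<n}" "\<forall>i<n. l i * l i \<noteq> 1" by (rule R.diagonalization)
 have g3: "\<gamma> * ?J * \<gamma>\<^sup>T = ?J"
 proof -
  have t: "\<gamma>\<^sup>T \<in> Mat n" using \<gamma>T(1) by simp
  have "acm (\<gamma> * ?J * \<gamma>\<^sup>T) = acm ?J"
   using g2 unfolding map_ac_mult[OF sq_closed(3)[OF \<gamma>T(1) Ji(1)] t] map_ac_mult[OF \<gamma>T(1) Ji(1)] by simp
  thus ?thesis by (simp only: map_mat_inj)
 qed
 note gi = GL_inv[OF \<gamma>T(1) isometry_det[OF \<gamma>T(1) Ji(1) dJ g3]]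
 have "spectral absv n ?J Ji \<gamma> (inv\<^bsub>GL n\<^esub> \<gamma>) ?s V Vi l"
  by (unfold_locales) (use m n Ji s(2) \<gamma>T(1) gi g3 V in auto)
 thus "\<exists>V Vi l. spectral absv n ?J Ji \<gamma> (inv\<^bsub>GL n\<^esub> \<gamma>) ?s V Vi l" by blast
qed

end

section \<open>The twisted form attached to \<open>S(\<gamma>)\<close> and the bound on
  \<open>det (\<gamma> - 1)\<close>\<close>

context spectral
begin

lemma F_points_torus_group: "F_points n torus_group = TF"
proof -
 have "ac t \<in> torus_group \<longleftrightarrow> t * \<gamma> = \<gamma> * t \<and> t * J * t\<^sup>T = J" if t: "t \<in> Mat n" for t
 proof -
  have tt: "t\<^sup>T \<in> Mat n" using t by simp
  have 1: "ac t * ac J * (ac t)\<^sup>T = ac J \<longleftrightarrow> t * J * t\<^sup>T = J"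
   unfolding map_ac_transpose[symmetric] ac_mult[OF t J(1), symmetric] ac_mult[OF sq_closed(3)[OF t J(1)] tt, symmetric] map_mat_inj ..
  have 2: "ac t * ac \<gamma> = ac \<gamma> * ac t \<longleftrightarrow> t * \<gamma> = \<gamma> * t"
   unfolding ac_mult[OF t \<gamma>(1), symmetric] ac_mult[OF \<gamma>(1) t, symmetric] map_mat_inj ..
  have "det t \<noteq> 0" if "t * J * t\<^sup>T = J" by (rule isometry_det[OF t J(1) inverses(4) that])
  thus ?thesis unfolding torus_group_def using t 1 2 by (auto simp: carrier_GL)
 qed
 thus ?thesis unfolding F_points_def TF_def by blast
qed

text \<open>\<open>P\<close> stands for the matrix of the dagger and \<open>\<gamma>1\<close> for
  the inverse of \<open>\<gamma> - 1\<close>. Then \<open>P * Ji * (\<gamma> - Id n)\<close> is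
  \<open>S(\<gamma>)\<close>, with inverse \<open>\<gamma>1 * (J * Pi)\<close>.\<close>

context
 fixes P Pi \<gamma>1 :: "'a mat"
 assumes P: "P \<in> Mat n" "Pi \<in> Mat n" "P * Pi = Id n" "P\<^sup>T = s \<cdot> P"
  and \<gamma>1: "\<gamma>1 \<in> Mat n" "(\<gamma> - Id n) * \<gamma>1 = Id n"
begin

lemma g1_carrier: "\<gamma> - Id n \<in> Mat n" by (rule sq_closed(2)[OF \<gamma>(1) one_carrier_mat])

lemma PJ: "P * Ji \<in> Mat n" "J * Pi \<in> Mat n" "P * Ji * (J * Pi) = Id n"
proof -
 show 1: "P * Ji \<in> Mat n" by (rule sq_closed(3)[OF P(1) J(2)])
 show 2: "J * Pi \<in> Mat n" by (rule sq_closed(3)[OF J(1) P(2)])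
 have "P * Ji * (J * Pi) = P * (Ji * (J * Pi))" by (rule as[OF P(1) J(2) 2])
 thus "P * Ji * (J * Pi) = Id n" unfolding sq_inv_cancel(1)[OF J(2,1) inverses(1) P(2)] P(3) .
qed

text \<open>Both \<open>Ji\<close> and \<open>P\<close> change by the same sign under transposition,
  and the two signs cancel.\<close>

lemma J_transpose: "J * (P * Ji)\<^sup>T = P"
proof -
 have "(P * Ji)\<^sup>T = (s \<cdot> Ji) * (s \<cdot> P)" unfolding sq_transpose(3)[OF P(1) J(2)] transpose_Ji P(4) ..
 also have "\<dots> = Ji * P" using P(1) J(2) by (simp add: ds cl ss_smult)
 finally show ?thesis using sq_inv_cancel(1)[OF J(1-3) P(1)] by simp
qed

text \<open>The first equation writes \<open>S(\<gamma>) P\<close> as a bilinear form equivalent to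
  \<open>(\<gamma> - 1) J\<close> under \<open>Q = P Ji\<close>, the shape required by
  \<open>discriminant_orthogonal\<close>. The others supply the explicit inverses.\<close>

lemma S_form:
 "P * Ji * (\<gamma> - Id n) * P = P * Ji * ((\<gamma> - Id n) * J) * (P * Ji)\<^sup>T"
 "P * Ji * (\<gamma> - Id n) * (\<gamma>1 * (J * Pi)) = Id n"
 "P * Ji * (\<gamma> - Id n) * P * (Pi * (\<gamma>1 * (J * Pi))) = Id n"
proof -
 let ?Q = "P * Ji" and ?D = "\<gamma> - Id n"
 note Q = PJ(1) and Qi = PJ(2) and D = g1_carrier
 have Qt: "?Q\<^sup>T \<in> Mat n" using Q by simp
 have "?Q * (?D * J) * ?Q\<^sup>T = ?Q * ?D * (J * ?Q\<^sup>T)" using Q D J(1) Qt by (simp only: as cl)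
 thus "?Q * ?D * P = ?Q * (?D * J) * ?Q\<^sup>T" unfolding J_transpose by simp
 have "?Q * ?D * (\<gamma>1 * (J * Pi)) = ?Q * (?D * (\<gamma>1 * (J * Pi)))" by (rule as[OF Q D sq_closed(3)[OF \<gamma>1(1) Qi]])
 thus 2: "?Q * ?D * (\<gamma>1 * (J * Pi)) = Id n" unfolding sq_inv_cancel(1)[OF D \<gamma>1 Qi] PJ(3) .
 have "?Q * ?D * P * (Pi * (\<gamma>1 * (J * Pi))) = ?Q * ?D * (P * (Pi * (\<gamma>1 * (J * Pi))))"
  by (rule as[OF sq_closed(3)[OF Q D] P(1) sq_closed(3)[OF P(2) sq_closed(3)[OF \<gamma>1(1) Qi]]])
 thus "?Q * ?D * P * (Pi * (\<gamma>1 * (J * Pi))) = Id n"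
  unfolding sq_inv_cancel(1)[OF P(1-3) sq_closed(3)[OF \<gamma>1(1) Qi]] 2 .
qed

lemma dagger_eq: "dagger P M = P * M\<^sup>T * Pi" "dagger (ac P) N = ac P * N\<^sup>T * ac Pi"
proof -
 have a: "ac P \<in> Mat n" "ac Pi \<in> Mat n" "ac P * ac Pi = Id n" using P ac_mult[OF P(1,2)] by auto
 have d: "dim_row P = n" "dim_row (ac P) = n" using P by auto
 show "dagger P M = P * M\<^sup>T * Pi" unfolding dagger_def d GL_inv_eqI(1)[OF P(1-3)] ..
 show "dagger (ac P) N = ac P * N\<^sup>T * ac Pi" unfolding dagger_def d GL_inv_eqI(1)[OF a] ..
qed

text \<open>Multiplying by \<open>P\<close> turns twisted conjugation of \<delta> into a change of
  variables in the bilinear form \<open>\<delta> P\<close>. The twisted centralizer becomes an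
  isometry group, whose Lie algebra is known.\<close>

lemma twisted_form:
 fixes \<delta> \<delta>i :: "'a mat"
 assumes \<delta>: "\<delta> \<in> Mat n" "\<delta>i \<in> Mat n" "\<delta> * \<delta>i = Id n"
 shows "M \<in> Mat n ==> Ad n \<delta> (- dagger P M) - M = - (\<delta> * P * M\<^sup>T * (Pi * \<delta>i)) - M"
  and "g \<in> Mat n ==> g * ac \<delta> * dagger (ac P) g = ac \<delta> \<longleftrightarrow> g * ac (\<delta> * P) * g\<^sup>T = ac (\<delta> * P)"
proof -
 assume M: "M \<in> Mat n"
 hence t: "M\<^sup>T \<in> Mat n" by simp
 have e: "P * M\<^sup>T * Pi \<in> Mat n" using P t by (auto intro!: cl)
 have "Ad n \<delta> (- dagger P M) = \<delta> * (- (P * M\<^sup>T * Pi)) * \<delta>i" unfolding Ad_def dagger_eq GL_inv_eqI(1)[OF \<delta>] ..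
 also have "\<dots> = - (\<delta> * (P * M\<^sup>T * Pi) * \<delta>i)"
  unfolding ds(8)[OF \<delta>(1) e] by (rule ds(7)[OF sq_closed(3)[OF \<delta>(1) e] \<delta>(2)])
 also have "\<delta> * (P * M\<^sup>T * Pi) * \<delta>i = \<delta> * P * M\<^sup>T * (Pi * \<delta>i)" using \<delta>(1,2) P(1,2) t by (simp add: as cl)
 finally show "Ad n \<delta> (- dagger P M) - M = - (\<delta> * P * M\<^sup>T * (Pi * \<delta>i)) - M" by simp
next
 assume g: "g \<in> Mat n"
 have a: "ac P \<in> Mat n" "ac Pi \<in> Mat n" "ac P * ac Pi = Id n" "ac \<delta> \<in> Mat n" "g\<^sup>T \<in> Mat n"
  using P ac_mult[OF P(1,2)] \<delta> g by auto
 let ?M = "g * ac (\<delta> * P) * g\<^sup>T"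
 have acB: "ac (\<delta> * P) = ac \<delta> * ac P" by (rule ac_mult[OF \<delta>(1) P(1)])
 have Mc: "?M \<in> Mat n" "ac (\<delta> * P) \<in> Mat n" using g a \<delta> P unfolding acB by (auto intro!: cl)
 have 1: "g * ac \<delta> * dagger (ac P) g = ?M * ac Pi" unfolding dagger_eq acB using g a by (simp add: as cl)
 have 2: "ac \<delta> = ac (\<delta> * P) * ac Pi" unfolding acB as[OF a(4,1,2)] a(3) using a(4) by simp
 have dPi: "det (ac Pi) \<noteq> 0" by (rule GL_inv_eqI(3)[OF a(1-3)])
 have "g * ac \<delta> * dagger (ac P) g = ac \<delta> \<longleftrightarrow> ?M * ac Pi = ac (\<delta> * P) * ac Pi" by (simp only: 1 2[symmetric])
 also have "\<dots> \<longleftrightarrow> ?M = ac (\<delta> * P)" using mat_cancel_right[OF Mc a(2) dPi] by auto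
 finally show "g * ac \<delta> * dagger (ac P) g = ac \<delta> \<longleftrightarrow> ?M = ac (\<delta> * P)" .
qed

text \<open>The element assumed to lie in the compact set is, up to the fixed factor
  \<open>Pi\<close>, the symmetric expression that occurs in \<open>quotient_bound\<close>.\<close>

lemma Y_form:
 assumes g: "g \<in> Mat n"
 shows "g * (\<gamma>1 * (J * Pi)) * dagger P g = g * \<gamma>1 * J * g\<^sup>T * Pi"
proof -
 have t: "g\<^sup>T \<in> Mat n" using g by simp
 have "Pi * P = Id n" by (rule mat_mult_left_right_inverse[OF P(1-3)])
 hence 1: "Pi * (P * (g\<^sup>T * Pi)) = g\<^sup>T * Pi" by (rule sq_inv_cancel(1)[OF P(2,1) _ sq_closed(3)[OF t P(2)]])
 have "g * (\<gamma>1 * (J * Pi)) * dagger P g = g * (\<gamma>1 * (J * (Pi * (P * (g\<^sup>T * Pi)))))"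
  unfolding dagger_eq using g \<gamma>1(1) J(1) P(1,2) t by (simp add: as cl)
 also have "\<dots> = g * \<gamma>1 * J * g\<^sup>T * Pi" unfolding 1 using g \<gamma>1(1) J(1) P(1,2) t by (simp add: as cl)
 finally show ?thesis .
qed

text \<open>\<open>M\<close> is the maximum of \<open>1\<close> and the inverse absolute value of
  one discriminant: the ordinary one in the symplectic case, the twisted one in the orthogonal case.
  Its logarithm is one of the two functions \<phi>, and the other may be added because it is
  nonnegative.\<close>

lemma det_minus_one_bound:
 assumes n: "n = 2 * m" and m: "m \<ge> 1" and C: "valid_case C" and JC: "J = form_mat m C" "P = dagger_mat m C" "s = form_sign C" "\<gamma>i = inv\<^bsub>GL n\<^esub> \<gamma>"
  and c: "1 \<le> absv c" and lc: "\<And>i. i < n ==> abd c (l i)" "\<And>i. i < n ==> abd c (inverse (l i))"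
 shows "\<exists>M\<ge>1. inverse (absv (det (\<gamma> - Id n))) \<le> absv (c * c) ^ (n * n * n + n) * M ^ n \<and>
  log q M \<le> phi_H absv m C torus_group \<gamma> + phi_S absv m C \<gamma>"
proof -
 let ?e = "n * n * n + n" and ?\<delta> = "absv (det (\<gamma> - Id n))"
 have \<delta>0: "?\<delta> > 0" by (rule absv_pos[OF det_minus_one(2)])
 have bound: "inverse ?\<delta> \<le> absv (c * c) ^ ?e * max 1 (inverse (absv D)) ^ n"
  if D: "D \<noteq> 0" "absv D ^ n \<le> absv (c * c) ^ ?e * ?\<delta>" for D
 proof -
  have D0: "absv D > 0" by (rule absv_pos[OF D(1)])
  have "inverse ?\<delta> \<le> absv (c * c) ^ ?e * inverse (absv D) ^ n" using D(2) D0 \<delta>0 by (simp add: field_simps)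
  also have "\<dots> \<le> absv (c * c) ^ ?e * max 1 (inverse (absv D)) ^ n"
   using D0 absv_nonneg by (intro mult_left_mono power_mono) auto
  finally show ?thesis .
 qed
 have pos: "0 \<le> phi_H absv m C torus_group \<gamma>" "0 \<le> phi_S absv m C \<gamma>"
  unfolding phi_H_def phi_S_def using q_gt_1 by simp_all
 show ?thesis
 proof (cases C)
  case Symplectic
  have Hp: "H_plus m C = {g \<in> carrier (GL n). g * ac J * g\<^sup>T = ac J}" unfolding H_plus_def JC(1) n ..
  have "D_disc m C torus_group \<gamma> = quotient_det n (\<lambda>M. \<gamma> * M * \<gamma>i - M) {A \<in> Mat n. A * J = - (J * A\<^sup>T)}
   {A \<in> Mat n. A * J = - (J * A\<^sup>T) \<and> A * \<gamma> = \<gamma> * A}"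
   using Lie_isometry(1)[OF J(1) inverses(4)] Lie_isometry(2)[OF J(1) inverses(4) \<gamma>(1)] Hp
   unfolding D_disc_def Ad_def JC(4) n[symmetric] torus_group_def by (simp add: Symplectic)
  hence "D_disc m C torus_group \<gamma> \<noteq> 0" "absv (D_disc m C torus_group \<gamma>) ^ n \<le> absv (c * c) ^ ?e * ?\<delta>"
   using discriminant_symplectic[OF _ c lc] Symplectic JC(3) by simp_all
  from bound[OF this] show ?thesis
   by (intro exI[of _ "max 1 (inverse (absv (D_disc m C torus_group \<gamma>)))"]) (use pos(2) in "simp add: phi_H_def")
 next
  case (Orthogonal \<Lambda>)
  let ?Q = "P * Ji" and ?D = "\<gamma> - Id n"
  let ?\<delta>m = "?Q * ?D"
  let ?B = "?Q * (?D * J) * ?Q\<^sup>T" and ?Bi = "Pi * (\<gamma>1 * (J * Pi))"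
  have S: "S_map m C \<gamma> = ?\<delta>m"
   using S_map_eq[OF m C] \<gamma>(1) GL_inv_eqI(1)[OF J(1-3)] unfolding n[symmetric] JC(1,2)[symmetric] by simp
  have dc: "?\<delta>m \<in> Mat n" "\<gamma>1 * (J * Pi) \<in> Mat n"
   by (rule sq_closed(3)[OF PJ(1) g1_carrier], rule sq_closed(3)[OF \<gamma>1(1) PJ(2)])
  have Bc: "?B \<in> Mat n" "?Bi \<in> Mat n" "?B * ?Bi = Id n"
   using S_form(3) unfolding S_form(1)[symmetric] by (auto intro!: sq_closed(3) P dc)
  have tc: "twisted_centralizer m C ?\<delta>m = {g \<in> carrier (GL n). g * ac ?B * g\<^sup>T = ac ?B}"
   unfolding twisted_centralizer_def JC(2)[symmetric] n[symmetric] S_form(1)[symmetric]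
   using twisted_form(2)[OF dc S_form(2)] by (auto simp: carrier_GL)
  have "D_eps m C (S_map m C \<gamma>) = quotient_det n (\<lambda>M. Ad n ?\<delta>m (- dagger P M) - M) (Mat n)
   {A \<in> Mat n. A * ?B = - (?B * A\<^sup>T)}"
   unfolding D_eps_def S n[symmetric] tc JC(2)[symmetric] Lie_GL Lie_isometry(1)[OF Bc(1) GL_inv_eqI(2)[OF Bc]] ..
  also have "\<dots> = quotient_det n (\<lambda>M. - (?B * M\<^sup>T * ?Bi) - M) (Mat n)
   {A \<in> Mat n. A * ?B = - (?B * A\<^sup>T)}"
   by (rule quotient_det_cong) (use twisted_form(1)[OF dc S_form(2)] S_form(1) in simp)
  finally have D: "D_eps m C (S_map m C \<gamma>) = \<dots>" .
  have "s = 1" using JC(3) Orthogonal by simp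
  from discriminant_orthogonal[OF this c lc PJ refl Bc(2,3)]
  have "D_eps m C (S_map m C \<gamma>) \<noteq> 0" "absv (D_eps m C (S_map m C \<gamma>)) ^ n \<le> absv (c * c) ^ ?e * ?\<delta>"
   unfolding D by blast+
  from bound[OF this] show ?thesis
   by (intro exI[of _ "max 1 (inverse (absv (D_eps m C (S_map m C \<gamma>))))"]) (use pos(1) in "simp add: phi_S_def")
 qed
qed

end

end

section \<open>Bounds from compactness and the choice of the uniform constants\<close>

context padic_field
begin

lemma compactin_bounded_ex:
 assumes "n > 0" "compactin (mat_topology absv n) S"
 shows "\<exists>R\<ge>1. \<forall>A\<in>S. mbd n R A" by (rule compactin_bounded[OF assms]) blast

lemma compactin_GL_bounded_ex:
 assumes "n > 0" "compactin (mat_topology absv n) S" "S \<subseteq> carrier (GL n)"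
 shows "\<exists>R\<ge>1. \<forall>A\<in>S. mbd n R A \<and> mbd n R (inv\<^bsub>GL n\<^esub> A)" by (rule compactin_GL_bounded[OF assms]) blast

lemma powi_uniformizer: "uniformizer absv \<pi> ==> absv (\<pi> powi (- k)) = q powi k"
 by (simp add: power_int_minus absv_inverse absv_powi uniformizer_absv power_int_inverse)

end

theorem corollary9:
  fixes absv :: "'a::field_char_0 \<Rightarrow> real" and \<pi> :: 'a
    and m n :: nat and C :: "'a form_case"
    and C\<^sub>G C\<^sub>H L :: "'a mat set" and V :: real
  assumes "padic_field absv" and "uniformizer absv \<pi>"
    and "m \<ge> 1" and "n = 2 * m" and "valid_case C"
    and "compactin (subtopology (mat_topology absv n) (carrier (GL n))) C\<^sub>G"
    and "compactin (subtopology (mat_topology absv n) (F_points n (H_group m C))) C\<^sub>H"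
    and "invariant_lattice absv n L"
    and "V > 0"
  shows "\<exists>c\<^sub>L c\<^sub>1 c\<^sub>2 c\<^sub>3 :: real. c\<^sub>L > 0 \<and> c\<^sub>1 > 0 \<and> c\<^sub>2 > 0 \<and> c\<^sub>3 > 0 \<and>
    (\<forall>T r K \<mu>.
      maximal_torus n (H_group m C) T \<and> has_split_rank n T r \<and>
      haar_measure_on absv n (F_points n T) \<mu> \<and>
      maximal_compact_subgroup absv n (F_points n T) K \<and> emeasure \<mu> K = ennreal V \<longrightarrow>
      (\<forall>g \<in> carrier (GL n). \<forall>h \<in> F_points n (H_group m C). \<forall>\<gamma> \<in> regular_elements m C T.
        g * inv\<^bsub>GL n\<^esub> (S_map m C \<gamma>) * dagger (dagger_mat m C) g \<in> C\<^sub>G \<and>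
        inv\<^bsub>GL n\<^esub> h * \<gamma> * h \<in> C\<^sub>H \<longrightarrow>
        (\<forall>k :: int.
          let x = 2 * real_of_int k + c\<^sub>1 + c\<^sub>2 * phi_H absv m C T \<gamma> + c\<^sub>3 * phi_S absv m C \<gamma> in
            (x < 0 \<longrightarrow> weight n \<pi> L (F_points n T) \<mu> k g h = 0) \<and>
            (x \<ge> 0 \<longrightarrow> weight n \<pi> L (F_points n T) \<mu> k g h \<le> c\<^sub>L * x ^ r))))"
proof -
 interpret padic_field absv by fact
 note \<pi> = assms(2) and m = assms(3) and n = assms(4) and C = assms(5) and CG = assms(6) and CH = assms(7) and Vol = assms(9)
 have L: "compactin (mat_topology absv n) L" using assms(8) by (simp add: invariant_lattice_def)
 have n0: "n > 0" using m n by simp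
 define J where "J = form_mat m C"
 define P where "P = dagger_mat m C"
 obtain Ji where J0: "form_mat m C \<in> Mat (2 * m)" "Ji \<in> Mat (2 * m)"
  "form_mat m C * Ji = 1\<^sub>m (2 * m)" "(form_mat m C)\<^sup>T = form_sign C \<cdot> form_mat m C" by (rule form_mat[OF m C])
 note J = J0[folded n J_def]
 obtain Pi where P0: "dagger_mat m C \<in> Mat (2 * m)" "Pi \<in> Mat (2 * m)"
  "dagger_mat m C * Pi = 1\<^sub>m (2 * m)" "(dagger_mat m C)\<^sup>T = form_sign C \<cdot> dagger_mat m C" by (rule dagger_mat)
 note P = P0[folded n P_def]
 have dJ: "det J \<noteq> 0" by (rule GL_inv_eqI(2)[OF J(1-3)])
 have Hp: "h * J * h\<^sup>T = J" "det h \<noteq> 0" "h \<in> Mat n" if h: "h \<in> F_points n (H_group m C)" for h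
 proof -
  show hc: "h \<in> Mat n" using h by (simp add: F_points_def)
  have t: "h\<^sup>T \<in> Mat n" using hc by simp
  have "acm h \<in> H_plus m C" using h by (cases C) (auto simp: F_points_def)
  hence "acm h * acm J * (acm h)\<^sup>T = acm J" by (simp add: H_plus_def J_def)
  hence "acm (h * J * h\<^sup>T) = acm J"
   unfolding map_ac_mult[OF sq_closed(3)[OF hc J(1)] t] map_ac_mult[OF hc J(1)] by simp
  thus 1: "h * J * h\<^sup>T = J" by (simp only: map_mat_inj)
  show "det h \<noteq> 0" by (rule isometry_det[OF hc J(1) dJ 1])
 qed
 have CG': "compactin (mat_topology absv n) C\<^sub>G" "C\<^sub>G \<subseteq> carrier (GL n)" using CG by (auto simp: compactin_subtopology)
 have CH': "compactin (mat_topology absv n) C\<^sub>H" "C\<^sub>H \<subseteq> carrier (GL n)" using CH Hp(2,3) by (auto simp: compactin_subtopology carrier_GL)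
 obtain RG where RG: "RG \<ge> 1" "\<forall>A\<in>C\<^sub>G. mbd n RG A \<and> mbd n RG (inv\<^bsub>GL n\<^esub> A)" using compactin_GL_bounded_ex[OF n0 CG'] by blast
 obtain RH where RH: "RH \<ge> 1" "\<forall>A\<in>C\<^sub>H. mbd n RH A \<and> mbd n RH (inv\<^bsub>GL n\<^esub> A)" using compactin_GL_bounded_ex[OF n0 CH'] by blast
 obtain RL where RL: "RL \<ge> 1" "\<forall>A\<in>L. mbd n RL A" using compactin_bounded_ex[OF n0 L] by blast
 obtain RJ where RJ: "RJ \<ge> 1" "mbd n RJ J" using mbd_exists[OF J(1)] by blast
 obtain RP where RP: "RP \<ge> 1" "mbd n RP Pi" using mbd_exists[OF P(2)] by blast
 \<comment> \<open>Integrality of eigenvalues is measured against an element of \<open>F\<close>, so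
   the real bound \<open>RH\<close> is replaced by the absolute value of a power of
   \<open>inverse \<pi>\<close>.\<close>
 obtain b where b: "RH < q ^ b" using real_arch_pow[OF q_gt_1] by blast
 define c where "c = inverse \<pi> ^ b"
 have ac: "absv c = q ^ b" unfolding c_def absv_power absv_inverse uniformizer_absv[OF \<pi>] by simp
 have c: "1 \<le> absv c" "RH \<le> absv c" "c \<noteq> 0"
 proof -
  show 1: "1 \<le> absv c" "RH \<le> absv c" unfolding ac using b RH(1) by simp_all
  show "c \<noteq> 0"
  proof
   assume "c = 0"
   thus False using 1(1) by simp
  qed
 qed
 \<comment> \<open>In the exponent, \<open>n * n * n\<close> stems from \<open>n\<close> cofactors
   with at most \<open>n * n\<close> eigenvalues each, and \<open>n\<close> from the integral
   remainder in \<open>discriminant_bound\<close>.\<close>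
 define C2 where "C2 = absv (c * c) ^ (n * n * n + n)"
 have C2: "1 \<le> C2" unfolding C2_def absv_mult by (rule one_le_power[OF mult_ge1_I[OF c(1,1)]])
 \<comment> \<open>The logarithm collects the bounds for the compact sets, the lattice and the
   forms. The absolute value makes the constant positive, and the additional \<open>1\<close> is the
   unit that \<open>measure_bound\<close> requires.\<close>
 define c1 where "c1 = \<bar>log q (RL * RL * (RH ^ n * RJ * (RP * RG)) * C2)\<bar> + 1"
 show ?thesis
 \<comment> \<open>The two coefficients are \<open>n\<close> because
   \<open>det (\<gamma> - 1)\<close> is controlled by \<open>M ^ n\<close> and
   \<open>log q M\<close> by the sum of the two functions \<phi>. None of the witnesses involves the
   torus.\<close>
 proof (rule exI[of _ "V * (2 * real n + 1) ^ n"], rule exI[of _ c1], rule exI[of _ "real n"], rule exI[of _ "real n"], intro conjI allI impI ballI)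
  show "0 < V * (2 * real n + 1) ^ n" using Vol by (intro mult_pos_pos zero_less_power) auto
  show "0 < c1" by (simp add: c1_def)
  show "0 < real n" "0 < real n" using n0 by simp_all
 next
  fix T r K and \<mu> :: "'a mat measure" and g h \<gamma> :: "'a mat" and k :: int
  assume T: "maximal_torus n (H_group m C) T \<and> has_split_rank n T r \<and>
   haar_measure_on absv n (F_points n T) \<mu> \<and>
   maximal_compact_subgroup absv n (F_points n T) K \<and> emeasure \<mu> K = ennreal V"
  assume g: "g \<in> carrier (GL n)" and h: "h \<in> F_points n (H_group m C)" and \<gamma>: "\<gamma> \<in> regular_elements m C T"
  assume Y: "g * inv\<^bsub>GL n\<^esub> (S_map m C \<gamma>) * dagger (dagger_mat m C) g \<in> C\<^sub>G \<and> inv\<^bsub>GL n\<^esub> h * \<gamma> * h \<in> C\<^sub>H"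
  let ?gi = "inv\<^bsub>GL n\<^esub> g" and ?hi = "inv\<^bsub>GL n\<^esub> h"
  from T have mT: "maximal_torus n (H_group m C) T" by blast
  from regular_spectral(1)[OF m n C mT \<gamma>, folded J_def, OF J]
  obtain U Ui l where "spectral absv n J Ji \<gamma> (inv\<^bsub>GL n\<^esub> \<gamma>) (form_sign C) U Ui l" by blast
  then interpret S: spectral absv n J Ji \<gamma> "inv\<^bsub>GL n\<^esub> \<gamma>" "form_sign C" U Ui l .
  have Teq: "T = S.torus_group"
   unfolding S.torus_group_def by (rule regular_spectral(2)[OF m n C mT \<gamma>, folded J_def, OF J])
  have TF: "F_points n T = S.TF" unfolding Teq by (rule S.F_points_torus_group)
  have gc: "g \<in> Mat n" "det g \<noteq> 0" using g by (auto simp: carrier_GL)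
  note gi = GL_inv[OF gc]
  note hc = Hp(3)[OF h] and hi = GL_inv[OF Hp(3)[OF h] Hp(2)[OF h]]
  have d1: "\<gamma> - Id n \<in> Mat n" by (rule sq_closed(2)[OF S.\<gamma>(1) one_carrier_mat])
  note \<gamma>1 = GL_inv[OF d1 S.det_minus_one(2)]
  let ?\<gamma>1 = "inv\<^bsub>GL n\<^esub> (\<gamma> - Id n)"
  have \<gamma>h: "mbd n RH (?hi * \<gamma> * h)" "mbd n RH (?hi * inv\<^bsub>GL n\<^esub> \<gamma> * h)"
  proof -
   show "mbd n RH (?hi * \<gamma> * h)" using RH(2) Y by blast
   have "?hi * \<gamma> * h * (?hi * inv\<^bsub>GL n\<^esub> \<gamma> * h) = ?hi * (\<gamma> * (h * (?hi * (inv\<^bsub>GL n\<^esub> \<gamma> * h))))"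
    using hi(1) hc S.\<gamma>(1,2) by (simp add: sq_assoc[where n=n] sq_closed[where n=n])
   also have "h * (?hi * (inv\<^bsub>GL n\<^esub> \<gamma> * h)) = inv\<^bsub>GL n\<^esub> \<gamma> * h"
    by (rule sq_inv_cancel(1)[OF hc hi(1,2) sq_closed(3)[OF S.\<gamma>(2) hc]])
   also have "\<gamma> * (inv\<^bsub>GL n\<^esub> \<gamma> * h) = h" by (rule sq_inv_cancel(1)[OF S.\<gamma>(1-3) hc])
   finally have "?hi * \<gamma> * h * (?hi * inv\<^bsub>GL n\<^esub> \<gamma> * h) = Id n" using hi(3) by simp
   hence "inv\<^bsub>GL n\<^esub> (?hi * \<gamma> * h) = ?hi * inv\<^bsub>GL n\<^esub> \<gamma> * h"
    by (rule GL_inv_eqI(1)[rotated 2]) (intro sq_closed(3) hi(1) hc S.\<gamma>(1,2))+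
   thus "mbd n RH (?hi * inv\<^bsub>GL n\<^esub> \<gamma> * h)" using RH(2) Y by metis
  qed
  have lc: "abd c (l i)" "abd c (inverse (l i))" if i: "i < n" for i
   by (rule S.eigenvalue_abd[OF c(3) hc hi(1,2) S.\<gamma>(1) S.l(1) mbd_mono[OF \<gamma>h(1) c(2)] i],
    rule S.eigenvalue_abd[OF c(3) hc hi(1,2) S.\<gamma>(2) S.gamma_inverse mbd_mono[OF \<gamma>h(2) c(2)] i])
  obtain M where M: "M \<ge> 1" "inverse (absv (det (\<gamma> - Id n))) \<le> C2 * M ^ n"
   "log q M \<le> phi_H absv m C T \<gamma> + phi_S absv m C \<gamma>"
   using S.det_minus_one_bound[OF P \<gamma>1(1,2) n m C J_def P_def refl refl c(1) lc] unfolding Teq C2_def by blast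
  let ?Y = "g * inv\<^bsub>GL n\<^esub> (S_map m C \<gamma>) * dagger (dagger_mat m C) g"
  let ?Z = "g * ?\<gamma>1 * J * g\<^sup>T"
  have Zc: "?Z \<in> Mat n" by (intro sq_closed(3) sq_closed(6) gc(1) \<gamma>1(1) J(1))
  have YZ: "?Y = ?Z * Pi"
  proof -
   have "S_map m C \<gamma> = P * Ji * (\<gamma> - Id n)"
    using S_map_eq[OF m C] S.\<gamma>(1) GL_inv_eqI(1)[OF J(1-3)] unfolding n[symmetric] J_def[symmetric] P_def[symmetric] by simp
   hence "inv\<^bsub>GL n\<^esub> (S_map m C \<gamma>) = ?\<gamma>1 * (J * Pi)"
    using GL_inv_eqI(1)[OF sq_closed(3)[OF S.PJ(1)[OF P \<gamma>1(1,2)] d1] sq_closed(3)[OF \<gamma>1(1) S.PJ(2)[OF P \<gamma>1(1,2)]] S.S_form(2)[OF P \<gamma>1(1,2)]]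
    by simp
   thus ?thesis using S.Y_form[OF P \<gamma>1(1,2) gc(1)] by (simp add: P_def)
  qed
  have YG: "?Y \<in> C\<^sub>G" using Y by blast
  have Yc: "?Y \<in> Mat n" "det ?Y \<noteq> 0" using YG CG'(2) by (auto simp: carrier_GL)
  note Yi = GL_inv[OF Yc]
  \<comment> \<open>From \<open>?Y = ?Z * Pi\<close> the inverse of \<open>?Z\<close> is
    \<open>Pi\<close> times the inverse of \<open>?Y\<close>, bounded by \<open>RP * RG\<close>;
    this is where the bound on inverses in \<open>C\<^sub>G\<close> is used.\<close>
  let ?Yi = "Pi * inv\<^bsub>GL n\<^esub> ?Y"
  have Yi1: "?Yi \<in> Mat n" by (rule sq_closed(3)[OF P(2) Yi(1)])
  have Yi2: "?Z * ?Yi = Id n" using sq_assoc[OF Zc P(2) Yi(1)] Yi(2) YZ by simp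
  have Yi3: "mbd n (RP * RG) ?Yi" by (rule mbd_mult[OF RP(2)]) (use RG YG RP(1) in auto)
  have RPG: "1 \<le> RP * RG" by (rule mult_ge1_I[OF RP(1) RG(1)])
  define E where "E = S.TF \<inter> (\<lambda>A. (\<pi> powi (- k)) \<cdot> (?gi * A * ?hi)) ` L"
  have ET: "E \<subseteq> S.TF" by (auto simp: E_def)
  have EL: "\<forall>t\<in>E. mbd n (q powi k * RL) (g * t * h)"
  proof
   fix t assume "t \<in> E"
   then obtain A where A: "A \<in> L" "t = (\<pi> powi (- k)) \<cdot> (?gi * A * ?hi)" by (auto simp: E_def)
   have Ac: "A \<in> Mat n" using RL(2) A(1) mbd_carrier by blast
   have e: "?gi * A * ?hi \<in> Mat n" by (intro sq_closed(3) gi(1) Ac hi(1))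
   have "g * (?gi * A * ?hi) * h = g * (?gi * (A * (?hi * h)))"
    using gc(1) gi(1) Ac hi(1) hc by (simp add: sq_assoc[where n=n] sq_closed[where n=n])
   also have "\<dots> = A" unfolding hi(3) using sq_inv_cancel(1)[OF gc(1) gi(1,2) Ac] Ac by simp
   finally have 1: "g * (?gi * A * ?hi) * h = A" .
   have "g * t * h = (\<pi> powi (- k)) \<cdot> A"
    unfolding A(2) sq_distrib(6)[OF gc(1) e] sq_distrib(5)[OF sq_closed(3)[OF gc(1) e] hc] 1 ..
   thus "mbd n (q powi k * RL) (g * t * h)"
    using mbd_smult[of n RL A "\<pi> powi (- k)"] RL A(1) unfolding powi_uniformizer[OF \<pi>] by auto
  qed
  \<comment> \<open>Maximality in the definition of the split rank, applied to the subtorus just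
    constructed inside \<open>T\<close>.\<close>
  have r: "card S.P1 \<le> r" using S.split_subtorus T unfolding Teq has_split_rank_def by blast
  have wE: "weight n \<pi> L (F_points n T) \<mu> k g h = measure \<mu> E" unfolding weight_def E_def TF ..
  define x where "x = 2 * real_of_int k + c1 + real n * phi_H absv m C T \<gamma> + real n * phi_S absv m C \<gamma>"
  have xge: "x \<ge> 2 * real_of_int k + log q (RL * RL * (RH ^ n * RJ * (RP * RG)) * C2) + real n * log q M + 1"
  proof -
   have "real n * log q M \<le> real n * (phi_H absv m C T \<gamma> + phi_S absv m C \<gamma>)" by (rule mult_left_mono[OF M(3)]) simp
   thus ?thesis unfolding x_def c1_def by (simp add: distrib_left)
  qed
  have T': "haar_measure_on absv n S.TF \<mu>" "maximal_compact_subgroup absv n S.TF K" "emeasure \<mu> K = ennreal V"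
   using T unfolding TF by blast+
  have "(x < 0 --> measure \<mu> E = 0) \<and> (0 \<le> x --> measure \<mu> E \<le> V * (2 * real n + 1) ^ n * x ^ r)"
   by (rule S.measure_bound[OF T' Vol \<pi> gc(1) gi(1,2) hc hi(1,2) Hp(1)[OF h] RH(1) \<gamma>h(1) RJ \<gamma>1(1,2) Yi1 Yi2 RPG Yi3 RL(1) ET EL M(1) C2 M(2) xge r])
  thus "let x = 2 * real_of_int k + c1 + real n * phi_H absv m C T \<gamma> + real n * phi_S absv m C \<gamma> in
      (x < 0 --> weight n \<pi> L (F_points n T) \<mu> k g h = 0) \<and>
      (x \<ge> 0 --> weight n \<pi> L (F_points n T) \<mu> k g h \<le> V * (2 * real n + 1) ^ n * x ^ r)"
   unfolding Let_def wE x_def .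
 qed
qed

end
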